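(* Let $T>0$ and let $f \in W^{2,\infty}_{\mathrm{loc}}(\mathbb{R})$ be such that $f'' \in L^\infty(\mathbb{R})$. Let $u \in H^{4}((0,T)\times\Omega)$ with $\partial_x u \in L^\infty((0,T)\times\Omega)$ be a solution of $$\partial_t u + \partial_x f(u) - \partial_x^2\partial_t u = 0 \quad\text{in } (0,T)\times\Omega$$ with initial data $u|_{t=0}=u_0 \in H^{4}(\Omega)$. For each $\tau>0$, let $q=(q_0,q_1,q_2)$ (depending on $\tau$) be an entropy solution on $(0,T)\times\Omega$ of the system $$\begin{aligned} \partial_t q_0 + \partial_x f(q_0) + \partial_x q_2 &= 0,\\ \partial_t q_1 + \tau\,\partial_x q_1 &= -q_2,\\ \tau\,\partial_t q_2 + \partial_x q_0 &= q_1, \end{aligned}$$ with initial data $q|_{t=0} = (u_0,\ \partial_x u_0,\ -\partial_{tx}u|_{t=0})$. Then, as $\tau\to 0$, $$\|u-q_0\|_{L^\infty(0,T;L^2(\Omega))} + \|\partial_x u - q_1\|_{L^\infty(0,T;L^2(\Omega))} = \mathcal{O}(\tau).$$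
   Context: $\Omega$ is a bounded one-dimensional interval with periodic boundary conditions (endpoints identified); all function spaces on $\Omega$ and $(0,T)\times\Omega$ are understood as spaces of functions periodic in $x$. $\mathcal{O}(\tau)$ means: there are $C>0$ and $\tau_0>0$, independent of $\tau$ (but possibly depending on $u$, $f$, $T$, $\Omega$), such that the quantity is at most $C\tau$ for all $\tau\in(0,\tau_0]$. Entropy solution: fix $\Phi$ with $\Phi'(a)=a f'(a)$ for $a\in\mathbb{R}$. The energy density and energy flux are $$e(q)=\tfrac12 q_0^2+\tfrac12 q_1^2+\tfrac{\tau}{2}q_2^2,\qquad G(q)=\Phi(q_0)+q_0q_2+\tfrac{\tau}{2}q_1^2 ,$$ and smooth solutions satisfy $\partial_t e(q)+\partial_x G(q)=0$. An entropy solution with initial data $q^{\mathrm{in}}$ is a function $q\in L^\infty((0,T)\times\Omega)^3$ that satisfies the system with initial data $q^{\mathrm{in}}$ in the sense of distributions (weak form with test functions in $C_c^\infty([0,T)\times\Omega)$, including the initial term) and the energy inequality $$\int_0^T\!\!\int_\Omega \bigl(e(q)\,\partial_t\varphi+G(q)\,\partial_x\varphi\bigr)\,dx\,dt+\int_\Omega e(q^{\mathrm{in}})\,\varphi(0,\cdot)\,dx\ \ge 0$$ for all nonnegative $\varphi\in C_c^\infty([0,T)\times\Omega)$. *)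

theory Defs
  imports "HOL-Analysis.Analysis" "HOL-Probability.Essential_Supremum"
begin

section \<open>Lebesgue and Sobolev spaces\<close>

text \<open>
  Elements of Lebesgue spaces are represented by Borel functions.  Functions on the domain
  \<open>S\<close> are total functions of which only the values in \<open>S\<close> matter; \<open>M\<close> is then the Lebesgue
  measure restricted to \<open>S\<close>.
\<close>

definition L2 :: "'a measure \<Rightarrow> ('a \<Rightarrow> real) set" where
  "L2 M = {u \<in> borel_measurable M. integrable M (\<lambda>x. (u x)\<^sup>2)}"

definition Linf :: "'a measure \<Rightarrow> ('a \<Rightarrow> real) set" where
  "Linf M = {u \<in> borel_measurable M. \<exists>C. AE x in M. \<bar>u x\<bar> \<le> C}"

definition Linf_loc :: "('a::euclidean_space \<Rightarrow> real) set" where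
  "Linf_loc = {u \<in> borel_measurable lborel. \<forall>K. compact K \<longrightarrow> u \<in> Linf (restrict_space lborel K)}"

definition pderiv_dir :: "'a::euclidean_space \<Rightarrow> ('a \<Rightarrow> real) \<Rightarrow> 'a \<Rightarrow> real" where
  "pderiv_dir b \<phi> = (\<lambda>x. frechet_derivative \<phi> (at x) b)"

primrec pderivs :: "'a::euclidean_space list \<Rightarrow> ('a \<Rightarrow> real) \<Rightarrow> 'a \<Rightarrow> real" where
  "pderivs [] \<phi> = \<phi>"
| "pderivs (b # bs) \<phi> = pderiv_dir b (pderivs bs \<phi>)"

text \<open>All iterated partial derivatives are totally differentiable, hence continuous.\<close>

definition C_infinity :: "('a::euclidean_space \<Rightarrow> real) set" where
  "C_infinity = {\<phi>. \<forall>bs \<in> lists Basis. pderivs bs \<phi> differentiable_on UNIV}"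

text \<open>
  \<open>v\<close> is the weak derivative of \<open>u\<close> in the directions \<open>bs\<close>, tested with the functions in \<open>V\<close>.
  For the spaces \<open>V\<close> of compactly supported test functions below, the integrability
  of all products with test functions is local integrability.
\<close>

definition integrable_vs_tests ::
    "('a::euclidean_space \<Rightarrow> real) set \<Rightarrow> 'a measure \<Rightarrow> ('a \<Rightarrow> real) \<Rightarrow> bool" where
  "integrable_vs_tests V M u \<longleftrightarrow>
     u \<in> borel_measurable M \<and> (\<forall>\<phi>\<in>V. integrable M (\<lambda>x. u x * \<phi> x))"

definition weak_deriv ::
    "('a::euclidean_space \<Rightarrow> real) set \<Rightarrow> 'a measure \<Rightarrow> 'a list \<Rightarrow> ('a \<Rightarrow> real) \<Rightarrow> ('a \<Rightarrow> real) \<Rightarrow> bool"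
  where
  "weak_deriv V M bs u v \<longleftrightarrow>
     integrable_vs_tests V M u \<and> integrable_vs_tests V M v \<and>
     (\<forall>\<phi>\<in>V. (\<integral>x. u x * pderivs bs \<phi> x \<partial>M) = (-1) ^ length bs * (\<integral>x. v x * \<phi> x \<partial>M))"

text \<open>
  Functions in \<open>X\<close> whose weak derivatives up to order \<open>k\<close> lie in \<open>X\<close>, where \<open>X\<close> is one of the
  Lebesgue spaces above.  Repeated basis vectors play the role of multi-indices.
\<close>

definition sobolev ::
    "('a::euclidean_space \<Rightarrow> real) set \<Rightarrow> 'a measure \<Rightarrow> ('a \<Rightarrow> real) set \<Rightarrow> nat \<Rightarrow> ('a \<Rightarrow> real) set"
  where
  "sobolev V M X k =
     {u \<in> X. \<forall>bs \<in> lists Basis. length bs \<le> k \<longrightarrow> (\<exists>v\<in>X. weak_deriv V M bs u v)}"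


section \<open>The real line, the periodic interval and the space-time domain\<close>

text \<open>
  The interval \<open>\<Omega>\<close> is \<open>(a, b)\<close> with its endpoints identified.  Periodicity of the function
  spaces is encoded by testing with all smooth \<open>(b - a)\<close>-periodic functions: a function with
  different boundary values at \<open>a\<close> and \<open>b\<close> has no weak \<open>x\<close>-derivative.
  Points of space-time are pairs \<open>(t, x)\<close>.
\<close>

definition test_line :: "(real \<Rightarrow> real) set" where
  "test_line = {\<phi> \<in> C_infinity. compact (closure {x. \<phi> x \<noteq> 0})}"

text \<open>
  Pointwise composition with \<open>f \<in> W\<^sup>2\<^sup>,\<^sup>\<infinity>\<^sub>l\<^sub>o\<^sub>c\<close> is only meaningful for its continuous (in fact
  continuously differentiable) representative; that choice has to be required separately.
\<close>

definition W2inf_loc :: "(real \<Rightarrow> real) set" where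
  "W2inf_loc = sobolev test_line lborel Linf_loc 2"

definition space_measure :: "real \<Rightarrow> real \<Rightarrow> real measure" where
  "space_measure a b = restrict_space lborel {a<..<b}"

definition test_space :: "real \<Rightarrow> real \<Rightarrow> (real \<Rightarrow> real) set" where
  "test_space a b = {\<phi> \<in> C_infinity. \<forall>x. \<phi> (x + (b - a)) = \<phi> x}"

definition H_space :: "nat \<Rightarrow> real \<Rightarrow> real \<Rightarrow> (real \<Rightarrow> real) set" where
  "H_space k a b = sobolev (test_space a b) (space_measure a b) (L2 (space_measure a b)) k"

abbreviation dir_t :: "real \<times> real" where "dir_t \<equiv> (1, 0)"

abbreviation dir_x :: "real \<times> real" where "dir_x \<equiv> (0, 1)"

definition st_measure :: "real \<Rightarrow> real \<Rightarrow> real \<Rightarrow> (real \<times> real) measure" where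
  "st_measure T a b = restrict_space lborel ({0<..<T} \<times> {a<..<b})"

text \<open>\<open>C\<^sub>c\<^sup>\<infinity>((0,T) \<times> \<Omega>)\<close>\<close>

definition test_open :: "real \<Rightarrow> real \<Rightarrow> real \<Rightarrow> (real \<times> real \<Rightarrow> real) set" where
  "test_open T a b =
     {\<phi> \<in> C_infinity. (\<forall>t x. \<phi> (t, x + (b - a)) = \<phi> (t, x)) \<and>
        (\<exists>s r. 0 < s \<and> r < T \<and> (\<forall>t x. t \<notin> {s..r} \<longrightarrow> \<phi> (t, x) = 0))}"

text \<open>
  \<open>C\<^sub>c\<^sup>\<infinity>([0,T) \<times> \<Omega>)\<close>: smoothness up to \<open>t = 0\<close> is expressed by a smooth extension to negative
  times, whose values there are irrelevant.
\<close>

definition test_init :: "real \<Rightarrow> real \<Rightarrow> real \<Rightarrow> (real \<times> real \<Rightarrow> real) set" where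
  "test_init T a b =
     {\<phi> \<in> C_infinity. (\<forall>t x. \<phi> (t, x + (b - a)) = \<phi> (t, x)) \<and>
        (\<exists>r<T. \<forall>t x. r < t \<longrightarrow> \<phi> (t, x) = 0)}"

definition st_weak_deriv ::
    "real \<Rightarrow> real \<Rightarrow> real \<Rightarrow> (real \<times> real) list \<Rightarrow>
     (real \<times> real \<Rightarrow> real) \<Rightarrow> (real \<times> real \<Rightarrow> real) \<Rightarrow> bool" where
  "st_weak_deriv T a b = weak_deriv (test_open T a b) (st_measure T a b)"

definition H_st :: "nat \<Rightarrow> real \<Rightarrow> real \<Rightarrow> real \<Rightarrow> (real \<times> real \<Rightarrow> real) set" where
  "H_st k T a b = sobolev (test_open T a b) (st_measure T a b) (L2 (st_measure T a b)) k"

text \<open>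
  \<open>w|\<^bsub>t=0\<^esub> = g\<close>, as the restriction of the continuous representative of \<open>w\<close>.  By Sobolev
  embedding in two dimensions, every function in \<open>H\<^sup>k\<close> with \<open>k \<ge> 2\<close> has one.
\<close>

definition initial_trace ::
    "real \<Rightarrow> real \<Rightarrow> real \<Rightarrow> (real \<times> real \<Rightarrow> real) \<Rightarrow> (real \<Rightarrow> real) \<Rightarrow> bool" where
  "initial_trace T a b w g \<longleftrightarrow>
     g \<in> borel_measurable (space_measure a b) \<and>
     (\<exists>w'. continuous_on ({0..<T} \<times> {a<..<b}) w' \<and>
        (AE p in st_measure T a b. w p = w' p) \<and>
        (AE x in space_measure a b. g x = w' (0, x)))"

definition ennreal_sqrt :: "ennreal \<Rightarrow> ennreal" where
  "ennreal_sqrt c = (if c = \<infinity> then \<infinity> else ennreal (sqrt (enn2real c)))"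

definition L2_norm_space :: "real \<Rightarrow> real \<Rightarrow> (real \<Rightarrow> real) \<Rightarrow> ennreal" where
  "L2_norm_space a b v = ennreal_sqrt (\<integral>\<^sup>+ x. ennreal ((v x)\<^sup>2) \<partial>space_measure a b)"

definition Linf_L2_norm :: "real \<Rightarrow> real \<Rightarrow> real \<Rightarrow> (real \<times> real \<Rightarrow> real) \<Rightarrow> ennreal" where
  "Linf_L2_norm T a b w =
     esssup (restrict_space lborel {0<..<T}) (\<lambda>t. L2_norm_space a b (\<lambda>x. w (t, x)))"


section \<open>The equation and its hyperbolic relaxation\<close>

text \<open>
  \<open>\<partial>\<^sub>t u + \<partial>\<^sub>x f(u) - \<partial>\<^sub>x\<^sup>2 \<partial>\<^sub>t u = 0\<close> almost everywhere, with weak derivatives.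
\<close>

definition solves_equation ::
    "(real \<Rightarrow> real) \<Rightarrow> real \<Rightarrow> real \<Rightarrow> real \<Rightarrow> (real \<times> real \<Rightarrow> real) \<Rightarrow> bool" where
  "solves_equation f T a b u \<longleftrightarrow>
     (\<exists>ut fx uxxt.
        st_weak_deriv T a b [dir_t] u ut \<and>
        st_weak_deriv T a b [dir_x] (\<lambda>p. f (u p)) fx \<and>
        st_weak_deriv T a b [dir_x, dir_x, dir_t] u uxxt \<and>
        (AE p in st_measure T a b. ut p + fx p - uxxt p = 0))"

definition energy :: "real \<Rightarrow> real \<Rightarrow> real \<Rightarrow> real \<Rightarrow> real" where
  "energy \<tau> y0 y1 y2 = 1 / 2 * y0\<^sup>2 + 1 / 2 * y1\<^sup>2 + \<tau> / 2 * y2\<^sup>2"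

text \<open>\<open>\<Phi>\<close> is an antiderivative of \<open>y f'(y)\<close>.\<close>

definition energy_flux :: "(real \<Rightarrow> real) \<Rightarrow> real \<Rightarrow> real \<Rightarrow> real \<Rightarrow> real \<Rightarrow> real" where
  "energy_flux \<Phi> \<tau> y0 y1 y2 = \<Phi> y0 + y0 * y2 + \<tau> / 2 * y1\<^sup>2"

text \<open>
  Weak form, including the initial data, of
  \<open>\<partial>\<^sub>t q0 + \<partial>\<^sub>x f(q0) + \<partial>\<^sub>x q2 = 0\<close>, \<open>\<partial>\<^sub>t q1 + \<tau> \<partial>\<^sub>x q1 = - q2\<close>, \<open>\<tau> \<partial>\<^sub>t q2 + \<partial>\<^sub>x q0 = q1\<close>.
\<close>

definition weak_solution ::
    "(real \<Rightarrow> real) \<Rightarrow> real \<Rightarrow> real \<Rightarrow> real \<Rightarrow> real \<Rightarrow>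
     (real \<Rightarrow> real) \<Rightarrow> (real \<Rightarrow> real) \<Rightarrow> (real \<Rightarrow> real) \<Rightarrow>
     (real \<times> real \<Rightarrow> real) \<Rightarrow> (real \<times> real \<Rightarrow> real) \<Rightarrow> (real \<times> real \<Rightarrow> real) \<Rightarrow> bool" where
  "weak_solution f T a b \<tau> q0in q1in q2in q0 q1 q2 \<longleftrightarrow>
     (\<forall>\<phi> \<in> test_init T a b.
        (\<integral>p. q0 p * pderiv_dir dir_t \<phi> p + (f (q0 p) + q2 p) * pderiv_dir dir_x \<phi> p
            \<partial>st_measure T a b)
          + (\<integral>x. q0in x * \<phi> (0, x) \<partial>space_measure a b) = 0 \<and>
        (\<integral>p. q1 p * pderiv_dir dir_t \<phi> p + \<tau> * q1 p * pderiv_dir dir_x \<phi> p - q2 p * \<phi> p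
            \<partial>st_measure T a b)
          + (\<integral>x. q1in x * \<phi> (0, x) \<partial>space_measure a b) = 0 \<and>
        (\<integral>p. \<tau> * q2 p * pderiv_dir dir_t \<phi> p + q0 p * pderiv_dir dir_x \<phi> p + q1 p * \<phi> p
            \<partial>st_measure T a b)
          + (\<integral>x. \<tau> * q2in x * \<phi> (0, x) \<partial>space_measure a b) = 0)"

definition energy_inequality ::
    "(real \<Rightarrow> real) \<Rightarrow> real \<Rightarrow> real \<Rightarrow> real \<Rightarrow> real \<Rightarrow>
     (real \<Rightarrow> real) \<Rightarrow> (real \<Rightarrow> real) \<Rightarrow> (real \<Rightarrow> real) \<Rightarrow>
     (real \<times> real \<Rightarrow> real) \<Rightarrow> (real \<times> real \<Rightarrow> real) \<Rightarrow> (real \<times> real \<Rightarrow> real) \<Rightarrow> bool" where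
  "energy_inequality \<Phi> T a b \<tau> q0in q1in q2in q0 q1 q2 \<longleftrightarrow>
     (\<forall>\<phi> \<in> test_init T a b. (\<forall>t x. 0 \<le> t \<longrightarrow> 0 \<le> \<phi> (t, x)) \<longrightarrow>
        0 \<le> (\<integral>p. energy \<tau> (q0 p) (q1 p) (q2 p) * pderiv_dir dir_t \<phi> p
                 + energy_flux \<Phi> \<tau> (q0 p) (q1 p) (q2 p) * pderiv_dir dir_x \<phi> p
               \<partial>st_measure T a b)
            + (\<integral>x. energy \<tau> (q0in x) (q1in x) (q2in x) * \<phi> (0, x) \<partial>space_measure a b))"

definition entropy_solution ::
    "(real \<Rightarrow> real) \<Rightarrow> (real \<Rightarrow> real) \<Rightarrow> real \<Rightarrow> real \<Rightarrow> real \<Rightarrow> real \<Rightarrow>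
     (real \<Rightarrow> real) \<Rightarrow> (real \<Rightarrow> real) \<Rightarrow> (real \<Rightarrow> real) \<Rightarrow>
     (real \<times> real \<Rightarrow> real) \<Rightarrow> (real \<times> real \<Rightarrow> real) \<Rightarrow> (real \<times> real \<Rightarrow> real) \<Rightarrow> bool" where
  "entropy_solution f \<Phi> T a b \<tau> q0in q1in q2in q0 q1 q2 \<longleftrightarrow>
     q0 \<in> Linf (st_measure T a b) \<and> q1 \<in> Linf (st_measure T a b) \<and> q2 \<in> Linf (st_measure T a b) \<and>
     weak_solution f T a b \<tau> q0in q1in q2in q0 q1 q2 \<and>
     energy_inequality \<Phi> T a b \<tau> q0in q1in q2in q0 q1 q2"

end

theory Submission
  imports Defs
begin

text \<open>
  An entropy solution \<open>q\<close> is compared, in relative energy, with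
  \<open>v = (u, \<partial>\<^sub>x u - \<tau> \<partial>\<^sub>t\<^sub>t\<^sub>x u, - \<partial>\<^sub>t\<^sub>x u)\<close>.  The correction \<open>- \<tau> \<partial>\<^sub>t\<^sub>t\<^sub>x u\<close> makes the third equation exact
  for \<open>v\<close>; the only residual \<open>\<tau> R\<close>, \<open>R = \<partial>\<^sub>x\<^sub>x u - \<partial>\<^sub>t\<^sub>t\<^sub>t\<^sub>x u - \<tau> \<partial>\<^sub>t\<^sub>t\<^sub>x\<^sub>x u\<close>, is then in the second equation,
  where it is paired with \<open>q\<^sub>1 - v\<^sub>1\<close>.  This difference is controlled by the relative energy uniformly
  in \<open>\<tau>\<close>, unlike \<open>q\<^sub>2 - v\<^sub>2\<close>, for which a factor \<open>\<surd>\<tau>\<close> is lost.  As the initial relative energy is \<open>O(\<tau>\<^sup>2)\<close>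
  and \<open>f\<close> has a quadratic Taylor remainder, a Gronwall argument bounds the relative energy by \<open>O(\<tau>\<^sup>2)\<close>.

  The components of \<open>v\<close> are only Sobolev functions.  They are admissible as test functions by
  doubling of variables with kernels that are products of functions of one variable.  Weak derivatives
  are therefore only ever tested with products \<open>\<alpha>(t) \<beta>(x)\<close>, for which mixed derivatives commute trivially.
\<close>

text \<open>The relative energy is the energy of \<open>q\<close>, minus the pairing of
  \<open>q\<close> with \<open>v\<close>, plus the energy of \<open>v\<close>. The first is governed
  by the energy inequality, the second by the equations of \<open>q\<close> tested with the
  components of \<open>v\<close>, the third by the product rules of \<open>v\<close> tested with
  \<open>v\<close> itself. All weights depend on time only, so on the periodic domain exact
  x-derivatives disappear, such as f(u) u_x and the x-derivative of u u_tx.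

  The bound on \<open>q0\<close> in L-infinity may depend on \<tau>. The Taylor remainder of f must
  therefore be quadratic on the whole line, which is what the global bound on f'' gives; the
  remainder is multiplied by u_x, hence the bound on u_x.

  The initial values of \<open>q\<close> and \<open>v\<close> differ only in the second component,
  by \<tau> times u_ttx at t = 0. The derivatives u_tttx and u_ttxx in R are of order four, and
  u_tttx also gives the trace of u_ttx: this is where the regularity of u is spent.\<close>

section \<open>Smooth functions of one real variable\<close>

primrec diff_n :: "nat \<Rightarrow> (real \<Rightarrow> real) \<Rightarrow> bool" where
  "diff_n 0 g \<longleftrightarrow> True"
| "diff_n (Suc n) g \<longleftrightarrow> (\<exists>g'. (\<forall>x. (g has_real_derivative g' x) (at x)) \<and> diff_n n g')"

definition smooth :: "(real \<Rightarrow> real) \<Rightarrow> bool" where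
  "smooth g \<longleftrightarrow> (\<forall>n. diff_n n g)"

lemma diff_n_mono: "diff_n n g \<Longrightarrow> m \<le> n \<Longrightarrow> diff_n m g"
proof (induction n arbitrary: g m)
  case (Suc n)
  then show ?case by (cases m) auto
qed auto

lemma diff_n_add: "diff_n n f \<Longrightarrow> diff_n n g \<Longrightarrow> diff_n n (\<lambda>x. f x + g x)"
proof (induction n arbitrary: f g)
  case (Suc n)
  from Suc.prems obtain f' g' where *: "\<And>x. (f has_real_derivative f' x) (at x)" "diff_n n f'"
     "\<And>x. (g has_real_derivative g' x) (at x)" "diff_n n g'"
    unfolding diff_n.simps by blast
  have "((\<lambda>x. f x + g x) has_real_derivative (f' x + g' x)) (at x)" for x
    by (intro derivative_intros *)
  with Suc.IH[OF *(2,4)] show ?case by (auto intro!: exI[of _ "\<lambda>x. f' x + g' x"])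
qed auto

text \<open>The product rule contains \<open>f\<close> and \<open>g\<close> undifferentiated;
  \<open>diff_n_mono\<close> lowers their order so that the induction hypothesis applies to both
  products.\<close>

lemma diff_n_mult: "diff_n n f \<Longrightarrow> diff_n n g \<Longrightarrow> diff_n n (\<lambda>x. f x * g x)"
proof (induction n arbitrary: f g)
  case (Suc n)
  from Suc.prems obtain f' g' where *: "\<And>x. (f has_real_derivative f' x) (at x)" "diff_n n f'"
     "\<And>x. (g has_real_derivative g' x) (at x)" "diff_n n g'"
    unfolding diff_n.simps by blast
  have "diff_n n (\<lambda>x. f' x * g x + f x * g' x)"
    using Suc.prems[THEN diff_n_mono, of n] * by (intro diff_n_add Suc.IH) simp_all
  moreover have "((\<lambda>x. f x * g x) has_real_derivative (f' x * g x + f x * g' x)) (at x)" for x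
    by (rule derivative_eq_intros *)+ (simp add: algebra_simps)
  ultimately show ?case by (auto intro!: exI[of _ "\<lambda>x. f' x * g x + f x * g' x"])
qed auto

lemma diff_n_compose: "diff_n n f \<Longrightarrow> diff_n n g \<Longrightarrow> diff_n n (\<lambda>x. f (g x))"
proof (induction n arbitrary: f g)
  case (Suc n)
  from Suc.prems obtain f' g' where *: "\<And>x. (f has_real_derivative f' x) (at x)" "diff_n n f'"
     "\<And>x. (g has_real_derivative g' x) (at x)" "diff_n n g'"
    unfolding diff_n.simps by blast
  have "diff_n n (\<lambda>x. f' (g x) * g' x)"
    using Suc.prems(2)[THEN diff_n_mono, of n] * by (intro diff_n_mult[OF Suc.IH[of f' g]]) simp_all
  moreover have "((\<lambda>x. f (g x)) has_real_derivative (f' (g x) * g' x)) (at x)" for x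
    using DERIV_chain2[OF *(1) *(3)] .
  ultimately show ?case by (auto intro!: exI[of _ "\<lambda>x. f' (g x) * g' x"])
qed auto

lemma diff_n_const: "diff_n n (\<lambda>x. c)"
  by (induction n arbitrary: c) (auto intro!: exI[of _ "\<lambda>x. 0"])

lemma diff_n_id: "diff_n n (\<lambda>x. x)"
  by (cases n) (auto intro!: exI[of _ "\<lambda>x. 1"] diff_n_const)

lemma diff_n_exp: "diff_n n exp"
proof (induction n)
  case (Suc n) then show ?case unfolding diff_n.simps by (intro exI[of _ exp]) (auto intro: DERIV_exp)
qed simp

lemma diff_n_sincos: "diff_n n sin \<and> diff_n n cos"
proof (induction n)
  case (Suc n)
  then have "diff_n n (\<lambda>x. (-1) * sin x)" by (intro diff_n_mult diff_n_const) auto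
  moreover have "(cos has_real_derivative (-1) * sin x) (at x)" for x :: real
    by (auto intro!: derivative_eq_intros)
  ultimately have "diff_n (Suc n) cos" unfolding diff_n.simps by (intro exI[of _ "\<lambda>x. (-1) * sin x"]) auto
  moreover have "diff_n (Suc n) sin" unfolding diff_n.simps using Suc by (intro exI[of _ cos]) (auto intro: DERIV_sin)
  ultimately show ?case by blast
qed auto

named_theorems smooth_intros

lemma smooth_add [smooth_intros]: "smooth f \<Longrightarrow> smooth g \<Longrightarrow> smooth (\<lambda>x. f x + g x)"
  by (simp add: smooth_def diff_n_add)

lemma smooth_mult [smooth_intros]: "smooth f \<Longrightarrow> smooth g \<Longrightarrow> smooth (\<lambda>x. f x * g x)"
  by (simp add: smooth_def diff_n_mult)

lemma smooth_compose: "smooth f \<Longrightarrow> smooth g \<Longrightarrow> smooth (\<lambda>x. f (g x))"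
  by (simp add: smooth_def diff_n_compose)

lemma smooth_const [smooth_intros]: "smooth (\<lambda>x. c)"
  by (simp add: smooth_def diff_n_const)

lemma smooth_id [smooth_intros]: "smooth (\<lambda>x. x)"
  by (simp add: smooth_def diff_n_id)

lemma smooth_minus [smooth_intros]: "smooth f \<Longrightarrow> smooth (\<lambda>x. - f x)"
  using smooth_mult[OF smooth_const[of "-1"], of f] by simp

lemma smooth_diff [smooth_intros]: "smooth f \<Longrightarrow> smooth g \<Longrightarrow> smooth (\<lambda>x. f x - g x)"
  using smooth_add[OF _ smooth_minus, of f g] by simp

lemma smooth_exp [smooth_intros]: "smooth f \<Longrightarrow> smooth (\<lambda>x. exp (f x))"
  by (rule smooth_compose[of exp]) (auto simp: smooth_def diff_n_exp)

lemma smooth_cos [smooth_intros]: "smooth f \<Longrightarrow> smooth (\<lambda>x. cos (f x))"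
  by (rule smooth_compose[of cos]) (auto simp: smooth_def diff_n_sincos)

text \<open>A derivative is unique, so the witness hidden in \<open>diff_n (Suc n)\<close> is
  \<open>deriv g\<close> for every \<open>n\<close>, and one function serves all orders.\<close>

lemma smoothD:
  assumes "smooth g"
  shows "(g has_real_derivative deriv g x) (at x)" "smooth (deriv g)"
proof -
  have *: "\<exists>g'. (\<forall>x. (g has_real_derivative g' x) (at x)) \<and> diff_n n g'" for n
    using assms by (auto simp: smooth_def dest!: spec[of _ "Suc n"])
  have **: "g' = deriv g" if "\<forall>x. (g has_real_derivative g' x) (at x)" for g'
    using that by (intro ext DERIV_imp_deriv[symmetric]) blast
  show "smooth (deriv g)" unfolding smooth_def using * ** by blast
  show "(g has_real_derivative deriv g x) (at x)" using *[of 0] ** by blast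
qed

lemma smoothI:
  assumes "\<And>x. (g has_real_derivative g' x) (at x)" "smooth g'"
  shows "smooth g"
  unfolding smooth_def
proof
  fix n show "diff_n n g" using assms by (cases n) (auto simp: smooth_def)
qed

lemma smooth_deriv_funpow: "smooth g \<Longrightarrow> smooth ((deriv ^^ n) g)"
  by (induction n) (auto intro: smoothD)

lemma smooth_continuous: "smooth g \<Longrightarrow> continuous_on A g"
  by (meson smoothD(1) DERIV_isCont continuous_at_imp_continuous_on)

lemma smooth_borel: "smooth g \<Longrightarrow> g \<in> borel_measurable borel"
  by (intro borel_measurable_continuous_onI smooth_continuous)

lemma smooth_deriv_mult:
  "smooth f \<Longrightarrow> smooth g \<Longrightarrow> deriv (\<lambda>x. f x * g x) = (\<lambda>x. deriv f x * g x + f x * deriv g x)"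
  by (rule ext, rule DERIV_imp_deriv) (auto intro!: derivative_eq_intros smoothD)

lemma deriv_reflect:
  assumes "smooth g" shows "deriv (\<lambda>x. g (c - x)) = (\<lambda>x. - deriv g (c - x))"
proof (rule ext, rule DERIV_imp_deriv)
  fix x have "((\<lambda>x. c - x) has_real_derivative -1) (at x)" by (auto intro!: derivative_eq_intros)
  from DERIV_chain2[where f=g, OF smoothD(1)[OF assms] this]
  show "((\<lambda>x. g (c - x)) has_real_derivative - deriv g (c - x)) (at x)" by simp
qed

lemma smooth_reflect: "smooth g \<Longrightarrow> smooth (\<lambda>x. g (c - x))"
  by (rule smooth_compose) (auto intro: smooth_intros)

section \<open>A smooth function vanishing on a half-line\<close>

text \<open>Differentiating \<open>exp (- (1 / y))\<close> produces powers of \<open>1 / y\<close>.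
  With the exponent \<open>k\<close> as a parameter the family is closed under differentiation up to
  linear combinations, as the induction in \<open>smooth_flat\<close> requires.\<close>

definition flat :: "nat \<Rightarrow> real \<Rightarrow> real" where
  "flat k y = (if y > 0 then (1 / y) ^ k * exp (- (1 / y)) else 0)"

lemma flat_deriv:
  "(flat k has_real_derivative (flat (k + 2) y - real k * flat (k + 1) y)) (at y)"
proof -
  consider "y < 0" | "y > 0" | "y = 0" by linarith
  then show ?thesis
  proof cases
    case 1
    have "((\<lambda>y. 0) has_real_derivative 0) (at y)" by simp
    then have "(flat k has_real_derivative 0) (at y)"
      by (rule DERIV_cong_ev[THEN iffD1, rotated -1])
         (auto simp: flat_def intro!: eventually_mono[OF eventually_nhds_in_open[of "{..<0}" y]] 1)
    then show ?thesis using 1 by (simp add: flat_def)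
  next
    case 2
    have "((\<lambda>y. (1 / y) ^ k * exp (- (1 / y))) has_real_derivative
        (flat (k + 2) y - real k * flat (k + 1) y)) (at y)"
    proof -
      have 1: "((\<lambda>y. 1 / y) has_real_derivative - (1 / y)\<^sup>2) (at y)"
        using 2 by (auto intro!: derivative_eq_intros simp: field_simps power2_eq_square)
      have "((\<lambda>y. (1 / y) ^ k * exp (- (1 / y))) has_real_derivative
          real k * (1 / y) ^ (k - 1) * - (1 / y)\<^sup>2 * exp (- (1 / y)) + (exp (- (1 / y)) * (1 / y)\<^sup>2) * (1 / y) ^ k) (at y)"
        by (rule DERIV_cong, rule DERIV_mult[OF DERIV_power[OF 1] DERIV_fun_exp[OF DERIV_minus[OF 1]]]) simp
      moreover have "real k * (1 / y) ^ (k - 1) * (1 / y)\<^sup>2 = real k * (1 / y) ^ (k + 1)"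
        by (cases k) (simp_all add: power2_eq_square)
      then have "real k * (1 / y) ^ (k - 1) * - (1 / y)\<^sup>2 * exp (- (1 / y)) + (exp (- (1 / y)) * (1 / y)\<^sup>2) * (1 / y) ^ k
          = flat (k + 2) y - real k * flat (k + 1) y"
        using 2 by (simp add: flat_def power_add power2_eq_square mult_ac)
      ultimately show ?thesis by simp
    qed
    then show ?thesis
      by (rule DERIV_cong_ev[THEN iffD1, rotated -1])
         (auto simp: flat_def intro!: eventually_mono[OF eventually_nhds_in_open[of "{0<..}" y]] 2)
  next
    case 3
    \<comment> \<open>With \<open>x = inverse h\<close> the difference quotient at the origin from
      the right is \<open>x ^ (k + 1) / exp x\<close>; from the left it is 0.\<close>
    have "((\<lambda>x. x ^ (k+1) / exp x) \<longlongrightarrow> 0) (at_top :: real filter)"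
      by (rule tendsto_power_div_exp_0)
    from filterlim_compose[OF this filterlim_inverse_at_top_right]
    have r: "((\<lambda>h. flat k h / h) \<longlongrightarrow> 0) (at_right 0)"
      by (rule Lim_transform_eventually)
         (auto simp: flat_def eventually_at_filter exp_minus field_simps)
    have l: "((\<lambda>h. flat k h / h) \<longlongrightarrow> 0) (at_left 0)"
      by (rule tendsto_eventually) (auto simp: flat_def eventually_at_filter)
    from l r have "((\<lambda>h. flat k h / h) \<longlongrightarrow> 0) (at 0)"
      by (simp add: filterlim_split_at)
    then show ?thesis using 3 by (simp add: DERIV_def flat_def)
  qed
qed

lemma smooth_flat: "smooth (flat k)"
proof -
  have "diff_n n (flat k)" for n
  proof (induction n arbitrary: k)
    case (Suc n)
    have "diff_n n (\<lambda>y. flat (k + 2) y + (- real k) * flat (k + 1) y)"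
      by (intro diff_n_add diff_n_mult diff_n_const Suc)
    then show ?case using flat_deriv[of k]
      by (auto intro!: exI[of _ "\<lambda>y. flat (k + 2) y + (- real k) * flat (k + 1) y"])
  qed auto
  then show ?thesis by (simp add: smooth_def)
qed

definition bump :: "real \<Rightarrow> real \<Rightarrow> real \<Rightarrow> real" where
  "bump c d x = flat 0 (x - c) * flat 0 (d - x)"

lemma smooth_bump [smooth_intros]: "smooth (bump c d)"
  unfolding bump_def by (intro smooth_intros smooth_compose[OF smooth_flat])

lemma bump_nonneg: "0 \<le> bump c d x" by (simp add: bump_def flat_def)
lemma bump_pos: "c < x \<Longrightarrow> x < d \<Longrightarrow> 0 < bump c d x" by (simp add: bump_def flat_def)
lemma bump_eq_0: "x \<le> c \<or> d \<le> x \<Longrightarrow> bump c d x = 0" by (auto simp: bump_def flat_def)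

section \<open>Products of smooth functions as test functions\<close>

lemma pderivs_real:
  assumes "smooth g" "bs \<in> lists Basis"
  shows "pderivs bs g = (deriv ^^ length bs) g"
  using assms(2)
proof (induction bs)
  case (Cons b bs)
  have *: "((deriv ^^ length bs) g has_real_derivative deriv ((deriv ^^ length bs) g) x) (at x)" for x
    by (intro smoothD smooth_deriv_funpow assms)
  have "pderiv_dir 1 ((deriv ^^ length bs) g) x = deriv ((deriv ^^ length bs) g) x" for x
    unfolding pderiv_dir_def
    using frechet_derivative_at[OF *[unfolded has_field_derivative_def, of x]] by (metis mult_1_right)
  then have "pderiv_dir 1 ((deriv ^^ length bs) g) = deriv ((deriv ^^ length bs) g)" by blast
  moreover have "pderivs bs g = (deriv ^^ length bs) g" using Cons by auto
  moreover have "b = 1" using Cons by (simp add: Basis_real_def)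
  ultimately show ?case by simp
qed simp

lemma C_infinity_real: assumes "smooth g" shows "g \<in> C_infinity"
proof -
  have "(deriv ^^ n) g differentiable_on UNIV" for n
    unfolding differentiable_on_def using smoothD(1)[OF smooth_deriv_funpow[OF assms]]
    by (auto simp: has_field_derivative_def differentiable_def)
  then show ?thesis unfolding C_infinity_def by (auto simp: pderivs_real[OF assms])
qed

lemma product_has_derivative:
  assumes "smooth f" "smooth g"
  shows "((\<lambda>p. f (fst p) * g (snd p)) has_derivative
    (\<lambda>h. deriv f (fst p) * fst h * g (snd p) + f (fst p) * (deriv g (snd p) * snd h))) (at p)"
proof -
  have 1: "((\<lambda>p. f (fst p)) has_derivative (\<lambda>h. deriv f (fst p) * fst h)) (at p)"
    by (rule has_derivative_compose[OF _ smoothD(1)[OF assms(1), unfolded has_field_derivative_def], of fst])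
       (auto intro!: derivative_eq_intros)
  have 2: "((\<lambda>p. g (snd p)) has_derivative (\<lambda>h. deriv g (snd p) * snd h)) (at p)"
    by (rule has_derivative_compose[OF _ smoothD(1)[OF assms(2), unfolded has_field_derivative_def], of snd])
       (auto intro!: derivative_eq_intros)
  show ?thesis using has_derivative_mult[OF 1 2] by (simp add: algebra_simps)
qed

lemma pderiv_dir_product:
  assumes "smooth f" "smooth g"
  shows "pderiv_dir dir_t (\<lambda>p. f (fst p) * g (snd p)) = (\<lambda>p. deriv f (fst p) * g (snd p))"
    "pderiv_dir dir_x (\<lambda>p. f (fst p) * g (snd p)) = (\<lambda>p. f (fst p) * deriv g (snd p))"
  unfolding pderiv_dir_def frechet_derivative_at[OF product_has_derivative[OF assms], symmetric]
  by auto

lemma pderivs_product: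
  assumes "smooth f" "smooth g" "bs \<in> lists Basis"
  shows "pderivs bs (\<lambda>p. f (fst p) * g (snd p)) =
    (\<lambda>p. (deriv ^^ count_list bs dir_t) f (fst p) * (deriv ^^ count_list bs dir_x) g (snd p))"
  using assms(3)
proof (induction bs)
  case (Cons b bs)
  then have "b = dir_t \<or> b = dir_x" by (auto simp: Basis_prod_def)
  with Cons assms show ?case by (auto simp: pderiv_dir_product smooth_deriv_funpow)
qed simp

lemma C_infinity_product:
  assumes "smooth f" "smooth g"
  shows "(\<lambda>p. f (fst p) * g (snd p)) \<in> C_infinity"
proof -
  have "(\<lambda>p. (deriv ^^ n) f (fst p) * (deriv ^^ m) g (snd p)) differentiable_on UNIV" for n m
    unfolding differentiable_on_def
    using product_has_derivative[OF smooth_deriv_funpow[OF assms(1)] smooth_deriv_funpow[OF assms(2)]]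
    unfolding differentiable_def by blast
  then show ?thesis unfolding C_infinity_def by (auto simp: pderivs_product[OF assms])
qed

lemma (in pair_sigma_finite) integrable_pair_mult:
  fixes f g :: "_ \<Rightarrow> real"
  assumes f: "integrable M1 f" and g: "integrable M2 g"
  shows "integrable (M1 \<Otimes>\<^sub>M M2) (\<lambda>p. f (fst p) * g (snd p))"
proof (rule Fubini_integrable)
  have [measurable]: "f \<in> borel_measurable M1" "g \<in> borel_measurable M2" using f g by auto
  show "(\<lambda>p. f (fst p) * g (snd p)) \<in> borel_measurable (M1 \<Otimes>\<^sub>M M2)" by measurable
qed (use f g in \<open>auto simp: abs_mult\<close>)

lemma integrable_bounded_mult:
  fixes f h :: "_ \<Rightarrow> real"
  assumes "integrable M f" "h \<in> borel_measurable M" "AE x in M. \<bar>h x\<bar> \<le> c"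
  shows "integrable M (\<lambda>x. h x * f x)" "integrable M (\<lambda>x. f x * h x)"
proof -
  show "integrable M (\<lambda>x. h x * f x)"
  proof (rule Bochner_Integration.integrable_bound[of _ "\<lambda>x. c * f x"])
    show "AE x in M. norm (h x * f x) \<le> norm (c * f x)"
      using assms(3) by eventually_elim (auto simp: abs_mult intro!: mult_right_mono)
  qed (use assms in auto)
  then show "integrable M (\<lambda>x. f x * h x)" by (simp add: mult.commute)
qed

section \<open>Square-integrable functions\<close>

lemma L2_measurable: "u \<in> L2 M \<Longrightarrow> u \<in> borel_measurable M" by (simp add: L2_def)

lemma L2_square: "u \<in> L2 M \<Longrightarrow> integrable M (\<lambda>x. (u x)\<^sup>2)" by (simp add: L2_def)

lemma L2_mult: assumes "u \<in> L2 M" "v \<in> L2 M" shows "integrable M (\<lambda>x. u x * v x)"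
proof (rule Bochner_Integration.integrable_bound[of _ "\<lambda>x. (u x)\<^sup>2 + (v x)\<^sup>2"])
  show "AE x in M. norm (u x * v x) \<le> norm ((u x)\<^sup>2 + (v x)\<^sup>2)"
  proof (rule AE_I2)
    fix x
    have "2 * (\<bar>u x\<bar> * \<bar>v x\<bar>) \<le> (u x)\<^sup>2 + (v x)\<^sup>2"
      using sum_squares_bound[of "\<bar>u x\<bar>" "\<bar>v x\<bar>"] by (simp add: mult.assoc)
    moreover have "0 \<le> \<bar>u x\<bar> * \<bar>v x\<bar>" by simp
    ultimately show "norm (u x * v x) \<le> norm ((u x)\<^sup>2 + (v x)\<^sup>2)"
      unfolding real_norm_def abs_mult by linarith
  qed
qed (use assms in \<open>auto simp: L2_def\<close>)

lemma L2_add: assumes "u \<in> L2 M" "v \<in> L2 M" shows "(\<lambda>x. u x + v x) \<in> L2 M"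
proof -
  have "integrable M (\<lambda>x. (u x)\<^sup>2 + (v x)\<^sup>2 + 2 * (u x * v x))"
    using assms L2_mult[OF assms] by (auto simp: L2_def)
  then show ?thesis using assms by (auto simp: L2_def power2_sum mult.assoc)
qed

lemma L2_cmult: "u \<in> L2 M \<Longrightarrow> (\<lambda>x. c * u x) \<in> L2 M"
  by (auto simp: L2_def power_mult_distrib)

lemma L2_minus: "u \<in> L2 M \<Longrightarrow> (\<lambda>x. - u x) \<in> L2 M"
  using L2_cmult[of u M "-1"] by simp

lemma L2_diff: "u \<in> L2 M \<Longrightarrow> v \<in> L2 M \<Longrightarrow> (\<lambda>x. u x - v x) \<in> L2 M"
  using L2_add[OF _ L2_minus, of u M v] by simp

lemma L2_bounded_mult:
  assumes u: "u \<in> L2 M" and h: "h \<in> borel_measurable M" "AE x in M. \<bar>h x\<bar> \<le> c"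
  shows "(\<lambda>x. h x * u x) \<in> L2 M" "(\<lambda>x. u x * h x) \<in> L2 M"
proof -
  have "integrable M (\<lambda>x. (h x)\<^sup>2 * (u x)\<^sup>2)"
  proof (rule integrable_bounded_mult)
    show "AE x in M. \<bar>(h x)\<^sup>2\<bar> \<le> c\<^sup>2" using h(2)
      by eventually_elim (metis abs_ge_zero abs_power2 power2_abs power_mono)
  qed (use u h in \<open>auto simp: L2_def\<close>)
  then show "(\<lambda>x. h x * u x) \<in> L2 M" using u h by (auto simp: L2_def power_mult_distrib)
  then show "(\<lambda>x. u x * h x) \<in> L2 M" by (simp add: mult.commute)
qed

lemma L2_AE_cong: "u \<in> L2 M \<Longrightarrow> v \<in> borel_measurable M \<Longrightarrow> AE x in M. u x = v x \<Longrightarrow> v \<in> L2 M"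
  unfolding L2_def mem_Collect_eq
  by (auto elim!: integrable_cong_AE_imp)

context finite_measure begin

lemma bounded_L2: "u \<in> borel_measurable M \<Longrightarrow> AE x in M. \<bar>u x\<bar> \<le> c \<Longrightarrow> u \<in> L2 M"
  using L2_bounded_mult(1)[of "\<lambda>x. 1" M u c] by (auto simp: L2_def)

lemma const_L2: "(\<lambda>x. c) \<in> L2 M" by (auto simp: L2_def)

lemma L2_integrable: "u \<in> L2 M \<Longrightarrow> integrable M u"
  using L2_mult[OF _ const_L2[of 1], of u] by simp

lemma Linf_L2: "u \<in> Linf M \<Longrightarrow> u \<in> L2 M" by (auto simp: Linf_def intro: bounded_L2)

end

section \<open>Approximate identities\<close>

definition clamp_real :: "real \<Rightarrow> real \<Rightarrow> real" where "clamp_real c y = max (- c) (min c y)"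

lemma clamp_real_bound: "0 \<le> c \<Longrightarrow> \<bar>clamp_real c y\<bar> \<le> c" by (auto simp: clamp_real_def)
lemma clamp_real_borel [measurable]: "clamp_real c \<in> borel_measurable borel"
  unfolding clamp_real_def by measurable
lemma clamp_real_id: "\<bar>y\<bar> \<le> c \<Longrightarrow> clamp_real c y = y" by (auto simp: clamp_real_def)
lemma clamp_real_diff: "0 \<le> c \<Longrightarrow> \<bar>y - clamp_real c y\<bar> \<le> \<bar>y\<bar>" by (auto simp: clamp_real_def)

lemma clamp_real_tendsto: "(\<lambda>n. clamp_real (real n) y) \<longlonglongrightarrow> y"
proof (rule tendsto_eventually)
  obtain m where "\<bar>y\<bar> \<le> real m" using real_arch_simple by blast
  then show "\<forall>\<^sub>F n in sequentially. clamp_real (real n) y = y"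
    by (intro eventually_sequentiallyI[of m] clamp_real_id) auto
qed

lemma clamp_real_continuous: "continuous_on A g \<Longrightarrow> continuous_on A (\<lambda>x. clamp_real c (g x))"
  unfolding clamp_real_def by (intro continuous_intros)

section \<open>Density of continuous functions in L1\<close>

lemma bounded_finite_measure:
  assumes "bounded S" "S \<in> sets lborel"
  shows "finite_measure (restrict_space lborel (S :: 'a::euclidean_space set))"
proof (rule finite_measureI)
  have "emeasure lborel S < \<infinity>" by (rule emeasure_bounded_finite[OF assms(1)])
  then show "emeasure (restrict_space lborel S) (space (restrict_space lborel S)) \<noteq> \<infinity>"
    using assms by (auto simp: emeasure_restrict_space space_restrict_space)
qed

text \<open>Truncating \<open>w\<close> at a high level costs little in L1. A measurable function is
  an almost everywhere limit of continuous ones, and clamping these at the same level keeps them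
  bounded, so that dominated convergence applies on a set of finite measure.\<close>

lemma continuous_dense_L1:
  fixes w :: "'a::euclidean_space \<Rightarrow> real" and S :: "'a set"
  defines "M \<equiv> restrict_space lborel S"
  assumes S: "bounded S" "S \<in> sets lborel" and w: "integrable (restrict_space lborel S) w" and "0 < e"
  obtains g c where "continuous_on UNIV g" "\<And>x. \<bar>g x\<bar> \<le> c" "(\<integral>x. \<bar>w x - g x\<bar> \<partial>M) < e"
proof -
  interpret finite_measure M unfolding M_def by (rule bounded_finite_measure[OF S])
  have [measurable]: "w \<in> borel_measurable M" using w by (auto simp: M_def)
  have "(\<lambda>n. \<integral>x. \<bar>w x - clamp_real (real n) (w x)\<bar> \<partial>M) \<longlonglongrightarrow> (\<integral>x. 0 \<partial>M)"
  proof (rule integral_dominated_convergence[where w = "\<lambda>x. \<bar>w x\<bar>"])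
    show "AE x in M. (\<lambda>n. \<bar>w x - clamp_real (real n) (w x)\<bar>) \<longlonglongrightarrow> 0"
    proof (rule AE_I2)
      fix x
      have "(\<lambda>n. \<bar>w x - clamp_real (real n) (w x)\<bar>) \<longlonglongrightarrow> \<bar>w x - w x\<bar>"
        by (intro tendsto_intros clamp_real_tendsto)
      then show "(\<lambda>n. \<bar>w x - clamp_real (real n) (w x)\<bar>) \<longlonglongrightarrow> 0" by simp
    qed
  qed (use w in \<open>auto simp: M_def clamp_real_diff\<close>)
  then have "\<forall>\<^sub>F n in sequentially. (\<integral>x. \<bar>w x - clamp_real (real n) (w x)\<bar> \<partial>M) < e / 2"
    using \<open>0 < e\<close> by (intro order_tendstoD(2)[of _ 0]) auto
  then obtain m where m: "(\<integral>x. \<bar>w x - clamp_real (real m) (w x)\<bar> \<partial>M) < e / 2"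
    by (auto simp: eventually_sequentially)
  define f where "f = (\<lambda>x. if x \<in> S then clamp_real (real m) (w x) else 0)"
  have "(\<lambda>x. clamp_real (real m) (w x)) \<in> borel_measurable M" by measurable
  then have "f \<in> borel_measurable lborel"
    unfolding f_def M_def using S(2)
    by (subst (asm) borel_measurable_restrict_space_iff)
       (auto simp: indicator_def of_bool_def if_distrib[of "\<lambda>c. c * _"] cong: if_cong)
  then have "f \<in> borel_measurable lebesgue" by (rule measurable_completion)
  then have "f measurable_on UNIV" by (rule lebesgue_measurable_imp_measurable_on_real) auto
  then obtain N g where N: "negligible N" and g: "\<And>n. continuous_on UNIV (g n)"
    "\<And>x. x \<notin> N \<Longrightarrow> (\<lambda>n. g n x) \<longlonglongrightarrow> f x"
    unfolding measurable_on_def by auto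
  have "AE x in lebesgue. x \<notin> N"
    using N by (intro AE_not_in) (simp add: negligible_iff_null_sets)
  then have "AE x in lborel. x \<notin> N" by (simp add: AE_completion_iff)
  then have AE_N: "AE x in M. x \<notin> N" unfolding M_def using S(2)
    by (subst AE_restrict_space_iff) auto
  have gb[measurable]: "g n \<in> borel_measurable M" for n
    unfolding M_def by (intro measurable_restrict_space1) (simp add: borel_measurable_continuous_onI g(1))
  have "(\<lambda>n. \<integral>x. \<bar>clamp_real (real m) (w x) - clamp_real (real m) (g n x)\<bar> \<partial>M) \<longlonglongrightarrow> (\<integral>x. 0 \<partial>M)"
  proof (rule integral_dominated_convergence[where w = "\<lambda>x. 2 * real m"])
    show "AE x in M. (\<lambda>n. \<bar>clamp_real (real m) (w x) - clamp_real (real m) (g n x)\<bar>) \<longlonglongrightarrow> 0"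
      using AE_N AE_space
    proof eventually_elim
      case (elim x)
      then have x: "x \<in> S" by (simp add: M_def space_restrict_space)
      have "(\<lambda>n. \<bar>clamp_real (real m) (w x) - clamp_real (real m) (g n x)\<bar>) \<longlonglongrightarrow>
        \<bar>clamp_real (real m) (w x) - clamp_real (real m) (f x)\<bar>"
        unfolding clamp_real_def by (intro tendsto_intros g(2) elim(1))
      then show ?case using x by (simp add: f_def clamp_real_id clamp_real_bound)
    qed
    show "AE x in M. norm \<bar>clamp_real (real m) (w x) - clamp_real (real m) (g n x)\<bar> \<le> 2 * real m" for n
    proof (rule AE_I2)
      fix x show "norm \<bar>clamp_real (real m) (w x) - clamp_real (real m) (g n x)\<bar> \<le> 2 * real m"
        using clamp_real_bound[of "real m" "w x"] clamp_real_bound[of "real m" "g n x"] by simp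
    qed
  qed auto
  then have "\<forall>\<^sub>F n in sequentially. (\<integral>x. \<bar>clamp_real (real m) (w x) - clamp_real (real m) (g n x)\<bar> \<partial>M) < e / 2"
    using \<open>0 < e\<close> by (intro order_tendstoD(2)[of _ 0]) auto
  then obtain n where n: "(\<integral>x. \<bar>clamp_real (real m) (w x) - clamp_real (real m) (g n x)\<bar> \<partial>M) < e / 2"
    by (auto simp: eventually_sequentially)
  have i1: "integrable M (\<lambda>x. clamp_real (real m) (w x))" "integrable M (\<lambda>x. clamp_real (real m) (g n x))"
    by (intro integrable_const_bound[where B="real m"]; simp add: clamp_real_bound)+
  have i2: "integrable M w" using w by (simp add: M_def)
  have "(\<integral>x. \<bar>w x - clamp_real (real m) (g n x)\<bar> \<partial>M) \<le>
    (\<integral>x. \<bar>w x - clamp_real (real m) (w x)\<bar> + \<bar>clamp_real (real m) (w x) - clamp_real (real m) (g n x)\<bar> \<partial>M)"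
    using i1 i2 by (intro integral_mono) auto
  also have "\<dots> < e" using m n i1 i2 by (subst Bochner_Integration.integral_add) auto
  finally show ?thesis
    by (intro that[of "\<lambda>x. clamp_real (real m) (g n x)" "real m"] clamp_real_continuous g(1))
       (auto simp: clamp_real_bound)
qed

text \<open>Mass at most 1 in each variable makes integration against the kernel a contraction from
  either side. Mass equal to 1 is required only eventually and pointwise in \<open>p\<close>: the
  time kernel looks forward and loses mass close to the final time. Concentration is pointwise in
  \<open>p\<close> as well, because a periodic kernel centred near one endpoint also charges points
  near the other endpoint, which are far away for \<open>dist\<close>.\<close>

locale approximate_identity =
  fixes S :: "'a::euclidean_space set" and k :: "nat \<Rightarrow> 'a \<Rightarrow> 'a \<Rightarrow> real"
  assumes open_S: "open S" and bounded_S: "bounded S"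
    and k_borel: "\<And>n. (\<lambda>p. k n (fst p) (snd p)) \<in> borel_measurable (borel \<Otimes>\<^sub>M borel)"
    and k_nonneg: "\<And>n p q. 0 \<le> k n p q"
    and k_bounded: "\<And>n. \<exists>c. \<forall>p q. k n p q \<le> c"
    and k_mass: "\<And>n p. p \<in> S \<Longrightarrow> (\<integral>q. k n p q \<partial>restrict_space lborel S) \<le> 1"
      "\<And>n q. q \<in> S \<Longrightarrow> (\<integral>p. k n p q \<partial>restrict_space lborel S) \<le> 1"
    and k_mass_1: "\<And>p. p \<in> S \<Longrightarrow> \<forall>\<^sub>F n in sequentially. (\<integral>q. k n p q \<partial>restrict_space lborel S) = 1"
    and k_concentrated:
      "\<And>p d. p \<in> S \<Longrightarrow> 0 < d \<Longrightarrow> \<forall>\<^sub>F n in sequentially. \<forall>q\<in>S. k n p q \<noteq> 0 \<longrightarrow> dist p q < d"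
begin

definition "M = restrict_space lborel S"

lemma S_sets: "S \<in> sets lborel" using open_S by simp

lemma space_M [simp]: "space M = S" by (simp add: M_def space_restrict_space)

sublocale fm: finite_measure M
  unfolding M_def by (rule bounded_finite_measure[OF bounded_S S_sets])

sublocale pm: pair_sigma_finite M M ..

lemma k_measurable [measurable]: "(\<lambda>p. k n (fst p) (snd p)) \<in> borel_measurable (M \<Otimes>\<^sub>M M)"
proof -
  have "(\<lambda>p. (fst p, snd p)) \<in> measurable (M \<Otimes>\<^sub>M M) (borel \<Otimes>\<^sub>M borel)"
    unfolding M_def by (intro measurable_Pair) (auto intro!: measurable_compose[OF measurable_fst] measurable_compose[OF measurable_snd] measurable_restrict_space1)
  from measurable_compose[OF this k_borel] show ?thesis by simp
qed

lemma k_measurable1 [measurable]: "p \<in> S \<Longrightarrow> k n p \<in> borel_measurable M"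
  using measurable_compose[OF measurable_Pair1'[of p M M] k_measurable] by simp

lemma k_measurable2 [measurable]: "q \<in> S \<Longrightarrow> (\<lambda>p. k n p q) \<in> borel_measurable M"
  using measurable_compose[OF measurable_Pair2'[of q M M] k_measurable] by simp

lemma k_abs_bounded: "\<exists>c. \<forall>p q. \<bar>k n p q\<bar> \<le> c" using k_bounded[of n] k_nonneg[of n] by simp

lemma k_integrable: "p \<in> S \<Longrightarrow> integrable M (\<lambda>q. k n p q)" "q \<in> S \<Longrightarrow> integrable M (\<lambda>p. k n p q)"
proof -
  obtain c where c: "\<forall>p q. \<bar>k n p q\<bar> \<le> c" using k_abs_bounded by blast
  show "p \<in> S \<Longrightarrow> integrable M (\<lambda>q. k n p q)" "q \<in> S \<Longrightarrow> integrable M (\<lambda>p. k n p q)"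
    using c by (auto intro!: fm.integrable_const_bound[where B=c])
qed

lemma integrable_pair_k:
  assumes "integrable M f" "integrable M g"
  shows "integrable (M \<Otimes>\<^sub>M M) (\<lambda>p. f (fst p) * g (snd p) * k n (fst p) (snd p))"
proof -
  obtain c where "\<forall>p q. \<bar>k n p q\<bar> \<le> c" using k_abs_bounded by blast
  then show ?thesis
    by (intro integrable_bounded_mult(2)[where c=c] pm.integrable_pair_mult assms) auto
qed

lemma integrable_fst_k: "integrable M f \<Longrightarrow> integrable (M \<Otimes>\<^sub>M M) (\<lambda>p. f (fst p) * k n (fst p) (snd p))"
  using integrable_pair_k[of f "\<lambda>_. 1"] by simp

lemma integrable_snd_k: "integrable M f \<Longrightarrow> integrable (M \<Otimes>\<^sub>M M) (\<lambda>p. f (snd p) * k n (fst p) (snd p))"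
  using integrable_pair_k[of "\<lambda>_. 1" f] by simp

lemma integral_fst_k:
  assumes "integrable M f"
  shows "(\<integral>p. f (fst p) * k n (fst p) (snd p) \<partial>(M \<Otimes>\<^sub>M M)) = (\<integral>p. f p * (\<integral>q. k n p q \<partial>M) \<partial>M)"
  using pm.integral_fst'[OF integrable_fst_k[OF assms]] by simp

lemma integral_snd_k:
  assumes "integrable M f"
  shows "(\<integral>p. f (snd p) * k n (fst p) (snd p) \<partial>(M \<Otimes>\<^sub>M M)) = (\<integral>q. f q * (\<integral>p. k n p q \<partial>M) \<partial>M)"
  using pm.integral_snd[of "\<lambda>p q. f q * k n p q"] integrable_snd_k[OF assms] by (simp add: case_prod_unfold)

lemma integral_fst_k_le:
  assumes "integrable M f" "\<And>p. 0 \<le> f p"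
  shows "(\<integral>p. f (fst p) * k n (fst p) (snd p) \<partial>(M \<Otimes>\<^sub>M M)) \<le> (\<integral>p. f p \<partial>M)"
  unfolding integral_fst_k[OF assms(1)]
proof (rule integral_mono)
  show "integrable M (\<lambda>p. f p * (\<integral>q. k n p q \<partial>M))"
    using pm.integrable_fst'[OF integrable_fst_k[OF assms(1), of n]] by simp
qed (use assms k_mass(1) in \<open>auto simp: M_def[symmetric] intro!: mult_left_le\<close>)

lemma integral_snd_k_le:
  assumes "integrable M f" "\<And>p. 0 \<le> f p"
  shows "(\<integral>p. f (snd p) * k n (fst p) (snd p) \<partial>(M \<Otimes>\<^sub>M M)) \<le> (\<integral>p. f p \<partial>M)"
  unfolding integral_snd_k[OF assms(1)]
proof (rule integral_mono)
  show "integrable M (\<lambda>q. f q * (\<integral>p. k n p q \<partial>M))"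
    using pm.integrable_snd[of "\<lambda>p q. f q * k n p q"] integrable_snd_k[OF assms(1), of n] by (simp add: case_prod_unfold)
qed (use assms k_mass(2) in \<open>auto simp: M_def[symmetric] intro!: mult_left_le\<close>)

definition osc :: "nat \<Rightarrow> ('a \<Rightarrow> real) \<Rightarrow> real" where
  "osc n w = (\<integral>p. \<bar>w (fst p) - w (snd p)\<bar> * k n (fst p) (snd p) \<partial>(M \<Otimes>\<^sub>M M))"

lemma osc_integrable:
  assumes "integrable M w"
  shows "integrable (M \<Otimes>\<^sub>M M) (\<lambda>p. \<bar>w (fst p) - w (snd p)\<bar> * k n (fst p) (snd p))"
proof (rule Bochner_Integration.integrable_bound)
  show "integrable (M \<Otimes>\<^sub>M M) (\<lambda>p. \<bar>w (fst p)\<bar> * k n (fst p) (snd p) + \<bar>w (snd p)\<bar> * k n (fst p) (snd p))"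
    using assms by (intro Bochner_Integration.integrable_add integrable_fst_k[of "\<lambda>p. \<bar>w p\<bar>"] integrable_snd_k[of "\<lambda>p. \<bar>w p\<bar>"]) auto
  have [measurable]: "w \<in> borel_measurable M" using assms by auto
  show "(\<lambda>p. \<bar>w (fst p) - w (snd p)\<bar> * k n (fst p) (snd p)) \<in> borel_measurable (M \<Otimes>\<^sub>M M)" by measurable
  show "AE p in M \<Otimes>\<^sub>M M. norm (\<bar>w (fst p) - w (snd p)\<bar> * k n (fst p) (snd p)) \<le>
      norm (\<bar>w (fst p)\<bar> * k n (fst p) (snd p) + \<bar>w (snd p)\<bar> * k n (fst p) (snd p))"
    by (rule AE_I2) (auto simp: k_nonneg distrib_right[symmetric] abs_mult intro!: mult_right_mono)
qed

text \<open>For fixed \<open>p\<close> the inner integral is at most the oscillation of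
  \<open>g\<close> over the points where the kernel does not vanish, and these shrink to
  \<open>p\<close>. The bound \<open>2 * c\<close> then allows dominated convergence in
  \<open>p\<close>.\<close>

lemma osc_continuous:
  assumes g: "continuous_on UNIV g" "\<And>x. \<bar>g x\<bar> \<le> c"
  shows "(\<lambda>n. osc n g) \<longlonglongrightarrow> 0"
proof -
  have c0: "0 \<le> c" using g(2)[of 0] by linarith
  have gM[measurable]: "g \<in> borel_measurable M" unfolding M_def
    by (intro measurable_restrict_space1) (simp add: borel_measurable_continuous_onI g(1))
  have gi: "integrable M g" using g(2) by (intro fm.integrable_const_bound[where B=c]) auto
  have inner: "integrable M (\<lambda>q. \<bar>g p - g q\<bar> * k n p q)" if "p \<in> S" for n p
  proof (rule integrable_bounded_mult(1)[OF k_integrable(1)[OF that]])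
    show "AE q in M. \<bar>\<bar>g p - g q\<bar>\<bar> \<le> 2 * c"
    proof (rule AE_I2)
      fix q show "\<bar>\<bar>g p - g q\<bar>\<bar> \<le> 2 * c" using g(2)[of p] g(2)[of q] by linarith
    qed
  qed measurable
  have bd: "(\<integral>q. \<bar>g p - g q\<bar> * k n p q \<partial>M) \<le> e" if p: "p \<in> S" and e: "0 \<le> e"
      "\<And>q. q \<in> S \<Longrightarrow> k n p q \<noteq> 0 \<Longrightarrow> \<bar>g p - g q\<bar> \<le> e" for n p e
  proof -
    have "(\<integral>q. \<bar>g p - g q\<bar> * k n p q \<partial>M) \<le> (\<integral>q. e * k n p q \<partial>M)"
    proof (rule integral_mono[OF inner[OF p]])
      show "integrable M (\<lambda>q. e * k n p q)" using k_integrable(1)[OF p] by simp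
      fix q assume "q \<in> space M"
      then show "\<bar>g p - g q\<bar> * k n p q \<le> e * k n p q"
        using e(2)[of q] k_nonneg[of n p q] by (cases "k n p q = 0") (auto intro!: mult_right_mono)
    qed
    also have "\<dots> = e * (\<integral>q. k n p q \<partial>M)" by simp
    also have "\<dots> \<le> e" using k_mass(1)[OF p, of n] e(1) by (simp add: M_def mult_left_le)
    finally show ?thesis .
  qed
  have "(\<lambda>n. \<integral>p. \<integral>q. \<bar>g p - g q\<bar> * k n p q \<partial>M \<partial>M) \<longlonglongrightarrow> (\<integral>p. 0 \<partial>M)"
  proof (rule integral_dominated_convergence[where w = "\<lambda>x. 2 * c"])
    show "(\<lambda>p. \<integral>q. \<bar>g p - g q\<bar> * k n p q \<partial>M) \<in> borel_measurable M" for n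
      using pm.integrable_fst'[OF osc_integrable[OF gi, of n]] by simp
    show "AE p in M. (\<lambda>n. \<integral>q. \<bar>g p - g q\<bar> * k n p q \<partial>M) \<longlonglongrightarrow> 0"
    proof (rule AE_I2, rule LIMSEQ_I)
      fix p r assume "p \<in> space M" and r: "0 < (r::real)"
      then have p: "p \<in> S" by simp
      have "isCont g p" using g(1) by (simp add: continuous_on_eq_continuous_at)
      then obtain d where d: "0 < d" "\<And>q. dist p q < d \<Longrightarrow> \<bar>g p - g q\<bar> < r / 2"
        unfolding continuous_at_eps_delta using r
        by (metis dist_commute dist_real_def half_gt_zero)
      have "\<forall>\<^sub>F n in sequentially. norm ((\<integral>q. \<bar>g p - g q\<bar> * k n p q \<partial>M) - 0) < r"
        using k_concentrated[OF p d(1)]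
      proof eventually_elim
        case (elim n)
        have "(\<integral>q. \<bar>g p - g q\<bar> * k n p q \<partial>M) \<le> r / 2"
          using elim d(2) r by (intro bd[OF p]) (auto intro: less_imp_le)
        moreover have "0 \<le> (\<integral>q. \<bar>g p - g q\<bar> * k n p q \<partial>M)"
          by (intro integral_nonneg_AE AE_I2) (auto simp: k_nonneg)
        ultimately show ?case using r by simp
      qed
      then show "\<exists>no. \<forall>n\<ge>no. norm ((\<integral>q. \<bar>g p - g q\<bar> * k n p q \<partial>M) - 0) < r"
        by (simp add: eventually_sequentially)
    qed
    show "AE p in M. norm (\<integral>q. \<bar>g p - g q\<bar> * k n p q \<partial>M) \<le> 2 * c" for n
    proof (rule AE_I2)
      fix p assume "p \<in> space M"
      then have "(\<integral>q. \<bar>g p - g q\<bar> * k n p q \<partial>M) \<le> 2 * c"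
      proof (intro bd)
        fix q show "\<bar>g p - g q\<bar> \<le> 2 * c" using g(2)[of p] g(2)[of q] by linarith
      qed (use c0 in auto)
      moreover have "0 \<le> (\<integral>q. \<bar>g p - g q\<bar> * k n p q \<partial>M)"
        by (intro integral_nonneg_AE AE_I2) (auto simp: k_nonneg)
      ultimately show "norm (\<integral>q. \<bar>g p - g q\<bar> * k n p q \<partial>M) \<le> 2 * c" by simp
    qed
  qed auto
  then show ?thesis unfolding osc_def using pm.integral_fst'[OF osc_integrable[OF gi]] by simp
qed

text \<open>The two mass bounds make \<open>osc n\<close> Lipschitz in the L1 norm with constant 2,
  uniformly in \<open>n\<close>, so the continuous case extends by density.\<close>

lemma osc_tendsto_0:
  assumes w: "integrable M w"
  shows "(\<lambda>n. osc n w) \<longlonglongrightarrow> 0"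
proof (rule LIMSEQ_I)
  fix r :: real assume r: "0 < r"
  obtain g c where g: "continuous_on UNIV g" "\<And>x. \<bar>g x\<bar> \<le> c" "(\<integral>x. \<bar>w x - g x\<bar> \<partial>M) < r / 4"
    using continuous_dense_L1[OF bounded_S S_sets w[unfolded M_def], of "r / 4"] r unfolding M_def by auto
  have [measurable]: "g \<in> borel_measurable M" unfolding M_def
    by (intro measurable_restrict_space1) (simp add: borel_measurable_continuous_onI g(1))
  have gi: "integrable M g" using g(2) by (intro fm.integrable_const_bound[where B=c]) auto
  let ?v = "\<lambda>x. \<bar>w x - g x\<bar>"
  have vi: "integrable M ?v" using gi w by auto
  have le: "osc n w \<le> osc n g + 2 * (\<integral>x. \<bar>w x - g x\<bar> \<partial>M)" for n
  proof -
    have "osc n w \<le> (\<integral>p. \<bar>g (fst p) - g (snd p)\<bar> * k n (fst p) (snd p)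
       + (?v (fst p) * k n (fst p) (snd p) + ?v (snd p) * k n (fst p) (snd p)) \<partial>(M \<Otimes>\<^sub>M M))"
      unfolding osc_def
    proof (rule integral_mono[OF osc_integrable[OF w]])
      show "integrable (M \<Otimes>\<^sub>M M) (\<lambda>p. \<bar>g (fst p) - g (snd p)\<bar> * k n (fst p) (snd p)
       + (?v (fst p) * k n (fst p) (snd p) + ?v (snd p) * k n (fst p) (snd p)))"
        by (intro Bochner_Integration.integrable_add osc_integrable gi integrable_fst_k[OF vi] integrable_snd_k[OF vi])
      fix p
      have "\<bar>w (fst p) - w (snd p)\<bar> \<le> \<bar>g (fst p) - g (snd p)\<bar> + (?v (fst p) + ?v (snd p))" by linarith
      from mult_right_mono[OF this k_nonneg[of n "fst p" "snd p"]]
      show "\<bar>w (fst p) - w (snd p)\<bar> * k n (fst p) (snd p) \<le> \<bar>g (fst p) - g (snd p)\<bar> * k n (fst p) (snd p)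
       + (?v (fst p) * k n (fst p) (snd p) + ?v (snd p) * k n (fst p) (snd p))"
        by (simp add: distrib_right)
    qed
    also have "\<dots> = osc n g + ((\<integral>p. ?v (fst p) * k n (fst p) (snd p) \<partial>(M \<Otimes>\<^sub>M M)) +
        (\<integral>p. ?v (snd p) * k n (fst p) (snd p) \<partial>(M \<Otimes>\<^sub>M M)))"
      unfolding osc_def
      by (subst Bochner_Integration.integral_add
          | intro Bochner_Integration.integrable_add osc_integrable gi integrable_fst_k[OF vi] integrable_snd_k[OF vi] refl)+
    also have "\<dots> \<le> osc n g + 2 * (\<integral>x. \<bar>w x - g x\<bar> \<partial>M)"
      using integral_fst_k_le[OF vi, of n] integral_snd_k_le[OF vi, of n] by simp
    finally show ?thesis .
  qed
  have nn: "0 \<le> osc n w" for n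
    unfolding osc_def by (intro integral_nonneg_AE AE_I2) (auto simp: k_nonneg)
  have "\<forall>\<^sub>F n in sequentially. osc n g < r / 2"
    using osc_continuous[OF g(1,2)] r by (intro order_tendstoD(2)[of _ 0]) auto
  then have "\<forall>\<^sub>F n in sequentially. norm (osc n w - 0) < r"
    by eventually_elim (use le nn g(3) in \<open>auto, smt (verit)\<close>)
  then show "\<exists>no. \<forall>n\<ge>no. norm (osc n w - 0) < r" by (simp add: eventually_sequentially)
qed

text \<open>This has the effect of Lebesgue's differentiation theorem. By
  \<open>osc_tendsto_0\<close> the averages of \<open>w\<close> approach \<open>w\<close> in L1,
  hence almost everywhere along a subsequence; the assumption holds for all late \<open>n\<close>
  and therefore survives the passage to the subsequence.\<close>

lemma AE_le_of_kernel_le: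
  assumes w: "integrable M w"
    and le: "AE p in M. \<forall>\<^sub>F n in sequentially. (\<integral>q. w q * k n p q \<partial>M) \<le> B"
  shows "AE p in M. w p \<le> B"
proof -
  let ?G = "\<lambda>n p. \<integral>q. \<bar>w p - w q\<bar> * k n p q \<partial>M"
  have [measurable]: "w \<in> borel_measurable M" using w by auto
  have Gi: "integrable M (?G n)" for n
    using pm.integrable_fst'[OF osc_integrable[OF w, of n]] by simp
  have Gn: "0 \<le> ?G n p" for n p
    by (intro integral_nonneg_AE AE_I2) (auto simp: k_nonneg)
  have "(\<lambda>n. \<integral>p. norm (?G n p) \<partial>M) \<longlonglongrightarrow> 0"
    using osc_tendsto_0[OF w] Gn pm.integral_fst'[OF osc_integrable[OF w]] by (simp add: osc_def)
  from tendsto_L1_AE_subseq[OF Gi this]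
  obtain r where r: "strict_mono r" "AE p in M. (\<lambda>n. ?G (r n) p) \<longlonglongrightarrow> 0" by auto
  show ?thesis using r(2) le AE_space
  proof eventually_elim
    case (elim p)
    then have p: "p \<in> S" by simp
    have wi: "integrable M (\<lambda>q. w q * k n p q)" for n
    proof -
      obtain c where "\<forall>p q. \<bar>k n p q\<bar> \<le> c" using k_abs_bounded by blast
      then show ?thesis using p by (intro integrable_bounded_mult(2)[where c=c] w) auto
    qed
    have "\<forall>\<^sub>F n in sequentially. w p - B \<le> ?G n p"
      using elim(2) k_mass_1[OF p]
    proof eventually_elim
      case (elim n)
      have "w p - B \<le> w p * (\<integral>q. k n p q \<partial>M) - (\<integral>q. w q * k n p q \<partial>M)"
        using elim by (simp add: M_def)
      also have "\<dots> = (\<integral>q. w p * k n p q - w q * k n p q \<partial>M)"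
        using wi k_integrable(1)[OF p] by (subst Bochner_Integration.integral_diff) auto
      also have "\<dots> \<le> ?G n p"
      proof (rule integral_mono)
        show "integrable M (\<lambda>q. w p * k n p q - w q * k n p q)"
          using wi k_integrable(1)[OF p] by auto
        then have "integrable M (\<lambda>q. \<bar>w p * k n p q - w q * k n p q\<bar>)" by auto
        then show "integrable M (\<lambda>q. \<bar>w p - w q\<bar> * k n p q)"
          by (simp add: left_diff_distrib[symmetric] abs_mult k_nonneg)
        fix q show "w p * k n p q - w q * k n p q \<le> \<bar>w p - w q\<bar> * k n p q"
          unfolding left_diff_distrib[symmetric] by (intro mult_right_mono k_nonneg) simp
      qed
      finally show ?case .
    qed
    then have "\<forall>\<^sub>F n in sequentially. w p - B \<le> ?G (r n) p"
      using eventually_subseq[OF r(1)] by blast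
    with elim(1) have "w p - B \<le> 0" by (intro tendsto_lowerbound[of _ 0 sequentially "w p - B"]) auto
    then show ?case by simp
  qed
qed

lemma AE_0_of_kernel_0:
  assumes w: "integrable M w"
    and eq: "AE p in M. \<forall>\<^sub>F n in sequentially. (\<integral>q. w q * k n p q \<partial>M) = 0"
  shows "AE p in M. w p = 0"
proof -
  have "AE p in M. w p \<le> 0"
    using eq by (intro AE_le_of_kernel_le[OF w]) (auto elim!: eventually_mono)
  moreover have "AE p in M. - w p \<le> 0"
    using w eq by (intro AE_le_of_kernel_le) (auto elim!: eventually_mono)
  ultimately show ?thesis by eventually_elim simp
qed

text \<open>Replacing \<open>w (snd p)\<close> by \<open>w (fst p)\<close> costs at most
  \<open>c * osc n w\<close>. What remains is \<open>A * w\<close> weighted by the kernel mass,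
  which tends to 1 pointwise.\<close>

lemma pairing_tendsto_bounded:
  assumes A[measurable]: "A \<in> borel_measurable M" and c: "\<And>p. \<bar>A p\<bar> \<le> c" and w: "integrable M w"
  shows "(\<lambda>n. \<integral>p. A (fst p) * w (snd p) * k n (fst p) (snd p) \<partial>(M \<Otimes>\<^sub>M M)) \<longlonglongrightarrow> (\<integral>p. A p * w p \<partial>M)"
proof -
  have [measurable]: "w \<in> borel_measurable M" using w by auto
  have c0: "0 \<le> c" using c[of undefined] by linarith
  have Ai: "integrable M A" using c by (intro fm.integrable_const_bound[where B=c]) auto
  have Aw: "integrable M (\<lambda>p. A p * w p)" using c by (intro integrable_bounded_mult[OF w, where c=c]) auto
  have i1: "integrable (M \<Otimes>\<^sub>M M) (\<lambda>p. A (fst p) * w (snd p) * k n (fst p) (snd p))" for n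
    by (rule integrable_pair_k[OF Ai w])
  have i2: "integrable (M \<Otimes>\<^sub>M M) (\<lambda>p. A (fst p) * w (fst p) * k n (fst p) (snd p))" for n
    by (rule integrable_fst_k[OF Aw])
  have "(\<lambda>n. \<integral>p. A p * w p * (\<integral>q. k n p q \<partial>M) \<partial>M) \<longlonglongrightarrow> (\<integral>p. A p * w p \<partial>M)"
  proof (rule integral_dominated_convergence[where w="\<lambda>p. \<bar>A p * w p\<bar>"])
    show "(\<lambda>p. A p * w p * (\<integral>q. k n p q \<partial>M)) \<in> borel_measurable M" for n
      using pm.integrable_fst'[OF i2[of n]] by simp
    show "AE p in M. (\<lambda>n. A p * w p * (\<integral>q. k n p q \<partial>M)) \<longlonglongrightarrow> A p * w p"
    proof (rule AE_I2)
      fix p assume "p \<in> space M"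
      then have "p \<in> S" by simp
      then have "(\<lambda>n. \<integral>q. k n p q \<partial>M) \<longlonglongrightarrow> 1"
        unfolding M_def by (intro tendsto_eventually k_mass_1)
      from tendsto_mult[OF tendsto_const[of "A p * w p"] this]
      show "(\<lambda>n. A p * w p * (\<integral>q. k n p q \<partial>M)) \<longlonglongrightarrow> A p * w p" by simp
    qed
    show "AE p in M. norm (A p * w p * (\<integral>q. k n p q \<partial>M)) \<le> \<bar>A p * w p\<bar>" for n
    proof (rule AE_I2)
      fix p assume "p \<in> space M"
      then have "p \<in> S" by simp
      then have "(\<integral>q. k n p q \<partial>M) \<le> 1" unfolding M_def by (rule k_mass(1))
      moreover have "0 \<le> (\<integral>q. k n p q \<partial>M)" by (intro integral_nonneg_AE AE_I2 k_nonneg)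
      ultimately show "norm (A p * w p * (\<integral>q. k n p q \<partial>M)) \<le> \<bar>A p * w p\<bar>"
        by (auto simp: abs_mult intro!: mult_left_le)
    qed
  qed (use Aw in auto)
  then have l1: "(\<lambda>n. \<integral>p. A (fst p) * w (fst p) * k n (fst p) (snd p) \<partial>(M \<Otimes>\<^sub>M M)) \<longlonglongrightarrow> (\<integral>p. A p * w p \<partial>M)"
    by (simp add: integral_fst_k[OF Aw])
  have "(\<lambda>n. (\<integral>p. A (fst p) * w (snd p) * k n (fst p) (snd p) \<partial>(M \<Otimes>\<^sub>M M)) -
      (\<integral>p. A (fst p) * w (fst p) * k n (fst p) (snd p) \<partial>(M \<Otimes>\<^sub>M M))) \<longlonglongrightarrow> 0"
  proof (rule Lim_null_comparison)
    show "(\<lambda>n. c * osc n w) \<longlonglongrightarrow> 0" using tendsto_mult[OF tendsto_const osc_tendsto_0[OF w], of c] by simp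
    show "\<forall>\<^sub>F n in sequentially. norm ((\<integral>p. A (fst p) * w (snd p) * k n (fst p) (snd p) \<partial>(M \<Otimes>\<^sub>M M)) -
      (\<integral>p. A (fst p) * w (fst p) * k n (fst p) (snd p) \<partial>(M \<Otimes>\<^sub>M M))) \<le> c * osc n w"
    proof (rule always_eventually, rule allI)
      fix n
      have "norm (\<integral>p. A (fst p) * w (snd p) * k n (fst p) (snd p) - A (fst p) * w (fst p) * k n (fst p) (snd p) \<partial>(M \<Otimes>\<^sub>M M))
        \<le> (\<integral>p. norm (A (fst p) * w (snd p) * k n (fst p) (snd p) - A (fst p) * w (fst p) * k n (fst p) (snd p)) \<partial>(M \<Otimes>\<^sub>M M))"
        by (rule integral_norm_bound)
      also have "\<dots> \<le> (\<integral>p. c * (\<bar>w (fst p) - w (snd p)\<bar> * k n (fst p) (snd p)) \<partial>(M \<Otimes>\<^sub>M M))"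
      proof (rule integral_mono)
        fix p
        have "A (fst p) * w (snd p) * k n (fst p) (snd p) - A (fst p) * w (fst p) * k n (fst p) (snd p)
          = A (fst p) * ((w (snd p) - w (fst p)) * k n (fst p) (snd p))" by (simp add: algebra_simps)
        then show "norm (A (fst p) * w (snd p) * k n (fst p) (snd p) - A (fst p) * w (fst p) * k n (fst p) (snd p))
           \<le> c * (\<bar>w (fst p) - w (snd p)\<bar> * k n (fst p) (snd p))"
          using c by (auto simp: abs_mult k_nonneg abs_minus_commute intro!: mult_right_mono)
      qed (use i1 i2 osc_integrable[OF w] in auto)
      also have "\<dots> = c * osc n w" by (simp add: osc_def)
      finally show "norm ((\<integral>p. A (fst p) * w (snd p) * k n (fst p) (snd p) \<partial>(M \<Otimes>\<^sub>M M)) -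
        (\<integral>p. A (fst p) * w (fst p) * k n (fst p) (snd p) \<partial>(M \<Otimes>\<^sub>M M))) \<le> c * osc n w"
        using i1 i2 by (subst (asm) Bochner_Integration.integral_diff) auto
    qed
  qed
  from tendsto_add[OF this l1] show ?thesis by simp
qed

text \<open>Young's inequality with weight \<open>s\<close> under the double integral, followed by
  the mass bounds. The result is independent of \<open>n\<close>, and the free weight lets a small
  \<open>A\<close> be paired with an arbitrary \<open>w\<close>.\<close>

lemma pairing_bound:
  assumes A: "A \<in> L2 M" and w: "w \<in> L2 M" and s: "0 < s"
  shows "\<bar>\<integral>p. A (fst p) * w (snd p) * k n (fst p) (snd p) \<partial>(M \<Otimes>\<^sub>M M)\<bar>
    \<le> s * (\<integral>p. (A p)\<^sup>2 \<partial>M) + (\<integral>p. (w p)\<^sup>2 \<partial>M) / s"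
    (is "?l \<le> _")
proof -
  have Ai: "integrable M A" "integrable M w" using A w fm.L2_integrable by auto
  have sq: "integrable M (\<lambda>p. s * (A p)\<^sup>2)" "integrable M (\<lambda>p. (w p)\<^sup>2 / s)" using L2_square[OF A] L2_square[OF w] by auto
  have ab: "\<bar>x * y\<bar> \<le> s * x\<^sup>2 + y\<^sup>2 / s" for x y
  proof -
    have "0 \<le> (s * \<bar>x\<bar> - \<bar>y\<bar>)\<^sup>2 / s" using s by simp
    also have "\<dots> = s * x\<^sup>2 + y\<^sup>2 / s - 2 * (\<bar>x\<bar> * \<bar>y\<bar>)"
      using s by (simp add: power2_diff power_mult_distrib field_simps power2_eq_square)
    finally have "2 * (\<bar>x\<bar> * \<bar>y\<bar>) \<le> s * x\<^sup>2 + y\<^sup>2 / s" by simp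
    moreover have "0 \<le> \<bar>x\<bar> * \<bar>y\<bar>" by simp
    ultimately show ?thesis unfolding abs_mult by linarith
  qed
  have "?l \<le> (\<integral>p. norm (A (fst p) * w (snd p) * k n (fst p) (snd p)) \<partial>(M \<Otimes>\<^sub>M M))"
    using integral_norm_bound[of "M \<Otimes>\<^sub>M M" "\<lambda>p. A (fst p) * w (snd p) * k n (fst p) (snd p)"] by simp
  also have "\<dots> \<le> (\<integral>p. (s * (A (fst p))\<^sup>2) * k n (fst p) (snd p) + ((w (snd p))\<^sup>2 / s) * k n (fst p) (snd p) \<partial>(M \<Otimes>\<^sub>M M))"
  proof (rule integral_mono)
    show "integrable (M \<Otimes>\<^sub>M M) (\<lambda>p. norm (A (fst p) * w (snd p) * k n (fst p) (snd p)))"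
      using integrable_pair_k[OF Ai] by auto
    show "integrable (M \<Otimes>\<^sub>M M) (\<lambda>p. (s * (A (fst p))\<^sup>2) * k n (fst p) (snd p) + ((w (snd p))\<^sup>2 / s) * k n (fst p) (snd p))"
      using integrable_fst_k[OF sq(1)] integrable_snd_k[OF sq(2)] by auto
    fix p
    show "norm (A (fst p) * w (snd p) * k n (fst p) (snd p)) \<le> (s * (A (fst p))\<^sup>2) * k n (fst p) (snd p) + ((w (snd p))\<^sup>2 / s) * k n (fst p) (snd p)"
      using mult_right_mono[OF ab[of "A (fst p)" "w (snd p)"] k_nonneg[of n "fst p" "snd p"]]
      by (simp add: abs_mult k_nonneg distrib_right)
  qed
  also have "\<dots> = (\<integral>p. (s * (A (fst p))\<^sup>2) * k n (fst p) (snd p) \<partial>(M \<Otimes>\<^sub>M M)) + (\<integral>p. ((w (snd p))\<^sup>2 / s) * k n (fst p) (snd p) \<partial>(M \<Otimes>\<^sub>M M))"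
    using integrable_fst_k[OF sq(1)] integrable_snd_k[OF sq(2)] by (intro Bochner_Integration.integral_add)
  also have "\<dots> \<le> (\<integral>p. s * (A p)\<^sup>2 \<partial>M) + (\<integral>p. (w p)\<^sup>2 / s \<partial>M)"
    using s by (intro add_mono integral_fst_k_le[OF sq(1)] integral_snd_k_le[OF sq(2)]) auto
  finally show ?thesis by simp
qed

lemma pairing_tendsto:
  assumes A: "A \<in> L2 M" and w: "w \<in> L2 M"
  shows "(\<lambda>n. \<integral>p. A (fst p) * w (snd p) * k n (fst p) (snd p) \<partial>(M \<Otimes>\<^sub>M M)) \<longlonglongrightarrow> (\<integral>p. A p * w p \<partial>M)"
proof (rule LIMSEQ_I)
  fix r :: real assume r: "0 < r"
  have [measurable]: "A \<in> borel_measurable M" "w \<in> borel_measurable M" using A w by (auto simp: L2_def)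
  let ?W = "\<integral>p. (w p)\<^sup>2 \<partial>M"
  \<comment> \<open>This \<open>s\<close> makes the \<open>w\<close> part of
    \<open>pairing_bound\<close> smaller than \<open>r / 8\<close>, the \<open>+ 1\<close> keeping
    it positive when \<open>w\<close> vanishes. The truncation level \<open>m\<close> is chosen
    afterwards so that the other part is smaller than \<open>r / 8\<close> too.\<close>
  define s where "s = 8 * (?W + 1) / r"
  have W0: "0 \<le> ?W" by simp
  then have s: "0 < s" using r W0 unfolding s_def by (intro divide_pos_pos mult_pos_pos add_nonneg_pos) auto
  have "?W < r / 8 * s" using r by (simp add: s_def)
  then have s: "0 < s" "?W / s < r / 8" using s by (simp_all add: pos_divide_less_eq)
  let ?A = "\<lambda>m p. clamp_real (real m) (A p)"
  let ?B = "\<lambda>m p. A p - ?A m p"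
  have A2: "?A m \<in> L2 M" for m by (rule fm.bounded_L2[where c="real m"]) (auto simp: clamp_real_bound)
  then have B2: "?B m \<in> L2 M" for m by (intro L2_diff A)
  have "(\<lambda>m. \<integral>p. (?B m p)\<^sup>2 \<partial>M) \<longlonglongrightarrow> (\<integral>p. 0 \<partial>M)"
  proof (rule integral_dominated_convergence[where w="\<lambda>p. (A p)\<^sup>2"])
    show "AE p in M. (\<lambda>m. (?B m p)\<^sup>2) \<longlonglongrightarrow> 0"
    proof (rule AE_I2)
      fix p have "(\<lambda>m. (?B m p)\<^sup>2) \<longlonglongrightarrow> (A p - A p)\<^sup>2" by (intro tendsto_intros clamp_real_tendsto)
      then show "(\<lambda>m. (?B m p)\<^sup>2) \<longlonglongrightarrow> 0" by simp
    qed
    show "AE p in M. norm ((?B m p)\<^sup>2) \<le> (A p)\<^sup>2" for m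
      by (rule AE_I2) (simp add: abs_le_square_iff[symmetric] clamp_real_diff)
  qed (use A in \<open>auto simp: L2_def\<close>)
  then have "\<forall>\<^sub>F m in sequentially. (\<integral>p. (?B m p)\<^sup>2 \<partial>M) < r / (8 * s)"
    using r s by (intro order_tendstoD(2)[of _ 0]) auto
  then obtain m where m: "(\<integral>p. (?B m p)\<^sup>2 \<partial>M) < r / (8 * s)" by (auto simp: eventually_sequentially)
  have sB: "s * (\<integral>p. (?B m p)\<^sup>2 \<partial>M) + ?W / s < r / 4"
  proof -
    have "s * (\<integral>p. (?B m p)\<^sup>2 \<partial>M) < s * (r / (8 * s))" using m s(1) by (rule mult_strict_left_mono)
    also have "\<dots> = r / 8" using s(1) by simp
    finally show ?thesis using s(2) by linarith
  qed
  let ?I = "\<lambda>A n. \<integral>p. A (fst p) * w (snd p) * k n (fst p) (snd p) \<partial>(M \<Otimes>\<^sub>M M)"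
  have w1: "integrable M w" by (rule fm.L2_integrable[OF w])
  have b1: "\<bar>?I (?B m) n\<bar> < r / 4" for n using pairing_bound[OF B2 w s(1), of m n] sB by linarith
  have b1': "?I A n = ?I (?A m) n + ?I (?B m) n" for n
  proof -
    have "?I A n = (\<integral>p. ?A m (fst p) * w (snd p) * k n (fst p) (snd p) + ?B m (fst p) * w (snd p) * k n (fst p) (snd p) \<partial>(M \<Otimes>\<^sub>M M))"
      by (intro Bochner_Integration.integral_cong) (auto simp: algebra_simps)
    then show ?thesis
      using integrable_pair_k[OF fm.L2_integrable[OF A2[of m]] w1, of n]
        integrable_pair_k[OF fm.L2_integrable[OF B2[of m]] w1, of n] by simp
  qed
  have b2: "\<bar>\<integral>p. ?B m p * w p \<partial>M\<bar> < r / 4"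
  proof -
    have t: "(\<lambda>n. s * (\<integral>p. (?B m p)\<^sup>2 \<partial>M) + ?W / s) \<longlonglongrightarrow> s * (\<integral>p. (?B m p)\<^sup>2 \<partial>M) + ?W / s" by simp
    have "\<bar>\<integral>p. ?B m p * w p \<partial>M\<bar> \<le> (\<integral>p. norm (?B m p * w p) \<partial>M)"
      using integral_norm_bound[of M "\<lambda>p. ?B m p * w p"] by simp
    also have "\<dots> \<le> (\<integral>p. s * (?B m p)\<^sup>2 + (w p)\<^sup>2 / s \<partial>M)"
    proof (rule integral_mono)
      fix p
      have "0 \<le> (s * \<bar>?B m p\<bar> - \<bar>w p\<bar>)\<^sup>2 / s" using s by simp
      also have "\<dots> = s * (?B m p)\<^sup>2 + (w p)\<^sup>2 / s - 2 * (\<bar>?B m p\<bar> * \<bar>w p\<bar>)"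
        using s(1) by (simp only: power2_diff power_mult_distrib power2_abs) (simp add: field_simps power2_eq_square)
      finally have "2 * (\<bar>?B m p\<bar> * \<bar>w p\<bar>) \<le> s * (?B m p)\<^sup>2 + (w p)\<^sup>2 / s" by simp
      moreover have "0 \<le> \<bar>?B m p\<bar> * \<bar>w p\<bar>" by simp
      ultimately show "norm (?B m p * w p) \<le> s * (?B m p)\<^sup>2 + (w p)\<^sup>2 / s" unfolding real_norm_def abs_mult by linarith
    qed (use L2_mult[OF B2 w] L2_square[OF B2] L2_square[OF w] in auto)
    also have "\<dots> = s * (\<integral>p. (?B m p)\<^sup>2 \<partial>M) + ?W / s"
      using L2_square[OF B2] L2_square[OF w] by simp
    finally show ?thesis using sB by linarith
  qed
  have b2': "(\<integral>p. A p * w p \<partial>M) = (\<integral>p. ?A m p * w p \<partial>M) + (\<integral>p. ?B m p * w p \<partial>M)"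
    using L2_mult[OF A2 w] L2_mult[OF B2 w] by (subst Bochner_Integration.integral_add[symmetric]) (auto simp: algebra_simps)
  have "(\<lambda>n. ?I (?A m) n) \<longlonglongrightarrow> (\<integral>p. ?A m p * w p \<partial>M)"
    by (rule pairing_tendsto_bounded[where c="real m"]) (auto simp: w1 clamp_real_bound)
  then have "\<forall>\<^sub>F n in sequentially. \<bar>?I (?A m) n - (\<integral>p. ?A m p * w p \<partial>M)\<bar> < r / 4"
    using r by (auto dest!: tendstoD[where e="r / 4"] simp: dist_real_def)
  then have "\<forall>\<^sub>F n in sequentially. norm (?I A n - (\<integral>p. A p * w p \<partial>M)) < r"
  proof eventually_elim
    case (elim n)
    then show ?case using b1[of n] b2 r unfolding b1' b2' real_norm_def by linarith
  qed
  then show "\<exists>no. \<forall>n\<ge>no. norm (?I A n - (\<integral>p. A p * w p \<partial>M)) < r" by (simp add: eventually_sequentially)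
qed

end

section \<open>Smoothing kernels in time and space\<close>

lemma restrict_lborel_Times:
  fixes A :: "'a::euclidean_space set" and B :: "'b::euclidean_space set"
  assumes "A \<in> sets borel" "B \<in> sets borel"
  shows "restrict_space lborel (A \<times> B) = restrict_space lborel A \<Otimes>\<^sub>M restrict_space lborel B"
proof -
  have AB: "A \<times> B \<in> sets (borel :: ('a \<times> 'b) measure)"
    unfolding borel_prod[symmetric] using assms by auto
  have sf: "sigma_finite_measure (restrict_space lborel C)" if "C \<in> sets borel" for C :: "'c::euclidean_space set"
    using that by (intro sigma_finite_measure_restrict_space sigma_finite_lborel) auto
  show ?thesis
  proof (rule pair_measure_eqI[symmetric])
    show "sets (restrict_space lborel A \<Otimes>\<^sub>M restrict_space lborel B) = sets (restrict_space lborel (A \<times> B))"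
    proof
      show "sets (restrict_space lborel A \<Otimes>\<^sub>M restrict_space lborel B) \<subseteq> sets (restrict_space lborel (A \<times> B))"
        unfolding sets_pair_measure
      proof (rule sets.sigma_sets_subset')
        show "space (restrict_space lborel A) \<times> space (restrict_space lborel B) \<in> sets (restrict_space lborel (A \<times> B))"
          using AB by (auto simp: space_restrict_space sets_restrict_space_iff)
        show "{a \<times> b |a b. a \<in> sets (restrict_space lborel A) \<and> b \<in> sets (restrict_space lborel B)}
          \<subseteq> sets (restrict_space lborel (A \<times> B))"
        proof safe
          fix a b assume "a \<in> sets (restrict_space lborel A)" "b \<in> sets (restrict_space lborel B)"
          then have ab: "a \<subseteq> A" "b \<subseteq> B" "a \<in> sets borel" "b \<in> sets borel"
            using assms by (auto simp: sets_restrict_space_iff)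
          then have "a \<times> b \<in> sets (borel \<Otimes>\<^sub>M borel)" by auto
          then have "a \<times> b \<in> sets borel" unfolding borel_prod .
          with ab AB show "a \<times> b \<in> sets (restrict_space lborel (A \<times> B))"
            by (subst sets_restrict_space_iff) auto
        qed
      qed
      show "sets (restrict_space lborel (A \<times> B)) \<subseteq> sets (restrict_space lborel A \<Otimes>\<^sub>M restrict_space lborel B)"
      proof
        fix X assume X: "X \<in> sets (restrict_space lborel (A \<times> B))"
        then have X0: "X \<subseteq> A \<times> B" "X \<in> sets borel"
          using AB by (auto simp: sets_restrict_space_iff)
        then have X': "X \<subseteq> A \<times> B" "X \<in> sets (borel \<Otimes>\<^sub>M borel)"
          unfolding borel_prod by auto
        have "(\<lambda>p. (fst p, snd p)) \<in> measurable (restrict_space lborel A \<Otimes>\<^sub>M restrict_space lborel B) (borel \<Otimes>\<^sub>M borel)"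
          by (intro measurable_Pair) (auto intro!: measurable_compose[OF measurable_fst] measurable_compose[OF measurable_snd] measurable_restrict_space1)
        from measurable_sets[OF this X'(2)] X'(1)
        show "X \<in> sets (restrict_space lborel A \<Otimes>\<^sub>M restrict_space lborel B)"
          by (simp add: space_pair_measure space_restrict_space Int_absorb2)
      qed
    qed
    fix a b assume "a \<in> sets (restrict_space lborel A)" "b \<in> sets (restrict_space lborel B)"
    then have ab: "a \<subseteq> A" "b \<subseteq> B" "a \<in> sets borel" "b \<in> sets borel"
      using assms by (auto simp: sets_restrict_space_iff)
    have "emeasure lborel (a \<times> b) = emeasure (lborel \<Otimes>\<^sub>M lborel) (a \<times> b)" by (simp add: lborel_prod)
    also have "\<dots> = emeasure lborel a * emeasure lborel b"
      using ab by (intro lborel.emeasure_pair_measure_Times) auto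
    finally show "emeasure (restrict_space lborel A) a * emeasure (restrict_space lborel B) b
        = emeasure (restrict_space lborel (A \<times> B)) (a \<times> b)"
      using ab assms AB by (subst (1 2 3) emeasure_restrict_space) auto
  qed (use assms sf in auto)
qed

lemma st_measure_pair: "st_measure T a b = space_measure 0 T \<Otimes>\<^sub>M space_measure a b"
  unfolding st_measure_def space_measure_def by (intro restrict_lborel_Times) auto

lemma approximate_identity_Times:
  assumes "approximate_identity S1 k1" "approximate_identity S2 k2"
  shows "approximate_identity (S1 \<times> S2) (\<lambda>n p q. k1 n (fst p) (fst q) * k2 n (snd p) (snd q))"
proof -
  interpret A: approximate_identity S1 k1 by fact
  interpret B: approximate_identity S2 k2 by fact
  interpret pair_sigma_finite A.M B.M ..
  have M: "restrict_space lborel (S1 \<times> S2) = A.M \<Otimes>\<^sub>M B.M"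
    unfolding A.M_def B.M_def using A.S_sets B.S_sets by (intro restrict_lborel_Times) auto
  have prod: "(\<integral>q. f (fst q) * g (snd q) \<partial>(A.M \<Otimes>\<^sub>M B.M)) = (\<integral>q. f q \<partial>A.M) * (\<integral>q. g q \<partial>B.M)"
    if "integrable A.M f" "integrable B.M g" for f g :: "_ \<Rightarrow> real"
    using integral_fst'[OF integrable_pair_mult[OF that]] by simp
  show ?thesis
  proof
    show "open (S1 \<times> S2)" using A.open_S B.open_S by (rule open_Times)
    show "bounded (S1 \<times> S2)" using A.bounded_S B.bounded_S by (rule bounded_Times)
    fix n
    have 1: "(\<lambda>p::('a \<times> 'b) \<times> ('a \<times> 'b). (fst (fst p), fst (snd p))) \<in> measurable (borel \<Otimes>\<^sub>M borel) (borel \<Otimes>\<^sub>M borel)"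
      unfolding borel_prod[symmetric, where 'a='a and 'b='b] by measurable
    have 2: "(\<lambda>p::('a \<times> 'b) \<times> ('a \<times> 'b). (snd (fst p), snd (snd p))) \<in> measurable (borel \<Otimes>\<^sub>M borel) (borel \<Otimes>\<^sub>M borel)"
      unfolding borel_prod[symmetric, where 'a='a and 'b='b] by measurable
    show "(\<lambda>p. k1 n (fst (fst p)) (fst (snd p)) * k2 n (snd (fst p)) (snd (snd p))) \<in> borel_measurable (borel \<Otimes>\<^sub>M borel)"
      using measurable_compose[OF 1 A.k_borel[of n]] measurable_compose[OF 2 B.k_borel[of n]] by simp
    show "0 \<le> k1 n (fst p) (fst q) * k2 n (snd p) (snd q)" for p q
      by (simp add: A.k_nonneg B.k_nonneg)
    obtain c d where "\<And>p q. k1 n p q \<le> c" "\<And>p q. k2 n p q \<le> d" using A.k_bounded B.k_bounded by metis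
    then have "k1 n (fst p) (fst q) * k2 n (snd p) (snd q) \<le> c * d" for p q
      using A.k_nonneg[of n] B.k_nonneg[of n] order_trans[OF A.k_nonneg[of n]] by (intro mult_mono) blast+
    then show "\<exists>c. \<forall>p q. k1 n (fst p) (fst q) * k2 n (snd p) (snd q) \<le> c" by blast
  next
    fix n p assume p: "p \<in> S1 \<times> S2"
    then show "(\<integral>q. k1 n (fst p) (fst q) * k2 n (snd p) (snd q) \<partial>restrict_space lborel (S1 \<times> S2)) \<le> 1"
      unfolding M using A.k_mass(1)[of "fst p" n] B.k_mass(1)[of "snd p" n]
      by (subst prod) (auto simp: A.k_integrable B.k_integrable A.M_def[symmetric] B.M_def[symmetric] A.k_nonneg B.k_nonneg intro!: mult_le_one integral_nonneg_AE)
  next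
    fix n p assume p: "p \<in> S1 \<times> S2"
    then show "(\<integral>q. k1 n (fst q) (fst p) * k2 n (snd q) (snd p) \<partial>restrict_space lborel (S1 \<times> S2)) \<le> 1"
      unfolding M using A.k_mass(2)[of "fst p" n] B.k_mass(2)[of "snd p" n]
      by (subst prod) (auto simp: A.k_integrable B.k_integrable A.M_def[symmetric] B.M_def[symmetric] A.k_nonneg B.k_nonneg intro!: mult_le_one integral_nonneg_AE)
  next
    fix p assume p: "p \<in> S1 \<times> S2"
    then have "fst p \<in> S1" "snd p \<in> S2" by auto
    from A.k_mass_1[OF this(1)] B.k_mass_1[OF this(2)]
    show "\<forall>\<^sub>F n in sequentially. (\<integral>q. k1 n (fst p) (fst q) * k2 n (snd p) (snd q) \<partial>restrict_space lborel (S1 \<times> S2)) = 1"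
      unfolding M by eventually_elim
        (subst prod, insert p, auto simp: A.k_integrable B.k_integrable A.M_def[symmetric] B.M_def[symmetric])
  next
    fix p and d :: real assume p: "p \<in> S1 \<times> S2" and d: "0 < d"
    then have "fst p \<in> S1" "snd p \<in> S2" "0 < d / 2" by auto
    from A.k_concentrated[OF this(1,3)] B.k_concentrated[OF this(2,3)]
    show "\<forall>\<^sub>F n in sequentially. \<forall>q\<in>S1 \<times> S2. k1 n (fst p) (fst q) * k2 n (snd p) (snd q) \<noteq> 0 \<longrightarrow> dist p q < d"
    proof eventually_elim
      case (elim n)
      show ?case
      proof (intro ballI impI)
        fix q assume "q \<in> S1 \<times> S2" "k1 n (fst p) (fst q) * k2 n (snd p) (snd q) \<noteq> 0"
        with elim have "dist (fst p) (fst q) < d / 2" "dist (snd p) (snd q) < d / 2" by auto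
        moreover have "dist p q \<le> dist (fst p) (fst q) + dist (snd p) (snd q)"
          unfolding dist_prod_def by (rule sqrt_sum_squares_le_sum) auto
        ultimately show "dist p q < d" by linarith
      qed
    qed
  qed
qed

lemma smooth_divide_const [smooth_intros]: "smooth f \<Longrightarrow> smooth (\<lambda>x. f x / c)"
  using smooth_mult[OF _ smooth_const[of "1 / c"], of f] by simp

lemma integral_space_measure:
  assumes "a \<le> b" "\<And>x. (G has_real_derivative g x) (at x)" "continuous_on UNIV g"
  shows "(\<integral>x. g x \<partial>space_measure a b) = G b - G a"
proof -
  have "(\<integral>x. g x \<partial>space_measure a b) = (\<integral>x. indicator {a<..<b} x *\<^sub>R g x \<partial>lborel)"
    unfolding space_measure_def by (rule integral_restrict_space) auto
  also have "\<dots> = (\<integral>x. g x * indicator {a .. b} x \<partial>lborel)"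
  proof (rule integral_cong_AE)
    have [measurable]: "g \<in> borel_measurable borel" using assms(3) by (rule borel_measurable_continuous_onI)
    show "(\<lambda>x. indicator {a<..<b} x *\<^sub>R g x) \<in> borel_measurable lborel" by measurable
    show "(\<lambda>x. g x * indicator {a .. b} x) \<in> borel_measurable lborel" by measurable
    show "AE x in lborel. indicator {a<..<b} x *\<^sub>R g x = g x * indicator {a .. b} x"
      using AE_lborel_singleton[of a] AE_lborel_singleton[of b] by eventually_elim (auto simp: indicator_def)
  qed
  also have "\<dots> = G b - G a"
    using assms by (intro integral_FTC_Icc_real) (auto simp: continuous_on_eq_continuous_at)
  finally show ?thesis .
qed

lemma has_real_derivative_shift:
  assumes "\<And>x. (G has_real_derivative g x) (at x)"
  shows "((\<lambda>s. G (s - t) / m) has_real_derivative g (s - t) / m) (at s)"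
    "((\<lambda>s. - G (t - s) / m) has_real_derivative g (t - s) / m) (at s)"
proof -
  have 1: "((\<lambda>s. s - t) has_real_derivative 1) (at s)" "((\<lambda>s. t - s) has_real_derivative -1) (at s)"
    by (auto intro!: derivative_eq_intros)
  show "((\<lambda>s. G (s - t) / m) has_real_derivative g (s - t) / m) (at s)"
    using DERIV_cdivide[OF DERIV_chain2[where f=G, OF assms 1(1)], of m] by simp
  show "((\<lambda>s. - G (t - s) / m) has_real_derivative g (t - s) / m) (at s)"
    using DERIV_cdivide[OF DERIV_minus[OF DERIV_chain2[where f=G, OF assms 1(2)]], of m] by simp
qed

lemma continuous_antiderivative:
  fixes g :: "real \<Rightarrow> real"
  assumes "continuous_on UNIV g"
  obtains G where "\<And>x. (G has_real_derivative g x) (at x)"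
proof -
  have "\<exists>F. \<forall>x :: real. - \<infinity> < ereal x \<longrightarrow> ereal x < \<infinity> \<longrightarrow> (F has_vector_derivative g x) (at x)"
    using assms by (intro einterval_antiderivative) (auto simp: continuous_on_eq_continuous_at)
  then show ?thesis using that by (auto simp: has_real_derivative_iff_has_vector_derivative)
qed

lemma bump_antiderivative:
  assumes "c < d"
  obtains m G where "0 < m" "\<And>x. (G has_real_derivative bump c d x / m) (at x)"
    "\<And>x. x \<le> c \<Longrightarrow> G x = 0" "\<And>x. d \<le> x \<Longrightarrow> G x = 1" "\<And>x. 0 \<le> G x" "\<And>x. G x \<le> 1"
proof -
  obtain G where G: "\<And>x. (G has_real_derivative bump c d x) (at x)"
    using continuous_antiderivative smooth_continuous[OF smooth_bump] by blast
  have mono: "G x \<le> G y" if "x \<le> y" for x y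
    using that DERIV_nonneg_imp_nondecreasing[of x y G] G bump_nonneg by blast
  have lt: "G c < G d"
    using assms by (rule DERIV_pos_imp_increasing_open) (use G bump_pos in \<open>blast, blast intro: DERIV_isCont continuous_at_imp_continuous_on G\<close>)
  have le: "G x = G c" if "x \<le> c" for x
  proof (rule antisym[OF mono[OF that]])
    show "G c \<le> G x"
      using that DERIV_nonpos_imp_nonincreasing[of x c G] G bump_eq_0[of _ c d] by (metis order_refl)
  qed
  have ge: "G x = G d" if "d \<le> x" for x
  proof (rule antisym[OF _ mono[OF that]])
    show "G x \<le> G d"
      using that DERIV_nonpos_imp_nonincreasing[of d x G] G bump_eq_0[of _ c d] by (metis order_refl)
  qed
  have low: "G c \<le> G x" for x using mono[of c x] le[of x] by (cases "c \<le> x") auto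
  have up: "G x \<le> G d" for x using mono[of x d] ge[of x] by (cases "x \<le> d") auto
  show ?thesis
  proof (rule that[of "G d - G c" "\<lambda>x. (G x - G c) / (G d - G c)"])
    show "0 < G d - G c" using lt by simp
    fix x
    show "((\<lambda>x. (G x - G c) / (G d - G c)) has_real_derivative bump c d x / (G d - G c)) (at x)"
      using DERIV_cdivide[OF DERIV_diff[OF G[of x] DERIV_const]] by simp
    show "(G x - G c) / (G d - G c) = 0" if "x \<le> c" using le[OF that] by simp
    show "(G x - G c) / (G d - G c) = 1" if "d \<le> x" using ge[OF that] lt by simp
    show "0 \<le> (G x - G c) / (G d - G c)" "(G x - G c) / (G d - G c) \<le> 1" using lt low[of x] up[of x] by auto
  qed
qed

section \<open>The kernel in time\<close>

definition unit_bump :: "real \<Rightarrow> real \<Rightarrow> real \<Rightarrow> real" where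
  "unit_bump c d x = bump c d x / (\<integral>x. bump c d x \<partial>space_measure c d)"

text \<open>The primitive is a smooth step from 0 to 1. It serves both to compute kernel masses, as
  increments of \<open>G\<close>, and to build cut-offs in time.\<close>

lemma unit_bump_antiderivative:
  assumes "c < d"
  obtains G where "\<And>x. (G has_real_derivative unit_bump c d x) (at x)"
    "\<And>x. x \<le> c \<Longrightarrow> G x = 0" "\<And>x. d \<le> x \<Longrightarrow> G x = 1" "\<And>x. 0 \<le> G x" "\<And>x. G x \<le> 1"
proof -
  obtain m G where G: "0 < m" "\<And>x. (G has_real_derivative bump c d x / m) (at x)"
    "\<And>x. x \<le> c \<Longrightarrow> G x = 0" "\<And>x. d \<le> x \<Longrightarrow> G x = 1" "\<And>x. 0 \<le> G x" "\<And>x. G x \<le> 1"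
    using bump_antiderivative[OF assms] by metis
  have "(\<integral>x. bump c d x / m \<partial>space_measure c d) = G d - G c"
    using assms G(2) by (intro integral_space_measure) (auto intro!: smooth_continuous smooth_intros)
  then have "unit_bump c d x = bump c d x / m" for x
    using G(1) G(3,4)[of c] G(3,4)[of d] by (simp add: unit_bump_def field_simps)
  then show ?thesis using that[of G] G by auto
qed

lemma smooth_unit_bump [smooth_intros]: "smooth (unit_bump c d)"
  unfolding unit_bump_def by (intro smooth_intros)

lemma unit_bump_nonneg: "0 \<le> unit_bump c d x"
  unfolding unit_bump_def by (intro divide_nonneg_nonneg bump_nonneg integral_nonneg_AE AE_I2)

lemma unit_bump_eq_0: "x \<le> c \<or> d \<le> x \<Longrightarrow> unit_bump c d x = 0" by (simp add: unit_bump_def bump_eq_0)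

lemma unit_bump_bounded: "\<exists>B. \<forall>x. unit_bump c d x \<le> B"
proof -
  have "bump c d x \<le> 1" for x by (auto simp: bump_def flat_def intro!: mult_le_one)
  then show ?thesis unfolding unit_bump_def
    by (intro exI[of _ "1 / (\<integral>x. bump c d x \<partial>space_measure c d)"] allI divide_right_mono integral_nonneg_AE AE_I2 bump_nonneg)
qed

text \<open>The support lies in \<open>s > t\<close>, so that the kernel vanishes near \<open>s = 0\<close> for all \<open>t \<ge> 0\<close>.\<close>

definition time_kernel :: "nat \<Rightarrow> real \<Rightarrow> real \<Rightarrow> real" where
  "time_kernel n t s = unit_bump (1 / real (Suc n)) (2 / real (Suc n)) (s - t)"

lemma eventually_inverse_less: "0 < d \<Longrightarrow> \<forall>\<^sub>F n in sequentially. c / real (Suc n) < d"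
  using order_tendstoD(2)[OF tendsto_mult[OF tendsto_const LIMSEQ_inverse_real_of_nat], of c d] by (simp add: divide_inverse)

lemma time_kernel_mass:
  assumes "0 \<le> t" "t + 2 / real (Suc n) < T"
  shows "(\<integral>s. time_kernel n t s \<partial>space_measure 0 T) = 1"
proof -
  let ?e = "1 / real (Suc n)" and ?d = "2 / real (Suc n)"
  have ed: "?e < ?d" "0 < ?e" by (simp_all add: divide_strict_right_mono)
  obtain G where G: "\<And>x. (G has_real_derivative unit_bump ?e ?d x) (at x)"
    "\<And>x. x \<le> ?e \<Longrightarrow> G x = 0" "\<And>x. ?d \<le> x \<Longrightarrow> G x = 1"
    using unit_bump_antiderivative[OF ed(1)] by metis
  have "(\<integral>s. time_kernel n t s \<partial>space_measure 0 T) = G (T - t) - G (0 - t)"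
    unfolding time_kernel_def
    using assms ed has_real_derivative_shift(1)[OF G(1), where m=1]
    by (intro integral_space_measure continuous_on_compose2[OF smooth_continuous[OF smooth_unit_bump, of UNIV]] continuous_intros) auto
  moreover have "- t \<le> ?e" using assms by (simp add: order_trans[of _ 0])
  ultimately show ?thesis using G(3)[of "T - t"] G(2)[of "- t"] assms by simp
qed

lemma approximate_identity_time:
  "approximate_identity {0<..<T} time_kernel"
proof
  fix n
  let ?e = "1 / real (Suc n)" and ?d = "2 / real (Suc n)"
  have ed: "?e < ?d" by (simp add: divide_strict_right_mono)
  obtain G where G: "\<And>x. (G has_real_derivative unit_bump ?e ?d x) (at x)"
    "\<And>x. x \<le> ?e \<Longrightarrow> G x = 0" "\<And>x. ?d \<le> x \<Longrightarrow> G x = 1" "\<And>x. 0 \<le> G x" "\<And>x. G x \<le> 1"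
    using unit_bump_antiderivative[OF ed] by metis
  have cont: "continuous_on A (unit_bump ?e ?d)" for A by (intro smooth_continuous smooth_unit_bump)
  have cont1: "continuous_on UNIV (\<lambda>s. unit_bump ?e ?d (s - t))" "continuous_on UNIV (\<lambda>s. unit_bump ?e ?d (t - s))" for t
    by (intro continuous_on_compose2[OF cont] continuous_intros; auto)+
  have "(\<lambda>p::real\<times>real. unit_bump ?e ?d (snd p - fst p)) \<in> borel_measurable (borel \<Otimes>\<^sub>M borel)"
    by (intro measurable_compose[OF _ smooth_borel[OF smooth_unit_bump]]) measurable
  then show "(\<lambda>p. time_kernel n (fst p) (snd p)) \<in> borel_measurable (borel \<Otimes>\<^sub>M borel)"
    by (simp add: time_kernel_def)
  show "0 \<le> time_kernel n p q" for p q by (simp add: time_kernel_def unit_bump_nonneg)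
  show "\<exists>c. \<forall>p q. time_kernel n p q \<le> c" using unit_bump_bounded unfolding time_kernel_def by blast
  { fix t assume t: "t \<in> {0<..<T}"
    have *: "(\<integral>s. time_kernel n t s \<partial>restrict_space lborel {0<..<T}) = G (T - t) - G (0 - t)"
      unfolding time_kernel_def space_measure_def[symmetric]
      using t has_real_derivative_shift(1)[OF G(1), where m=1]
      by (intro integral_space_measure cont1) auto
    show "(\<integral>s. time_kernel n t s \<partial>restrict_space lborel {0<..<T}) \<le> 1" unfolding *
      using G(5)[of "T - t"] G(4)[of "0 - t"] by linarith
  }
  { fix s assume s: "s \<in> {0<..<T}"
    have "(\<integral>t. time_kernel n t s \<partial>restrict_space lborel {0<..<T}) = - G (s - T) - (- G (s - 0))"
      unfolding time_kernel_def space_measure_def[symmetric]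
      using s has_real_derivative_shift(2)[OF G(1), where m=1]
      by (intro integral_space_measure cont1) auto
    then show "(\<integral>t. time_kernel n t s \<partial>restrict_space lborel {0<..<T}) \<le> 1"
      using G(5)[of s] G(4)[of "s - T"] by simp
  }
next
  fix t assume t: "t \<in> {0<..<T}"
  then have "0 < T - t" by simp
  from eventually_inverse_less[OF this, of 2]
  show "\<forall>\<^sub>F n in sequentially. (\<integral>s. time_kernel n t s \<partial>restrict_space lborel {0<..<T}) = 1"
    by eventually_elim (use t in \<open>auto simp: space_measure_def[symmetric] intro!: time_kernel_mass\<close>)
next
  fix t d :: real assume "0 < d"
  from eventually_inverse_less[OF this, of 2]
  show "\<forall>\<^sub>F n in sequentially. \<forall>s\<in>{0<..<T}. time_kernel n t s \<noteq> 0 \<longrightarrow> dist t s < d"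
  proof eventually_elim
    case (elim n)
    show ?case
    proof (intro ballI impI)
      fix s assume "time_kernel n t s \<noteq> 0"
      then have "1 / real (Suc n) < s - t \<and> s - t < 2 / real (Suc n)"
        unfolding time_kernel_def using unit_bump_eq_0 by (meson not_le)
      moreover have "0 < 1 / real (Suc n)" by simp
      ultimately show "dist t s < d" using elim unfolding dist_real_def by linarith
    qed
  qed
qed auto

section \<open>The periodic kernel in space\<close>

text \<open>Composition with the cosine gives smoothness and periodicity at once. The bump is
  positive exactly where \<open>cos (2 * pi * z / L)\<close> exceeds
  \<open>1 - 1 / real (Suc n)\<close>, a small neighbourhood of the multiples of the period.\<close>

definition periodic_bump :: "real \<Rightarrow> nat \<Rightarrow> real \<Rightarrow> real" where
  "periodic_bump L n z = flat 0 (cos (2 * pi * z / L) - 1 + 1 / real (Suc n))"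

definition space_kernel :: "real \<Rightarrow> real \<Rightarrow> nat \<Rightarrow> real \<Rightarrow> real \<Rightarrow> real" where
  "space_kernel a b n x y = periodic_bump (b - a) n (y - x) / (\<integral>z. periodic_bump (b - a) n z \<partial>space_measure a b)"

lemma smooth_periodic_bump [smooth_intros]: "smooth (periodic_bump L n)"
  unfolding periodic_bump_def
  by (rule smooth_compose[OF smooth_flat]) (intro smooth_intros)

lemma periodic_bump_periodic: "L \<noteq> 0 \<Longrightarrow> periodic_bump L n (z + L) = periodic_bump L n z"
proof -
  assume "L \<noteq> 0"
  then have "2 * pi * (z + L) / L = 2 * pi * z / L + 2 * pi" by (simp add: field_simps)
  then show ?thesis by (simp add: periodic_bump_def)
qed

text \<open>The increment of \<open>G\<close> over one period has derivative 0 by periodicity. Hence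
  the mass of a translated bump does not depend on its centre, and the space kernel has mass exactly
  1 in both variables.\<close>

lemma periodic_bump_antiderivative:
  assumes "a < b"
  obtains G where "\<And>x. (G has_real_derivative periodic_bump (b - a) n x) (at x)"
    "\<And>x. G (x + (b - a)) - G x = (\<integral>z. periodic_bump (b - a) n z \<partial>space_measure a b)"
    "0 < (\<integral>z. periodic_bump (b - a) n z \<partial>space_measure a b)"
proof -
  let ?g = "periodic_bump (b - a) n"
  have cont: "continuous_on UNIV ?g" by (intro smooth_continuous smooth_periodic_bump)
  obtain G where G: "\<And>x. (G has_real_derivative ?g x) (at x)"
    using continuous_antiderivative cont by blast
  have m: "(\<integral>z. ?g z \<partial>space_measure a b) = G b - G a"
    using assms by (intro integral_space_measure G cont) auto
  have "((\<lambda>x. G (x + (b - a)) - G x) has_real_derivative 0) (at x)" for x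
  proof -
    have 0: "periodic_bump (b - a) n (x - - (b - a)) / 1 - periodic_bump (b - a) n x = 0"
      using assms periodic_bump_periodic[of "b - a" n x] unfolding diff_minus_eq_add by simp
    have "((\<lambda>x. G (x - - (b - a)) / 1 - G x) has_real_derivative 0) (at x)"
      using DERIV_diff[OF has_real_derivative_shift(1)[OF G, of "- (b - a)" 1 x] G[of x]] unfolding 0 .
    then show ?thesis unfolding diff_minus_eq_add div_by_1 .
  qed
  then have const: "G (x + (b - a)) - G x = G (y + (b - a)) - G y" for x y
    by (rule DERIV_isconst_all[rule_format])
  have eq: "G (x + (b - a)) - G x = (\<integral>z. ?g z \<partial>space_measure a b)" for x
    using const[of x a] m by simp
  have nn: "0 \<le> ?g x" for x by (simp add: periodic_bump_def flat_def)
  have mono: "G x \<le> G y" if "x \<le> y" for x y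
    using that DERIV_nonneg_imp_nondecreasing[of x y G] G nn by blast
  \<comment> \<open>Positivity of the mass: \<open>G\<close> is nondecreasing, and it increases
    strictly just to the right of 0, where the integrand is positive.\<close>
  have "0 < ?g 0" by (simp add: periodic_bump_def flat_def)
  from DERIV_pos_inc_right[OF G this] obtain d where d: "0 < d" "\<And>h. 0 < h \<Longrightarrow> h < d \<Longrightarrow> G 0 < G (0 + h)" by blast
  define h where "h = min (d / 2) (b - a)"
  have "G 0 < G (0 + h)" using d assms by (intro d(2)) (auto simp: h_def)
  also have "\<dots> \<le> G (0 + (b - a))" by (intro mono) (auto simp: h_def)
  finally have "0 < (\<integral>z. ?g z \<partial>space_measure a b)" using eq[of 0] by simp
  with G eq show ?thesis by (rule that)
qed

lemma cos_less_1: assumes "0 < \<theta>" "\<theta> < 2 * pi" shows "cos \<theta> < 1"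
proof -
  have "cos \<theta> \<noteq> 1"
  proof
    assume "cos \<theta> = 1"
    then obtain k :: int where k: "\<theta> = of_int k * 2 * pi" unfolding cos_one_2pi_int by blast
    with assms have "0 < of_int k * (2 * pi)" "of_int k * (2 * pi) < 1 * (2 * pi)" by auto
    then have "(0::real) < of_int k" "of_int k < (1::real)"
      by (auto simp: zero_less_mult_iff mult_less_cancel_right)
    then show False by simp
  qed
  then show ?thesis using cos_le_one[of \<theta>] by linarith
qed

lemma space_kernel_mass:
  assumes ab: "a < b"
  shows "(\<integral>y. space_kernel a b n x y \<partial>space_measure a b) = 1" "(\<integral>x. space_kernel a b n x y \<partial>space_measure a b) = 1"
proof -
  let ?g = "periodic_bump (b - a) n" let ?m = "\<integral>z. ?g z \<partial>space_measure a b"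
  obtain G where G: "\<And>x. (G has_real_derivative ?g x) (at x)"
    "\<And>x. G (x + (b - a)) - G x = ?m" "0 < ?m"
    using periodic_bump_antiderivative[OF ab, of n] by metis
  have cont: "continuous_on A ?g" for A by (intro smooth_continuous smooth_periodic_bump)
  have cont1: "continuous_on UNIV (\<lambda>s. ?g (s - t) / ?m)" "continuous_on UNIV (\<lambda>s. ?g (t - s) / ?m)" for t
    using G(3) by (intro continuous_intros continuous_on_compose2[OF cont]; auto)+
  have "(\<integral>y. space_kernel a b n x y \<partial>space_measure a b) = G (b - x) / ?m - G (a - x) / ?m"
    unfolding space_kernel_def
    using ab by (intro integral_space_measure cont1 has_real_derivative_shift G(1)) auto
  then show "(\<integral>y. space_kernel a b n x y \<partial>space_measure a b) = 1"
    using G(2)[of "a - x"] G(3) by (simp add: diff_divide_distrib[symmetric])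
  have "(\<integral>x. space_kernel a b n x y \<partial>space_measure a b) = - G (y - b) / ?m - - G (y - a) / ?m"
    unfolding space_kernel_def
    using ab by (intro integral_space_measure cont1 has_real_derivative_shift G(1)) auto
  then show "(\<integral>x. space_kernel a b n x y \<partial>space_measure a b) = 1"
    using G(2)[of "y - b"] G(3) by (simp add: diff_divide_distrib[symmetric])
qed

lemma approximate_identity_space:
  assumes ab: "a < b"
  shows "approximate_identity {a<..<b} (space_kernel a b)"
proof
  fix n
  let ?g = "periodic_bump (b - a) n"
  let ?m = "\<integral>z. ?g z \<partial>space_measure a b"
  have m0: "0 < ?m" using periodic_bump_antiderivative[OF ab, of n] by metis
  have "(\<lambda>p::real\<times>real. ?g (snd p - fst p)) \<in> borel_measurable (borel \<Otimes>\<^sub>M borel)"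
    by (intro measurable_compose[OF _ smooth_borel[OF smooth_periodic_bump]]) measurable
  then show "(\<lambda>p. space_kernel a b n (fst p) (snd p)) \<in> borel_measurable (borel \<Otimes>\<^sub>M borel)"
    unfolding space_kernel_def by measurable
  show "0 \<le> space_kernel a b n p q" for p q
    using m0 by (simp add: space_kernel_def periodic_bump_def flat_def)
  have "?g z \<le> 1" for z by (simp add: periodic_bump_def flat_def)
  then show "\<exists>c. \<forall>p q. space_kernel a b n p q \<le> c"
    using m0 by (intro exI[of _ "1 / ?m"]) (auto simp: space_kernel_def intro!: divide_right_mono)
  note mass = space_kernel_mass[OF ab, unfolded space_measure_def]
  show "(\<integral>y. space_kernel a b n x y \<partial>restrict_space lborel {a<..<b}) \<le> 1" for x by (simp add: mass(1)[unfolded space_measure_def])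
  show "(\<integral>x. space_kernel a b n x y \<partial>restrict_space lborel {a<..<b}) \<le> 1" for y by (simp add: mass(2)[unfolded space_measure_def])
next
  fix x
  show "\<forall>\<^sub>F n in sequentially. (\<integral>y. space_kernel a b n x y \<partial>restrict_space lborel {a<..<b}) = 1"
    by (simp add: space_kernel_mass(1)[OF ab, unfolded space_measure_def])
next
  fix x d assume x: "x \<in> {a<..<b}" and d: "0 < (d::real)"
  \<comment> \<open>\<open>m\<close> bounds the distance from \<open>x\<close> to the points of the
    interval and is less than the period, so on \<open>[d', m]\<close> the cosine stays away from 1.
    Taking the minimum with \<open>m\<close> in \<open>d'\<close> keeps this interval
    nonempty.\<close>
  define m where "m = max (x - a) (b - x)"
  define d' where "d' = min d m"
  have m: "0 < m" "m < b - a" using x by (auto simp: m_def)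
  have d': "0 < d'" "d' \<le> m" "d' \<le> d" using d m by (auto simp: d'_def)
  let ?C = "\<lambda>z. cos (2 * pi * z / (b - a))"
  have "\<exists>z\<in>{d'..m}. \<forall>y\<in>{d'..m}. ?C y \<le> ?C z"
    using d' m by (intro continuous_attains_sup) (auto intro!: continuous_intros)
  then obtain z where z: "z \<in> {d'..m}" "\<And>y. y \<in> {d'..m} \<Longrightarrow> ?C y \<le> ?C z" by blast
  have "z / (b - a) < 1" using z(1) m by simp
  then have "2 * pi * (z / (b - a)) < 2 * pi * 1" by (intro mult_strict_left_mono) auto
  then have "?C z < 1" using z(1) d' m by (intro cos_less_1) auto
  then have "0 < 1 - ?C z" by simp
  from eventually_inverse_less[OF this, of 1]
  show "\<forall>\<^sub>F n in sequentially. \<forall>y\<in>{a<..<b}. space_kernel a b n x y \<noteq> 0 \<longrightarrow> dist x y < d"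
  proof eventually_elim
    case (elim n)
    show ?case
    proof (intro ballI impI, rule ccontr)
      fix y assume y: "y \<in> {a<..<b}" "space_kernel a b n x y \<noteq> 0" "\<not> dist x y < d"
      then have "\<bar>y - x\<bar> \<in> {d'..m}" using d' x by (auto simp: dist_real_def m_def)
      from z(2)[OF this] have "?C (y - x) \<le> ?C z"
        by (cases "y - x \<ge> 0") (auto simp: minus_diff_eq[of y x, symmetric] simp del: minus_diff_eq)
      moreover have "0 < ?C (y - x) - 1 + 1 / real (Suc n)"
        using y(2) by (auto simp: space_kernel_def periodic_bump_def flat_def split: if_splits)
      ultimately show False using elim by linarith
    qed
  qed
qed auto

section \<open>Products as test functions on the periodic domain\<close>

lemma smooth_bounded_interval: "smooth g \<Longrightarrow> \<exists>c. \<forall>x\<in>{l..r}. \<bar>g x\<bar> \<le> c"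
proof -
  assume "smooth g"
  then have "compact (g ` {l..r})" by (intro compact_continuous_image smooth_continuous) auto
  then have "bounded (g ` {l..r})" by (rule compact_imp_bounded)
  then show ?thesis by (auto simp: bounded_iff)
qed

lemma finite_measure_space_measure: "finite_measure (space_measure a b)"
  unfolding space_measure_def by (rule bounded_finite_measure) auto

lemma space_space_measure [simp]: "space (space_measure a b) = {a<..<b}"
  by (simp add: space_measure_def space_restrict_space)

lemma borel_space_measure :
  "g \<in> borel_measurable borel \<Longrightarrow> g \<in> borel_measurable (space_measure a b)"
  unfolding space_measure_def by (intro measurable_restrict_space1) simp

lemma id_borel_space_measure: "(\<lambda>x. x) \<in> borel_measurable (space_measure a b)"
  by (rule borel_space_measure) simp

locale periodic_domain =
  fixes T a b :: real
  assumes T: "0 < T" and ab: "a < b"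
begin

definition "MT = space_measure 0 T"
definition "MX = space_measure a b"
definition "MQ = MT \<Otimes>\<^sub>M MX"

lemma st_measure_MQ: "st_measure T a b = MQ" by (simp add: MQ_def MT_def MX_def st_measure_pair)

lemma space_MT [simp]: "space MT = {0<..<T}" by (simp add: MT_def)
lemma space_MX [simp]: "space MX = {a<..<b}" by (simp add: MX_def)
lemma space_MQ [simp]: "space MQ = {0<..<T} \<times> {a<..<b}" by (simp add: MQ_def space_pair_measure)

definition kernel :: "nat \<Rightarrow> real \<times> real \<Rightarrow> real \<times> real \<Rightarrow> real" where
  "kernel n p q = time_kernel n (fst p) (fst q) * space_kernel a b n (snd p) (snd q)"

sublocale KT: approximate_identity "{0<..<T}" time_kernel
  rewrites "approximate_identity.M {0<..<T} = MT"
proof -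
  show *: "approximate_identity {0<..<T} time_kernel" by (rule approximate_identity_time)
  show "approximate_identity.M {0<..<T} = MT"
    by (simp add: approximate_identity.M_def[OF *] MT_def space_measure_def)
qed

sublocale KX: approximate_identity "{a<..<b}" "space_kernel a b"
  rewrites "approximate_identity.M {a<..<b} = MX"
proof -
  show *: "approximate_identity {a<..<b} (space_kernel a b)" by (rule approximate_identity_space[OF ab])
  show "approximate_identity.M {a<..<b} = MX"
    by (simp add: approximate_identity.M_def[OF *] MX_def space_measure_def)
qed

sublocale KQ: approximate_identity "{0<..<T} \<times> {a<..<b}" kernel
  rewrites "approximate_identity.M ({0<..<T} \<times> {a<..<b}) = MQ"
proof -
  show *: "approximate_identity ({0<..<T} \<times> {a<..<b}) kernel"
    using approximate_identity_Times[OF KT.approximate_identity_axioms KX.approximate_identity_axioms]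
    by (simp add: kernel_def[abs_def])
  show "approximate_identity.M ({0<..<T} \<times> {a<..<b}) = MQ"
    unfolding approximate_identity.M_def[OF *] MQ_def MT_def MX_def space_measure_def
    by (intro restrict_lborel_Times) auto
qed

sublocale TX: pair_sigma_finite MT MX ..

lemma measure_MX: "measure MX (space MX) = b - a"
proof -
  have "(\<integral>x. (1::real) \<partial>MX) = b - a"
    unfolding MX_def using ab by (subst integral_space_measure[where G="\<lambda>x. x"]) auto
  then show ?thesis by simp
qed

definition test_t :: "(real \<Rightarrow> real) \<Rightarrow> bool" where
  "test_t \<alpha> \<longleftrightarrow> smooth \<alpha> \<and> (\<exists>s r. 0 < s \<and> r < T \<and> (\<forall>t. t \<notin> {s..r} \<longrightarrow> \<alpha> t = 0))"

definition test_t0 :: "(real \<Rightarrow> real) \<Rightarrow> bool" where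
  "test_t0 \<alpha> \<longleftrightarrow> smooth \<alpha> \<and> (\<exists>r<T. \<forall>t>r. \<alpha> t = 0)"

definition periodic_smooth :: "(real \<Rightarrow> real) \<Rightarrow> bool" where
  "periodic_smooth \<beta> \<longleftrightarrow> smooth \<beta> \<and> (\<forall>x. \<beta> (x + (b - a)) = \<beta> x)"

lemma test_t_smooth: "test_t \<alpha> \<Longrightarrow> smooth \<alpha>" by (simp add: test_t_def)
lemma test_t0_smooth: "test_t0 \<alpha> \<Longrightarrow> smooth \<alpha>" by (simp add: test_t0_def)
lemma periodic_smooth_smooth: "periodic_smooth \<beta> \<Longrightarrow> smooth \<beta>" by (simp add: periodic_smooth_def)

lemma test_t_imp_t0: "test_t \<alpha> \<Longrightarrow> test_t0 \<alpha>"
  unfolding test_t_def test_t0_def by (metis atLeastAtMost_iff not_less)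

lemma test_t0_T: "test_t0 \<alpha> \<Longrightarrow> \<alpha> T = 0" by (auto simp: test_t0_def)
lemma test_t_mult: "test_t \<alpha> \<Longrightarrow> smooth g \<Longrightarrow> test_t (\<lambda>t. \<alpha> t * g t)"
  unfolding test_t_def by (auto intro: smooth_intros)

lemma test_t0_mult: "test_t0 \<alpha> \<Longrightarrow> smooth g \<Longrightarrow> test_t0 (\<lambda>t. \<alpha> t * g t)"
  unfolding test_t0_def by (auto intro: smooth_intros)

lemma periodic_smooth_const: "periodic_smooth (\<lambda>x. c)"
  by (simp add: periodic_smooth_def smooth_const)

lemma deriv_eq_0_off: 
  assumes "open U" "x \<in> U" "\<And>y. y \<in> U \<Longrightarrow> g y = (0::real)" shows "deriv g x = 0"
proof -
  have "\<forall>\<^sub>F y in nhds x. g y = 0" using eventually_nhds_in_open[OF assms(1,2)] assms(3) by (auto elim: eventually_mono)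
  then have "deriv g x = deriv (\<lambda>_. 0) x" by (rule deriv_cong_ev) simp
  then show ?thesis by simp
qed

lemma test_t_deriv: assumes "test_t \<alpha>" shows "test_t (deriv \<alpha>)"
proof -
  from assms obtain s r where sr: "smooth \<alpha>" "0 < s" "r < T" "\<And>t. t \<notin> {s..r} \<Longrightarrow> \<alpha> t = 0"
    by (auto simp: test_t_def)
  have "deriv \<alpha> t = 0" if "t \<notin> {s..r}" for t
    using that sr(4) by (intro deriv_eq_0_off[of "- {s..r}"]) auto
  then show ?thesis using sr smoothD(2) unfolding test_t_def by blast
qed

lemma periodic_smooth_deriv: assumes "periodic_smooth \<beta>" shows "periodic_smooth (deriv \<beta>)"
proof -
  have s: "smooth \<beta>" and p: "\<And>x. \<beta> (x + (b - a)) = \<beta> x" using assms by (auto simp: periodic_smooth_def)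
  have "deriv \<beta> (x + (b - a)) = deriv \<beta> x" for x
  proof -
    have "((\<lambda>x. x + (b - a)) has_real_derivative 1) (at x)" by (auto intro!: derivative_eq_intros)
    from DERIV_chain2[where f=\<beta>, OF smoothD(1)[OF s] this]
    have "(\<beta> has_real_derivative deriv \<beta> (x + (b - a))) (at x)" by (simp add: p)
    then show ?thesis by (simp add: DERIV_imp_deriv)
  qed
  then show ?thesis using s by (simp add: periodic_smooth_def smoothD)
qed

lemma test_t_funpow: "test_t \<alpha> \<Longrightarrow> test_t ((deriv ^^ n) \<alpha>)"
  by (induction n) (auto intro: test_t_deriv)

lemma periodic_smooth_funpow: "periodic_smooth \<beta> \<Longrightarrow> periodic_smooth ((deriv ^^ n) \<beta>)"
  by (induction n) (auto intro: periodic_smooth_deriv)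

lemma test_open_product:
  assumes "test_t \<alpha>" "periodic_smooth \<beta>"
  shows "(\<lambda>p. \<alpha> (fst p) * \<beta> (snd p)) \<in> test_open T a b"
proof -
  have "(\<lambda>p. \<alpha> (fst p) * \<beta> (snd p)) \<in> C_infinity"
    using assms by (intro C_infinity_product test_t_smooth periodic_smooth_smooth)
  then show ?thesis using assms by (fastforce simp: test_open_def test_t_def periodic_smooth_def)
qed

lemma test_init_product:
  assumes "test_t0 \<alpha>" "periodic_smooth \<beta>"
  shows "(\<lambda>p. \<alpha> (fst p) * \<beta> (snd p)) \<in> test_init T a b"
proof -
  have "(\<lambda>p. \<alpha> (fst p) * \<beta> (snd p)) \<in> C_infinity"
    using assms by (intro C_infinity_product test_t0_smooth periodic_smooth_smooth)
  then show ?thesis using assms by (fastforce simp: test_init_def test_t0_def periodic_smooth_def)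
qed

lemma test_space_periodic: "periodic_smooth \<beta> \<Longrightarrow> \<beta> \<in> test_space a b"
  by (simp add: test_space_def periodic_smooth_def C_infinity_real)

lemma smooth_MT : "smooth g \<Longrightarrow> g \<in> borel_measurable MT"
  unfolding MT_def by (intro borel_space_measure smooth_borel)
lemma smooth_MX : "smooth g \<Longrightarrow> g \<in> borel_measurable MX"
  unfolding MX_def by (intro borel_space_measure smooth_borel)

lemma smooth_product_measurable:
  assumes "smooth \<alpha>" "smooth \<beta>"
  shows "(\<lambda>p. \<alpha> (fst p) * \<beta> (snd p)) \<in> borel_measurable MQ"
proof -
  have [measurable]: "\<alpha> \<in> borel_measurable MT" "\<beta> \<in> borel_measurable MX" using assms by (auto intro: smooth_MT smooth_MX)
  show ?thesis unfolding MQ_def by measurable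
qed

lemma smooth_product_bounded:
  assumes "smooth \<alpha>" "smooth \<beta>"
  obtains c where "\<And>p. p \<in> space MQ \<Longrightarrow> \<bar>\<alpha> (fst p) * \<beta> (snd p)\<bar> \<le> c"
proof -
  obtain c where c: "\<forall>x\<in>{0..T}. \<bar>\<alpha> x\<bar> \<le> c" using smooth_bounded_interval[OF assms(1), of 0 T] by blast
  obtain d where d: "\<forall>x\<in>{a..b}. \<bar>\<beta> x\<bar> \<le> d" using smooth_bounded_interval[OF assms(2), of a b] by blast
  have "\<bar>\<alpha> (fst p) * \<beta> (snd p)\<bar> \<le> c * d" if "p \<in> space MQ" for p
  proof -
    have "\<bar>\<alpha> (fst p)\<bar> \<le> c" "\<bar>\<beta> (snd p)\<bar> \<le> d" using c d that by auto
    then show ?thesis unfolding abs_mult by (intro mult_mono) auto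
  qed
  then show ?thesis by (rule that)
qed

lemma integrable_product_test:
  assumes "integrable MQ u" "smooth \<alpha>" "smooth \<beta>"
  shows "integrable MQ (\<lambda>p. u p * (\<alpha> (fst p) * \<beta> (snd p)))"
proof -
  obtain c where c: "\<And>p. p \<in> space MQ \<Longrightarrow> \<bar>\<alpha> (fst p) * \<beta> (snd p)\<bar> \<le> c"
    using smooth_product_bounded[OF assms(2,3)] by blast
  show ?thesis
    by (rule integrable_bounded_mult(2)[OF assms(1) smooth_product_measurable[OF assms(2,3)]])
       (auto intro!: AE_I2 c)
qed

lemma L2_product_test:
  assumes "u \<in> L2 MQ" "smooth \<alpha>" "smooth \<beta>"
  shows "(\<lambda>p. u p * (\<alpha> (fst p) * \<beta> (snd p))) \<in> L2 MQ"
proof -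
  obtain c where c: "\<And>p. p \<in> space MQ \<Longrightarrow> \<bar>\<alpha> (fst p) * \<beta> (snd p)\<bar> \<le> c"
    using smooth_product_bounded[OF assms(2,3)] by blast
  show ?thesis
    by (rule L2_bounded_mult(2)[OF assms(1) smooth_product_measurable[OF assms(2,3)]])
       (auto intro!: AE_I2 c)
qed

text \<open>\<open>v = \<partial>\<^sub>t\<^sup>i \<partial>\<^sub>x\<^sup>j u\<close>, tested with products only.\<close>

definition weak :: "nat \<Rightarrow> nat \<Rightarrow> (real \<times> real \<Rightarrow> real) \<Rightarrow> (real \<times> real \<Rightarrow> real) \<Rightarrow> bool" where
  "weak i j u v \<longleftrightarrow> (\<forall>\<alpha> \<beta>. test_t \<alpha> \<longrightarrow> periodic_smooth \<beta> \<longrightarrow>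
     (\<integral>p. u p * ((deriv ^^ i) \<alpha> (fst p) * (deriv ^^ j) \<beta> (snd p)) \<partial>MQ) =
       (-1) ^ (i + j) * (\<integral>p. v p * (\<alpha> (fst p) * \<beta> (snd p)) \<partial>MQ))"

text \<open>A derivative supplied by \<open>st_weak_deriv\<close> need not be integrable up to
  \<open>t = 0\<close> or \<open>t = T\<close>; its products with tests supported away from these
  times are.\<close>

definition locally_integrable :: "(real \<times> real \<Rightarrow> real) \<Rightarrow> bool" where
  "locally_integrable v \<longleftrightarrow> v \<in> borel_measurable MQ \<and> (\<forall>\<alpha> \<beta>. test_t \<alpha> \<longrightarrow> periodic_smooth \<beta> \<longrightarrow>
     integrable MQ (\<lambda>p. v p * (\<alpha> (fst p) * \<beta> (snd p))))"

lemma length_eq_counts: "bs \<in> lists Basis \<Longrightarrow> length bs = count_list bs dir_t + count_list bs dir_x"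
  by (induction bs) (auto simp: Basis_prod_def)

lemma st_weak_deriv_weak:
  assumes "st_weak_deriv T a b bs u v" "bs \<in> lists Basis"
  shows "weak (count_list bs dir_t) (count_list bs dir_x) u v" "locally_integrable v"
proof -
  show "weak (count_list bs dir_t) (count_list bs dir_x) u v"
    unfolding weak_def
  proof (intro allI impI)
    fix \<alpha> \<beta> assume t: "test_t \<alpha>" "periodic_smooth \<beta>"
    from assms(1)[unfolded st_weak_deriv_def weak_deriv_def] test_open_product[OF t]
    show "(\<integral>p. u p * ((deriv ^^ count_list bs dir_t) \<alpha> (fst p) * (deriv ^^ count_list bs dir_x) \<beta> (snd p)) \<partial>MQ) =
       (-1) ^ (count_list bs dir_t + count_list bs dir_x) * (\<integral>p. v p * (\<alpha> (fst p) * \<beta> (snd p)) \<partial>MQ)"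
      using t unfolding length_eq_counts[OF assms(2), symmetric] st_measure_MQ
      by (auto simp: pderivs_product[OF test_t_smooth periodic_smooth_smooth assms(2)])
  qed
  show "locally_integrable v"
    using assms(1) test_open_product
    by (auto simp: st_weak_deriv_def weak_deriv_def integrable_vs_tests_def locally_integrable_def st_measure_MQ)
qed

lemma L2_locally_integrable: "v \<in> L2 MQ \<Longrightarrow> locally_integrable v"
  unfolding locally_integrable_def
  using KQ.fm.L2_integrable[of v] integrable_product_test[of v] L2_measurable test_t_smooth periodic_smooth_smooth by blast

lemma integrable_locally_integrable: "integrable MQ v \<Longrightarrow> locally_integrable v"
  unfolding locally_integrable_def
  using integrable_product_test[of v] test_t_smooth periodic_smooth_smooth by blast

lemma H_st_weak:
  assumes "u \<in> H_st k T a b" "i + j \<le> k"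
  obtains v where "v \<in> L2 MQ" "weak i j u v"
proof -
  let ?bs = "replicate i dir_t @ replicate j dir_x"
  have bs: "?bs \<in> lists Basis" by (auto simp: Basis_prod_def)
  moreover have "length ?bs \<le> k" using assms(2) by simp
  ultimately obtain v where v: "v \<in> L2 MQ" "st_weak_deriv T a b ?bs u v"
    using assms(1) unfolding H_st_def sobolev_def st_weak_deriv_def st_measure_MQ by blast
  have "count_list ?bs dir_t = i" "count_list ?bs dir_x = j"
    by (induction i; induction j; simp)+
  then show ?thesis using st_weak_deriv_weak(1)[OF v(2) bs] v(1) that by simp
qed

text \<open>Derivatives of tests are tests: the first relation is applied to
  \<open>(deriv ^^ i') \<alpha>\<close> and \<open>(deriv ^^ j') \<beta>\<close>. In this way all
  relations among the derivatives come from those of one function.\<close>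

lemma weak_trans:
  assumes "weak i j u v" "weak (i + i') (j + j') u v'"
  shows "weak i' j' v v'"
  unfolding weak_def
proof (intro allI impI)
  fix \<alpha> \<beta> assume t: "test_t \<alpha>" "periodic_smooth \<beta>"
  have e: "(-1::real) ^ (i + j) * (-1) ^ (i + j) = 1" by (simp add: power_add[symmetric])
  have "(-1) ^ (i + j) * (\<integral>p. v p * ((deriv ^^ i') \<alpha> (fst p) * (deriv ^^ j') \<beta> (snd p)) \<partial>MQ) =
    (\<integral>p. u p * ((deriv ^^ (i + i')) \<alpha> (fst p) * (deriv ^^ (j + j')) \<beta> (snd p)) \<partial>MQ)"
    using assms(1) test_t_funpow[OF t(1), of i'] periodic_smooth_funpow[OF t(2), of j']
    unfolding weak_def by (simp add: funpow_add)
  also have "\<dots> = (-1) ^ (i + j) * ((-1) ^ (i' + j') * (\<integral>p. v' p * (\<alpha> (fst p) * \<beta> (snd p)) \<partial>MQ))"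
    using assms(2) t unfolding weak_def by (simp add: power_add)
  finally show "(\<integral>p. v p * ((deriv ^^ i') \<alpha> (fst p) * (deriv ^^ j') \<beta> (snd p)) \<partial>MQ) =
    (-1) ^ (i' + j') * (\<integral>p. v' p * (\<alpha> (fst p) * \<beta> (snd p)) \<partial>MQ)" by simp
qed

lemma time_kernel_test:
  assumes "test_t \<eta>" shows "test_t (\<lambda>s. \<eta> s * time_kernel n t s)"
proof (rule test_t_mult[OF assms])
  show "smooth (time_kernel n t)" unfolding time_kernel_def
    by (rule smooth_compose[OF smooth_unit_bump]) (intro smooth_intros)
qed

lemma space_kernel_test: "periodic_smooth (\<lambda>y. space_kernel a b n x y)"
  unfolding periodic_smooth_def space_kernel_def
proof
  show "smooth (\<lambda>y. periodic_bump (b - a) n (y - x) / integral\<^sup>L (space_measure a b) (periodic_bump (b - a) n))"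
    by (intro smooth_divide_const smooth_compose[OF smooth_periodic_bump]) (intro smooth_intros)
  show "\<forall>xa. periodic_bump (b - a) n (xa + (b - a) - x) / integral\<^sup>L (space_measure a b) (periodic_bump (b - a) n) =
    periodic_bump (b - a) n (xa - x) / integral\<^sup>L (space_measure a b) (periodic_bump (b - a) n)"
    using ab periodic_bump_periodic[of "b - a" n] by (metis diff_add_eq less_irrefl right_minus_eq)
qed

text \<open>A cut-off \<open>\<eta>\<close> in time makes \<open>h\<close> integrable and turns the
  kernels centred at any point into admissible tests. All kernel averages of \<open>h\<close> times
  \<open>\<eta>\<close> then vanish, and countably many bumps exhaust the time interval.\<close>

lemma fundamental_lemma:
  assumes h: "locally_integrable h"
    and 0: "\<And>\<alpha> \<beta>. test_t \<alpha> \<Longrightarrow> periodic_smooth \<beta> \<Longrightarrow> (\<integral>p. h p * (\<alpha> (fst p) * \<beta> (snd p)) \<partial>MQ) = 0"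
  shows "AE p in MQ. h p = 0"
proof -
  have *: "AE p in MQ. h p * \<eta> (fst p) = 0" if \<eta>: "test_t \<eta>" for \<eta>
  proof (rule KQ.AE_0_of_kernel_0)
    show "integrable MQ (\<lambda>p. h p * \<eta> (fst p))"
      using h \<eta> periodic_smooth_const[of 1] unfolding locally_integrable_def by fastforce
    show "AE p in MQ. \<forall>\<^sub>F n in sequentially. (\<integral>q. h q * \<eta> (fst q) * kernel n p q \<partial>MQ) = 0"
    proof (rule AE_I2, rule always_eventually, rule allI)
      fix p n
      show "(\<integral>q. h q * \<eta> (fst q) * kernel n p q \<partial>MQ) = 0"
        using 0[OF time_kernel_test[OF \<eta>] space_kernel_test, of n "fst p" n "snd p"]
        by (simp add: kernel_def mult_ac)
    qed
  qed
  have "AE p in MQ. \<forall>m::nat. h p * bump (1 / real (Suc m)) (T - 1 / real (Suc m)) (fst p) = 0"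
    unfolding AE_all_countable
  proof
    fix m :: nat
    show "AE p in MQ. h p * bump (1 / real (Suc m)) (T - 1 / real (Suc m)) (fst p) = 0"
    proof (rule *, unfold test_t_def, intro conjI exI allI impI)
      show "smooth (bump (1 / real (Suc m)) (T - 1 / real (Suc m)))" by (rule smooth_bump)
      fix t assume "t \<notin> {1 / real (Suc m)..T - 1 / real (Suc m)}"
      then show "bump (1 / real (Suc m)) (T - 1 / real (Suc m)) t = 0" by (intro bump_eq_0) auto
    qed auto
  qed
  then show ?thesis using AE_space
  proof eventually_elim
    case (elim p)
    then have "0 < min (fst p) (T - fst p)" by auto
    from eventually_inverse_less[OF this, of 1] obtain m where "1 / real (Suc m) < min (fst p) (T - fst p)"
      by (auto simp: eventually_sequentially)
    then have "0 < bump (1 / real (Suc m)) (T - 1 / real (Suc m)) (fst p)" by (intro bump_pos) auto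
    then show ?case using elim(1) by (metis less_irrefl mult_eq_0_iff)
  qed
qed

lemma locally_integrable_diff:
  "locally_integrable v \<Longrightarrow> locally_integrable w \<Longrightarrow> locally_integrable (\<lambda>p. v p - w p)"
  unfolding locally_integrable_def by (auto simp: left_diff_distrib)

lemma weak_unique:
  assumes "weak i j u v" "weak i j u w" "locally_integrable v" "locally_integrable w"
  shows "AE p in MQ. v p = w p"
proof -
  have "AE p in MQ. v p - w p = 0"
  proof (rule fundamental_lemma[OF locally_integrable_diff[OF assms(3,4)]])
    fix \<alpha> \<beta> assume t: "test_t \<alpha>" "periodic_smooth \<beta>"
    have "(-1::real) ^ (i + j) * (\<integral>p. v p * (\<alpha> (fst p) * \<beta> (snd p)) \<partial>MQ) = (-1) ^ (i + j) * (\<integral>p. w p * (\<alpha> (fst p) * \<beta> (snd p)) \<partial>MQ)"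
      using assms(1)[unfolded weak_def, rule_format, OF t] assms(2)[unfolded weak_def, rule_format, OF t] by simp
    moreover have "integrable MQ (\<lambda>p. v p * (\<alpha> (fst p) * \<beta> (snd p)))" "integrable MQ (\<lambda>p. w p * (\<alpha> (fst p) * \<beta> (snd p)))"
      using assms(3,4) t by (auto simp: locally_integrable_def)
    ultimately show "(\<integral>p. (v p - w p) * (\<alpha> (fst p) * \<beta> (snd p)) \<partial>MQ) = 0"
      by (simp add: left_diff_distrib)
  qed
  then show ?thesis by eventually_elim simp
qed

lemma AE_MT_const: assumes "AE t in MT. P" shows P
proof (rule ccontr)
  assume "\<not> P"
  then have "(\<integral>t. (1::real) \<partial>MT) = (\<integral>t. 0 \<partial>MT)" using assms by (intro integral_cong_AE) auto
  moreover have "(\<integral>t. (1::real) \<partial>MT) = T"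
    unfolding MT_def using T by (subst integral_space_measure[where G="\<lambda>x. x"]) auto
  ultimately show False using T by simp
qed

lemma AE_MX_const: assumes "AE x in MX. P" shows P
proof (rule ccontr)
  assume "\<not> P"
  then have "(\<integral>t. (1::real) \<partial>MX) = (\<integral>t. 0 \<partial>MX)" using assms by (intro integral_cong_AE) auto
  then show False using ab measure_MX by simp
qed

lemma AE_MQ_fst: assumes "AE p in MQ. P (fst p)" shows "AE t in MT. P t"
proof -
  have "AE t in MT. AE x in MX. P t" using TX.AE_pair[OF assms[unfolded MQ_def]] by simp
  then show ?thesis by eventually_elim (rule AE_MX_const)
qed

end

section \<open>Primitives and integration by parts\<close>

lemma L2_Cauchy_Schwarz:
  fixes f g :: "'a \<Rightarrow> real"
  assumes f: "f \<in> L2 M" and g: "g \<in> L2 M"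
  shows "(LINT x|M. f x * g x)\<^sup>2 \<le> (\<integral>x. (f x)\<^sup>2 \<partial>M) * (\<integral>x. (g x)\<^sup>2 \<partial>M)"
proof -
  let ?F = "\<integral>x. (f x)\<^sup>2 \<partial>M" and ?G = "\<integral>x. (g x)\<^sup>2 \<partial>M" and ?H = "\<integral>x. f x * g x \<partial>M"
  note i = L2_square[OF f] L2_square[OF g] L2_mult[OF f g]
  show ?thesis
  proof (cases "?G = 0")
    case True
    then have "AE x in M. (g x)\<^sup>2 = 0"
      using integral_nonneg_eq_0_iff_AE[OF i(2)] by simp
    then have "?H = (\<integral>x. 0 \<partial>M)"
      using f g by (intro integral_cong_AE) (auto simp: L2_def)
    then show ?thesis by simp
  next
    case False
    moreover have "0 \<le> ?G" by simp
    ultimately have G: "0 < ?G" by linarith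
    define c where "c = ?H / ?G"
    have "0 \<le> (\<integral>x. (f x - c * g x)\<^sup>2 \<partial>M)" by simp
    also have "\<dots> = (\<integral>x. (f x)\<^sup>2 - 2 * c * (f x * g x) + c\<^sup>2 * (g x)\<^sup>2 \<partial>M)"
      by (intro Bochner_Integration.integral_cong) (auto simp: power2_eq_square algebra_simps)
    also have "\<dots> = ?F - 2 * c * ?H + c\<^sup>2 * ?G" using i by simp
    also have "\<dots> = ?F - ?H\<^sup>2 / ?G" using G by (simp add: c_def power2_eq_square field_simps)
    finally show ?thesis using G by (simp add: field_simps)
  qed
qed

lemma (in pair_sigma_finite) AE_pair_snd:
  assumes "AE x in M2. Q x" shows "AE p in M1 \<Otimes>\<^sub>M M2. Q (snd p)"
proof -
  obtain N where N: "{x \<in> space M2. \<not> Q x} \<subseteq> N" "emeasure M2 N = 0" "N \<in> sets M2"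
    using AE_E[OF assms] by metis
  have "AE p in M1 \<Otimes>\<^sub>M M2. snd p \<notin> N"
  proof (rule AE_pair_measure)
    show "{p \<in> space (M1 \<Otimes>\<^sub>M M2). snd p \<notin> N} \<in> sets (M1 \<Otimes>\<^sub>M M2)"
      using N(3) by measurable
    have "AE y in M2. y \<notin> N" using N(2,3) by (intro AE_not_in) auto
    then show "AE x in M1. AE y in M2. snd (x, y) \<notin> N" by simp
  qed
  then show ?thesis using AE_space
    by eventually_elim (use N(1) in \<open>auto simp: space_pair_measure\<close>)
qed

text \<open>The integral of \<open>v\<close> from \<open>c\<close> to \<open>t\<close>, written over
  the whole interval: it becomes a partial integral of a function that is jointly measurable in
  \<open>(t, s)\<close>, and Fubini applies on a fixed product.\<close>

definition primitive :: "real \<Rightarrow> real \<Rightarrow> (real \<Rightarrow> real) \<Rightarrow> real \<Rightarrow> real" where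
  "primitive c d v t = (\<integral>s. (if s < t then v s else 0) \<partial>space_measure c d)"

lemma integral_space_measure_above:
  assumes "s \<in> {c<..<d}" "\<And>t. (G has_real_derivative g t) (at t)" "continuous_on UNIV g"
  shows "(\<integral>t. (if s < t then g t else 0) \<partial>space_measure c d) = G d - G s"
proof -
  have "(\<integral>t. (if s < t then g t else 0) \<partial>space_measure c d) = (\<integral>t. g t \<partial>space_measure s d)"
    unfolding space_measure_def using assms(1)
    by (subst (1 2) integral_restrict_space) (auto intro!: Bochner_Integration.integral_cong simp: indicator_def)
  also have "\<dots> = G d - G s" using assms by (intro integral_space_measure) auto
  finally show ?thesis .
qed

lemma integral_space_measure_below:
  assumes "s \<in> {c<..<d}" "\<And>t. (G has_real_derivative g t) (at t)" "continuous_on UNIV g"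
  shows "(\<integral>t. (if t < s then g t else 0) \<partial>space_measure c d) = G s - G c"
proof -
  have "(\<integral>t. (if t < s then g t else 0) \<partial>space_measure c d) = (\<integral>t. g t \<partial>space_measure c s)"
    unfolding space_measure_def using assms(1)
    by (subst (1 2) integral_restrict_space) (auto intro!: Bochner_Integration.integral_cong simp: indicator_def)
  also have "\<dots> = G s - G c" using assms by (intro integral_space_measure) auto
  finally show ?thesis .
qed

text \<open>Fubini on the triangle \<open>s < t\<close>; the inner integral of
  \<open>deriv \<gamma>\<close> from \<open>s\<close> to \<open>d\<close> is elementary. No
  regularity of \<open>v\<close> beyond integrability enters.\<close>

lemma primitive_by_parts:
  assumes v: "integrable (space_measure c d) v" and \<gamma>: "smooth \<gamma>"
  shows "(\<integral>t. primitive c d v t * deriv \<gamma> t \<partial>space_measure c d) = (\<integral>s. v s * (\<gamma> d - \<gamma> s) \<partial>space_measure c d)"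
proof -
  let ?I = "space_measure c d"
  interpret finite_measure ?I by (rule finite_measure_space_measure)
  interpret pair_sigma_finite ?I ?I ..
  note id_borel_space_measure[measurable]
  have [measurable]: "v \<in> borel_measurable ?I" using v by auto
  have [measurable]: "deriv \<gamma> \<in> borel_measurable ?I" using smoothD(2)[OF \<gamma>] by (intro borel_space_measure smooth_borel)
  obtain B where B: "\<And>x. x \<in> {c..d} \<Longrightarrow> \<bar>deriv \<gamma> x\<bar> \<le> B"
    using smooth_bounded_interval[OF smoothD(2)[OF \<gamma>], of c d] by blast
  define h where "h = (\<lambda>p. if snd p < fst p then deriv \<gamma> (fst p) else (0::real))"
  have [measurable]: "h \<in> borel_measurable (?I \<Otimes>\<^sub>M ?I)" unfolding h_def by measurable
  have "integrable (?I \<Otimes>\<^sub>M ?I) (\<lambda>p. h p * (1 * v (snd p)))"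
  proof (rule integrable_bounded_mult(1)[where c="\<bar>B\<bar>"])
    show "integrable (?I \<Otimes>\<^sub>M ?I) (\<lambda>p. 1 * v (snd p))"
      using integrable_pair_mult[of "\<lambda>_. 1" v] v by simp
    show "AE p in ?I \<Otimes>\<^sub>M ?I. \<bar>h p\<bar> \<le> \<bar>B\<bar>"
    proof (rule AE_I2)
      fix p assume "p \<in> space (?I \<Otimes>\<^sub>M ?I)"
      then have "\<bar>deriv \<gamma> (fst p)\<bar> \<le> B" by (intro B) (auto simp: space_pair_measure)
      then show "\<bar>h p\<bar> \<le> \<bar>B\<bar>" by (auto simp: h_def)
    qed
  qed auto
  moreover have "(\<lambda>p. h p * (1 * v (snd p))) = (\<lambda>(t, s). (if s < t then v s else 0) * deriv \<gamma> t)"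
    by (auto simp: h_def)
  ultimately have i: "integrable (?I \<Otimes>\<^sub>M ?I) (\<lambda>(t, s). (if s < t then v s else 0) * deriv \<gamma> t)" by simp
  have "(\<integral>t. primitive c d v t * deriv \<gamma> t \<partial>?I) = (\<integral>t. (\<integral>s. (if s < t then v s else 0) * deriv \<gamma> t \<partial>?I) \<partial>?I)"
    by (simp add: primitive_def)
  also have "\<dots> = (\<integral>s. (\<integral>t. (if s < t then v s else 0) * deriv \<gamma> t \<partial>?I) \<partial>?I)"
    unfolding integral_fst[OF i] integral_snd[OF i] ..
  also have "\<dots> = (\<integral>s. v s * (\<gamma> d - \<gamma> s) \<partial>?I)"
  proof (rule Bochner_Integration.integral_cong[OF refl])
    fix s assume s: "s \<in> space ?I"
    have "(\<integral>t. (if s < t then v s else 0) * deriv \<gamma> t \<partial>?I) = (\<integral>t. v s * (if s < t then deriv \<gamma> t else 0) \<partial>?I)"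
      by (intro Bochner_Integration.integral_cong) auto
    also have "\<dots> = v s * (\<gamma> d - \<gamma> s)"
      using s by (simp add: integral_space_measure_above[OF _ smoothD(1)[OF \<gamma>]] smooth_continuous[OF smoothD(2)[OF \<gamma>]])
    finally show "(\<integral>t. (if s < t then v s else 0) * deriv \<gamma> t \<partial>?I) = v s * (\<gamma> d - \<gamma> s)" .
  qed
  finally show ?thesis .
qed

text \<open>Cauchy-Schwarz against the indicator of \<open>s < t\<close>, whose square has integral
  \<open>t - c\<close>. This factor is what makes the primitive small close to the initial time in
  \<open>trace_term_tendsto\<close>.\<close>

lemma primitive_square_le:
  assumes v: "v \<in> L2 (space_measure c d)" and t: "t \<in> {c<..<d}"
  shows "(primitive c d v t)\<^sup>2 \<le> (t - c) * (\<integral>s. (v s)\<^sup>2 \<partial>space_measure c d)"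
proof -
  let ?I = "space_measure c d"
  interpret finite_measure ?I by (rule finite_measure_space_measure)
  let ?f = "\<lambda>s. if s < t then 1 else (0::real)"
  note id_borel_space_measure[measurable]
  have f: "?f \<in> L2 ?I" by (rule bounded_L2[where c=1]) auto
  have "(\<integral>s. (?f s)\<^sup>2 \<partial>?I) = (\<integral>s. ?f s \<partial>?I)" by (intro Bochner_Integration.integral_cong) auto
  also have "\<dots> = t - c" using integral_space_measure_below[OF t, of "\<lambda>x. x" "\<lambda>_. 1"] by simp
  finally have 1: "(\<integral>s. (?f s)\<^sup>2 \<partial>?I) = t - c" .
  have "primitive c d v t = (\<integral>s. ?f s * v s \<partial>?I)"
    unfolding primitive_def by (intro Bochner_Integration.integral_cong) auto
  then show ?thesis using L2_Cauchy_Schwarz[OF f v] 1 by simp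
qed

text \<open>With \<open>N\<close> equal to \<open>MX\<close> this treats primitives in time, with
  \<open>N\<close> equal to \<open>MT\<close> primitives in space.\<close>

locale interval_pair = finite_measure N for N :: "'b measure" +
  fixes c d :: real
begin

definition "I = space_measure c d"

sublocale I: finite_measure I unfolding I_def by (rule finite_measure_space_measure)
sublocale P: pair_sigma_finite I N ..
sublocale PF: finite_measure "I \<Otimes>\<^sub>M N"
  by (intro finite_measure_pair_measure I.finite_measure_axioms finite_measure_axioms)

lemma id_borel_I: "(\<lambda>x. x) \<in> borel_measurable I" unfolding I_def by (rule id_borel_space_measure)

definition "prim w p = primitive c d (\<lambda>s. w (s, snd p)) (fst p)"

lemma prim_measurable [measurable]:
  assumes [measurable]: "w \<in> borel_measurable (I \<Otimes>\<^sub>M N)"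
  shows "prim w \<in> borel_measurable (I \<Otimes>\<^sub>M N)"
proof -
  note id_borel_I[measurable]
  have "(\<lambda>(p, s). if s < fst p then w (s, snd p) else 0) \<in> borel_measurable ((I \<Otimes>\<^sub>M N) \<Otimes>\<^sub>M I)"
    by measurable
  then show ?thesis unfolding prim_def[abs_def] primitive_def I_def[symmetric]
    by (rule I.borel_measurable_lebesgue_integral)
qed

lemma section_L2:
  assumes w: "w \<in> L2 (I \<Otimes>\<^sub>M N)"
  shows "AE x in N. (\<lambda>s. w (s, x)) \<in> L2 I"
    "integrable N (\<lambda>x. \<integral>s. (w (s, x))\<^sup>2 \<partial>I)"
proof -
  have i: "integrable (I \<Otimes>\<^sub>M N) (\<lambda>(s, x). (w (s, x))\<^sup>2)" using L2_square[OF w] by (simp add: case_prod_unfold)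
  show "integrable N (\<lambda>x. \<integral>s. (w (s, x))\<^sup>2 \<partial>I)" by (rule P.integrable_snd[OF i])
  show "AE x in N. (\<lambda>s. w (s, x)) \<in> L2 I" using P.AE_integrable_snd[OF i] AE_space
  proof eventually_elim
    case (elim x)
    then show ?case
      using measurable_compose[OF measurable_Pair2'[OF elim(2)] L2_measurable[OF w]] by (simp add: L2_def)
  qed
qed

lemma prim_bound:
  assumes w: "w \<in> L2 (I \<Otimes>\<^sub>M N)"
  shows "AE p in I \<Otimes>\<^sub>M N. (prim w p)\<^sup>2 \<le> (fst p - c) * (\<integral>s. (w (s, snd p))\<^sup>2 \<partial>I)"
  using P.AE_pair_snd[OF section_L2(1)[OF w]] AE_space
proof eventually_elim
  case (elim p)
  then have "fst p \<in> {c<..<d}" by (auto simp: I_def space_pair_measure)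
  with elim show ?case unfolding prim_def I_def by (intro primitive_square_le)
qed

lemma prim_L2:
  assumes w: "w \<in> L2 (I \<Otimes>\<^sub>M N)"
  shows "prim w \<in> L2 (I \<Otimes>\<^sub>M N)"
  unfolding L2_def
proof (intro CollectI conjI)
  show m: "prim w \<in> borel_measurable (I \<Otimes>\<^sub>M N)" by (rule prim_measurable[OF L2_measurable[OF w]])
  show "integrable (I \<Otimes>\<^sub>M N) (\<lambda>p. (prim w p)\<^sup>2)"
  proof (rule Bochner_Integration.integrable_bound)
    show "integrable (I \<Otimes>\<^sub>M N) (\<lambda>p. (d - c) * (\<integral>s. (w (s, snd p))\<^sup>2 \<partial>I))"
      by (rule P.integrable_pair_mult[OF _ section_L2(2)[OF w]]) simp
    show "AE p in I \<Otimes>\<^sub>M N. norm ((prim w p)\<^sup>2) \<le> norm ((d - c) * (\<integral>s. (w (s, snd p))\<^sup>2 \<partial>I))"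
      using prim_bound[OF w] AE_space
    proof eventually_elim
      case (elim p)
      then have "fst p \<in> {c<..<d}" by (auto simp: I_def space_pair_measure)
      then have "(fst p - c) * (\<integral>s. (w (s, snd p))\<^sup>2 \<partial>I) \<le> (d - c) * (\<integral>s. (w (s, snd p))\<^sup>2 \<partial>I)"
        by (intro mult_right_mono integral_nonneg_AE) auto
      with elim(1) show ?case by simp
    qed
  qed (use m in measurable)
qed

lemma prim_by_parts:
  assumes w: "w \<in> L2 (I \<Otimes>\<^sub>M N)" and \<gamma>: "smooth \<gamma>"
    and \<beta>: "\<beta> \<in> borel_measurable N" "\<And>x. x \<in> space N \<Longrightarrow> \<bar>\<beta> x\<bar> \<le> B"
  shows "(\<integral>p. prim w p * (deriv \<gamma> (fst p) * \<beta> (snd p)) \<partial>(I \<Otimes>\<^sub>M N)) =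
    (\<integral>p. w p * ((\<gamma> d - \<gamma> (fst p)) * \<beta> (snd p)) \<partial>(I \<Otimes>\<^sub>M N))"
proof -
  have bd: "\<exists>C. AE p in I \<Otimes>\<^sub>M N. \<bar>g (fst p) * \<beta> (snd p)\<bar> \<le> C" if g: "smooth g" for g
  proof -
    obtain C where C: "\<forall>x\<in>{c..d}. \<bar>g x\<bar> \<le> C"
      using smooth_bounded_interval[OF g, of c d] by blast
    have "\<bar>g (fst p) * \<beta> (snd p)\<bar> \<le> C * B" if "p \<in> space (I \<Otimes>\<^sub>M N)" for p
    proof -
      have "\<bar>g (fst p)\<bar> \<le> C" "\<bar>\<beta> (snd p)\<bar> \<le> B"
        using that C \<beta>(2) by (auto simp: I_def space_pair_measure)
      then show ?thesis unfolding abs_mult by (intro mult_mono) auto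
    qed
    then show ?thesis by (intro exI[of _ "C * B"] AE_I2)
  qed
  have meas: "(\<lambda>p. g (fst p) * \<beta> (snd p)) \<in> borel_measurable (I \<Otimes>\<^sub>M N)" if "smooth g" for g
  proof -
    have [measurable]: "g \<in> borel_measurable I" unfolding I_def using that by (intro borel_space_measure smooth_borel)
    note \<beta>(1)[measurable]
    show ?thesis by measurable
  qed
  have i: "integrable (I \<Otimes>\<^sub>M N) (\<lambda>p. v p * (g (fst p) * \<beta> (snd p)))" if v: "v \<in> L2 (I \<Otimes>\<^sub>M N)" and g: "smooth g" for v g
  proof -
    obtain C where "AE p in I \<Otimes>\<^sub>M N. \<bar>g (fst p) * \<beta> (snd p)\<bar> \<le> C" using bd[OF g] by blast
    then show ?thesis by (rule integrable_bounded_mult(2)[OF PF.L2_integrable[OF v] meas[OF g]])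
  qed
  have \<gamma>': "smooth (deriv \<gamma>)" "smooth (\<lambda>t. \<gamma> d - \<gamma> t)" using \<gamma> by (auto intro!: smooth_intros smoothD)
  have "(\<integral>p. prim w p * (deriv \<gamma> (fst p) * \<beta> (snd p)) \<partial>(I \<Otimes>\<^sub>M N)) =
    (\<integral>x. \<integral>t. prim w (t, x) * (deriv \<gamma> t * \<beta> x) \<partial>I \<partial>N)"
    using P.integral_snd[of "\<lambda>t x. prim w (t, x) * (deriv \<gamma> t * \<beta> x)"] i[OF prim_L2[OF w] \<gamma>'(1)]
    by (simp add: case_prod_unfold)
  also have "\<dots> = (\<integral>x. \<integral>s. w (s, x) * ((\<gamma> d - \<gamma> s) * \<beta> x) \<partial>I \<partial>N)"
  proof (rule integral_cong_AE)
    show "(\<lambda>x. \<integral>t. prim w (t, x) * (deriv \<gamma> t * \<beta> x) \<partial>I) \<in> borel_measurable N"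
      using P.integrable_snd[of "\<lambda>t x. prim w (t, x) * (deriv \<gamma> t * \<beta> x)"] i[OF prim_L2[OF w] \<gamma>'(1)]
      by (auto simp: case_prod_unfold)
    show "(\<lambda>x. \<integral>s. w (s, x) * ((\<gamma> d - \<gamma> s) * \<beta> x) \<partial>I) \<in> borel_measurable N"
      using P.integrable_snd[of "\<lambda>s x. w (s, x) * ((\<gamma> d - \<gamma> s) * \<beta> x)"] i[OF w \<gamma>'(2)]
      by (auto simp: case_prod_unfold)
    show "AE x in N. (\<integral>t. prim w (t, x) * (deriv \<gamma> t * \<beta> x) \<partial>I) = (\<integral>s. w (s, x) * ((\<gamma> d - \<gamma> s) * \<beta> x) \<partial>I)"
      using section_L2(1)[OF w]
    proof eventually_elim
      case (elim x)
      have "(\<integral>t. prim w (t, x) * (deriv \<gamma> t * \<beta> x) \<partial>I) = (\<integral>t. primitive c d (\<lambda>s. w (s, x)) t * deriv \<gamma> t * \<beta> x \<partial>I)"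
        by (simp add: prim_def mult.assoc)
      also have "\<dots> = (\<integral>t. primitive c d (\<lambda>s. w (s, x)) t * deriv \<gamma> t \<partial>I) * \<beta> x" by simp
      also have "\<dots> = (\<integral>s. w (s, x) * (\<gamma> d - \<gamma> s) \<partial>I) * \<beta> x"
        using I.L2_integrable[OF elim] unfolding I_def by (subst primitive_by_parts[OF _ \<gamma>]) auto
      also have "\<dots> = (\<integral>s. w (s, x) * (\<gamma> d - \<gamma> s) * \<beta> x \<partial>I)" by simp
      finally show ?case by (simp add: mult.assoc)
    qed
  qed
  also have "\<dots> = (\<integral>p. w p * ((\<gamma> d - \<gamma> (fst p)) * \<beta> (snd p)) \<partial>(I \<Otimes>\<^sub>M N))"
    using P.integral_snd[of "\<lambda>s x. w (s, x) * ((\<gamma> d - \<gamma> s) * \<beta> x)"] i[OF w \<gamma>'(2)]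
    by (simp add: case_prod_unfold)
  finally show ?thesis .
qed

end

context periodic_domain begin

sublocale PT: interval_pair MX 0 T
  rewrites "interval_pair.I 0 T = MT"
proof -
  show *: "interval_pair MX" by unfold_locales
  show "interval_pair.I 0 T = MT" by (simp add: interval_pair.I_def[OF *] MT_def)
qed

sublocale PX: interval_pair MT a b
  rewrites "interval_pair.I a b = MX"
proof -
  show *: "interval_pair MT" by unfold_locales
  show "interval_pair.I a b = MX" by (simp add: interval_pair.I_def[OF *] MX_def)
qed

definition prim_t where "prim_t w p = primitive 0 T (\<lambda>s. w (s, snd p)) (fst p)"
definition prim_x where "prim_x w p = primitive a b (\<lambda>y. w (fst p, y)) (snd p)"

lemma prim_t_eq: "prim_t = PT.prim" by (simp add: fun_eq_iff prim_t_def PT.prim_def)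

text \<open>The locale integrates in the first coordinate; exchanging coordinates transfers its
  results to primitives in \<open>x\<close>.\<close>

definition swapf :: "(real \<times> real \<Rightarrow> real) \<Rightarrow> real \<times> real \<Rightarrow> real" where "swapf w p = w (snd p, fst p)"

lemma swapf_measurable: "w \<in> borel_measurable MQ \<Longrightarrow> swapf w \<in> borel_measurable (MX \<Otimes>\<^sub>M MT)"
  unfolding swapf_def[abs_def] MQ_def
  by (rule measurable_compose[OF measurable_Pair[OF measurable_snd measurable_fst]])

lemma swapf_measurable': "w \<in> borel_measurable (MX \<Otimes>\<^sub>M MT) \<Longrightarrow> swapf w \<in> borel_measurable MQ"
  unfolding swapf_def[abs_def] MQ_def
  by (rule measurable_compose[OF measurable_Pair[OF measurable_snd measurable_fst]])

lemma swapf_integrable_iff: "integrable (MX \<Otimes>\<^sub>M MT) (swapf w) \<longleftrightarrow> integrable MQ w"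
  using TX.integrable_product_swap_iff[of w] by (simp add: swapf_def[abs_def] MQ_def case_prod_unfold)

lemma swapf_L2: "w \<in> L2 MQ \<Longrightarrow> swapf w \<in> L2 (MX \<Otimes>\<^sub>M MT)"
  using swapf_integrable_iff[of "\<lambda>p. (w p)\<^sup>2"] swapf_measurable[of w] by (simp add: L2_def swapf_def[abs_def])

lemma swapf_L2': "w \<in> L2 (MX \<Otimes>\<^sub>M MT) \<Longrightarrow> swapf w \<in> L2 MQ"
  using swapf_integrable_iff[of "\<lambda>p. (swapf w p)\<^sup>2"] swapf_measurable'[of w] by (simp add: L2_def swapf_def[abs_def])

lemma swapf_integral: "w \<in> borel_measurable MQ \<Longrightarrow> integral\<^sup>L (MX \<Otimes>\<^sub>M MT) (swapf w) = integral\<^sup>L MQ w"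
  using TX.integral_product_swap[of w] by (simp add: swapf_def[abs_def] MQ_def case_prod_unfold)

lemma prim_x_eq: "prim_x w = swapf (PX.prim (swapf w))"
  by (simp add: fun_eq_iff prim_x_def PX.prim_def swapf_def)

lemma prim_t_L2: "w \<in> L2 MQ \<Longrightarrow> prim_t w \<in> L2 MQ"
  unfolding prim_t_eq MQ_def by (rule PT.prim_L2)

lemma prim_x_L2: "w \<in> L2 MQ \<Longrightarrow> prim_x w \<in> L2 MQ"
  unfolding prim_x_eq by (intro swapf_L2' PX.prim_L2 swapf_L2)

lemma L2_snd: "w0 \<in> L2 MX \<Longrightarrow> (\<lambda>p. w0 (snd p)) \<in> L2 MQ"
  using TX.integrable_pair_mult[of "\<lambda>_. 1" "\<lambda>x. (w0 x)\<^sup>2"]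
  by (auto simp: L2_def MQ_def)

lemma L2_snd_D: assumes "(\<lambda>p. w0 (snd p)) \<in> L2 MQ" "w0 \<in> borel_measurable MX" shows "w0 \<in> L2 MX"
proof -
  have "integrable (MT \<Otimes>\<^sub>M MX) (\<lambda>(t, x). (w0 x)\<^sup>2)"
    using L2_square[OF assms(1)] by (simp add: MQ_def case_prod_unfold)
  from TX.AE_integrable_fst[OF this] have "integrable MX (\<lambda>x. (w0 x)\<^sup>2)" by (rule AE_MT_const)
  with assms(2) show ?thesis by (simp add: L2_def)
qed

lemma integral_MQ_product:
  fixes f g :: "real \<Rightarrow> real"
  assumes "integrable MT f" "integrable MX g"
  shows "(\<integral>p. f (fst p) * g (snd p) \<partial>MQ) = (\<integral>t. f t \<partial>MT) * (\<integral>x. g x \<partial>MX)"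
  using TX.integral_fst'[OF TX.integrable_pair_mult[OF assms]] by (simp add: MQ_def)

lemma smooth_integrable_MT: "smooth g \<Longrightarrow> integrable MT g"
  using smooth_bounded_interval[of g 0 T] smooth_MT[of g]
  by (auto intro!: KT.fm.integrable_const_bound AE_I2)

lemma smooth_integrable_MX: "smooth g \<Longrightarrow> integrable MX g"
  using smooth_bounded_interval[of g a b] smooth_MX[of g]
  by (auto intro!: KX.fm.integrable_const_bound AE_I2)

lemma integral_MT_deriv: "smooth g \<Longrightarrow> (\<integral>t. deriv g t \<partial>MT) = g T - g 0"
  unfolding MT_def using T by (intro integral_space_measure smoothD smooth_continuous) auto

lemma integral_MX_deriv: "smooth g \<Longrightarrow> (\<integral>t. deriv g t \<partial>MX) = g b - g a"
  unfolding MX_def using ab by (intro integral_space_measure smoothD smooth_continuous) auto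

lemma prim_t_by_parts:
  assumes w: "w \<in> L2 MQ" and \<gamma>: "smooth \<gamma>" and \<beta>: "smooth \<beta>"
  shows "(\<integral>p. prim_t w p * (deriv \<gamma> (fst p) * \<beta> (snd p)) \<partial>MQ) =
    (\<integral>p. w p * ((\<gamma> T - \<gamma> (fst p)) * \<beta> (snd p)) \<partial>MQ)"
proof -
  obtain B where "\<forall>x\<in>{a..b}. \<bar>\<beta> x\<bar> \<le> B" using smooth_bounded_interval[OF \<beta>] by blast
  then show ?thesis using PT.prim_by_parts[of w \<gamma> \<beta> B] w \<gamma> smooth_MX[OF \<beta>] unfolding prim_t_eq MQ_def by auto
qed

lemma prim_x_by_parts:
  assumes w: "w \<in> L2 MQ" and \<alpha>: "smooth \<alpha>" and \<gamma>: "smooth \<gamma>"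
  shows "(\<integral>p. prim_x w p * (\<alpha> (fst p) * deriv \<gamma> (snd p)) \<partial>MQ) =
    (\<integral>p. w p * (\<alpha> (fst p) * (\<gamma> b - \<gamma> (snd p))) \<partial>MQ)"
proof -
  obtain B where B: "\<forall>x\<in>{0..T}. \<bar>\<alpha> x\<bar> \<le> B" using smooth_bounded_interval[OF \<alpha>] by blast
  have 1: "(\<integral>p. PX.prim (swapf w) p * (deriv \<gamma> (fst p) * \<alpha> (snd p)) \<partial>(MX \<Otimes>\<^sub>M MT)) =
    (\<integral>p. swapf w p * ((\<gamma> b - \<gamma> (fst p)) * \<alpha> (snd p)) \<partial>(MX \<Otimes>\<^sub>M MT))"
    using B by (intro PX.prim_by_parts[where B=B] swapf_L2 w \<gamma> smooth_MT \<alpha>) auto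
  have 2: "(\<lambda>p. prim_x w p * (\<alpha> (fst p) * deriv \<gamma> (snd p))) \<in> borel_measurable MQ"
    "(\<lambda>p. w p * (\<alpha> (fst p) * (\<gamma> b - \<gamma> (snd p)))) \<in> borel_measurable MQ"
    using L2_product_test[OF prim_x_L2[OF w] \<alpha> smoothD(2)[OF \<gamma>]]
      L2_product_test[OF w \<alpha>, of "\<lambda>x. \<gamma> b - \<gamma> x"] \<gamma>
    by (auto simp: L2_def smooth_intros)
  have 3: "swapf (\<lambda>p. prim_x w p * (\<alpha> (fst p) * deriv \<gamma> (snd p))) = (\<lambda>p. PX.prim (swapf w) p * (deriv \<gamma> (fst p) * \<alpha> (snd p)))"
    "swapf (\<lambda>p. w p * (\<alpha> (fst p) * (\<gamma> b - \<gamma> (snd p)))) = (\<lambda>p. swapf w p * ((\<gamma> b - \<gamma> (fst p)) * \<alpha> (snd p)))"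
    by (auto simp: prim_x_eq swapf_def fun_eq_iff)
  show ?thesis using 1 swapf_integral[OF 2(1)] swapf_integral[OF 2(2)] unfolding 3 by simp
qed

section \<open>Representation of weakly differentiable functions\<close>

text \<open>A periodic function has a periodic primitive exactly when its mean over a period
  vanishes, so the mean \<open>m\<close> is subtracted first.\<close>

lemma periodic_antiderivative:
  assumes \<beta>: "periodic_smooth \<beta>"
  defines "m \<equiv> (\<integral>x. \<beta> x \<partial>MX) / (b - a)"
  obtains \<gamma> where "periodic_smooth \<gamma>" "deriv \<gamma> = (\<lambda>x. \<beta> x - m)"
proof -
  obtain B where B: "\<And>x. (B has_real_derivative \<beta> x) (at x)"
    using continuous_antiderivative[OF smooth_continuous[OF periodic_smooth_smooth[OF \<beta>]]] by blast
  have Bs: "smooth B" using B periodic_smooth_smooth[OF \<beta>] by (rule smoothI)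
  have per: "\<beta> (x + (b - a)) = \<beta> x" for x using \<beta> by (simp add: periodic_smooth_def)
  have "((\<lambda>x. B (x - - (b - a)) / 1 - B x) has_real_derivative \<beta> (x - - (b - a)) / 1 - \<beta> x) (at x)" for x
    by (rule DERIV_diff[OF has_real_derivative_shift(1)[OF B] B])
  then have "((\<lambda>x. B (x + (b - a)) - B x) has_real_derivative 0) (at x)" for x
    unfolding diff_minus_eq_add div_by_1 per by simp
  then have "B (x + (b - a)) - B x = B (a + (b - a)) - B a" for x
    by (rule DERIV_isconst_all[rule_format])
  then have D: "B (x + (b - a)) - B x = B b - B a" for x by simp
  have "B b - B a = (\<integral>x. \<beta> x \<partial>MX)"
    unfolding MX_def using ab
    by (intro integral_space_measure[symmetric] B smooth_continuous periodic_smooth_smooth \<beta>) auto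
  moreover have "m * (b - a) = (\<integral>x. \<beta> x \<partial>MX)" using ab by (simp add: m_def)
  ultimately have shift: "B (x + (b - a)) = B x + m * (b - a)" for x
    using D[of x] by linarith
  show ?thesis
  proof (rule that[of "\<lambda>x. B x - m * x"])
    show "periodic_smooth (\<lambda>x. B x - m * x)"
      unfolding periodic_smooth_def using Bs shift by (auto intro!: smooth_intros simp: algebra_simps)
    show "deriv (\<lambda>x. B x - m * x) = (\<lambda>x. \<beta> x - m)"
    proof (rule ext, rule DERIV_imp_deriv)
      fix x show "((\<lambda>x. B x - m * x) has_real_derivative \<beta> x - m) (at x)"
        using DERIV_diff[OF B DERIV_cmult_Id] by simp
    qed
  qed
qed

text \<open>Subtracting the integral of \<open>\<alpha>\<close> times a fixed unit bump leaves a
  function of integral zero. Its primitive, normalised to vanish before the support, then vanishes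
  after it as well.\<close>

lemma test_t_antiderivative:
  assumes \<alpha>: "test_t \<alpha>"
  obtains \<gamma> where "test_t \<gamma>" "deriv \<gamma> = (\<lambda>t. \<alpha> t - (\<integral>t. \<alpha> t \<partial>MT) * unit_bump (T / 3) (2 * T / 3) t)"
proof -
  obtain s r where sr: "smooth \<alpha>" "0 < s" "r < T" "\<And>t. t \<notin> {s..r} \<Longrightarrow> \<alpha> t = 0"
    using \<alpha> by (auto simp: test_t_def)
  obtain A where A: "\<And>x. (A has_real_derivative \<alpha> x) (at x)"
    using continuous_antiderivative[OF smooth_continuous[OF sr(1)]] by blast
  have As: "smooth A" using A sr(1) by (rule smoothI)
  let ?\<rho> = "unit_bump (T / 3) (2 * T / 3)"
  have "T / 3 < 2 * T / 3" using T by simp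
  then obtain G where G: "\<And>x. (G has_real_derivative ?\<rho> x) (at x)"
    "\<And>x. x \<le> T / 3 \<Longrightarrow> G x = 0" "\<And>x. 2 * T / 3 \<le> x \<Longrightarrow> G x = 1"
    using unit_bump_antiderivative by metis
  have Gs: "smooth G" using G(1) smooth_unit_bump by (rule smoothI)
  let ?m = "\<integral>t. \<alpha> t \<partial>MT"
  have m: "A T - A 0 = ?m"
    unfolding MT_def using T by (intro integral_space_measure[symmetric] A smooth_continuous sr) auto
  have "\<exists>c. \<forall>x\<in>{..<s}. A x = c"
  proof (rule has_field_derivative_zero_constant)
    fix x assume "x \<in> {..<s}"
    then have "\<alpha> x = 0" using sr(4)[of x] by simp
    then show "(A has_real_derivative 0) (at x within {..<s})"
      using has_field_derivative_at_within[OF A[of x]] by simp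
  qed simp
  then have low: "A t = A 0" if "t < s" for t using that sr(2) by fastforce
  have "\<exists>c. \<forall>x\<in>{r<..}. A x = c"
  proof (rule has_field_derivative_zero_constant)
    fix x assume "x \<in> {r<..}"
    then have "\<alpha> x = 0" using sr(4)[of x] by simp
    then show "(A has_real_derivative 0) (at x within {r<..})"
      using has_field_derivative_at_within[OF A[of x]] by simp
  qed simp
  then have up: "A t = A T" if "r < t" for t using that sr(3) by fastforce
  show ?thesis
  proof (rule that[of "\<lambda>t. A t - A 0 - ?m * G t"])
    show "test_t (\<lambda>t. A t - A 0 - ?m * G t)" unfolding test_t_def
    proof (rule conjI, intro smooth_intros As Gs, rule exI[of _ "min s (T / 3)"], rule exI[of _ "max r (2 * T / 3)"],
        intro conjI allI impI)
      fix t assume "t \<notin> {min s (T / 3)..max r (2 * T / 3)}"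
      then consider "t < s" "t \<le> T / 3" | "r < t" "2 * T / 3 \<le> t" by fastforce
      then show "A t - A 0 - ?m * G t = 0"
        by cases (simp_all add: low G(2) up G(3) m)
    qed (use sr T in auto)
    show "deriv (\<lambda>t. A t - A 0 - ?m * G t) = (\<lambda>t. \<alpha> t - ?m * ?\<rho> t)"
    proof (rule ext, rule DERIV_imp_deriv)
      fix t show "((\<lambda>t. A t - A 0 - ?m * G t) has_real_derivative \<alpha> t - ?m * ?\<rho> t) (at t)"
        using DERIV_diff[OF DERIV_diff[OF A DERIV_const] DERIV_cmult[OF G(1)]] by simp
    qed
  qed
qed

text \<open>By \<open>prim_t_by_parts\<close> the difference \<open>z\<close> of \<open>w\<close>
  and \<open>prim_t w'\<close> has zero time derivative. Testing with the primitives from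
  \<open>test_t_antiderivative\<close> shows that the pairing of \<open>z\<close> with a product
  depends on \<open>\<alpha>\<close> only through its integral. So \<open>z\<close> is a function of
  \<open>x\<close>, recovered by averaging against the unit bump.\<close>

lemma time_representation:
  assumes w: "w \<in> L2 MQ" "w' \<in> L2 MQ" and weak: "weak 1 0 w w'"
  obtains w0 where "w0 \<in> L2 MX" "AE p in MQ. w p = w0 (snd p) + prim_t w' p"
proof -
  define z where "z = (\<lambda>p. w p - prim_t w' p)"
  have z: "z \<in> L2 MQ" unfolding z_def by (intro L2_diff w prim_t_L2)
  have z0: "(\<integral>p. z p * (deriv \<alpha> (fst p) * \<beta> (snd p)) \<partial>MQ) = 0" if t: "test_t \<alpha>" "periodic_smooth \<beta>" for \<alpha> \<beta>
  proof -
    have s: "smooth \<alpha>" "smooth (deriv \<alpha>)" "smooth \<beta>" using t by (auto intro: test_t_smooth smoothD periodic_smooth_smooth)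
    have i: "integrable MQ (\<lambda>p. w p * (deriv \<alpha> (fst p) * \<beta> (snd p)))" "integrable MQ (\<lambda>p. prim_t w' p * (deriv \<alpha> (fst p) * \<beta> (snd p)))"
      by (intro KQ.fm.L2_integrable L2_product_test w prim_t_L2 s)+
    have "(\<integral>p. z p * (deriv \<alpha> (fst p) * \<beta> (snd p)) \<partial>MQ) =
      (\<integral>p. w p * (deriv \<alpha> (fst p) * \<beta> (snd p)) \<partial>MQ) - (\<integral>p. prim_t w' p * (deriv \<alpha> (fst p) * \<beta> (snd p)) \<partial>MQ)"
      using i by (simp add: z_def left_diff_distrib)
    also have "\<dots> = 0"
      using weak[unfolded weak_def, rule_format, OF t] test_t0_T[OF test_t_imp_t0[OF t(1)]]
      by (subst prim_t_by_parts[OF w(2) s(1,3)]) simp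
    finally show ?thesis .
  qed
  let ?\<rho> = "unit_bump (T / 3) (2 * T / 3)"
  have \<rho>s: "smooth ?\<rho>" by (rule smooth_unit_bump)
  define w0 where "w0 = (\<lambda>x. \<integral>t. z (t, x) * ?\<rho> t \<partial>MT)"
  have zi: "integrable (MT \<Otimes>\<^sub>M MX) (\<lambda>(t, x). z (t, x) * ?\<rho> t)"
    using KQ.fm.L2_integrable[OF L2_product_test[OF z \<rho>s smooth_const[of 1]]] by (simp add: MQ_def case_prod_unfold)
  have w0i: "integrable MX w0" unfolding w0_def using TX.integrable_snd[OF zi] by simp
  then have w0m: "w0 \<in> borel_measurable MX" by auto
  have w0Q: "integrable MQ (\<lambda>p. w0 (snd p))"
    using TX.integrable_pair_mult[OF _ w0i, of "\<lambda>_. 1"] by (simp add: MQ_def)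
  have zw: "AE p in MQ. z p = w0 (snd p)"
  proof -
    have "AE p in MQ. z p - w0 (snd p) = 0"
    proof (rule fundamental_lemma)
      show "locally_integrable (\<lambda>p. z p - w0 (snd p))"
        by (intro locally_integrable_diff L2_locally_integrable[OF z] integrable_locally_integrable w0Q)
      fix \<alpha> \<beta> assume t: "test_t \<alpha>" "periodic_smooth \<beta>"
      have s: "smooth \<alpha>" "smooth \<beta>" using t by (auto intro: test_t_smooth periodic_smooth_smooth)
      let ?m = "\<integral>t. \<alpha> t \<partial>MT"
      obtain \<gamma> where \<gamma>: "test_t \<gamma>" "deriv \<gamma> = (\<lambda>t. \<alpha> t - ?m * ?\<rho> t)"
        using test_t_antiderivative[OF t(1)] .
      have i: "integrable MQ (\<lambda>p. z p * (\<alpha> (fst p) * \<beta> (snd p)))" "integrable MQ (\<lambda>p. z p * (?\<rho> (fst p) * \<beta> (snd p)))"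
        by (intro KQ.fm.L2_integrable L2_product_test z s \<rho>s)+
      have iw: "integrable MQ (\<lambda>p. w0 (snd p) * (\<alpha> (fst p) * \<beta> (snd p)))"
        by (rule integrable_product_test[OF w0Q s])
      have i\<beta>: "integrable MX (\<lambda>x. w0 x * \<beta> x)"
      proof -
        obtain B where B: "\<forall>x\<in>{a..b}. \<bar>\<beta> x\<bar> \<le> B" using smooth_bounded_interval[OF s(2)] by blast
        show ?thesis by (rule integrable_bounded_mult(2)[OF w0i smooth_MX[OF s(2)], of B]) (use B in \<open>auto intro!: AE_I2\<close>)
      qed
      have 1: "(\<integral>p. z p * (\<alpha> (fst p) * \<beta> (snd p)) \<partial>MQ) = ?m * (\<integral>p. z p * (?\<rho> (fst p) * \<beta> (snd p)) \<partial>MQ)"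
      proof -
        have "(\<integral>p. z p * (\<alpha> (fst p) * \<beta> (snd p)) - ?m * (z p * (?\<rho> (fst p) * \<beta> (snd p))) \<partial>MQ) = 0"
          using z0[OF \<gamma>(1) t(2)] unfolding \<gamma>(2) by (simp add: algebra_simps)
        then show ?thesis using i by simp
      qed
      have "(\<integral>p. z p * (?\<rho> (fst p) * \<beta> (snd p)) \<partial>MQ) = (\<integral>x. \<integral>t. z (t, x) * (?\<rho> t * \<beta> x) \<partial>MT \<partial>MX)"
        using TX.integral_snd[of "\<lambda>t x. z (t, x) * (?\<rho> t * \<beta> x)"] i(2) by (simp add: MQ_def case_prod_unfold)
      also have "\<dots> = (\<integral>x. w0 x * \<beta> x \<partial>MX)" unfolding w0_def
        by (intro Bochner_Integration.integral_cong refl) (simp add: mult.assoc[symmetric])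
      finally have 2: "(\<integral>p. z p * (?\<rho> (fst p) * \<beta> (snd p)) \<partial>MQ) = (\<integral>x. w0 x * \<beta> x \<partial>MX)" .
      have 3: "(\<integral>p. w0 (snd p) * (\<alpha> (fst p) * \<beta> (snd p)) \<partial>MQ) = ?m * (\<integral>x. w0 x * \<beta> x \<partial>MX)"
        using integral_MQ_product[OF smooth_integrable_MT[OF s(1)] i\<beta>] by (simp add: mult_ac)
      show "(\<integral>p. (z p - w0 (snd p)) * (\<alpha> (fst p) * \<beta> (snd p)) \<partial>MQ) = 0"
        using i iw 1 2 3 by (simp add: left_diff_distrib)
    qed
    then show ?thesis by eventually_elim simp
  qed
  have "(\<lambda>p. w0 (snd p)) \<in> L2 MQ" using w0Q zw by (intro L2_AE_cong[OF z]) auto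
  then have "w0 \<in> L2 MX" using w0m by (rule L2_snd_D)
  moreover have "AE p in MQ. w p = w0 (snd p) + prim_t w' p"
    using zw by eventually_elim (simp add: z_def)
  ultimately show ?thesis by (rule that)
qed

text \<open>The argument in time has one addition here. Constants in \<open>x\<close> are admissible
  tests, so the integral of \<open>w'\<close> over a period vanishes for almost every
  \<open>t\<close>, which removes the boundary value \<open>\<beta> b\<close> left by integration by
  parts.\<close>

lemma space_representation:
  assumes w: "w \<in> L2 MQ" "w' \<in> L2 MQ" and weak: "weak 0 1 w w'"
  obtains c where "integrable MT c" "AE p in MQ. w p = c (fst p) + prim_x w' p"
    "AE t in MT. (\<integral>x. w' (t, x) \<partial>MX) = 0"
proof -
  have w'i: "integrable (MT \<Otimes>\<^sub>M MX) (\<lambda>(t, x). w' (t, x))" using KQ.fm.L2_integrable[OF w(2)] by (simp add: MQ_def)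
  define v where "v = (\<lambda>t. \<integral>x. w' (t, x) \<partial>MX)"
  have vi: "integrable MT v" unfolding v_def using TX.integrable_fst[OF w'i] by simp
  have vQ: "integrable MQ (\<lambda>p. v (fst p))"
    using TX.integrable_pair_mult[OF vi, of "\<lambda>_. 1"] by (simp add: MQ_def)
  have w'0: "(\<integral>p. w' p * \<alpha> (fst p) \<partial>MQ) = 0" if t: "test_t \<alpha>" for \<alpha>
    using weak[unfolded weak_def, rule_format, OF t periodic_smooth_const[of 1]] by simp
  have v0: "AE t in MT. v t = 0"
  proof (rule AE_MQ_fst, rule fundamental_lemma[OF integrable_locally_integrable[OF vQ]])
    fix \<alpha> \<beta> assume t: "test_t \<alpha>" "periodic_smooth \<beta>"
    have s: "smooth \<alpha>" "smooth \<beta>" using t by (auto intro: test_t_smooth periodic_smooth_smooth)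
    obtain B where B: "\<forall>x\<in>{0..T}. \<bar>\<alpha> x\<bar> \<le> B" using smooth_bounded_interval[OF s(1)] by blast
    have va: "integrable MT (\<lambda>t. v t * \<alpha> t)"
      by (rule integrable_bounded_mult(2)[OF vi smooth_MT[OF s(1)], of B]) (use B in \<open>auto intro!: AE_I2\<close>)
    have "(\<integral>t. v t * \<alpha> t \<partial>MT) = (\<integral>t. \<integral>x. w' (t, x) * \<alpha> t \<partial>MX \<partial>MT)" by (simp add: v_def)
    also have "\<dots> = (\<integral>p. w' p * \<alpha> (fst p) \<partial>MQ)"
      using TX.integral_fst[of "\<lambda>t x. w' (t, x) * \<alpha> t"] KQ.fm.L2_integrable[OF L2_product_test[OF w(2) s(1) smooth_const[of 1]]]
      by (simp add: MQ_def case_prod_unfold)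
    finally have "(\<integral>t. v t * \<alpha> t \<partial>MT) = 0" using w'0[OF t(1)] by simp
    then show "(\<integral>p. v (fst p) * (\<alpha> (fst p) * \<beta> (snd p)) \<partial>MQ) = 0"
      using integral_MQ_product[OF va smooth_integrable_MX[OF s(2)]] by (simp add: mult.assoc)
  qed
  define z where "z = (\<lambda>p. w p - prim_x w' p)"
  have z: "z \<in> L2 MQ" unfolding z_def by (intro L2_diff w prim_x_L2)
  have z0: "(\<integral>p. z p * (\<alpha> (fst p) * deriv \<beta> (snd p)) \<partial>MQ) = 0" if t: "test_t \<alpha>" "periodic_smooth \<beta>" for \<alpha> \<beta>
  proof -
    have s: "smooth \<alpha>" "smooth (deriv \<beta>)" "smooth \<beta>" using t by (auto intro: test_t_smooth smoothD periodic_smooth_smooth)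
    have i: "integrable MQ (\<lambda>p. w p * (\<alpha> (fst p) * deriv \<beta> (snd p)))" "integrable MQ (\<lambda>p. prim_x w' p * (\<alpha> (fst p) * deriv \<beta> (snd p)))"
      "integrable MQ (\<lambda>p. w' p * (\<alpha> (fst p) * \<beta> (snd p)))" "integrable MQ (\<lambda>p. w' p * \<alpha> (fst p))"
      using KQ.fm.L2_integrable[OF L2_product_test[OF w(2) s(1) smooth_const[of 1]]]
      by (auto intro!: KQ.fm.L2_integrable L2_product_test w prim_x_L2 s)
    have "(\<integral>p. z p * (\<alpha> (fst p) * deriv \<beta> (snd p)) \<partial>MQ) =
      (\<integral>p. w p * (\<alpha> (fst p) * deriv \<beta> (snd p)) \<partial>MQ) - (\<integral>p. prim_x w' p * (\<alpha> (fst p) * deriv \<beta> (snd p)) \<partial>MQ)"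
      using i by (simp add: z_def left_diff_distrib)
    also have "(\<integral>p. prim_x w' p * (\<alpha> (fst p) * deriv \<beta> (snd p)) \<partial>MQ) =
      (\<integral>p. \<beta> b * (w' p * \<alpha> (fst p)) - w' p * (\<alpha> (fst p) * \<beta> (snd p)) \<partial>MQ)"
      by (subst prim_x_by_parts[OF w(2) s(1,3)]) (simp add: algebra_simps)
    also have "\<dots> = - (\<integral>p. w' p * (\<alpha> (fst p) * \<beta> (snd p)) \<partial>MQ)"
      using i w'0[OF t(1)] by simp
    also have "(\<integral>p. w p * (\<alpha> (fst p) * deriv \<beta> (snd p)) \<partial>MQ) = - (\<integral>p. w' p * (\<alpha> (fst p) * \<beta> (snd p)) \<partial>MQ)"
      using weak[unfolded weak_def, rule_format, OF t] by simp
    finally show ?thesis by simp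
  qed
  define c where "c = (\<lambda>t. (\<integral>x. z (t, x) \<partial>MX) / (b - a))"
  have zi: "integrable (MT \<Otimes>\<^sub>M MX) (\<lambda>(t, x). z (t, x))" using KQ.fm.L2_integrable[OF z] by (simp add: MQ_def)
  have ci: "integrable MT c" unfolding c_def using TX.integrable_fst[OF zi] by simp
  have cQ: "integrable MQ (\<lambda>p. c (fst p))"
    using TX.integrable_pair_mult[OF ci, of "\<lambda>_. 1"] by (simp add: MQ_def)
  have "AE p in MQ. z p - c (fst p) = 0"
  proof (rule fundamental_lemma)
    show "locally_integrable (\<lambda>p. z p - c (fst p))"
      by (intro locally_integrable_diff L2_locally_integrable[OF z] integrable_locally_integrable cQ)
    fix \<alpha> \<beta> assume t: "test_t \<alpha>" "periodic_smooth \<beta>"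
    have s: "smooth \<alpha>" "smooth \<beta>" using t by (auto intro: test_t_smooth periodic_smooth_smooth)
    let ?m = "(\<integral>x. \<beta> x \<partial>MX) / (b - a)"
    obtain \<gamma> where \<gamma>: "periodic_smooth \<gamma>" "deriv \<gamma> = (\<lambda>x. \<beta> x - ?m)"
      using periodic_antiderivative[OF t(2)] .
    have i: "integrable MQ (\<lambda>p. z p * (\<alpha> (fst p) * \<beta> (snd p)))" "integrable MQ (\<lambda>p. z p * \<alpha> (fst p))"
      using KQ.fm.L2_integrable[OF L2_product_test[OF z s(1) smooth_const[of 1]]]
      by (auto intro!: KQ.fm.L2_integrable L2_product_test z s)
    have ic: "integrable MQ (\<lambda>p. c (fst p) * (\<alpha> (fst p) * \<beta> (snd p)))"
      by (rule integrable_product_test[OF cQ s])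
    obtain B where B: "\<forall>x\<in>{0..T}. \<bar>\<alpha> x\<bar> \<le> B" using smooth_bounded_interval[OF s(1)] by blast
    have ca: "integrable MT (\<lambda>t. c t * \<alpha> t)"
      by (rule integrable_bounded_mult(2)[OF ci smooth_MT[OF s(1)], of B]) (use B in \<open>auto intro!: AE_I2\<close>)
    have 1: "(\<integral>p. z p * (\<alpha> (fst p) * \<beta> (snd p)) \<partial>MQ) = ?m * (\<integral>p. z p * \<alpha> (fst p) \<partial>MQ)"
    proof -
      have "(\<integral>p. z p * (\<alpha> (fst p) * \<beta> (snd p)) - ?m * (z p * \<alpha> (fst p)) \<partial>MQ) = 0"
        using z0[OF t(1) \<gamma>(1)] unfolding \<gamma>(2) by (simp add: algebra_simps)
      then show ?thesis using i by simp
    qed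
    have "(\<integral>p. z p * \<alpha> (fst p) \<partial>MQ) = (\<integral>t. \<integral>x. z (t, x) * \<alpha> t \<partial>MX \<partial>MT)"
      using TX.integral_fst[of "\<lambda>t x. z (t, x) * \<alpha> t"] i(2) by (simp add: MQ_def case_prod_unfold)
    also have "\<dots> = (\<integral>t. (b - a) * (c t * \<alpha> t) \<partial>MT)"
      using ab by (intro Bochner_Integration.integral_cong refl) (simp add: c_def)
    finally have 2: "(\<integral>p. z p * \<alpha> (fst p) \<partial>MQ) = (b - a) * (\<integral>t. c t * \<alpha> t \<partial>MT)" by simp
    have 3: "(\<integral>p. c (fst p) * (\<alpha> (fst p) * \<beta> (snd p)) \<partial>MQ) = (\<integral>t. c t * \<alpha> t \<partial>MT) * (\<integral>x. \<beta> x \<partial>MX)"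
      using integral_MQ_product[OF ca smooth_integrable_MX[OF s(2)]] by (simp add: mult.assoc)
    have "?m * ((b - a) * (\<integral>t. c t * \<alpha> t \<partial>MT)) = (\<integral>t. c t * \<alpha> t \<partial>MT) * (\<integral>x. \<beta> x \<partial>MX)"
      using ab by simp
    then have "(\<integral>p. z p * (\<alpha> (fst p) * \<beta> (snd p)) \<partial>MQ) = (\<integral>p. c (fst p) * (\<alpha> (fst p) * \<beta> (snd p)) \<partial>MQ)"
      unfolding 1 2 3 .
    then show "(\<integral>p. (z p - c (fst p)) * (\<alpha> (fst p) * \<beta> (snd p)) \<partial>MQ) = 0"
      using i ic by (simp add: left_diff_distrib)
  qed
  then have "AE p in MQ. w p = c (fst p) + prim_x w' p" by eventually_elim (simp add: z_def)
  with ci show ?thesis using v0 unfolding v_def by (rule that)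
qed

section \<open>Weak balance laws\<close>

text \<open>\<open>\<partial>\<^sub>t A + \<partial>\<^sub>x B = C\<close> with initial value \<open>A = g\<close> at \<open>t = 0\<close>.\<close>

definition weak_form ::
    "(real \<times> real \<Rightarrow> real) \<Rightarrow> (real \<times> real \<Rightarrow> real) \<Rightarrow> (real \<times> real \<Rightarrow> real) \<Rightarrow> (real \<Rightarrow> real) \<Rightarrow> bool" where
  "weak_form A B C g \<longleftrightarrow> A \<in> L2 MQ \<and> B \<in> L2 MQ \<and> C \<in> L2 MQ \<and> g \<in> L2 MX \<and>
    (\<forall>\<alpha> \<beta>. test_t0 \<alpha> \<longrightarrow> periodic_smooth \<beta> \<longrightarrow>
      (\<integral>p. A p * (deriv \<alpha> (fst p) * \<beta> (snd p)) \<partial>MQ) + (\<integral>p. B p * (\<alpha> (fst p) * deriv \<beta> (snd p)) \<partial>MQ) +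
      (\<integral>p. C p * (\<alpha> (fst p) * \<beta> (snd p)) \<partial>MQ) + \<alpha> 0 * (\<integral>x. g x * \<beta> x \<partial>MX) = 0)"

text \<open>The last condition identifies \<open>w0\<close> as the value of \<open>w\<close> at time
  0 without choosing a continuous representative. Only first derivatives are recorded, so the notion
  still covers u_ttx.\<close>

definition H1 ::
    "(real \<times> real \<Rightarrow> real) \<Rightarrow> (real \<times> real \<Rightarrow> real) \<Rightarrow> (real \<times> real \<Rightarrow> real) \<Rightarrow> (real \<Rightarrow> real) \<Rightarrow> bool" where
  "H1 w wt wx w0 \<longleftrightarrow> w \<in> L2 MQ \<and> wt \<in> L2 MQ \<and> wx \<in> L2 MQ \<and> w0 \<in> L2 MX \<and>
    weak 1 0 w wt \<and> weak 0 1 w wx \<and> (AE p in MQ. w p = w0 (snd p) + prim_t wt p)"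

lemma zero_L2: "(\<lambda>_. 0) \<in> L2 M" by (simp add: L2_def)

text \<open>Here \<open>\<alpha>\<close> need not vanish at \<open>t = 0\<close>, so the definition
  of \<open>weak\<close> does not suffice. Integrating the representation by parts,
  \<open>\<alpha> T = 0\<close> removes the final boundary term and \<open>w0\<close> yields the
  initial one.\<close>

lemma H1_weak_form_time:
  assumes "H1 w wt wx w0"
  shows "weak_form w (\<lambda>_. 0) wt w0"
  unfolding weak_form_def
proof (intro conjI allI impI)
  have w: "w \<in> L2 MQ" "wt \<in> L2 MQ" "w0 \<in> L2 MX" "AE p in MQ. w p = w0 (snd p) + prim_t wt p"
    using assms by (auto simp: H1_def)
  show "w \<in> L2 MQ" "wt \<in> L2 MQ" "w0 \<in> L2 MX" "(\<lambda>_. 0) \<in> L2 MQ" using w zero_L2 by auto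
  fix \<alpha> \<beta> assume t: "test_t0 \<alpha>" "periodic_smooth \<beta>"
  have s: "smooth \<alpha>" "smooth \<beta>" "smooth (deriv \<alpha>)" using t by (auto intro: test_t0_smooth periodic_smooth_smooth smoothD)
  have w0Q: "(\<lambda>p. w0 (snd p)) \<in> L2 MQ" by (rule L2_snd[OF w(3)])
  have i: "integrable MQ (\<lambda>p. w0 (snd p) * (deriv \<alpha> (fst p) * \<beta> (snd p)))"
    "integrable MQ (\<lambda>p. prim_t wt p * (deriv \<alpha> (fst p) * \<beta> (snd p)))"
    "integrable MQ (\<lambda>p. w p * (deriv \<alpha> (fst p) * \<beta> (snd p)))"
    by (intro KQ.fm.L2_integrable L2_product_test w w0Q prim_t_L2 s)+
  have "(\<integral>p. w p * (deriv \<alpha> (fst p) * \<beta> (snd p)) \<partial>MQ) =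
    (\<integral>p. w0 (snd p) * (deriv \<alpha> (fst p) * \<beta> (snd p)) + prim_t wt p * (deriv \<alpha> (fst p) * \<beta> (snd p)) \<partial>MQ)"
  proof (rule integral_cong_AE)
    show "AE p in MQ. w p * (deriv \<alpha> (fst p) * \<beta> (snd p)) =
      w0 (snd p) * (deriv \<alpha> (fst p) * \<beta> (snd p)) + prim_t wt p * (deriv \<alpha> (fst p) * \<beta> (snd p))"
      using w(4) by eventually_elim (simp add: distrib_right)
  qed (use i in auto)
  also have "\<dots> = (\<integral>p. w0 (snd p) * (deriv \<alpha> (fst p) * \<beta> (snd p)) \<partial>MQ) +
    (\<integral>p. prim_t wt p * (deriv \<alpha> (fst p) * \<beta> (snd p)) \<partial>MQ)"
    using i by simp
  also have "(\<integral>p. prim_t wt p * (deriv \<alpha> (fst p) * \<beta> (snd p)) \<partial>MQ) = - (\<integral>p. wt p * (\<alpha> (fst p) * \<beta> (snd p)) \<partial>MQ)"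
    by (subst prim_t_by_parts[OF w(2) s(1,2)]) (simp add: test_t0_T[OF t(1)])
  also have "(\<integral>p. w0 (snd p) * (deriv \<alpha> (fst p) * \<beta> (snd p)) \<partial>MQ) = - \<alpha> 0 * (\<integral>x. w0 x * \<beta> x \<partial>MX)"
  proof -
    have "(\<lambda>x. w0 x * \<beta> x) \<in> L2 MX"
    proof -
      obtain B where B: "\<forall>x\<in>{a..b}. \<bar>\<beta> x\<bar> \<le> B" using smooth_bounded_interval[OF s(2)] by blast
      show ?thesis by (rule L2_bounded_mult(2)[OF w(3) smooth_MX[OF s(2)], of B]) (use B in \<open>auto intro!: AE_I2\<close>)
    qed
    from integral_MQ_product[OF smooth_integrable_MT[OF s(3)] KX.fm.L2_integrable[OF this]]
    show ?thesis by (simp add: integral_MT_deriv[OF s(1)] test_t0_T[OF t(1)] mult_ac)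
  qed
  finally show "(\<integral>p. w p * (deriv \<alpha> (fst p) * \<beta> (snd p)) \<partial>MQ) + (\<integral>p. 0 * (\<alpha> (fst p) * deriv \<beta> (snd p)) \<partial>MQ) +
      (\<integral>p. wt p * (\<alpha> (fst p) * \<beta> (snd p)) \<partial>MQ) + \<alpha> 0 * (\<integral>x. w0 x * \<beta> x \<partial>MX) = 0" by simp
qed

text \<open>\<open>weak\<close> allows only weights supported inside the time interval. The
  representation in \<open>x\<close> splits off a function of \<open>t\<close> alone, which pairs to
  0 with the derivative of a periodic function, so every smooth weight in time becomes
  admissible.\<close>

lemma weak_space_all:
  assumes w: "w \<in> L2 MQ" "wx \<in> L2 MQ" "weak 0 1 w wx" and \<alpha>: "smooth \<alpha>" and \<beta>: "periodic_smooth \<beta>"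
  shows "(\<integral>p. w p * (\<alpha> (fst p) * deriv \<beta> (snd p)) \<partial>MQ) = - (\<integral>p. wx p * (\<alpha> (fst p) * \<beta> (snd p)) \<partial>MQ)"
proof -
  obtain c where c: "integrable MT c" "AE p in MQ. w p = c (fst p) + prim_x wx p"
    "AE t in MT. (\<integral>x. wx (t, x) \<partial>MX) = 0" using space_representation[OF w] by metis
  have s: "smooth \<beta>" "smooth (deriv \<beta>)" using \<beta> by (auto intro: periodic_smooth_smooth smoothD)
  have cQ: "integrable MQ (\<lambda>p. c (fst p))"
    using TX.integrable_pair_mult[OF c(1), of "\<lambda>_. 1"] by (simp add: MQ_def)
  have i: "integrable MQ (\<lambda>p. w p * (\<alpha> (fst p) * deriv \<beta> (snd p)))" "integrable MQ (\<lambda>p. prim_x wx p * (\<alpha> (fst p) * deriv \<beta> (snd p)))"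
      "integrable MQ (\<lambda>p. wx p * (\<alpha> (fst p) * \<beta> (snd p)))" "integrable MQ (\<lambda>p. wx p * \<alpha> (fst p))"
    using KQ.fm.L2_integrable[OF L2_product_test[OF w(2) \<alpha> smooth_const[of 1]]]
    by (auto intro!: KQ.fm.L2_integrable L2_product_test w prim_x_L2 s \<alpha>)
  have ic: "integrable MQ (\<lambda>p. c (fst p) * (\<alpha> (fst p) * deriv \<beta> (snd p)))"
    by (rule integrable_product_test[OF cQ \<alpha> s(2)])
  have "(\<integral>p. w p * (\<alpha> (fst p) * deriv \<beta> (snd p)) \<partial>MQ) =
    (\<integral>p. c (fst p) * (\<alpha> (fst p) * deriv \<beta> (snd p)) + prim_x wx p * (\<alpha> (fst p) * deriv \<beta> (snd p)) \<partial>MQ)"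
  proof (rule integral_cong_AE)
    show "AE p in MQ. w p * (\<alpha> (fst p) * deriv \<beta> (snd p)) =
      c (fst p) * (\<alpha> (fst p) * deriv \<beta> (snd p)) + prim_x wx p * (\<alpha> (fst p) * deriv \<beta> (snd p))"
      using c(2) by eventually_elim (simp add: distrib_right)
  qed (use i ic in auto)
  also have "\<dots> = (\<integral>p. c (fst p) * (\<alpha> (fst p) * deriv \<beta> (snd p)) \<partial>MQ) + (\<integral>p. prim_x wx p * (\<alpha> (fst p) * deriv \<beta> (snd p)) \<partial>MQ)"
    using i ic by simp
  also have "(\<integral>p. c (fst p) * (\<alpha> (fst p) * deriv \<beta> (snd p)) \<partial>MQ) = 0"
  proof -
    obtain B where B: "\<forall>x\<in>{0..T}. \<bar>\<alpha> x\<bar> \<le> B" using smooth_bounded_interval[OF \<alpha>] by blast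
    have ca: "integrable MT (\<lambda>t. c t * \<alpha> t)"
      by (rule integrable_bounded_mult(2)[OF c(1) smooth_MT[OF \<alpha>], of B]) (use B in \<open>auto intro!: AE_I2\<close>)
    have "\<beta> b = \<beta> a" using \<beta>[unfolded periodic_smooth_def, THEN conjunct2, rule_format, of a] by simp
    then show ?thesis
      using integral_MQ_product[OF ca smooth_integrable_MX[OF s(2)]] integral_MX_deriv[OF s(1)] by (simp add: mult.assoc)
  qed
  also have "(\<integral>p. prim_x wx p * (\<alpha> (fst p) * deriv \<beta> (snd p)) \<partial>MQ) =
      (\<integral>p. \<beta> b * (wx p * \<alpha> (fst p)) - wx p * (\<alpha> (fst p) * \<beta> (snd p)) \<partial>MQ)"
    by (subst prim_x_by_parts[OF w(2) \<alpha> s(1)]) (simp add: algebra_simps)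
  also have "\<dots> = \<beta> b * (\<integral>p. wx p * \<alpha> (fst p) \<partial>MQ) - (\<integral>p. wx p * (\<alpha> (fst p) * \<beta> (snd p)) \<partial>MQ)"
    using i by simp
  also have "(\<integral>p. wx p * \<alpha> (fst p) \<partial>MQ) = 0"
  proof -
    have j: "integrable (MT \<Otimes>\<^sub>M MX) (\<lambda>(t, x). wx (t, x) * \<alpha> t)" using i(4) by (simp add: MQ_def case_prod_unfold)
    have "(\<integral>p. wx p * \<alpha> (fst p) \<partial>MQ) = (\<integral>t. \<integral>x. wx (t, x) * \<alpha> t \<partial>MX \<partial>MT)"
      using TX.integral_fst[OF j] by (simp add: MQ_def case_prod_unfold)
    also have "\<dots> = (\<integral>t. 0 \<partial>MT)"
      using TX.integrable_fst[OF j] c(3) by (intro integral_cong_AE) auto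
    finally show ?thesis by simp
  qed
  finally show ?thesis by simp
qed

lemma H1_weak_form_space:
  assumes "H1 w wt wx w0"
  shows "weak_form (\<lambda>_. 0) w wx (\<lambda>_. 0)"
  unfolding weak_form_def
proof (intro conjI allI impI)
  have w: "w \<in> L2 MQ" "wx \<in> L2 MQ" "weak 0 1 w wx" using assms by (auto simp: H1_def)
  show "w \<in> L2 MQ" "wx \<in> L2 MQ" "(\<lambda>_. 0) \<in> L2 MQ" "(\<lambda>_. 0) \<in> L2 MX" using w zero_L2 by auto
  fix \<alpha> \<beta> assume "test_t0 \<alpha>" "periodic_smooth \<beta>"
  from weak_space_all[OF w test_t0_smooth[OF this(1)] this(2)]
  show "(\<integral>p. 0 * (deriv \<alpha> (fst p) * \<beta> (snd p)) \<partial>MQ) + (\<integral>p. w p * (\<alpha> (fst p) * deriv \<beta> (snd p)) \<partial>MQ) +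
      (\<integral>p. wx p * (\<alpha> (fst p) * \<beta> (snd p)) \<partial>MQ) + \<alpha> 0 * (\<integral>x. 0 * \<beta> x \<partial>MX) = 0" by simp
qed

lemma weak_form_add:
  assumes "weak_form A B C g" "weak_form A' B' C' g'"
  shows "weak_form (\<lambda>p. A p + A' p) (\<lambda>p. B p + B' p) (\<lambda>p. C p + C' p) (\<lambda>x. g x + g' x)"
  unfolding weak_form_def
proof (intro conjI allI impI)
  note a = assms(1)[unfolded weak_form_def] note a' = assms(2)[unfolded weak_form_def]
  show "(\<lambda>p. A p + A' p) \<in> L2 MQ" "(\<lambda>p. B p + B' p) \<in> L2 MQ" "(\<lambda>p. C p + C' p) \<in> L2 MQ" "(\<lambda>x. g x + g' x) \<in> L2 MX"
    using a a' by (auto intro: L2_add)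
  fix \<alpha> \<beta> assume t: "test_t0 \<alpha>" "periodic_smooth \<beta>"
  have s: "smooth \<alpha>" "smooth \<beta>" "smooth (deriv \<alpha>)" "smooth (deriv \<beta>)"
    using t by (auto intro: test_t0_smooth periodic_smooth_smooth smoothD)
  have gi: "integrable MX (\<lambda>x. h x * \<beta> x)" if "h \<in> L2 MX" for h
  proof -
    obtain B where B: "\<forall>x\<in>{a..b}. \<bar>\<beta> x\<bar> \<le> B" using smooth_bounded_interval[OF s(2)] by blast
    show ?thesis by (rule integrable_bounded_mult(2)[OF KX.fm.L2_integrable[OF that] smooth_MX[OF s(2)], of B]) (use B in \<open>auto intro!: AE_I2\<close>)
  qed
  have i: "integrable MQ (\<lambda>p. h p * (\<alpha>' (fst p) * \<beta>' (snd p)))" if "h \<in> L2 MQ" "smooth \<alpha>'" "smooth \<beta>'" for h \<alpha>' \<beta>'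
    by (intro KQ.fm.L2_integrable L2_product_test that)
  from a a' have e: "(\<integral>p. A p * (deriv \<alpha> (fst p) * \<beta> (snd p)) \<partial>MQ) + (\<integral>p. B p * (\<alpha> (fst p) * deriv \<beta> (snd p)) \<partial>MQ) +
      (\<integral>p. C p * (\<alpha> (fst p) * \<beta> (snd p)) \<partial>MQ) + \<alpha> 0 * (\<integral>x. g x * \<beta> x \<partial>MX) = 0"
    "(\<integral>p. A' p * (deriv \<alpha> (fst p) * \<beta> (snd p)) \<partial>MQ) + (\<integral>p. B' p * (\<alpha> (fst p) * deriv \<beta> (snd p)) \<partial>MQ) +
      (\<integral>p. C' p * (\<alpha> (fst p) * \<beta> (snd p)) \<partial>MQ) + \<alpha> 0 * (\<integral>x. g' x * \<beta> x \<partial>MX) = 0"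
    using t by blast+
  show "(\<integral>p. (A p + A' p) * (deriv \<alpha> (fst p) * \<beta> (snd p)) \<partial>MQ) + (\<integral>p. (B p + B' p) * (\<alpha> (fst p) * deriv \<beta> (snd p)) \<partial>MQ) +
      (\<integral>p. (C p + C' p) * (\<alpha> (fst p) * \<beta> (snd p)) \<partial>MQ) + \<alpha> 0 * (\<integral>x. (g x + g' x) * \<beta> x \<partial>MX) = 0"
    using e a a' by (simp add: distrib_right distrib_left i s gi)
qed

lemma weak_form_cmult:
  assumes "weak_form A B C g"
  shows "weak_form (\<lambda>p. k * A p) (\<lambda>p. k * B p) (\<lambda>p. k * C p) (\<lambda>x. k * g x)"
  unfolding weak_form_def
proof (intro conjI allI impI)
  note a = assms(1)[unfolded weak_form_def]
  show "(\<lambda>p. k * A p) \<in> L2 MQ" "(\<lambda>p. k * B p) \<in> L2 MQ" "(\<lambda>p. k * C p) \<in> L2 MQ" "(\<lambda>x. k * g x) \<in> L2 MX"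
    using a by (auto intro: L2_cmult)
  fix \<alpha> \<beta> assume t: "test_t0 \<alpha>" "periodic_smooth \<beta>"
  then have "k * ((\<integral>p. A p * (deriv \<alpha> (fst p) * \<beta> (snd p)) \<partial>MQ) + (\<integral>p. B p * (\<alpha> (fst p) * deriv \<beta> (snd p)) \<partial>MQ) +
      (\<integral>p. C p * (\<alpha> (fst p) * \<beta> (snd p)) \<partial>MQ) + \<alpha> 0 * (\<integral>x. g x * \<beta> x \<partial>MX)) = 0"
    using a by auto
  then show "(\<integral>p. k * A p * (deriv \<alpha> (fst p) * \<beta> (snd p)) \<partial>MQ) + (\<integral>p. k * B p * (\<alpha> (fst p) * deriv \<beta> (snd p)) \<partial>MQ) +
      (\<integral>p. k * C p * (\<alpha> (fst p) * \<beta> (snd p)) \<partial>MQ) + \<alpha> 0 * (\<integral>x. k * g x * \<beta> x \<partial>MX) = 0"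
    unfolding mult.assoc integral_mult_right_zero by (simp add: algebra_simps)
qed

text \<open>The sections in time are known to be integrable only for almost every \<open>x\<close>;
  elsewhere the integrals may take the default value 0 and additivity may fail.\<close>

lemma prim_t_add_AE:
  assumes "v \<in> L2 MQ" "w \<in> L2 MQ"
  shows "AE p in MQ. prim_t (\<lambda>p. v p + k * w p) p = prim_t v p + k * prim_t w p"
proof -
  have "AE p in MQ. (\<lambda>s. v (s, snd p)) \<in> L2 MT" "AE p in MQ. (\<lambda>s. w (s, snd p)) \<in> L2 MT"
    using TX.AE_pair_snd[OF PT.section_L2(1), of v] TX.AE_pair_snd[OF PT.section_L2(1), of w] assms unfolding MQ_def by auto
  then show ?thesis
  proof eventually_elim
    case (elim p)
    have i: "integrable MT (\<lambda>s. if s < fst p then h s else 0)" if "h \<in> L2 MT" for h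
    proof -
      have "(\<lambda>s. (if s < fst p then 1 else 0)) \<in> borel_measurable MT"
        unfolding MT_def by (rule borel_space_measure) measurable
      from integrable_bounded_mult(1)[OF KT.fm.L2_integrable[OF that] this, of 1]
      show ?thesis by (simp add: if_distrib[of "\<lambda>c. c * _"] cong: if_cong)
    qed
    have "(\<integral>s. (if s < fst p then v (s, snd p) + k * w (s, snd p) else 0) \<partial>MT) =
      (\<integral>s. (if s < fst p then v (s, snd p) else 0) + k * (if s < fst p then w (s, snd p) else 0) \<partial>MT)"
      by (intro Bochner_Integration.integral_cong) auto
    then show ?case using i[OF elim(1)] i[OF elim(2)] by (simp add: prim_t_def primitive_def MT_def[symmetric])
  qed
qed

lemma weak_add:
  assumes w: "weak i j v v'" "weak i j w w'" "v \<in> L2 MQ" "v' \<in> L2 MQ" "w \<in> L2 MQ" "w' \<in> L2 MQ"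
  shows "weak i j (\<lambda>p. v p + k * w p) (\<lambda>p. v' p + k * w' p)"
  unfolding weak_def
proof (intro allI impI)
  fix \<alpha> \<beta> assume t: "test_t \<alpha>" "periodic_smooth \<beta>"
  have s: "smooth \<alpha>" "smooth \<beta>" "smooth ((deriv ^^ i) \<alpha>)" "smooth ((deriv ^^ j) \<beta>)"
    using t by (auto intro: test_t_smooth periodic_smooth_smooth smooth_deriv_funpow)
  have i: "integrable MQ (\<lambda>p. h p * (\<alpha>' (fst p) * \<beta>' (snd p)))" if "h \<in> L2 MQ" "smooth \<alpha>'" "smooth \<beta>'" for h \<alpha>' \<beta>'
    by (intro KQ.fm.L2_integrable L2_product_test that)
  show "(\<integral>p. (v p + k * w p) * ((deriv ^^ i) \<alpha> (fst p) * (deriv ^^ j) \<beta> (snd p)) \<partial>MQ) =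
       (-1) ^ (i + j) * (\<integral>p. (v' p + k * w' p) * (\<alpha> (fst p) * \<beta> (snd p)) \<partial>MQ)"
    using w(1)[unfolded weak_def, rule_format, OF t] w(2)[unfolded weak_def, rule_format, OF t]
    by (simp add: distrib_right mult.assoc i w s) (simp add: algebra_simps)
qed

lemma H1_add:
  assumes "H1 v vt vx v0" "H1 w wt wx w0"
  shows "H1 (\<lambda>p. v p + k * w p) (\<lambda>p. vt p + k * wt p) (\<lambda>p. vx p + k * wx p) (\<lambda>x. v0 x + k * w0 x)"
proof -
  note a = assms[unfolded H1_def]
  have rep: "AE p in MQ. v p = v0 (snd p) + prim_t vt p" "AE p in MQ. w p = w0 (snd p) + prim_t wt p"
    and l: "vt \<in> L2 MQ" "wt \<in> L2 MQ" using a by auto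
  have "AE p in MQ. v p + k * w p = v0 (snd p) + k * w0 (snd p) + prim_t (\<lambda>p. vt p + k * wt p) p"
    using rep prim_t_add_AE[OF l, of k] by eventually_elim (simp add: algebra_simps)
  then show ?thesis using a unfolding H1_def by (auto intro!: L2_add L2_cmult weak_add)
qed

section \<open>Testing a weak balance law with a Sobolev function\<close>

text \<open>The kernels as profiles evaluated at differences: differentiation in the centre and in
  the other variable then gives the same differentiated profile up to sign.\<close>

definition time_bump :: "nat \<Rightarrow> real \<Rightarrow> real" where
  "time_bump n = unit_bump (1 / real (Suc n)) (2 / real (Suc n))"

definition space_bump :: "nat \<Rightarrow> real \<Rightarrow> real" where
  "space_bump n z = periodic_bump (b - a) n z / (\<integral>z. periodic_bump (b - a) n z \<partial>space_measure a b)"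

lemma kernel_eq: "kernel n p q = time_bump n (fst q - fst p) * space_bump n (snd q - snd p)"
  by (simp add: kernel_def time_bump_def space_bump_def time_kernel_def space_kernel_def)

lemma smooth_time_bump: "smooth (time_bump n)" unfolding time_bump_def by (rule smooth_unit_bump)

lemma smooth_space_bump: "smooth (space_bump n)"
  unfolding space_bump_def[abs_def] by (intro smooth_divide_const smooth_periodic_bump)

lemma smooth_shift: "smooth g \<Longrightarrow> smooth (\<lambda>x. g (x - c))"
  by (rule smooth_compose) (auto intro: smooth_intros)

lemma deriv_shift: assumes "smooth g" shows "deriv (\<lambda>x. g (x - c)) = (\<lambda>x. deriv g (x - c))"
proof (rule ext, rule DERIV_imp_deriv)
  fix x show "((\<lambda>x. g (x - c)) has_real_derivative deriv g (x - c)) (at x)"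
    using has_real_derivative_shift(1)[OF smoothD(1)[OF assms], of c 1 x] by simp
qed

lemma space_bump_periodic: "space_bump n (x + (b - a)) = space_bump n x"
  using ab periodic_bump_periodic[of "b - a" n x] by (simp add: space_bump_def)

lemma space_bump_test: "periodic_smooth (\<lambda>x. space_bump n (y - x))" "periodic_smooth (\<lambda>y. space_bump n (y - x))"
proof -
  have "space_bump n (y - (z + (b - a))) = space_bump n (y - z)" for y z
    using space_bump_periodic[of n "y - (z + (b - a))"] by (simp add: algebra_simps)
  then show "periodic_smooth (\<lambda>x. space_bump n (y - x))"
    unfolding periodic_smooth_def by (auto intro: smooth_reflect smooth_space_bump)
  have "space_bump n (z + (b - a) - x) = space_bump n (z - x)" for z x
    using space_bump_periodic[of n "z - x"] by (simp add: algebra_simps)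
  then show "periodic_smooth (\<lambda>y. space_bump n (y - x))"
    unfolding periodic_smooth_def by (auto intro: smooth_shift smooth_space_bump)
qed

lemma time_bump_test:
  assumes "0 \<le> t" "t + 2 / real (Suc n) < T"
  shows "test_t (\<lambda>s. time_bump n (s - t))"
  unfolding test_t_def
proof (rule conjI[OF smooth_shift[OF smooth_time_bump]], rule exI[of _ "t + 1 / real (Suc n)"],
    rule exI[of _ "t + 2 / real (Suc n)"], intro conjI allI impI)
  show "0 < t + 1 / real (Suc n)" using assms(1) by (intro add_nonneg_pos) auto
  fix s assume "s \<notin> {t + 1 / real (Suc n)..t + 2 / real (Suc n)}"
  then show "time_bump n (s - t) = 0" unfolding time_bump_def by (intro unit_bump_eq_0) auto
qed (use assms in auto)

lemma time_bump_mass: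
  assumes "0 \<le> t" "t + 2 / real (Suc n) < T"
  shows "(\<integral>s. time_bump n (s - t) \<partial>MT) = 1"
  using time_kernel_mass[OF assms] by (simp add: time_kernel_def time_bump_def MT_def)

text \<open>General profiles are allowed so that \<open>conv_pair\<close> covers the kernel together
  with its time and space derivatives.\<close>

definition conv :: "(real \<Rightarrow> real) \<Rightarrow> (real \<Rightarrow> real) \<Rightarrow> (real \<times> real) \<Rightarrow> (real \<times> real) \<Rightarrow> real" where
  "conv f g p q = f (fst q - fst p) * g (snd q - snd p)"

lemma conv_pair:
  assumes F: "integrable MQ F" and G: "integrable MQ G" and f: "smooth f" and g: "smooth g"
  shows "integrable (MQ \<Otimes>\<^sub>M MQ) (\<lambda>z. F (fst z) * G (snd z) * conv f g (fst z) (snd z))"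
    "(\<integral>z. F (fst z) * G (snd z) * conv f g (fst z) (snd z) \<partial>(MQ \<Otimes>\<^sub>M MQ)) =
      (\<integral>p. F p * (\<integral>q. G q * conv f g p q \<partial>MQ) \<partial>MQ)"
    "(\<integral>z. F (fst z) * G (snd z) * conv f g (fst z) (snd z) \<partial>(MQ \<Otimes>\<^sub>M MQ)) =
      (\<integral>q. G q * (\<integral>p. F p * conv f g p q \<partial>MQ) \<partial>MQ)"
    "integrable MQ (\<lambda>q. G q * (\<integral>p. F p * conv f g p q \<partial>MQ))"
proof -
  \<comment> \<open>Differences of two points of the domain lie in these two intervals, so bounds of
    the profiles there suffice.\<close>
  obtain c where c: "\<forall>x\<in>{-T..T}. \<bar>f x\<bar> \<le> c" using smooth_bounded_interval[OF f, of "-T" T] by blast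
  obtain d where d: "\<forall>x\<in>{a-b..b-a}. \<bar>g x\<bar> \<le> d" using smooth_bounded_interval[OF g, of "a-b" "b-a"] by blast
  have fm: "f \<in> borel_measurable borel" "g \<in> borel_measurable borel" using f g by (auto intro: smooth_borel)
  have id: "(\<lambda>x. x) \<in> borel_measurable MT" "(\<lambda>x. x) \<in> borel_measurable MX"
    unfolding MT_def MX_def by (rule id_borel_space_measure)+
  have meas: "(\<lambda>z. conv f g (fst z) (snd z)) \<in> borel_measurable (MQ \<Otimes>\<^sub>M MQ)"
    unfolding conv_def MQ_def
  proof (rule borel_measurable_times)
    note id[measurable]
    show "(\<lambda>z. f (fst (snd z) - fst (fst z))) \<in> borel_measurable ((MT \<Otimes>\<^sub>M MX) \<Otimes>\<^sub>M MT \<Otimes>\<^sub>M MX)"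
      by (rule measurable_compose[OF _ fm(1)]) measurable
    show "(\<lambda>z. g (snd (snd z) - snd (fst z))) \<in> borel_measurable ((MT \<Otimes>\<^sub>M MX) \<Otimes>\<^sub>M MT \<Otimes>\<^sub>M MX)"
      by (rule measurable_compose[OF _ fm(2)]) measurable
  qed
  have bd: "\<bar>conv f g (fst z) (snd z)\<bar> \<le> c * d" if "z \<in> space (MQ \<Otimes>\<^sub>M MQ)" for z
  proof -
    have "\<bar>f (fst (snd z) - fst (fst z))\<bar> \<le> c" "\<bar>g (snd (snd z) - snd (fst z))\<bar> \<le> d"
      using that by (auto intro!: c[rule_format] d[rule_format] simp: space_pair_measure)
    then show ?thesis unfolding conv_def abs_mult by (intro mult_mono) auto
  qed
  show i: "integrable (MQ \<Otimes>\<^sub>M MQ) (\<lambda>z. F (fst z) * G (snd z) * conv f g (fst z) (snd z))"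
    by (rule integrable_bounded_mult(2)[OF KQ.pm.integrable_pair_mult[OF F G] meas, of "c * d"])
       (auto intro!: AE_I2 bd)
  show "(\<integral>z. F (fst z) * G (snd z) * conv f g (fst z) (snd z) \<partial>(MQ \<Otimes>\<^sub>M MQ)) =
      (\<integral>p. F p * (\<integral>q. G q * conv f g p q \<partial>MQ) \<partial>MQ)"
    using KQ.pm.integral_fst'[OF i] by (simp add: mult.assoc)
  have i': "integrable (MQ \<Otimes>\<^sub>M MQ) (\<lambda>(p, q). F p * G q * conv f g p q)" using i by (simp add: case_prod_unfold)
  have e: "F p * G q * conv f g p q = G q * (F p * conv f g p q)" for p q by (simp add: mult_ac)
  show "(\<integral>z. F (fst z) * G (snd z) * conv f g (fst z) (snd z) \<partial>(MQ \<Otimes>\<^sub>M MQ)) =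
      (\<integral>q. G q * (\<integral>p. F p * conv f g p q \<partial>MQ) \<partial>MQ)"
    using KQ.pm.integral_snd[OF i'] unfolding e by (simp add: case_prod_unfold e)
  show "integrable MQ (\<lambda>q. G q * (\<integral>p. F p * conv f g p q \<partial>MQ))"
    using KQ.pm.integrable_snd[OF i'] unfolding e by simp
qed

text \<open>The time bump averages \<open>w\<close> over a thin layer next to \<open>t = 0\<close>.
  Replacing \<open>w\<close> by \<open>w0\<close> leaves a pairing in space that converges by
  \<open>KX.pairing_tendsto\<close>; the error is the primitive of \<open>wt\<close>, small in the
  layer.\<close>

lemma trace_term_tendsto:
  assumes w: "H1 w wt wx w0" and g: "g \<in> L2 MX"
  shows "(\<lambda>n. \<integral>q. w q * (time_bump n (fst q) * (\<integral>x. g x * space_bump n (snd q - x) \<partial>MX)) \<partial>MQ) \<longlonglongrightarrow> (\<integral>x. g x * w0 x \<partial>MX)"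
proof -
  have L: "w \<in> L2 MQ" "wt \<in> L2 MQ" "w0 \<in> L2 MX" and rep: "AE p in MQ. w p = w0 (snd p) + prim_t wt p"
    using w by (auto simp: H1_def)
  have sk: "space_bump n (y - x) = space_kernel a b n x y" for n x y by (simp add: space_bump_def space_kernel_def)
  have sb0: "0 \<le> space_bump n (y - x)" for n x y unfolding sk by (rule KX.k_nonneg)
  have tb0: "0 \<le> time_bump n s" for n s by (simp add: time_bump_def unit_bump_nonneg)
  have gi: "integrable MX g" "integrable MX w0" "integrable MX (\<lambda>x. \<bar>g x\<bar>)"
    using KX.fm.L2_integrable g L by auto
  define h where "h n y = (\<integral>x. g x * space_bump n (y - x) \<partial>MX)" for n y
  define H where "H n y = (\<integral>x. \<bar>g x\<bar> * space_bump n (y - x) \<partial>MX)" for n y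
  define m where "m y = (\<integral>s. (wt (s, y))\<^sup>2 \<partial>MT)" for y
  have m0: "0 \<le> m y" for y by (simp add: m_def)
  have mi: "integrable MX m" unfolding m_def using PT.section_L2(2)[of wt] L(2) by (simp add: MQ_def)
  have sm: "(\<lambda>y. sqrt (m y)) \<in> L2 MX" using mi m0 by (auto simp: L2_def)
  have pair: "integrable MX (\<lambda>y. v y * (\<integral>x. A x * space_bump n (y - x) \<partial>MX))"
    "(\<integral>y. v y * (\<integral>x. A x * space_bump n (y - x) \<partial>MX) \<partial>MX) = (\<integral>p. A (fst p) * v (snd p) * space_kernel a b n (fst p) (snd p) \<partial>(MX \<Otimes>\<^sub>M MX))"
    if A: "integrable MX A" and v: "integrable MX v" for A v n
  proof -
    have i: "integrable (MX \<Otimes>\<^sub>M MX) (\<lambda>(x, y). A x * v y * space_kernel a b n x y)"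
      using KX.integrable_pair_k[OF A v] by (simp add: case_prod_unfold)
    have e: "A x * v y * space_kernel a b n x y = v y * (A x * space_bump n (y - x))" for x y by (simp add: sk mult_ac)
    show "integrable MX (\<lambda>y. v y * (\<integral>x. A x * space_bump n (y - x) \<partial>MX))"
      using KX.pm.integrable_snd[OF i] unfolding e by simp
    show "(\<integral>y. v y * (\<integral>x. A x * space_bump n (y - x) \<partial>MX) \<partial>MX) = (\<integral>p. A (fst p) * v (snd p) * space_kernel a b n (fst p) (snd p) \<partial>(MX \<Otimes>\<^sub>M MX))"
      using KX.pm.integral_snd[OF i] unfolding e by (simp add: case_prod_unfold e)
  qed
  have tbi: "integrable MT (time_bump n)" for n by (rule smooth_integrable_MT[OF smooth_time_bump])
  have hi: "integrable MX (h n)" "integrable MX (\<lambda>y. w0 y * h n y)" "integrable MX (\<lambda>y. sqrt (m y) * H n y)" for n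
    unfolding h_def H_def
    using pair(1)[OF gi(1), of "\<lambda>_. 1"] pair(1)[OF gi(1) gi(2)] pair(1)[OF gi(3) KX.fm.L2_integrable[OF sm]] by auto
  have H_h: "\<bar>h n y\<bar> \<le> H n y" for n y
    unfolding h_def H_def using integral_norm_bound[of MX "\<lambda>x. g x * space_bump n (y - x)"] sb0 by (simp add: abs_mult)
  have bound: "(\<integral>y. sqrt (m y) * H n y \<partial>MX) \<le> (\<integral>x. (g x)\<^sup>2 \<partial>MX) + (\<integral>y. m y \<partial>MX)" for n
  proof -
    have "(\<lambda>x. \<bar>g x\<bar>) \<in> L2 MX" using g by (auto simp: L2_def)
    from KX.pairing_bound[OF this sm, of 1 n]
    have "(\<integral>y. sqrt (m y) * H n y \<partial>MX) \<le> 1 * (\<integral>x. (\<bar>g x\<bar>)\<^sup>2 \<partial>MX) + (\<integral>y. (sqrt (m y))\<^sup>2 \<partial>MX) / 1"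
      unfolding H_def pair(2)[OF gi(3) KX.fm.L2_integrable[OF sm]]
      by simp
    then show ?thesis using m0 by simp
  qed
  have l1: "(\<lambda>n. \<integral>y. w0 y * h n y \<partial>MX) \<longlonglongrightarrow> (\<integral>x. g x * w0 x \<partial>MX)"
    unfolding h_def pair(2)[OF gi(1,2)] by (rule KX.pairing_tendsto[OF g L(3)])
  have ev: "\<forall>\<^sub>F n in sequentially. 0 + 2 / real (Suc n) < T" using eventually_inverse_less[OF T, of 2] by simp
  have vL: "prim_t wt \<in> L2 MQ" by (rule prim_t_L2[OF L(2)])
  let ?E = "\<lambda>n. (\<integral>q. w q * (time_bump n (fst q) * h n (snd q)) \<partial>MQ) - (\<integral>y. w0 y * h n y \<partial>MX)"
  let ?B = "\<lambda>n. sqrt (2 / real (Suc n)) * ((\<integral>x. (g x)\<^sup>2 \<partial>MX) + (\<integral>y. m y \<partial>MX))"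
  have "\<forall>\<^sub>F n in sequentially. norm (?E n) \<le> ?B n"
    using ev
  proof eventually_elim
    case (elim n)
    have mass: "(\<integral>s. time_bump n s \<partial>MT) = 1" using time_bump_mass[of 0 n] elim by simp
    have i1: "integrable MQ (\<lambda>q. time_bump n (fst q) * (w0 (snd q) * h n (snd q)))"
      unfolding MQ_def by (rule TX.integrable_pair_mult[OF tbi hi(2)])
    have i3: "integrable MQ (\<lambda>q. sqrt (2 / real (Suc n)) * (time_bump n (fst q) * (sqrt (m (snd q)) * H n (snd q))))"
      unfolding MQ_def by (intro integrable_mult_right TX.integrable_pair_mult[OF tbi hi(3)])
    have hm: "h n \<in> borel_measurable MX" using hi(1) by auto
    have tm: "time_bump n \<in> borel_measurable MT" using tbi by auto
    have vm: "prim_t wt \<in> borel_measurable MQ" using vL by (rule L2_measurable)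
    have wm: "w \<in> borel_measurable MQ" using L(1) by (rule L2_measurable)
    have thbm: "(\<lambda>q. time_bump n (fst q) * h n (snd q)) \<in> borel_measurable MQ"
      using hm tm unfolding MQ_def by measurable
    have pb: "AE q in MQ. \<bar>prim_t wt q * (time_bump n (fst q) * h n (snd q))\<bar> \<le>
        sqrt (2 / real (Suc n)) * (time_bump n (fst q) * (sqrt (m (snd q)) * H n (snd q)))"
      using PT.prim_bound[of wt, OF L(2)[unfolded MQ_def]] AE_space unfolding prim_t_eq MQ_def
    proof eventually_elim
      case (elim q)
      show ?case
      proof (cases "time_bump n (fst q) = 0")
        case False
        \<comment> \<open>The bump vanishes for later times, so the elapsed time in
          \<open>PT.prim_bound\<close> is at most \<open>2 / real (Suc n)\<close>; its square root
          is the small factor in \<open>?B\<close>.\<close>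
        then have "fst q < 2 / real (Suc n)" unfolding time_bump_def using unit_bump_eq_0 by (meson not_le)
        then have "fst q * m (snd q) \<le> 2 / real (Suc n) * m (snd q)"
          by (intro mult_right_mono m0) simp
        then have "(PT.prim wt q)\<^sup>2 \<le> 2 / real (Suc n) * m (snd q)"
          using elim(1) unfolding m_def diff_zero by linarith
        then have "\<bar>PT.prim wt q\<bar> \<le> sqrt (2 / real (Suc n)) * sqrt (m (snd q))"
          unfolding real_sqrt_mult[symmetric] by (rule real_le_rsqrt[of "\<bar>PT.prim wt q\<bar>", simplified])
        then have "\<bar>PT.prim wt q\<bar> * \<bar>time_bump n (fst q) * h n (snd q)\<bar> \<le>
           (sqrt (2 / real (Suc n)) * sqrt (m (snd q))) * (time_bump n (fst q) * H n (snd q))"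
          using H_h[of n "snd q"] tb0[of n "fst q"] m0[of "snd q"]
          by (intro mult_mono) (auto simp: abs_mult intro!: mult_left_mono)
        then show ?thesis by (simp add: abs_mult mult_ac)
      qed simp
    qed
    have i2: "integrable MQ (\<lambda>q. prim_t wt q * (time_bump n (fst q) * h n (snd q)))"
    proof (rule Bochner_Integration.integrable_bound[OF i3])
      show "AE q in MQ. norm (prim_t wt q * (time_bump n (fst q) * h n (snd q)))
        \<le> norm (sqrt (2 / real (Suc n)) * (time_bump n (fst q) * (sqrt (m (snd q)) * H n (snd q))))"
        using pb by eventually_elim (metis abs_ge_self order_trans real_norm_def)
    qed (use vm thbm in measurable)
    have "(\<integral>q. w q * (time_bump n (fst q) * h n (snd q)) \<partial>MQ) =
      (\<integral>q. time_bump n (fst q) * (w0 (snd q) * h n (snd q)) + prim_t wt q * (time_bump n (fst q) * h n (snd q)) \<partial>MQ)"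
    proof (rule integral_cong_AE)
      show "AE q in MQ. w q * (time_bump n (fst q) * h n (snd q)) =
        time_bump n (fst q) * (w0 (snd q) * h n (snd q)) + prim_t wt q * (time_bump n (fst q) * h n (snd q))"
        using rep by eventually_elim (simp add: algebra_simps)
    qed (use i1 i2 wm thbm in auto)
    also have "\<dots> = (\<integral>q. time_bump n (fst q) * (w0 (snd q) * h n (snd q)) \<partial>MQ) + (\<integral>q. prim_t wt q * (time_bump n (fst q) * h n (snd q)) \<partial>MQ)"
      using i1 i2 by simp
    also have "(\<integral>q. time_bump n (fst q) * (w0 (snd q) * h n (snd q)) \<partial>MQ) = (\<integral>y. w0 y * h n y \<partial>MX)"
      using integral_MQ_product[OF tbi hi(2)] mass by simp
    finally have "norm (?E n) = \<bar>\<integral>q. prim_t wt q * (time_bump n (fst q) * h n (snd q)) \<partial>MQ\<bar>" by simp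
    also have "\<dots> \<le> (\<integral>q. \<bar>prim_t wt q * (time_bump n (fst q) * h n (snd q))\<bar> \<partial>MQ)" by (rule integral_abs_bound)
    also have "\<dots> \<le> (\<integral>q. sqrt (2 / real (Suc n)) * (time_bump n (fst q) * (sqrt (m (snd q)) * H n (snd q))) \<partial>MQ)"
      by (rule integral_mono_AE[OF _ i3 pb]) (use i2 in auto)
    also have "\<dots> = sqrt (2 / real (Suc n)) * (\<integral>y. sqrt (m y) * H n y \<partial>MX)"
      using integral_MQ_product[OF tbi hi(3)] mass by simp
    also have "\<dots> \<le> ?B n" by (intro mult_left_mono bound) auto
    finally show ?case .
  qed
  moreover have "?B \<longlonglongrightarrow> 0"
  proof -
    have "(\<lambda>n. 2 / real (Suc n)) \<longlonglongrightarrow> 2 * 0"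
      using tendsto_mult[OF tendsto_const LIMSEQ_inverse_real_of_nat, of 2] by (simp add: divide_inverse)
    then have "?B \<longlonglongrightarrow> sqrt (2 * 0) * ((\<integral>x. (g x)\<^sup>2 \<partial>MX) + (\<integral>y. m y \<partial>MX))"
      by (intro tendsto_intros)
    then show ?thesis by simp
  qed
  ultimately have "?E \<longlonglongrightarrow> 0" by (rule Lim_null_comparison)
  from tendsto_add[OF this l1] show ?thesis by (simp add: h_def)
qed

text \<open>Doubling of variables: the law is tested in \<open>(t, x)\<close> with \<open>\<phi>(t)\<close> times a smoothing kernel
  centred at \<open>(s, y)\<close>, multiplied by \<open>w(s, y)\<close> and integrated; the derivatives that fall on the kernel
  are moved to \<open>w\<close> in the variables \<open>(s, y)\<close>.\<close>

theorem weak_form_test_H1: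
  assumes A: "weak_form A B C g" and w: "H1 w wt wx w0" and \<phi>: "test_t0 \<phi>"
  shows "(\<integral>p. A p * (wt p * \<phi> (fst p) + w p * deriv \<phi> (fst p)) + B p * wx p * \<phi> (fst p) + C p * w p * \<phi> (fst p) \<partial>MQ) +
    \<phi> 0 * (\<integral>x. g x * w0 x \<partial>MX) = 0"
proof -
  have LA: "A \<in> L2 MQ" "B \<in> L2 MQ" "C \<in> L2 MQ" "g \<in> L2 MX" using A by (auto simp: weak_form_def)
  have Lw: "w \<in> L2 MQ" "wt \<in> L2 MQ" "wx \<in> L2 MQ" "weak 1 0 w wt" "weak 0 1 w wx" using w by (auto simp: H1_def)
  obtain r where r: "r < T" "\<And>t. r < t \<Longrightarrow> \<phi> t = 0" and \<phi>s: "smooth \<phi>" using \<phi> by (auto simp: test_t0_def)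
  have \<phi>d: "smooth (deriv \<phi>)" using \<phi>s by (rule smoothD)
  have L\<phi>: "(\<lambda>p. F p * \<phi> (fst p)) \<in> L2 MQ" "(\<lambda>p. F p * deriv \<phi> (fst p)) \<in> L2 MQ" if "F \<in> L2 MQ" for F
    using L2_product_test[OF that \<phi>s smooth_const[of 1]] L2_product_test[OF that \<phi>d smooth_const[of 1]] by auto
  note int = KQ.fm.L2_integrable
  have td: "smooth (deriv (time_bump n))" "smooth (deriv (space_bump n))" for n by (intro smoothD smooth_time_bump smooth_space_bump)+
  define I where "I F G f h = (\<integral>z. F (fst z) * G (snd z) * conv f h (fst z) (snd z) \<partial>(MQ \<Otimes>\<^sub>M MQ))" for F G f h
  define tr where "tr n = (\<integral>q. w q * (time_bump n (fst q) * (\<integral>x. g x * space_bump n (snd q - x) \<partial>MX)) \<partial>MQ)" for n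
  have identity: "I (\<lambda>p. A p * deriv \<phi> (fst p)) w (time_bump n) (space_bump n) + I (\<lambda>p. A p * \<phi> (fst p)) wt (time_bump n) (space_bump n)
     + I (\<lambda>p. B p * \<phi> (fst p)) wx (time_bump n) (space_bump n) + I (\<lambda>p. C p * \<phi> (fst p)) w (time_bump n) (space_bump n) + \<phi> 0 * tr n = 0"
    if n: "2 / real (Suc n) < T - r" for n
  proof -
    define J where "J F f h q = (\<integral>p. F p * conv f h p q \<partial>MQ)" for F f h q
    have J: "I F w f h = (\<integral>q. w q * J F f h q \<partial>MQ)" "integrable MQ (\<lambda>q. w q * J F f h q)"
      if "F \<in> L2 MQ" "smooth f" "smooth h" for F f h
      unfolding I_def J_def using conv_pair(3,4)[OF int[OF that(1)] int[OF Lw(1)] that(2,3)] by auto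
    have ci: "integrable MQ (\<lambda>p. F p * conv f h p q)" if "F \<in> L2 MQ" "smooth f" "smooth h" for F f h q
      unfolding conv_def by (intro int L2_product_test that smooth_reflect)
    have eq: "J (\<lambda>p. A p * deriv \<phi> (fst p)) (time_bump n) (space_bump n) q - J (\<lambda>p. A p * \<phi> (fst p)) (deriv (time_bump n)) (space_bump n) q
      - J (\<lambda>p. B p * \<phi> (fst p)) (time_bump n) (deriv (space_bump n)) q + J (\<lambda>p. C p * \<phi> (fst p)) (time_bump n) (space_bump n) q
      + \<phi> 0 * (time_bump n (fst q) * (\<integral>x. g x * space_bump n (snd q - x) \<partial>MX)) = 0" for q
    proof -
      let ?\<alpha> = "\<lambda>t. \<phi> t * time_bump n (fst q - t)" and ?\<beta> = "\<lambda>x. space_bump n (snd q - x)"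
      have t: "test_t0 ?\<alpha>" "periodic_smooth ?\<beta>"
        by (intro test_t0_mult \<phi> smooth_reflect smooth_time_bump, rule space_bump_test)
      \<comment> \<open>The kernel depends on the difference of \<open>q\<close> and
        \<open>p\<close>, so its derivatives in the variables of the law and of \<open>w\<close>
        have opposite signs. This is why facts \<open>2\<close> and \<open>3\<close> return the
        terms with \<open>wt\<close> and \<open>wx\<close> with a plus sign.\<close>
      have d\<alpha>: "deriv ?\<alpha> = (\<lambda>t. deriv \<phi> t * time_bump n (fst q - t) - \<phi> t * deriv (time_bump n) (fst q - t))"
        using smooth_deriv_mult[OF \<phi>s smooth_reflect[OF smooth_time_bump]] deriv_reflect[OF smooth_time_bump] by simp
      have d\<beta>: "deriv ?\<beta> = (\<lambda>x. - deriv (space_bump n) (snd q - x))" by (rule deriv_reflect[OF smooth_space_bump])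
      have "(\<integral>p. A p * (deriv ?\<alpha> (fst p) * ?\<beta> (snd p)) \<partial>MQ) =
        (\<integral>p. A p * deriv \<phi> (fst p) * conv (time_bump n) (space_bump n) p q - A p * \<phi> (fst p) * conv (deriv (time_bump n)) (space_bump n) p q \<partial>MQ)"
        unfolding d\<alpha> conv_def by (simp add: algebra_simps)
      also have "\<dots> = J (\<lambda>p. A p * deriv \<phi> (fst p)) (time_bump n) (space_bump n) q - J (\<lambda>p. A p * \<phi> (fst p)) (deriv (time_bump n)) (space_bump n) q"
        unfolding J_def by (intro Bochner_Integration.integral_diff ci L\<phi> LA smooth_time_bump smooth_space_bump td)
      finally have 1: "(\<integral>p. A p * (deriv ?\<alpha> (fst p) * ?\<beta> (snd p)) \<partial>MQ) = \<dots>" .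
      have 2: "(\<integral>p. B p * (?\<alpha> (fst p) * deriv ?\<beta> (snd p)) \<partial>MQ) = - J (\<lambda>p. B p * \<phi> (fst p)) (time_bump n) (deriv (space_bump n)) q"
        unfolding d\<beta> J_def conv_def by (simp add: mult_ac)
      have 3: "(\<integral>p. C p * (?\<alpha> (fst p) * ?\<beta> (snd p)) \<partial>MQ) = J (\<lambda>p. C p * \<phi> (fst p)) (time_bump n) (space_bump n) q"
        unfolding J_def conv_def by (simp add: mult_ac)
      have "(\<integral>p. A p * (deriv ?\<alpha> (fst p) * ?\<beta> (snd p)) \<partial>MQ) + (\<integral>p. B p * (?\<alpha> (fst p) * deriv ?\<beta> (snd p)) \<partial>MQ) +
        (\<integral>p. C p * (?\<alpha> (fst p) * ?\<beta> (snd p)) \<partial>MQ) + ?\<alpha> 0 * (\<integral>x. g x * ?\<beta> x \<partial>MX) = 0"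
        using A t unfolding weak_form_def by blast
      then show ?thesis unfolding 1 2 3 by (simp add: mult.assoc)
    qed
    have fin: "I (\<lambda>p. A p * deriv \<phi> (fst p)) w (time_bump n) (space_bump n) - I (\<lambda>p. A p * \<phi> (fst p)) w (deriv (time_bump n)) (space_bump n)
      - I (\<lambda>p. B p * \<phi> (fst p)) w (time_bump n) (deriv (space_bump n)) + I (\<lambda>p. C p * \<phi> (fst p)) w (time_bump n) (space_bump n) + \<phi> 0 * tr n = 0"
    proof -
      let ?J1 = "J (\<lambda>p. A p * deriv \<phi> (fst p)) (time_bump n) (space_bump n)" and ?J2 = "J (\<lambda>p. A p * \<phi> (fst p)) (deriv (time_bump n)) (space_bump n)"
        and ?J3 = "J (\<lambda>p. B p * \<phi> (fst p)) (time_bump n) (deriv (space_bump n))" and ?J4 = "J (\<lambda>p. C p * \<phi> (fst p)) (time_bump n) (space_bump n)"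
      have i: "integrable MQ (\<lambda>q. w q * ?J1 q)" "integrable MQ (\<lambda>q. w q * ?J2 q)" "integrable MQ (\<lambda>q. w q * ?J3 q)" "integrable MQ (\<lambda>q. w q * ?J4 q)"
        by (intro J L\<phi> LA smooth_time_bump smooth_space_bump td)+
      have "\<phi> 0 * tr n = (\<integral>q. \<phi> 0 * (w q * (time_bump n (fst q) * (\<integral>x. g x * space_bump n (snd q - x) \<partial>MX))) \<partial>MQ)"
        unfolding tr_def by simp
      also have "\<dots> = (\<integral>q. - (w q * ?J1 q - w q * ?J2 q - w q * ?J3 q + w q * ?J4 q) \<partial>MQ)"
      proof (rule Bochner_Integration.integral_cong[OF refl])
        fix q
        have "\<phi> 0 * (time_bump n (fst q) * (\<integral>x. g x * space_bump n (snd q - x) \<partial>MX)) = - (?J1 q - ?J2 q - ?J3 q + ?J4 q)"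
          using eq[of q] by linarith
        from arg_cong[OF this, of "\<lambda>z. w q * z"]
        show "\<phi> 0 * (w q * (time_bump n (fst q) * (\<integral>x. g x * space_bump n (snd q - x) \<partial>MX))) =
          - (w q * ?J1 q - w q * ?J2 q - w q * ?J3 q + w q * ?J4 q)" by (simp add: algebra_simps)
      qed
      also have "\<dots> = - ((\<integral>q. w q * ?J1 q \<partial>MQ) - (\<integral>q. w q * ?J2 q \<partial>MQ) - (\<integral>q. w q * ?J3 q \<partial>MQ) + (\<integral>q. w q * ?J4 q \<partial>MQ))"
        using i by simp
      finally show ?thesis
        by (subst (1 2 3 4) J(1)) (auto intro!: L\<phi> LA smooth_time_bump smooth_space_bump td)
    qed
    \<comment> \<open>Where \<open>\<phi>\<close> does not vanish, the forward bump centred at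
      \<open>fst p\<close> ends before \<open>T\<close>; it is then a legitimate test for the weak
      derivatives of \<open>w\<close>.\<close>
    have late: "\<phi> (fst p) = 0 \<or> 0 \<le> fst p \<and> fst p + 2 / real (Suc n) < T" if "p \<in> space MQ" for p
      using that r(2)[of "fst p"] n by (cases "r < fst p") auto
    have 2: "I (\<lambda>p. A p * \<phi> (fst p)) w (deriv (time_bump n)) (space_bump n) = - I (\<lambda>p. A p * \<phi> (fst p)) wt (time_bump n) (space_bump n)"
    proof -
      have "I (\<lambda>p. A p * \<phi> (fst p)) w (deriv (time_bump n)) (space_bump n) = (\<integral>p. - (A p * \<phi> (fst p) * (\<integral>q. wt q * conv (time_bump n) (space_bump n) p q \<partial>MQ)) \<partial>MQ)"
        unfolding I_def conv_pair(2)[OF int[OF L\<phi>(1)[OF LA(1)]] int[OF Lw(1)] td(1) smooth_space_bump]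
      proof (rule Bochner_Integration.integral_cong[OF refl])
        fix p assume p: "p \<in> space MQ"
        show "A p * \<phi> (fst p) * (\<integral>q. w q * conv (deriv (time_bump n)) (space_bump n) p q \<partial>MQ) = - (A p * \<phi> (fst p) * (\<integral>q. wt q * conv (time_bump n) (space_bump n) p q \<partial>MQ))"
        proof (cases "\<phi> (fst p) = 0")
          case False
          then have "test_t (\<lambda>s. time_bump n (s - fst p))" using late[OF p] by (intro time_bump_test) auto
          from Lw(4)[unfolded weak_def, rule_format, OF this space_bump_test(2)[of n "snd p"]]
          show ?thesis by (simp add: conv_def deriv_shift[OF smooth_time_bump])
        qed simp
      qed
      then show ?thesis unfolding I_def conv_pair(2)[OF int[OF L\<phi>(1)[OF LA(1)]] int[OF Lw(2)] smooth_time_bump smooth_space_bump] by simp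
    qed
    have 3: "I (\<lambda>p. B p * \<phi> (fst p)) w (time_bump n) (deriv (space_bump n)) = - I (\<lambda>p. B p * \<phi> (fst p)) wx (time_bump n) (space_bump n)"
    proof -
      have "I (\<lambda>p. B p * \<phi> (fst p)) w (time_bump n) (deriv (space_bump n)) = (\<integral>p. - (B p * \<phi> (fst p) * (\<integral>q. wx q * conv (time_bump n) (space_bump n) p q \<partial>MQ)) \<partial>MQ)"
        unfolding I_def conv_pair(2)[OF int[OF L\<phi>(1)[OF LA(2)]] int[OF Lw(1)] smooth_time_bump td(2)]
      proof (rule Bochner_Integration.integral_cong[OF refl])
        fix p assume p: "p \<in> space MQ"
        show "B p * \<phi> (fst p) * (\<integral>q. w q * conv (time_bump n) (deriv (space_bump n)) p q \<partial>MQ) = - (B p * \<phi> (fst p) * (\<integral>q. wx q * conv (time_bump n) (space_bump n) p q \<partial>MQ))"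
        proof (cases "\<phi> (fst p) = 0")
          case False
          then have "test_t (\<lambda>s. time_bump n (s - fst p))" using late[OF p] by (intro time_bump_test) auto
          from Lw(5)[unfolded weak_def, rule_format, OF this space_bump_test(2)[of n "snd p"]]
          show ?thesis by (simp add: conv_def deriv_shift[OF smooth_space_bump])
        qed simp
      qed
      then show ?thesis unfolding I_def conv_pair(2)[OF int[OF L\<phi>(1)[OF LA(2)]] int[OF Lw(3)] smooth_time_bump smooth_space_bump] by simp
    qed
    show ?thesis using fin unfolding 2 3 by simp
  qed
  have lim: "(\<lambda>n. I F G (time_bump n) (space_bump n)) \<longlonglongrightarrow> (\<integral>p. F p * G p \<partial>MQ)" if "F \<in> L2 MQ" "G \<in> L2 MQ" for F G
    using KQ.pairing_tendsto[OF that] by (simp add: I_def conv_def kernel_eq)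
  have "0 < T - r" using r by simp
  from eventually_inverse_less[OF this, of 2]
  have "(\<lambda>n. I (\<lambda>p. A p * deriv \<phi> (fst p)) w (time_bump n) (space_bump n) + I (\<lambda>p. A p * \<phi> (fst p)) wt (time_bump n) (space_bump n)
     + I (\<lambda>p. B p * \<phi> (fst p)) wx (time_bump n) (space_bump n) + I (\<lambda>p. C p * \<phi> (fst p)) w (time_bump n) (space_bump n) + \<phi> 0 * tr n) \<longlonglongrightarrow> 0"
    by (intro tendsto_eventually) (auto elim!: eventually_mono intro: identity)
  moreover have "(\<lambda>n. I (\<lambda>p. A p * deriv \<phi> (fst p)) w (time_bump n) (space_bump n) + I (\<lambda>p. A p * \<phi> (fst p)) wt (time_bump n) (space_bump n)
     + I (\<lambda>p. B p * \<phi> (fst p)) wx (time_bump n) (space_bump n) + I (\<lambda>p. C p * \<phi> (fst p)) w (time_bump n) (space_bump n) + \<phi> 0 * tr n) \<longlonglongrightarrow>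
    (\<integral>p. A p * deriv \<phi> (fst p) * w p \<partial>MQ) + (\<integral>p. A p * \<phi> (fst p) * wt p \<partial>MQ) + (\<integral>p. B p * \<phi> (fst p) * wx p \<partial>MQ)
     + (\<integral>p. C p * \<phi> (fst p) * w p \<partial>MQ) + \<phi> 0 * (\<integral>x. g x * w0 x \<partial>MX)"
    unfolding tr_def by (intro tendsto_add tendsto_mult tendsto_const trace_term_tendsto[OF w LA(4)] lim L\<phi> LA Lw)
  ultimately have lim0: "(\<integral>p. A p * deriv \<phi> (fst p) * w p \<partial>MQ) + (\<integral>p. A p * \<phi> (fst p) * wt p \<partial>MQ) + (\<integral>p. B p * \<phi> (fst p) * wx p \<partial>MQ)
     + (\<integral>p. C p * \<phi> (fst p) * w p \<partial>MQ) + \<phi> 0 * (\<integral>x. g x * w0 x \<partial>MX) = 0"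
    using LIMSEQ_unique by blast
  have i: "integrable MQ (\<lambda>p. A p * deriv \<phi> (fst p) * w p)" "integrable MQ (\<lambda>p. A p * \<phi> (fst p) * wt p)"
    "integrable MQ (\<lambda>p. B p * \<phi> (fst p) * wx p)" "integrable MQ (\<lambda>p. C p * \<phi> (fst p) * w p)"
    by (intro L2_mult L\<phi> LA Lw)+
  have "(\<integral>p. A p * (wt p * \<phi> (fst p) + w p * deriv \<phi> (fst p)) + B p * wx p * \<phi> (fst p) + C p * w p * \<phi> (fst p) \<partial>MQ) =
    (\<integral>p. A p * deriv \<phi> (fst p) * w p + A p * \<phi> (fst p) * wt p + B p * \<phi> (fst p) * wx p + C p * \<phi> (fst p) * w p \<partial>MQ)"
    by (intro Bochner_Integration.integral_cong refl) (simp add: algebra_simps)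
  also have "\<dots> = (\<integral>p. A p * deriv \<phi> (fst p) * w p \<partial>MQ) + (\<integral>p. A p * \<phi> (fst p) * wt p \<partial>MQ) + (\<integral>p. B p * \<phi> (fst p) * wx p \<partial>MQ)
     + (\<integral>p. C p * \<phi> (fst p) * w p \<partial>MQ)" using i by simp
  finally show ?thesis using lim0 by simp
qed

end

section \<open>Functions with bounded weak second derivative\<close>

lemma integral_compact_support:
  fixes g :: "real \<Rightarrow> real"
  assumes g: "continuous_on UNIV g" and 0: "\<And>x. x \<notin> {l<..<u} \<Longrightarrow> g x = 0"
  shows "integrable lborel g" "(\<integral>x. g x \<partial>lborel) = (\<integral>x. g x \<partial>space_measure l u)"
proof -
  have gi: "g x = indicator {l..u} x *\<^sub>R g x" "g x = indicator {l<..<u} x *\<^sub>R g x" for x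
    by (cases "x \<in> {l<..<u}"; simp add: 0 indicator_def)+
  have "set_integrable lborel {l..u} g"
    by (rule borel_integrable_atLeastAtMost') (rule continuous_on_subset[OF g], simp)
  then show "integrable lborel g" unfolding set_integrable_def gi(1)[symmetric] .
  show "(\<integral>x. g x \<partial>lborel) = (\<integral>x. g x \<partial>space_measure l u)"
    unfolding space_measure_def by (subst integral_restrict_space, simp) (simp only: gi(2)[symmetric])
qed

lemma unit_bump_shift_integral:
  assumes h: "continuous_on UNIV h"
  shows "(\<lambda>n. \<integral>x. h x * unit_bump (1 / real (Suc n)) (2 / real (Suc n)) (x - c) \<partial>lborel) \<longlonglongrightarrow> h c"
proof (rule LIMSEQ_I)
  fix r :: real assume r: "0 < r"
  have "isCont h c" using h by (simp add: continuous_on_eq_continuous_at)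
  then obtain d where d: "0 < d" "\<And>x. dist x c < d \<Longrightarrow> dist (h x) (h c) < r / 2"
    unfolding continuous_at_eps_delta using r half_gt_zero by blast
  have "\<forall>\<^sub>F n in sequentially. norm ((\<integral>x. h x * unit_bump (1 / real (Suc n)) (2 / real (Suc n)) (x - c) \<partial>lborel) - h c) < r"
    using eventually_inverse_less[OF d(1), of 2]
  proof eventually_elim
    case (elim n)
    let ?e = "1 / real (Suc n)" and ?d = "2 / real (Suc n)"
    let ?\<rho> = "\<lambda>x. unit_bump ?e ?d (x - c)"
    have ed: "?e < ?d" "0 < ?e" by (simp_all add: divide_strict_right_mono)
    obtain G where G: "\<And>x. (G has_real_derivative unit_bump ?e ?d x) (at x)"
      "\<And>x. x \<le> ?e \<Longrightarrow> G x = 0" "\<And>x. ?d \<le> x \<Longrightarrow> G x = 1"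
      using unit_bump_antiderivative[OF ed(1)] by metis
    have \<rho>c: "continuous_on UNIV ?\<rho>"
      by (intro continuous_on_compose2[OF smooth_continuous[OF smooth_unit_bump, of UNIV]] continuous_intros) auto
    have \<rho>0: "?\<rho> x = 0" if "x \<notin> {c<..<c + ?d}" for x
      using that ed by (intro unit_bump_eq_0) auto
    have mass: "(\<integral>x. ?\<rho> x \<partial>lborel) = 1"
    proof -
      have "(\<integral>x. ?\<rho> x \<partial>lborel) = (\<integral>x. ?\<rho> x \<partial>space_measure c (c + ?d))"
        by (rule integral_compact_support[OF \<rho>c \<rho>0])
      also have "\<dots> = G (c + ?d - c) - G (c - c)"
        using has_real_derivative_shift(1)[OF G(1), where m=1] ed by (intro integral_space_measure \<rho>c) auto
      finally show ?thesis using G(2)[of 0] G(3)[of ?d] ed by simp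
    qed
    have i: "integrable lborel ?\<rho>" by (rule integral_compact_support[OF \<rho>c \<rho>0])
    have ih: "integrable lborel (\<lambda>x. h x * ?\<rho> x)"
      by (rule integral_compact_support[OF continuous_on_mult[OF h \<rho>c], of c "c + ?d"]) (use \<rho>0 in auto)
    have "(\<integral>x. h x * ?\<rho> x \<partial>lborel) - h c = (\<integral>x. (h x - h c) * ?\<rho> x \<partial>lborel)"
      using i ih mass by (simp add: left_diff_distrib)
    then have "norm ((\<integral>x. h x * ?\<rho> x \<partial>lborel) - h c) \<le> (\<integral>x. norm ((h x - h c) * ?\<rho> x) \<partial>lborel)"
      using integral_norm_bound[of lborel "\<lambda>x. (h x - h c) * ?\<rho> x"] by simp
    also have "\<dots> \<le> (\<integral>x. r / 2 * ?\<rho> x \<partial>lborel)"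
    proof (rule integral_mono)
      show "integrable lborel (\<lambda>x. norm ((h x - h c) * ?\<rho> x))" using i ih by (simp add: left_diff_distrib)
      show "integrable lborel (\<lambda>x. r / 2 * ?\<rho> x)" using i by simp
      fix x show "norm ((h x - h c) * ?\<rho> x) \<le> r / 2 * ?\<rho> x"
      proof (cases "?\<rho> x = 0")
        case False
        then have "c < x \<and> x < c + ?d" using \<rho>0 by fastforce
        then have "dist x c < d" using elim by (auto simp: dist_real_def)
        from d(2)[OF this] have "\<bar>h x - h c\<bar> \<le> r / 2" by (simp add: dist_real_def)
        from mult_right_mono[OF this unit_bump_nonneg[of ?e ?d "x - c"]] show ?thesis
          by (simp only: real_norm_def abs_mult abs_of_nonneg[OF unit_bump_nonneg])
      qed simp
    qed
    also have "\<dots> < r" using mass r by simp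
    finally show ?case .
  qed
  then show "\<exists>no. \<forall>n\<ge>no. norm ((\<integral>x. h x * unit_bump (1 / real (Suc n)) (2 / real (Suc n)) (x - c) \<partial>lborel) - h c) < r"
    by (simp add: eventually_sequentially)
qed

text \<open>Jensen's inequality at two points is tested with \<open>\<phi>\<close>, \<open>\<phi>'' = s \<rho>(\<cdot> - x) + (1 - s) \<rho>(\<cdot> - y) - \<rho>(\<cdot> - z)\<close>
  for \<open>z = s x + (1 - s) y\<close>: such a \<open>\<phi>\<close> is nonnegative and compactly supported.\<close>

lemma convex_of_weak_second_derivative:
  assumes f: "continuous_on UNIV f" and w: "weak_deriv test_line lborel [1, 1] f f2"
    and L: "AE x in lborel. - L \<le> f2 x"
  shows "convex_on UNIV (\<lambda>x. f x + L / 2 * x\<^sup>2)"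
proof (rule convex_onI)
  fix s x y :: real assume s: "0 < s" "s < 1"
  let ?h = "\<lambda>x. f x + L / 2 * x\<^sup>2"
  have hc: "continuous_on UNIV ?h" by (intro continuous_intros f)
  define z where "z = (1 - s) * x + s * y"
  let ?\<rho> = "\<lambda>n. unit_bump (1 / real (Suc n)) (2 / real (Suc n))"
  let ?I = "\<lambda>n c. \<integral>\<xi>. ?h \<xi> * ?\<rho> n (\<xi> - c) \<partial>lborel"
  have "0 \<le> (1 - s) * ?I n x + s * ?I n y - ?I n z" for n
  proof -
    let ?e = "1 / real (Suc n)" and ?d = "2 / real (Suc n)"
    have ed: "?e < ?d" "0 < ?e" by (simp_all add: divide_strict_right_mono)
    obtain G where G: "\<And>x. (G has_real_derivative ?\<rho> n x) (at x)"
      "\<And>x. x \<le> ?e \<Longrightarrow> G x = 0" "\<And>x. ?d \<le> x \<Longrightarrow> G x = 1"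
      using unit_bump_antiderivative[OF ed(1)] by metis
    have Gs: "smooth G" using G(1) smooth_unit_bump by (rule smoothI)
    \<comment> \<open>\<open>P\<close> is a convex ramp: constant to the left, of slope 1 to the
      right. Convexity makes \<open>\<phi>\<close> nonnegative, and since \<open>z\<close> is the
      same convex combination of \<open>x\<close> and \<open>y\<close>, the affine parts of the
      three translates cancel far out.\<close>
    obtain P where P: "\<And>x. (P has_real_derivative G x) (at x)"
      using continuous_antiderivative[OF smooth_continuous[OF Gs]] by blast
    have Ps: "smooth P" using P Gs by (rule smoothI)
    have "\<exists>c. \<forall>x\<in>{..<?e}. P x = c"
    proof (rule has_field_derivative_zero_constant)
      fix x assume "x \<in> {..<?e}"
      then show "(P has_real_derivative 0) (at x within {..<?e})"
        using has_field_derivative_at_within[OF P[of x]] G(2)[of x] by simp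
    qed simp
    then obtain c0 where c0: "\<And>x. x < ?e \<Longrightarrow> P x = c0" by auto
    have "\<exists>c. \<forall>x\<in>{?d<..}. P x - x = c"
    proof (rule has_field_derivative_zero_constant)
      fix x assume "x \<in> {?d<..}"
      then show "((\<lambda>x. P x - x) has_real_derivative 0) (at x within {?d<..})"
        using has_field_derivative_at_within[OF DERIV_diff[OF P[of x] DERIV_ident]] G(3)[of x] by simp
    qed simp
    then obtain c1 where c1: "\<And>x. ?d < x \<Longrightarrow> P x - x = c1" by auto
    have conv: "convex_on UNIV P"
      by (rule f''_ge0_imp_convex[OF _ P G(1)]) (auto simp: unit_bump_nonneg)
    define \<phi> where "\<phi> \<xi> = (1 - s) * P (\<xi> - x) + s * P (\<xi> - y) - P (\<xi> - z)" for \<xi>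
    define \<phi>1 where "\<phi>1 \<xi> = (1 - s) * G (\<xi> - x) + s * G (\<xi> - y) - G (\<xi> - z)" for \<xi>
    define \<phi>2 where "\<phi>2 \<xi> = (1 - s) * ?\<rho> n (\<xi> - x) + s * ?\<rho> n (\<xi> - y) - ?\<rho> n (\<xi> - z)" for \<xi>
    have sh: "smooth (\<lambda>x. g (x - c))" if "smooth g" for g c
      using that by (rule smooth_compose) (auto intro: smooth_intros)
    have sm: "smooth \<phi>" "smooth \<phi>1" "smooth \<phi>2"
      unfolding \<phi>_def[abs_def] \<phi>1_def[abs_def] \<phi>2_def[abs_def]
      by (intro smooth_intros sh Ps Gs smooth_unit_bump)+
    have dsh: "((\<lambda>\<xi>. (1 - s) * g (\<xi> - x) + s * g (\<xi> - y) - g (\<xi> - z)) has_real_derivative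
       (1 - s) * g' (\<xi> - x) + s * g' (\<xi> - y) - g' (\<xi> - z)) (at \<xi>)"
      if "\<And>x. (g has_real_derivative g' x) (at x)" for g g' \<xi>
      using has_real_derivative_shift(1)[OF that, where m=1]
      by (intro DERIV_diff DERIV_add DERIV_cmult) auto
    have d1: "(\<phi> has_real_derivative \<phi>1 \<xi>) (at \<xi>)" for \<xi> unfolding \<phi>_def[abs_def] \<phi>1_def by (rule dsh[OF P])
    have d2: "(\<phi>1 has_real_derivative \<phi>2 \<xi>) (at \<xi>)" for \<xi> unfolding \<phi>1_def[abs_def] \<phi>2_def by (rule dsh[OF G(1)])
    have \<phi>0: "0 \<le> \<phi> \<xi>" for \<xi>
    proof -
      have "\<xi> - z = (1 - s) * (\<xi> - x) + s * (\<xi> - y)" by (simp add: z_def algebra_simps)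
      then have "P (\<xi> - z) \<le> (1 - s) * P (\<xi> - x) + s * P (\<xi> - y)"
        using convex_onD[OF conv, of s "\<xi> - x" "\<xi> - y"] s by simp
      then show ?thesis by (simp add: \<phi>_def)
    qed
    define R where "R = \<bar>x\<bar> + \<bar>y\<bar> + \<bar>z\<bar> + ?d + 1"
    have R0: "0 < R" using ed unfolding R_def by linarith
    have out: "\<phi> \<xi> = 0 \<and> \<phi>1 \<xi> = 0 \<and> \<phi>2 \<xi> = 0" if \<xi>: "\<xi> \<notin> {-R<..<R}" for \<xi>
    proof -
      consider "\<xi> \<le> - R" | "R \<le> \<xi>" using \<xi> by fastforce
      then show ?thesis
      proof cases
        case 1
        then have *: "\<xi> - x < ?e" "\<xi> - y < ?e" "\<xi> - z < ?e" using ed unfolding R_def by linarith+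
        show ?thesis using * by (simp add: \<phi>_def \<phi>1_def \<phi>2_def c0 G(2) unit_bump_eq_0 algebra_simps)
      next
        case 2
        then have *: "?d < \<xi> - x" "?d < \<xi> - y" "?d < \<xi> - z" unfolding R_def by linarith+
        have "P (\<xi> - x) = \<xi> - x + c1" "P (\<xi> - y) = \<xi> - y + c1" "P (\<xi> - z) = \<xi> - z + c1"
          using c1[OF *(1)] c1[OF *(2)] c1[OF *(3)] by auto
        then have "\<phi> \<xi> = (1 - s) * (\<xi> - x + c1) + s * (\<xi> - y + c1) - (\<xi> - z + c1)" by (simp only: \<phi>_def)
        also have "\<dots> = 0" by (simp add: z_def algebra_simps)
        finally show ?thesis using * by (simp add: \<phi>1_def \<phi>2_def G(3) unit_bump_eq_0)
      qed
    qed
    have cpt: "compact (closure {x. g x \<noteq> 0})" if "\<And>\<xi>. \<xi> \<notin> {-R<..<R} \<Longrightarrow> g \<xi> = 0" for g :: "real \<Rightarrow> real"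
    proof -
      have "{x. g x \<noteq> 0} \<subseteq> {-R..R}"
      proof
        fix x assume "x \<in> {x. g x \<noteq> 0}"
        then have "x \<in> {-R<..<R}" using that[of x] by blast
        then show "x \<in> {-R..R}" by simp
      qed
      then have "bounded {x. g x \<noteq> 0}" by (rule bounded_subset[rotated]) simp
      then show ?thesis by (simp add: compact_closure)
    qed
    have t0: "\<phi> \<in> test_line" "\<phi>2 \<in> test_line"
    proof -
      have "compact (closure {x. \<phi> x \<noteq> 0})" "compact (closure {x. \<phi>2 x \<noteq> 0})"
        by (rule cpt, use out in blast)+
      then show "\<phi> \<in> test_line" "\<phi>2 \<in> test_line" unfolding test_line_def using C_infinity_real sm by auto
    qed
    have "pderivs [1, 1] \<phi> = (deriv ^^ 2) \<phi>"
      using pderivs_real[OF sm(1), of "[1, 1]"] by (simp add: numeral_2_eq_2)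
    moreover have "deriv \<phi> = \<phi>1" "deriv \<phi>1 = \<phi>2" using d1 d2 by (auto intro!: ext DERIV_imp_deriv)
    ultimately have pd: "pderivs [1, 1] \<phi> = \<phi>2" by (simp add: numeral_2_eq_2)
    have fi: "integrable lborel (\<lambda>x. f x * \<phi>2 x)" "integrable lborel (\<lambda>x. f2 x * \<phi> x)"
      and feq: "(\<integral>x. f x * \<phi>2 x \<partial>lborel) = (\<integral>x. f2 x * \<phi> x \<partial>lborel)"
      using w t0 pd unfolding weak_deriv_def integrable_vs_tests_def by (auto dest!: bspec[OF _ t0(1)])
    have cs: "continuous_on UNIV \<phi>" "continuous_on UNIV \<phi>1" "continuous_on UNIV \<phi>2" using sm by (auto intro: smooth_continuous)
    have \<phi>i: "integrable lborel \<phi>" by (rule integral_compact_support[OF cs(1)]) (use out in auto)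
    have qi: "integrable lborel (\<lambda>x. x\<^sup>2 / 2 * \<phi>2 x)"
      by (rule integral_compact_support[where l="-R" and u=R]) (use out in \<open>auto intro!: continuous_intros cs\<close>)
    \<comment> \<open>Two integrations by parts at once, through the antiderivative
      \<open>x\<^sup>2 / 2 * \<phi>1 x - x * \<phi> x\<close>. Thus \<open>L\<close> times the
      integral of \<open>\<phi>\<close> becomes the quadratic part of \<open>?h\<close> tested with
      \<open>\<phi>2\<close>.\<close>
    have q: "(\<integral>x. x\<^sup>2 / 2 * \<phi>2 x \<partial>lborel) = (\<integral>x. \<phi> x \<partial>lborel)"
    proof -
      have "(\<integral>x. x\<^sup>2 / 2 * \<phi>2 x \<partial>lborel) - (\<integral>x. \<phi> x \<partial>lborel) = (\<integral>x. x\<^sup>2 / 2 * \<phi>2 x - \<phi> x \<partial>lborel)"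
        using \<phi>i qi by simp
      also have "\<dots> = (\<integral>x. x\<^sup>2 / 2 * \<phi>2 x - \<phi> x \<partial>space_measure (-R) R)"
        by (rule integral_compact_support) (use out in \<open>auto intro!: continuous_intros cs\<close>)
      also have "\<dots> = (R\<^sup>2 / 2 * \<phi>1 R - R * \<phi> R) - ((-R)\<^sup>2 / 2 * \<phi>1 (-R) - (-R) * \<phi> (-R))"
      proof (rule integral_space_measure)
        fix x
        have sq: "((\<lambda>x. x\<^sup>2 / 2) has_real_derivative x) (at x)" by (auto intro!: derivative_eq_intros)
        show "((\<lambda>x. x\<^sup>2 / 2 * \<phi>1 x - x * \<phi> x) has_real_derivative (x\<^sup>2 / 2 * \<phi>2 x - \<phi> x)) (at x)"
          by (rule DERIV_cong[OF DERIV_diff[OF DERIV_mult[OF sq d2] DERIV_mult[OF DERIV_ident d1]]]) (simp add: algebra_simps)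
      qed (use R0 in \<open>auto intro!: continuous_intros cs\<close>)
      also have "\<dots> = 0" using out[of R] out[of "-R"] by simp
      finally show ?thesis by simp
    qed
    have "0 \<le> (\<integral>x. f2 x * \<phi> x + L * \<phi> x \<partial>lborel)"
    proof (rule integral_nonneg_AE)
      show "AE x in lborel. 0 \<le> f2 x * \<phi> x + L * \<phi> x" using L
      proof eventually_elim
        case (elim x) then show ?case unfolding distrib_right[symmetric] by (intro mult_nonneg_nonneg \<phi>0) simp
      qed
    qed
    also have "\<dots> = (\<integral>x. f x * \<phi>2 x \<partial>lborel) + L * (\<integral>x. x\<^sup>2 / 2 * \<phi>2 x \<partial>lborel)"
      unfolding feq q using fi \<phi>i by simp
    also have "\<dots> = (\<integral>x. f x * \<phi>2 x + L * (x\<^sup>2 / 2 * \<phi>2 x) \<partial>lborel)"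
    proof -
      have "integrable lborel (\<lambda>x. L * (x\<^sup>2 / 2 * \<phi>2 x))" by (intro integrable_mult_right qi)
      from Bochner_Integration.integral_add[OF fi(1) this] show ?thesis by (simp only: integral_mult_right_zero)
    qed
    also have "\<dots> = (\<integral>\<xi>. (1 - s) * (?h \<xi> * ?\<rho> n (\<xi> - x)) + s * (?h \<xi> * ?\<rho> n (\<xi> - y)) - ?h \<xi> * ?\<rho> n (\<xi> - z) \<partial>lborel)"
    proof (rule Bochner_Integration.integral_cong[OF refl])
      fix \<xi>
      have "L / 2 * \<xi>\<^sup>2 = L * (\<xi>\<^sup>2 / 2)" by simp
      then show "f \<xi> * \<phi>2 \<xi> + L * (\<xi>\<^sup>2 / 2 * \<phi>2 \<xi>) =
        (1 - s) * (?h \<xi> * ?\<rho> n (\<xi> - x)) + s * (?h \<xi> * ?\<rho> n (\<xi> - y)) - ?h \<xi> * ?\<rho> n (\<xi> - z)"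
        by (simp only: \<phi>2_def) (simp only: algebra_simps)
    qed
    also have "\<dots> = (1 - s) * ?I n x + s * ?I n y - ?I n z"
    proof -
      have i: "integrable lborel (\<lambda>\<xi>. ?h \<xi> * ?\<rho> n (\<xi> - c))" for c
      proof (rule integral_compact_support)
        show "continuous_on UNIV (\<lambda>\<xi>. ?h \<xi> * ?\<rho> n (\<xi> - c))"
          by (intro continuous_intros f smooth_continuous sh smooth_unit_bump)
        show "?h \<xi> * ?\<rho> n (\<xi> - c) = 0" if "\<xi> \<notin> {c<..<c + ?d}" for \<xi>
          using that ed unit_bump_eq_0[of "\<xi> - c" ?e ?d] by auto
      qed
      have "(\<integral>\<xi>. (1 - s) * A \<xi> + s * B \<xi> - C \<xi> \<partial>lborel) =
        (1 - s) * (\<integral>\<xi>. A \<xi> \<partial>lborel) + s * (\<integral>\<xi>. B \<xi> \<partial>lborel) - (\<integral>\<xi>. C \<xi> \<partial>lborel)"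
        if "integrable lborel A" "integrable lborel B" "integrable lborel C" for A B C :: "real \<Rightarrow> real"
        using that by simp
      from this[OF i i i] show ?thesis .
    qed
    finally show ?thesis .
  qed
  moreover have "(\<lambda>n. (1 - s) * ?I n x + s * ?I n y - ?I n z) \<longlonglongrightarrow> (1 - s) * ?h x + s * ?h y - ?h z"
    by (intro tendsto_intros unit_bump_shift_integral hc)
  ultimately have "0 \<le> (1 - s) * ?h x + s * ?h y - ?h z"
    by (intro LIMSEQ_le_const) auto
  then show "?h ((1 - s) *\<^sub>R x + s *\<^sub>R y) \<le> (1 - s) * ?h x + s * ?h y" by (simp add: z_def)
qed simp

text \<open>Both \<open>f\<close> and its negative become convex after adding
  \<open>L / 2 * x\<^sup>2\<close>. Supporting lines of the two functions at one point squeeze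
  \<open>f\<close> between parabolas that touch there. This is the quadratic Taylor estimate, and
  differentiability follows from it.\<close>

lemma weak_second_derivative_bounded:
  assumes f: "continuous_on UNIV f" and w: "weak_deriv test_line lborel [1, 1] f f2" and f2: "f2 \<in> Linf lborel"
  obtains L where "0 \<le> L" "\<And>x. (f has_real_derivative deriv f x) (at x)"
    "\<And>x y. \<bar>f y - f x - deriv f x * (y - x)\<bar> \<le> L / 2 * (y - x)\<^sup>2"
    "\<And>x y. \<bar>deriv f y - deriv f x\<bar> \<le> L * \<bar>y - x\<bar>"
proof -
  obtain C where C: "AE x in lborel. \<bar>f2 x\<bar> \<le> C" using f2 by (auto simp: Linf_def)
  define L where "L = \<bar>C\<bar>"
  have L0: "0 \<le> L" by (simp add: L_def)
  have c1: "convex_on UNIV (\<lambda>x. f x + L / 2 * x\<^sup>2)"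
  proof (rule convex_of_weak_second_derivative[OF f w])
    show "AE x in lborel. - L \<le> f2 x" using C by eventually_elim (auto simp: L_def)
  qed
  have w': "weak_deriv test_line lborel [1, 1] (\<lambda>x. - f x) (\<lambda>x. - f2 x)"
    using w by (simp add: weak_deriv_def integrable_vs_tests_def)
  have c2: "convex_on UNIV (\<lambda>x. - f x + L / 2 * x\<^sup>2)"
  proof (rule convex_of_weak_second_derivative[OF continuous_on_minus[OF f] w'])
    show "AE x in lborel. - L \<le> - f2 x" using C by eventually_elim (auto simp: L_def)
  qed
  have "\<exists>m. \<forall>y. \<bar>f y - f x - m * (y - x)\<bar> \<le> L / 2 * (y - x)\<^sup>2" for x
  proof -
    obtain p1 where p1: "\<And>y. f y + L / 2 * y\<^sup>2 \<ge> f x + L / 2 * x\<^sup>2 + p1 * (y - x)"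
      using convex_le_Inf_differential[OF c1, of x] by auto
    obtain p2 where p2: "\<And>y. - f y + L / 2 * y\<^sup>2 \<ge> - f x + L / 2 * x\<^sup>2 + p2 * (y - x)"
      using convex_le_Inf_differential[OF c2, of x] by auto
    \<comment> \<open>Adding the two supporting inequalities at \<open>x + r\<close> cancels
      \<open>f\<close> and leaves a quadratic in \<open>r\<close> that is nonnegative for all
      \<open>r\<close> and vanishes at 0. Its linear coefficient \<open>c\<close> must be zero,
      which ties the two slopes together.\<close>
    define c where "c = 2 * L * x - (p1 + p2)"
    have q: "0 \<le> L * r\<^sup>2 + c * r" for r
    proof -
      have e: "L / 2 * (x + r)\<^sup>2 = L / 2 * x\<^sup>2 + L * x * r + L / 2 * r\<^sup>2"
        by (simp add: power2_eq_square field_simps)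
      have "p1 * r + p2 * r \<le> 2 * (L * x * r) + L * r\<^sup>2"
        using p1[of "x + r"] p2[of "x + r"] unfolding e add_diff_cancel_left' by linarith
      moreover have "c * r = 2 * (L * x * r) - (p1 * r + p2 * r)" by (simp add: c_def algebra_simps)
      ultimately show ?thesis by linarith
    qed
    have "c = 0"
    proof (rule ccontr)
      assume "c \<noteq> 0"
      have L1: "0 < L + 1" using L0 by simp
      \<comment> \<open>The choice \<open>r = - k\<close> turns the quadratic into
        \<open>- k\<^sup>2\<close>; dividing by \<open>L + 1\<close> also covers
        \<open>L = 0\<close>.\<close>
      define k where "k = c / (L + 1)"
      have ck: "c = k * (L + 1)" using L1 by (simp add: k_def)
      have "0 \<le> L * (- k)\<^sup>2 + c * (- k)" by (rule q)
      also have "\<dots> = - k\<^sup>2" unfolding ck by (simp add: power2_eq_square algebra_simps)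
      finally have "k\<^sup>2 \<le> 0" by simp
      then show False using \<open>c \<noteq> 0\<close> ck by simp
    qed
    then have p: "p2 = 2 * L * x - p1" by (simp add: c_def)
    have "\<bar>f y - f x - (p1 - L * x) * (y - x)\<bar> \<le> L / 2 * (y - x)\<^sup>2" for y
    proof -
      have sq: "L / 2 * (y - x)\<^sup>2 = L / 2 * y\<^sup>2 - L / 2 * x\<^sup>2 - L * x * (y - x)"
        by (simp add: power2_eq_square field_simps)
      have a: "(p1 - L * x) * (y - x) = p1 * (y - x) - L * x * (y - x)" by (simp add: left_diff_distrib)
      have b: "p2 * (y - x) = 2 * (L * x * (y - x)) - p1 * (y - x)" by (simp add: p algebra_simps)
      show ?thesis using p1[of y] p2[of y] unfolding sq a b by linarith
    qed
    then show ?thesis by blast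
  qed
  then obtain m where m: "\<And>x y. \<bar>f y - f x - m x * (y - x)\<bar> \<le> L / 2 * (y - x)\<^sup>2" by metis
  have dm: "(f has_real_derivative m x) (at x)" for x
    unfolding has_field_derivative_iff
  proof (rule LIM_zero_cancel, rule Lim_null_comparison)
    show "\<forall>\<^sub>F y in at x. norm ((f y - f x) / (y - x) - m x) \<le> L / 2 * \<bar>y - x\<bar>"
      unfolding eventually_at_filter
    proof (rule always_eventually, intro allI impI)
      fix y assume "y \<noteq> x"
      then have "(f y - f x) / (y - x) - m x = (f y - f x - m x * (y - x)) / (y - x)" by (simp add: field_simps)
      then have "norm ((f y - f x) / (y - x) - m x) \<le> L / 2 * (y - x)\<^sup>2 / \<bar>y - x\<bar>"
        using divide_right_mono[OF m[of y x] abs_ge_zero[of "y - x"]] by simp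
      also have "\<dots> = L / 2 * \<bar>y - x\<bar>"
      proof -
        have e: "L / 2 * (y - x)\<^sup>2 = L / 2 * \<bar>y - x\<bar> * \<bar>y - x\<bar>" by (simp add: power2_eq_square mult.assoc)
        have "\<bar>y - x\<bar> \<noteq> 0" using \<open>y \<noteq> x\<close> by simp
        then show ?thesis unfolding e by (rule nonzero_mult_div_cancel_right)
      qed
      finally show "norm ((f y - f x) / (y - x) - m x) \<le> L / 2 * \<bar>y - x\<bar>" .
    qed
    have "((\<lambda>y. L / 2 * \<bar>y - x\<bar>) \<longlongrightarrow> L / 2 * \<bar>x - x\<bar>) (at x)" by (intro tendsto_intros)
    then show "((\<lambda>y. L / 2 * \<bar>y - x\<bar>) \<longlongrightarrow> 0) (at x)" by simp
  qed
  then have md: "m = deriv f" by (intro ext DERIV_imp_deriv[symmetric])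
  show ?thesis
  proof (rule that[OF L0])
    fix x y
    show "(f has_real_derivative deriv f x) (at x)" "\<bar>f y - f x - deriv f x * (y - x)\<bar> \<le> L / 2 * (y - x)\<^sup>2"
      using dm m md by auto
    have "\<bar>(m y - m x) * (y - x)\<bar> \<le> L * (y - x)\<^sup>2"
    proof -
      have e: "L / 2 * (x - y)\<^sup>2 = L / 2 * (y - x)\<^sup>2" by (simp add: power2_commute)
      \<comment> \<open>Adding the Taylor estimates based at \<open>x\<close> and at
        \<open>y\<close> cancels the values of \<open>f\<close> and leaves the difference of
        slopes.\<close>
      have eq: "(m y - m x) * (y - x) = (f y - f x - m x * (y - x)) + (f x - f y - m y * (x - y))" by (simp add: algebra_simps)
      show ?thesis unfolding eq using m[of y x] m[of x y] e by linarith
    qed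
    then have "\<bar>m y - m x\<bar> * \<bar>y - x\<bar> \<le> (L * \<bar>y - x\<bar>) * \<bar>y - x\<bar>" by (simp add: abs_mult power2_eq_square mult.assoc)
    then show "\<bar>deriv f y - deriv f x\<bar> \<le> L * \<bar>y - x\<bar>"
      unfolding md[symmetric] by (cases "y = x") (auto simp: mult_le_cancel_right)
  qed
qed

section \<open>The chain rule\<close>

lemma primitive_continuous:
  assumes v: "integrable (space_measure c d) v"
  shows "continuous_on UNIV (primitive c d v)"
  unfolding continuous_on_sequentially
proof (intro allI ballI impI, elim conjE)
  fix t s assume s: "s \<longlonglongrightarrow> (t::real)"
  let ?I = "space_measure c d"
  note id_borel_space_measure[measurable]
  have [measurable]: "v \<in> borel_measurable ?I" using v by auto
  have "(\<lambda>n. \<integral>y. (if y < s n then v y else 0) \<partial>?I) \<longlonglongrightarrow> (\<integral>y. (if y < t then v y else 0) \<partial>?I)"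
  proof (rule integral_dominated_convergence[where w="\<lambda>y. \<bar>v y\<bar>"])
    have "AE y in lborel. y \<noteq> t" by (rule AE_lborel_singleton)
    then have "AE y in ?I. y \<noteq> t" unfolding space_measure_def by (subst AE_restrict_space_iff) auto
    then show "AE y in ?I. (\<lambda>n. if y < s n then v y else 0) \<longlonglongrightarrow> (if y < t then v y else 0)"
    proof eventually_elim
      case (elim y)
      consider "y < t" | "t < y" using elim by linarith
      then show ?case
      proof cases
        case 1
        have "\<forall>\<^sub>F n in sequentially. y < s n" by (rule order_tendstoD(1)[OF s 1])
        then show ?thesis by (intro tendsto_eventually, elim eventually_mono) (use 1 in auto)
      next
        case 2
        have "\<forall>\<^sub>F n in sequentially. s n < y" by (rule order_tendstoD(2)[OF s 2])
        then show ?thesis by (intro tendsto_eventually, elim eventually_mono) (use 2 in auto)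
      qed
    qed
  qed (use v in auto)
  then show "(primitive c d v \<circ> s) \<longlonglongrightarrow> primitive c d v t" by (simp add: primitive_def o_def)
qed

context periodic_domain begin

text \<open>For almost every \<open>t\<close> the section of \<open>uxx\<close> is integrable, so
  \<open>ux\<close> has a continuous representative \<open>W\<close> and \<open>u\<close> a
  continuously differentiable one \<open>U\<close>; there the classical chain rule applies. The zero
  mean of \<open>ux\<close> gives \<open>U b = U a\<close>, and the boundary terms cancel.\<close>

lemma chain_rule_section:
  assumes u: "u \<in> L2 MQ" "ux \<in> L2 MQ" "uxx \<in> L2 MQ" "weak 0 1 u ux" "weak 0 1 ux uxx"
    and F: "\<And>y. (F has_real_derivative F' y) (at y)" "continuous_on UNIV F'"
    and \<beta>: "periodic_smooth \<beta>"
  shows "AE t in MT. (\<integral>x. F' (u (t, x)) * ux (t, x) * \<beta> x + F (u (t, x)) * deriv \<beta> x \<partial>MX) = 0"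
proof -
  obtain c0 where c0: "AE p in MQ. u p = c0 (fst p) + prim_x ux p" "AE t in MT. (\<integral>x. ux (t, x) \<partial>MX) = 0"
    using space_representation[OF u(1,2,4)] by metis
  obtain c1 where c1: "AE p in MQ. ux p = c1 (fst p) + prim_x uxx p"
    using space_representation[OF u(2,3,5)] by metis
  have i: "integrable (MT \<Otimes>\<^sub>M MX) (\<lambda>(t, x). uxx (t, x))" using KQ.fm.L2_integrable[OF u(3)] by (simp add: MQ_def)
  have F'm: "F' \<in> borel_measurable borel" "F \<in> borel_measurable borel"
    using F DERIV_isCont by (auto intro!: borel_measurable_continuous_onI continuous_at_imp_continuous_on)
  have um: "u \<in> borel_measurable (MT \<Otimes>\<^sub>M MX)" "ux \<in> borel_measurable (MT \<Otimes>\<^sub>M MX)"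
    using u L2_measurable unfolding MQ_def by blast+
  have s: "smooth \<beta>" "smooth (deriv \<beta>)" using \<beta> by (auto intro: periodic_smooth_smooth smoothD)
  show ?thesis
    using TX.AE_pair[OF c0(1)[unfolded MQ_def]] TX.AE_pair[OF c1[unfolded MQ_def]] c0(2) TX.AE_integrable_fst[OF i] AE_space
  proof eventually_elim
    case (elim t)
    define W where "W x = c1 t + primitive a b (\<lambda>y. uxx (t, y)) x" for x
    have Wc: "continuous_on UNIV W"
      unfolding W_def[abs_def] using elim(4) by (intro continuous_intros primitive_continuous) (simp add: MX_def)
    have uW: "AE x in MX. ux (t, x) = W x" using elim(2) by (simp add: W_def prim_x_def)
    obtain V where V: "\<And>x. (V has_real_derivative W x) (at x)" using continuous_antiderivative[OF Wc] by blast
    define U where "U x = c0 t + V x - V a" for x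
    have dU: "(U has_real_derivative W x) (at x)" for x
      unfolding U_def[abs_def] using DERIV_diff[OF DERIV_add[OF DERIV_const V] DERIV_const] by simp
    have tm: "(\<lambda>x. (t, x)) \<in> measurable MX (MT \<Otimes>\<^sub>M MX)" using elim(5) by (rule measurable_Pair1')
    have m: "(\<lambda>x. u (t, x)) \<in> borel_measurable MX" "(\<lambda>x. ux (t, x)) \<in> borel_measurable MX"
      using measurable_compose[OF tm um(1)] measurable_compose[OF tm um(2)] by auto
    have Wm: "W \<in> borel_measurable MX" unfolding MX_def
      by (intro borel_space_measure borel_measurable_continuous_onI Wc)
    have uU: "AE x in MX. u (t, x) = U x" using elim(1) AE_space
    proof eventually_elim
      case (elim x)
      have "primitive a b (\<lambda>y. ux (t, y)) x = (\<integral>y. (if y < x then W y else 0) \<partial>MX)"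
        unfolding primitive_def MX_def[symmetric]
      proof (rule integral_cong_AE)
        have [measurable]: "(\<lambda>y. y) \<in> borel_measurable MX" unfolding MX_def by (rule id_borel_space_measure)
        note m(2)[measurable] Wm[measurable]
        show "(\<lambda>y. if y < x then ux (t, y) else 0) \<in> borel_measurable MX" by measurable
        show "(\<lambda>y. if y < x then W y else 0) \<in> borel_measurable MX" by measurable
        show "AE y in MX. (if y < x then ux (t, y) else 0) = (if y < x then W y else 0)"
          using uW by eventually_elim simp
      qed
      also have "\<dots> = V x - V a"
        unfolding MX_def using elim(2) by (intro integral_space_measure_below V Wc) simp
      finally show ?case using elim(1) by (simp add: prim_x_def U_def)
    qed
    have "V b - V a = (\<integral>x. W x \<partial>MX)"
      unfolding MX_def using ab by (intro integral_space_measure[symmetric] V Wc) auto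
    also have "\<dots> = (\<integral>x. ux (t, x) \<partial>MX)"
    proof (rule integral_cong_AE[OF Wm m(2)])
      show "AE x in MX. W x = ux (t, x)" using uW by eventually_elim simp
    qed
    finally have UU: "U b = U a" using elim(3) by (simp add: U_def)
    have bm: "\<beta> \<in> borel_measurable MX" "deriv \<beta> \<in> borel_measurable MX" by (intro smooth_MX s)+
    have Uc: "continuous_on UNIV U" using dU DERIV_isCont by (auto intro!: continuous_at_imp_continuous_on)
    have Fc: "continuous_on UNIV F" using F(1) DERIV_isCont by (auto intro!: continuous_at_imp_continuous_on)
    have cont: "continuous_on UNIV (\<lambda>x. F' (U x) * W x * \<beta> x + F (U x) * deriv \<beta> x)"
      by (intro continuous_intros Wc smooth_continuous s continuous_on_compose2[OF F(2) Uc] continuous_on_compose2[OF Fc Uc]) auto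
    have "(\<integral>x. F' (u (t, x)) * ux (t, x) * \<beta> x + F (u (t, x)) * deriv \<beta> x \<partial>MX) =
      (\<integral>x. F' (U x) * W x * \<beta> x + F (U x) * deriv \<beta> x \<partial>MX)"
    proof (rule integral_cong_AE)
      show "(\<lambda>x. F' (u (t, x)) * ux (t, x) * \<beta> x + F (u (t, x)) * deriv \<beta> x) \<in> borel_measurable MX"
        by (intro borel_measurable_add borel_measurable_times measurable_compose[OF m(1) F'm(1)] measurable_compose[OF m(1) F'm(2)] m bm)
      show "(\<lambda>x. F' (U x) * W x * \<beta> x + F (U x) * deriv \<beta> x) \<in> borel_measurable MX"
        unfolding MX_def by (intro borel_space_measure borel_measurable_continuous_onI cont)
      show "AE x in MX. F' (u (t, x)) * ux (t, x) * \<beta> x + F (u (t, x)) * deriv \<beta> x = F' (U x) * W x * \<beta> x + F (U x) * deriv \<beta> x"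
        using uU uW by eventually_elim simp
    qed
    also have "\<dots> = F (U b) * \<beta> b - F (U a) * \<beta> a"
      unfolding MX_def
    proof (rule integral_space_measure)
      fix x
      show "((\<lambda>x. F (U x) * \<beta> x) has_real_derivative F' (U x) * W x * \<beta> x + F (U x) * deriv \<beta> x) (at x)"
        by (rule DERIV_cong[OF DERIV_mult[OF DERIV_chain2[where f=F, OF F(1) dU] smoothD(1)[OF s(1)]]]) (simp add: algebra_simps)
    qed (use ab cont in auto)
    also have "\<dots> = 0" using UU \<beta>[unfolded periodic_smooth_def, THEN conjunct2, rule_format, of a] by simp
    finally show ?case .
  qed
qed

lemma chain_rule:
  assumes u: "u \<in> L2 MQ" "ux \<in> L2 MQ" "uxx \<in> L2 MQ" "weak 0 1 u ux" "weak 0 1 ux uxx"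
    and F: "\<And>y. (F has_real_derivative F' y) (at y)" "continuous_on UNIV F'"
    and i: "integrable MQ (\<lambda>p. F' (u p) * ux p)" "integrable MQ (\<lambda>p. F (u p))"
    and \<alpha>: "smooth \<alpha>" and \<beta>: "periodic_smooth \<beta>"
  shows "(\<integral>p. F (u p) * (\<alpha> (fst p) * deriv \<beta> (snd p)) \<partial>MQ) = - (\<integral>p. F' (u p) * ux p * (\<alpha> (fst p) * \<beta> (snd p)) \<partial>MQ)"
proof -
  have s: "smooth \<beta>" "smooth (deriv \<beta>)" using \<beta> by (auto intro: periodic_smooth_smooth smoothD)
  have i': "integrable MQ (\<lambda>p. F (u p) * (\<alpha> (fst p) * deriv \<beta> (snd p)))" "integrable MQ (\<lambda>p. F' (u p) * ux p * (\<alpha> (fst p) * \<beta> (snd p)))"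
    by (intro integrable_product_test i \<alpha> s)+
  then have j: "integrable (MT \<Otimes>\<^sub>M MX) (\<lambda>(t, x). F' (u (t, x)) * ux (t, x) * (\<alpha> t * \<beta> x) + F (u (t, x)) * (\<alpha> t * deriv \<beta> x))"
    by (simp add: MQ_def case_prod_unfold)
  have "(\<integral>p. F' (u p) * ux p * (\<alpha> (fst p) * \<beta> (snd p)) + F (u p) * (\<alpha> (fst p) * deriv \<beta> (snd p)) \<partial>MQ) =
    (\<integral>t. \<integral>x. F' (u (t, x)) * ux (t, x) * (\<alpha> t * \<beta> x) + F (u (t, x)) * (\<alpha> t * deriv \<beta> x) \<partial>MX \<partial>MT)"
    using TX.integral_fst[OF j] by (simp add: MQ_def case_prod_unfold)
  also have "\<dots> = (\<integral>t. 0 \<partial>MT)"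
  proof (rule integral_cong_AE)
    show "(\<lambda>t. \<integral>x. F' (u (t, x)) * ux (t, x) * (\<alpha> t * \<beta> x) + F (u (t, x)) * (\<alpha> t * deriv \<beta> x) \<partial>MX) \<in> borel_measurable MT"
      using TX.integrable_fst[OF j] by auto
    show "AE t in MT. (\<integral>x. F' (u (t, x)) * ux (t, x) * (\<alpha> t * \<beta> x) + F (u (t, x)) * (\<alpha> t * deriv \<beta> x) \<partial>MX) = 0"
      using chain_rule_section[OF u F \<beta>]
    proof eventually_elim
      case (elim t)
      have "(\<integral>x. F' (u (t, x)) * ux (t, x) * (\<alpha> t * \<beta> x) + F (u (t, x)) * (\<alpha> t * deriv \<beta> x) \<partial>MX) =
        (\<integral>x. \<alpha> t * (F' (u (t, x)) * ux (t, x) * \<beta> x + F (u (t, x)) * deriv \<beta> x) \<partial>MX)"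
        by (intro Bochner_Integration.integral_cong refl) (simp add: algebra_simps)
      then show ?case using elim by simp
    qed
  qed simp
  finally show ?thesis using i' by simp
qed

section \<open>Initial values\<close>

lemma AE_MQ_swap: assumes "AE p in MQ. Q p" shows "AE x in MX. AE t in MT. Q (t, x)"
proof -
  have "AE p in distr (MX \<Otimes>\<^sub>M MT) (MT \<Otimes>\<^sub>M MX) (\<lambda>(x, y). (y, x)). Q p"
    using assms unfolding MQ_def by (subst TX.distr_pair_swap[symmetric])
  then have "AE p in MX \<Otimes>\<^sub>M MT. Q ((\<lambda>(x, y). (y, x)) p)"
    by (rule AE_distrD[rotated]) (rule measurable_pair_swap')
  from PX.P.AE_pair[OF this] show ?thesis by simp
qed

text \<open>For almost every \<open>x\<close>, the continuous representative and the representation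
  are both continuous in \<open>t\<close> up to 0 and agree for almost every \<open>t\<close>. Were
  they different at 0, they would differ on a time interval of positive length.\<close>

lemma initial_trace_unique:
  assumes tr: "initial_trace T a b w g" and rep: "AE p in MQ. w p = w0 (snd p) + prim_t wt p" and wt: "wt \<in> L2 MQ"
  shows "AE x in MX. g x = w0 x"
proof -
  obtain w' where w': "continuous_on ({0..<T} \<times> {a<..<b}) w'" "AE p in MQ. w p = w' p" "AE x in MX. g x = w' (0, x)"
    using tr unfolding initial_trace_def st_measure_MQ MX_def by auto
  have "AE p in MQ. w' p = w0 (snd p) + prim_t wt p" using rep w'(2) by eventually_elim simp
  from AE_MQ_swap[OF this] have "AE x in MX. AE t in MT. w' (t, x) = w0 x + primitive 0 T (\<lambda>s. wt (s, x)) t"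
    by (simp add: prim_t_def)
  moreover have "AE x in MX. (\<lambda>s. wt (s, x)) \<in> L2 MT" using PT.section_L2(1)[of wt] wt by (simp add: MQ_def)
  ultimately show ?thesis using w'(3) AE_space
  proof eventually_elim
    case (elim x)
    define D where "D t = w' (t, x) - (w0 x + primitive 0 T (\<lambda>s. wt (s, x)) t)" for t
    have "integrable (space_measure 0 T) (\<lambda>s. wt (s, x))" using KT.fm.L2_integrable[OF elim(2)] by (simp add: MT_def)
    then have "continuous_on {0..<T} (primitive 0 T (\<lambda>s. wt (s, x)))"
      by (intro continuous_on_subset[OF primitive_continuous]) auto
    moreover have "continuous_on {0..<T} (\<lambda>t. w' (t, x))"
      by (rule continuous_on_compose2[OF w'(1)]) (use elim(4) in \<open>auto intro!: continuous_intros\<close>)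
    ultimately have Dc: "continuous_on {0..<T} D" unfolding D_def[abs_def] by (intro continuous_intros)
    have "D 0 = 0"
    proof (rule ccontr)
      assume "D 0 \<noteq> 0"
      then obtain d where d: "0 < d" "\<And>t. t \<in> {0..<T} \<Longrightarrow> dist t 0 < d \<Longrightarrow> dist (D t) (D 0) < \<bar>D 0\<bar>"
        using Dc[unfolded continuous_on_iff, rule_format, of 0 "\<bar>D 0\<bar>"] T by auto
      define m where "m = min (d / 2) (T / 2)"
      have m: "0 < m" "m < d" "m < T" using d T by (auto simp: m_def)
      have "(\<integral>t. (if t < m then 1 else (0::real)) \<partial>MT) = (\<integral>t. 0 \<partial>MT)"
      proof (rule integral_cong_AE)
        show "(\<lambda>t. if t < m then 1 else (0::real)) \<in> borel_measurable MT"
          unfolding MT_def by (rule borel_space_measure) measurable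
        show "AE t in MT. (if t < m then 1 else (0::real)) = 0" using elim(1) AE_space
        proof eventually_elim
          case (elim t)
          have "\<not> t < m"
          proof
            assume "t < m"
            then have "dist (D t) (D 0) < \<bar>D 0\<bar>" using elim(2) m by (intro d(2)) (auto simp: dist_real_def)
            then show False using elim(1) by (simp add: D_def dist_real_def)
          qed
          then show ?case by simp
        qed
      qed simp
      moreover have "(\<integral>t. (if t < m then 1 else (0::real)) \<partial>MT) = m - 0"
        unfolding MT_def using m by (intro integral_space_measure_below[where G="\<lambda>x. x"]) auto
      ultimately show False using m by simp
    qed
    moreover have "primitive 0 T (\<lambda>s. wt (s, x)) 0 = 0"
    proof -
      have "primitive 0 T (\<lambda>s. wt (s, x)) 0 = (\<integral>s. 0 \<partial>space_measure 0 T)"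
        unfolding primitive_def by (rule Bochner_Integration.integral_cong) auto
      then show ?thesis by simp
    qed
    ultimately show ?case using elim(3) by (simp add: D_def)
  qed
qed

text \<open>The law for \<open>u\<close> is tested with \<open>deriv \<beta>\<close> and the law for
  \<open>ux\<close> with \<open>\<beta>\<close>, both with a cut-off \<open>\<alpha>\<close> equal
  to 1 at time 0. The integrals over space-time cancel after moving one x-derivative, and the
  initial terms say that \<open>v0\<close> is the weak derivative of \<open>u0\<close>.\<close>

lemma initial_derivative_unique:
  assumes u: "H1 u ut ux u0" and ux: "H1 ux utx uxx v0" and utx: "weak 0 1 ut utx"
    and u0x: "weak_deriv (test_space a b) (space_measure a b) [1] u0 u0x"
  shows "AE x in MX. u0x x = v0 x"
proof -
  have L: "u \<in> L2 MQ" "ut \<in> L2 MQ" "ux \<in> L2 MQ" "utx \<in> L2 MQ" "v0 \<in> L2 MX" "weak 0 1 u ux"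
    using u ux by (auto simp: H1_def)
  have "T / 3 < 2 * T / 3" using T by simp
  then obtain G where G: "\<And>x. (G has_real_derivative unit_bump (T / 3) (2 * T / 3) x) (at x)"
    "\<And>x. x \<le> T / 3 \<Longrightarrow> G x = 0" "\<And>x. 2 * T / 3 \<le> x \<Longrightarrow> G x = 1"
    using unit_bump_antiderivative by metis
  have Gs: "smooth G" using G(1) smooth_unit_bump by (rule smoothI)
  define \<alpha> where "\<alpha> t = 1 - G t" for t
  have \<alpha>: "test_t0 \<alpha>"
    unfolding test_t0_def \<alpha>_def[abs_def] using T
    by (intro conjI smooth_intros Gs exI[of _ "2 * T / 3"]) (auto simp: G(3))
  have \<alpha>0: "\<alpha> 0 = 1" using G(2)[of 0] T by (simp add: \<alpha>_def)
  have \<alpha>s: "smooth \<alpha>" "smooth (deriv \<alpha>)" using \<alpha> by (auto intro: test_t0_smooth smoothD)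
  have eq: "(\<integral>x. v0 x * \<beta> x \<partial>MX) = (\<integral>x. u0x x * \<beta> x \<partial>MX)" if \<beta>: "periodic_smooth \<beta>" for \<beta>
  proof -
    have \<beta>': "periodic_smooth (deriv \<beta>)" by (rule periodic_smooth_deriv[OF \<beta>])
    have 1: "(\<integral>p. ux p * (deriv \<alpha> (fst p) * \<beta> (snd p)) \<partial>MQ) + (\<integral>p. utx p * (\<alpha> (fst p) * \<beta> (snd p)) \<partial>MQ) + (\<integral>x. v0 x * \<beta> x \<partial>MX) = 0"
      using H1_weak_form_time[OF ux] \<alpha> \<beta> \<alpha>0 unfolding weak_form_def by force
    have 2: "(\<integral>p. u p * (deriv \<alpha> (fst p) * deriv \<beta> (snd p)) \<partial>MQ) + (\<integral>p. ut p * (\<alpha> (fst p) * deriv \<beta> (snd p)) \<partial>MQ) + (\<integral>x. u0 x * deriv \<beta> x \<partial>MX) = 0"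
      using H1_weak_form_time[OF u] \<alpha> \<beta>' \<alpha>0 unfolding weak_form_def by force
    have "pderivs [1] \<beta> = deriv \<beta>" using pderivs_real[OF periodic_smooth_smooth[OF \<beta>], of "[1]"] by simp
    then have 3: "(\<integral>x. u0 x * deriv \<beta> x \<partial>MX) = - (\<integral>x. u0x x * \<beta> x \<partial>MX)"
      using u0x test_space_periodic[OF \<beta>] unfolding weak_deriv_def MX_def[symmetric] by force
    show ?thesis
      using 1 2 3 weak_space_all[OF L(1,3,6) \<alpha>s(2) \<beta>] weak_space_all[OF L(2,4) utx \<alpha>s(1) \<beta>] by linarith
  qed
  have i: "integrable MX v0" "integrable MX u0x"
    using KX.fm.L2_integrable[OF L(5)] u0x test_space_periodic[OF periodic_smooth_const[of 1]]
    unfolding weak_deriv_def integrable_vs_tests_def MX_def[symmetric] by force+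
  have "AE x in MX. u0x x - v0 x = 0"
  proof (rule KX.AE_0_of_kernel_0)
    show "integrable MX (\<lambda>x. u0x x - v0 x)" using i by simp
    show "AE x in MX. \<forall>\<^sub>F n in sequentially. (\<integral>y. (u0x y - v0 y) * space_kernel a b n x y \<partial>MX) = 0"
    proof (rule AE_I2, rule always_eventually, rule allI)
      fix x n
      have k: "periodic_smooth (\<lambda>y. space_kernel a b n x y)" by (rule space_kernel_test)
      obtain B where B: "\<forall>y\<in>{a..b}. \<bar>space_kernel a b n x y\<bar> \<le> B" using smooth_bounded_interval[OF periodic_smooth_smooth[OF k]] by blast
      have j: "integrable MX (\<lambda>y. h y * space_kernel a b n x y)" if "integrable MX h" for h
        by (rule integrable_bounded_mult(2)[OF that smooth_MX[OF periodic_smooth_smooth[OF k]], of B]) (use B in \<open>auto intro!: AE_I2\<close>)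
      show "(\<integral>y. (u0x y - v0 y) * space_kernel a b n x y \<partial>MX) = 0"
        using eq[OF k] i by (simp add: left_diff_distrib j)
    qed
  qed
  then show ?thesis by eventually_elim simp
qed

lemma H1_cong_initial:
  assumes "H1 w wt wx w0" "AE x in MX. g x = w0 x" "g \<in> borel_measurable MX"
  shows "H1 w wt wx g"
proof -
  have "w0 \<in> L2 MX" using assms(1) by (simp add: H1_def)
  moreover have "AE x in MX. w0 x = g x" using assms(2) by eventually_elim simp
  ultimately have 1: "g \<in> L2 MX" using L2_AE_cong[OF _ assms(3)] by blast
  have 2: "AE p in MQ. g (snd p) = w0 (snd p)" unfolding MQ_def by (rule TX.AE_pair_snd[OF assms(2)])
  have "AE p in MQ. w p = w0 (snd p) + prim_t wt p" using assms(1) by (simp add: H1_def)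
  with 2 have "AE p in MQ. w p = g (snd p) + prim_t wt p" by eventually_elim simp
  with 1 show ?thesis using assms(1) unfolding H1_def by blast
qed

text \<open>Applied to u_ttx, this bounds the correction in \<open>v1\<close> at almost every fixed
  time, uniformly, as is required to return from \<open>v1\<close> to u_x in the final norm.\<close>

lemma H1_time_slice_bound:
  assumes w: "H1 w wt wx w0"
  shows "AE t in MT. integrable MX (\<lambda>x. (w (t, x))\<^sup>2) \<and>
    (\<integral>x. (w (t, x))\<^sup>2 \<partial>MX) \<le> 2 * (\<integral>x. (w0 x)\<^sup>2 \<partial>MX) + 2 * T * (\<integral>p. (wt p)\<^sup>2 \<partial>MQ)"
proof -
  have L: "w \<in> L2 MQ" "wt \<in> L2 MQ" "w0 \<in> L2 MX" and rep: "AE p in MQ. w p = w0 (snd p) + prim_t wt p"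
    using w by (auto simp: H1_def)
  define m where "m y = (\<integral>s. (wt (s, y))\<^sup>2 \<partial>MT)" for y
  have mi: "integrable MX m" unfolding m_def using PT.section_L2(2)[of wt] L(2) by (simp add: MQ_def)
  have mint: "(\<integral>y. m y \<partial>MX) = (\<integral>p. (wt p)\<^sup>2 \<partial>MQ)"
    unfolding m_def using TX.integral_snd[of "\<lambda>s y. (wt (s, y))\<^sup>2"] L2_square[OF L(2)] by (simp add: MQ_def case_prod_unfold)
  have "AE p in MQ. (prim_t wt p)\<^sup>2 \<le> (fst p - 0) * m (snd p)"
    using PT.prim_bound[of wt] L(2) unfolding prim_t_eq MQ_def m_def by simp
  then have "AE p in MQ. (w p)\<^sup>2 \<le> 2 * (w0 (snd p))\<^sup>2 + 2 * T * m (snd p)" using rep AE_space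
  proof eventually_elim
    case (elim p)
    have "0 \<le> m (snd p)" by (simp add: m_def)
    then have "fst p * m (snd p) \<le> T * m (snd p)" using elim(3) by (intro mult_right_mono) auto
    moreover have "0 \<le> (w0 (snd p) - prim_t wt p)\<^sup>2" by simp
    ultimately show ?case using elim(1) unfolding elim(2) power2_sum power2_diff by simp
  qed
  from TX.AE_pair[OF this[unfolded MQ_def]]
  have 1: "AE t in MT. AE x in MX. (w (t, x))\<^sup>2 \<le> 2 * (w0 x)\<^sup>2 + 2 * T * m x" by simp
  have i: "integrable (MT \<Otimes>\<^sub>M MX) (\<lambda>(t, x). (w (t, x))\<^sup>2)" using L2_square[OF L(1)] by (simp add: MQ_def case_prod_unfold)
  show ?thesis using 1 TX.AE_integrable_fst[OF i]
  proof eventually_elim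
    case (elim t)
    have "(\<integral>x. (w (t, x))\<^sup>2 \<partial>MX) \<le> (\<integral>x. 2 * (w0 x)\<^sup>2 + 2 * T * m x \<partial>MX)"
      using elim L2_square[OF L(3)] mi by (intro integral_mono_AE) auto
    also have "\<dots> = 2 * (\<integral>x. (w0 x)\<^sup>2 \<partial>MX) + 2 * T * (\<integral>p. (wt p)\<^sup>2 \<partial>MQ)"
      using L2_square[OF L(3)] mi by (simp add: mint)
    finally show ?case using elim(2) by simp
  qed
qed

section \<open>The relative energy inequality\<close>

lemma weak_formI:
  assumes "A \<in> L2 MQ" "B \<in> L2 MQ" "C \<in> L2 MQ" "g \<in> L2 MX"
    and "\<And>\<alpha> \<beta>. test_t0 \<alpha> \<Longrightarrow> periodic_smooth \<beta> \<Longrightarrow>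
      (\<integral>p. A p * (deriv \<alpha> (fst p) * \<beta> (snd p)) + B p * (\<alpha> (fst p) * deriv \<beta> (snd p)) + C p * (\<alpha> (fst p) * \<beta> (snd p)) \<partial>MQ)
      + (\<integral>x. g x * (\<alpha> 0 * \<beta> x) \<partial>MX) = 0"
  shows "weak_form A B C g"
  unfolding weak_form_def
proof (intro conjI allI impI)
  fix \<alpha> \<beta> assume t: "test_t0 \<alpha>" "periodic_smooth \<beta>"
  have s: "smooth \<alpha>" "smooth \<beta>" "smooth (deriv \<alpha>)" "smooth (deriv \<beta>)"
    using t by (auto intro: test_t0_smooth periodic_smooth_smooth smoothD)
  have i: "integrable MQ (\<lambda>p. h p * (\<alpha>' (fst p) * \<beta>' (snd p)))" if "h \<in> L2 MQ" "smooth \<alpha>'" "smooth \<beta>'" for h \<alpha>' \<beta>'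
    by (intro KQ.fm.L2_integrable L2_product_test that)
  have "(\<integral>x. g x * (\<alpha> 0 * \<beta> x) \<partial>MX) = (\<integral>x. \<alpha> 0 * (g x * \<beta> x) \<partial>MX)" by (simp add: mult_ac)
  then show "(\<integral>p. A p * (deriv \<alpha> (fst p) * \<beta> (snd p)) \<partial>MQ) + (\<integral>p. B p * (\<alpha> (fst p) * deriv \<beta> (snd p)) \<partial>MQ) +
      (\<integral>p. C p * (\<alpha> (fst p) * \<beta> (snd p)) \<partial>MQ) + \<alpha> 0 * (\<integral>x. g x * \<beta> x \<partial>MX) = 0"
    using assms(5)[OF t] by (simp add: i assms s)
qed (use assms in auto)

lemma weak_solution_weak_forms:
  assumes sol: "weak_solution f T a b \<tau> q0in q1in q2in q0 q1 q2"
    and q: "q0 \<in> L2 MQ" "q1 \<in> L2 MQ" "q2 \<in> L2 MQ" "(\<lambda>p. f (q0 p)) \<in> L2 MQ"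
    and qin: "q0in \<in> L2 MX" "q1in \<in> L2 MX" "q2in \<in> L2 MX"
  shows "weak_form q0 (\<lambda>p. f (q0 p) + q2 p) (\<lambda>_. 0) q0in"
    "weak_form q1 (\<lambda>p. \<tau> * q1 p) (\<lambda>p. - q2 p) q1in"
    "weak_form (\<lambda>p. \<tau> * q2 p) q0 q1 (\<lambda>x. \<tau> * q2in x)"
proof -
  note L = q qin zero_L2 L2_add L2_cmult L2_minus
  have *: "(\<integral>p. q0 p * (deriv \<alpha> (fst p) * \<beta> (snd p)) + (f (q0 p) + q2 p) * (\<alpha> (fst p) * deriv \<beta> (snd p)) \<partial>MQ)
        + (\<integral>x. q0in x * (\<alpha> 0 * \<beta> x) \<partial>MX) = 0 \<and>
      (\<integral>p. q1 p * (deriv \<alpha> (fst p) * \<beta> (snd p)) + \<tau> * q1 p * (\<alpha> (fst p) * deriv \<beta> (snd p)) - q2 p * (\<alpha> (fst p) * \<beta> (snd p)) \<partial>MQ)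
        + (\<integral>x. q1in x * (\<alpha> 0 * \<beta> x) \<partial>MX) = 0 \<and>
      (\<integral>p. \<tau> * q2 p * (deriv \<alpha> (fst p) * \<beta> (snd p)) + q0 p * (\<alpha> (fst p) * deriv \<beta> (snd p)) + q1 p * (\<alpha> (fst p) * \<beta> (snd p)) \<partial>MQ)
        + (\<integral>x. \<tau> * q2in x * (\<alpha> 0 * \<beta> x) \<partial>MX) = 0"
    if t: "test_t0 \<alpha>" "periodic_smooth \<beta>" for \<alpha> \<beta>
    using sol[unfolded weak_solution_def, rule_format, OF test_init_product[OF t]]
    unfolding pderiv_dir_product[OF test_t0_smooth[OF t(1)] periodic_smooth_smooth[OF t(2)]] st_measure_MQ MX_def[symmetric]
    by simp
  show "weak_form q0 (\<lambda>p. f (q0 p) + q2 p) (\<lambda>_. 0) q0in" using * by (intro weak_formI L) simp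
  show "weak_form q1 (\<lambda>p. \<tau> * q1 p) (\<lambda>p. - q2 p) q1in" using * by (intro weak_formI L) simp
  show "weak_form (\<lambda>p. \<tau> * q2 p) q0 q1 (\<lambda>x. \<tau> * q2in x)" using * by (intro weak_formI L) simp
qed

lemma L2_mult_test:
  assumes "u \<in> L2 MQ" "v \<in> L2 MQ" "smooth \<phi>"
  shows "integrable MQ (\<lambda>p. u p * v p * \<phi> (fst p))"
  using integrable_product_test[OF L2_mult[OF assms(1,2)] assms(3) smooth_const[of 1]] by simp

text \<open>With a test constant in \<open>x\<close> the flux term drops out of the energy
  inequality.\<close>

lemma energy_inequality_time:
  assumes ei: "energy_inequality \<Phi> T a b \<tau> q0in q1in q2in q0 q1 q2"
    and \<phi>: "test_t0 \<phi>" "\<And>t. 0 \<le> t \<Longrightarrow> 0 \<le> \<phi> t"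
  shows "0 \<le> (\<integral>p. energy \<tau> (q0 p) (q1 p) (q2 p) * deriv \<phi> (fst p) \<partial>MQ) +
    \<phi> 0 * (\<integral>x. energy \<tau> (q0in x) (q1in x) (q2in x) \<partial>MX)"
proof -
  have s: "smooth \<phi>" by (rule test_t0_smooth[OF \<phi>(1)])
  have "(\<lambda>p. \<phi> (fst p) * 1) \<in> test_init T a b"
    by (rule test_init_product[OF \<phi>(1) periodic_smooth_const])
  from ei[unfolded energy_inequality_def, rule_format, OF this]
  show ?thesis
    using \<phi>(2) unfolding pderiv_dir_product[OF s smooth_const] st_measure_MQ MX_def[symmetric] by (simp add: mult.commute)
qed

text \<open>The factor of \<open>\<phi>\<close> does not involve \<open>q2\<close>: this is what the choice of \<open>v1\<close> achieves.  The last two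
  terms on the left integrate to zero.\<close>

lemma relative_energy_identity:
  fixes q0 q1 q2 u d10 d01 d11 d02 d21 d12 d31 d22 Fq Fu F' g \<phi> \<tau> :: real
  assumes d10: "d10 = d12 - F' * d01" and v: "v1 = d01 - \<tau> * d21" "v1t = d11 - \<tau> * d31" "v1x = d02 - \<tau> * d22"
  shows "energy \<tau> q0 q1 q2 * g
     - (q0 * (d10 * \<phi> + u * g) + (Fq + q2) * d01 * \<phi> + 0 * u * \<phi>)
     - (q1 * (v1t * \<phi> + v1 * g) + \<tau> * q1 * v1x * \<phi> + - q2 * v1 * \<phi>)
     + (\<tau> * q2 * (d21 * \<phi> + d11 * g) + q0 * d12 * \<phi> + q1 * d11 * \<phi>)
     + 1/2 * (u * (d10 * \<phi> + u * g) + 0 * d01 * \<phi> + d10 * u * \<phi>)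
     + 1/2 * ((v1 + \<tau> * 0) * (v1t * \<phi> + v1 * g) + (0 + \<tau> * v1) * v1x * \<phi> + (v1t + \<tau> * v1x) * v1 * \<phi>)
     + \<tau>/2 * (d11 * (d21 * \<phi> + d11 * g) + 0 * d12 * \<phi> + d21 * d11 * \<phi>)
     - (0 * (d21 * \<phi> + d11 * g) + u * d12 * \<phi> + d01 * d11 * \<phi>) + Fu * d01 * \<phi> =
    energy \<tau> (q0 - u) (q1 - v1) (q2 + d11) * g
     + (- (d01 * (Fq - Fu - F' * (q0 - u))) - \<tau> * (d02 - d31 - \<tau> * d22) * (q1 - v1)) * \<phi>"
proof -
  let ?c = "- (d01 * (Fq - Fu - F' * (q0 - u))) - \<tau> * (d02 - d31 - \<tau> * d22) * (q1 - v1)"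
  have p: "- (q0 * d10 + (Fq + q2) * d01) - (q1 * v1t + \<tau> * q1 * v1x - q2 * v1) + (\<tau> * q2 * d21 + q0 * d12 + q1 * d11)
      + u * d10 + (v1 * v1t + \<tau> * v1 * v1x) + \<tau> * d11 * d21 - (u * d12 + d01 * d11) + Fu * d01 = ?c"
    unfolding v d10 by algebra
  have g: "energy \<tau> q0 q1 q2 - q0 * u - q1 * v1 + \<tau> * q2 * d11 + 1/2 * u\<^sup>2 + 1/2 * v1\<^sup>2 + \<tau>/2 * d11\<^sup>2
      = energy \<tau> (q0 - u) (q1 - v1) (q2 + d11)"
    unfolding energy_def power2_diff power2_sum by (simp add: algebra_simps)
  show ?thesis unfolding p[symmetric] g[symmetric] by (simp add: algebra_simps power2_eq_square)
qed

text \<open>In the factor of the energy, \<open>K * L\<close> comes from the Taylor remainder,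
  bounded by \<open>L\<close> times the first energy term, and \<open>1\<close> comes from Young's
  inequality for \<open>\<tau> * R\<close> and \<open>z1\<close>.\<close>

lemma relative_energy_source_le:
  fixes D r \<tau> R w z1 z2 K L :: real
  assumes "\<bar>D\<bar> \<le> K" "\<bar>r\<bar> \<le> L / 2 * w\<^sup>2" "0 \<le> L" "0 \<le> \<tau>"
  shows "- (D * r) - \<tau> * R * z1 \<le> (K * L + 1) * energy \<tau> w z1 z2 + \<tau>\<^sup>2 / 2 * R\<^sup>2"
proof -
  have K: "0 \<le> K" using assms(1) by linarith
  have "- (D * r) \<le> \<bar>D\<bar> * \<bar>r\<bar>" unfolding abs_mult[symmetric] by (rule abs_ge_minus_self)
  also have "\<dots> \<le> K * (L / 2 * w\<^sup>2)" using assms K by (intro mult_mono) auto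
  also have "\<dots> = K * L * (1 / 2 * w\<^sup>2)" by simp
  also have "\<dots> \<le> K * L * energy \<tau> w z1 z2"
    using K assms by (intro mult_left_mono) (auto simp: energy_def)
  finally have 1: "- (D * r) \<le> K * L * energy \<tau> w z1 z2" .
  have "0 \<le> (\<tau> * R + z1)\<^sup>2" by simp
  then have 2: "- (\<tau> * R * z1) \<le> \<tau>\<^sup>2 / 2 * R\<^sup>2 + 1 / 2 * z1\<^sup>2" unfolding power2_sum power_mult_distrib by simp
  have 3: "1 / 2 * z1\<^sup>2 \<le> energy \<tau> w z1 z2" using assms by (simp add: energy_def)
  show ?thesis unfolding distrib_right using 1 2 3 by linarith
qed

text \<open>Stated for arbitrary functions so that linearity is used once, with the nine long
  integrands kept opaque.\<close>

lemma integral_nine_terms: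
  fixes X1 X2 X3 X4 X5 X6 X7 X8 X9 :: "'z \<Rightarrow> real"
  assumes "integrable M X1" "integrable M X2" "integrable M X3" "integrable M X4" "integrable M X5" "integrable M X6"
    "integrable M X7" "integrable M X8" "integrable M X9"
  shows "integrable M (\<lambda>p. X1 p - X2 p - X3 p + X4 p + 1/2 * X5 p + 1/2 * X6 p + c * X7 p - X8 p + X9 p) \<and>
    (LINT p|M. X1 p - X2 p - X3 p + X4 p + 1/2 * X5 p + 1/2 * X6 p + c * X7 p - X8 p + X9 p) =
      (LINT p|M. X1 p) - (LINT p|M. X2 p) - (LINT p|M. X3 p) + (LINT p|M. X4 p)
      + 1/2 * (LINT p|M. X5 p) + 1/2 * (LINT p|M. X6 p) + c * (LINT p|M. X7 p) - (LINT p|M. X8 p) + (LINT p|M. X9 p)"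
proof -
  note h = assms[THEN has_bochner_integral_integrable]
  show ?thesis unfolding has_bochner_integral_iff[symmetric]
    by (intro has_bochner_integral_add has_bochner_integral_diff has_bochner_integral_mult_right h)
qed

text \<open>From the energy inequality subtract the first two equations tested with \<open>u\<close>
  and \<open>v1\<close>, and add the third tested with \<open>d11\<close>, the negative of the third
  component of \<open>v\<close>. The product rules of \<open>u\<close>, \<open>v1\<close> and
  \<open>d11\<close> tested with themselves, weighted by 1/2, 1/2 and \<tau>/2, contribute the
  energy of \<open>v\<close>. Pointwise the sum is \<open>relative_energy_identity\<close>.\<close>

theorem relative_energy_inequality:
  fixes u d10 d01 d11 d02 d21 d12 d31 d22 :: "real \<times> real \<Rightarrow> real"
  assumes \<tau>: "0 < \<tau>"
    and f: "\<And>x y. \<bar>f y - f x - deriv f x * (y - x)\<bar> \<le> L / 2 * (y - x)\<^sup>2" "0 \<le> L"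
    and H: "H1 u d10 d01 u0" "H1 d01 d11 d02 u0x" "H1 d11 d21 d12 utx0" "H1 d21 d31 d22 z0"
    and eq: "AE p in MQ. d10 p + deriv f (u p) * d01 p - d12 p = 0"
    and K: "AE p in MQ. \<bar>d01 p\<bar> \<le> K"
    and fu: "\<And>\<phi>. test_t0 \<phi> \<Longrightarrow> (\<integral>p. f (u p) * d01 p * \<phi> (fst p) \<partial>MQ) = 0" "integrable MQ (\<lambda>p. f (u p) * d01 p)"
    and q: "q0 \<in> L2 MQ" "q1 \<in> L2 MQ" "q2 \<in> L2 MQ" "(\<lambda>p. f (q0 p)) \<in> L2 MQ"
    and sol: "weak_solution f T a b \<tau> u0 u0x (\<lambda>x. - utx0 x) q0 q1 q2"
    and ei: "energy_inequality \<Phi> T a b \<tau> u0 u0x (\<lambda>x. - utx0 x) q0 q1 q2"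
    and \<phi>: "test_t0 \<phi>" "\<And>t. 0 \<le> t \<Longrightarrow> 0 \<le> \<phi> t"
  defines "e \<equiv> \<lambda>p. energy \<tau> (q0 p - u p) (q1 p - (d01 p - \<tau> * d21 p)) (q2 p + d11 p)"
    and "R \<equiv> \<lambda>p. d02 p - d31 p - \<tau> * d22 p"
  shows "0 \<le> (\<integral>p. e p * (deriv \<phi> (fst p) + (K * L + 1) * \<phi> (fst p)) \<partial>MQ) +
    \<tau>\<^sup>2 / 2 * (\<integral>p. (R p)\<^sup>2 * \<phi> (fst p) \<partial>MQ) + \<phi> 0 * (\<tau>\<^sup>2 / 2 * (\<integral>x. (z0 x)\<^sup>2 \<partial>MX))"
proof -
  have D: "u \<in> L2 MQ" "d10 \<in> L2 MQ" "d01 \<in> L2 MQ" "d11 \<in> L2 MQ" "d02 \<in> L2 MQ" "d21 \<in> L2 MQ" "d12 \<in> L2 MQ" "d31 \<in> L2 MQ" "d22 \<in> L2 MQ"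
    and I: "u0 \<in> L2 MX" "u0x \<in> L2 MX" "utx0 \<in> L2 MX" "z0 \<in> L2 MX"
    using H by (auto simp: H1_def)
  have s: "smooth \<phi>" "smooth (deriv \<phi>)" using \<phi>(1) by (auto intro: test_t0_smooth smoothD)
  define v1 v1t v1x where "v1 = (\<lambda>p. d01 p - \<tau> * d21 p)" and "v1t = (\<lambda>p. d11 p - \<tau> * d31 p)" and "v1x = (\<lambda>p. d02 p - \<tau> * d22 p)"
  define v10 where "v10 = (\<lambda>x. u0x x - \<tau> * z0 x)"
  have Hv1: "H1 v1 v1t v1x v10"
    using H1_add[OF H(2,4), of "- \<tau>"] by (simp add: v1_def v1t_def v1x_def v10_def)
  have V: "v1 \<in> L2 MQ" "v1t \<in> L2 MQ" "v1x \<in> L2 MQ" "v10 \<in> L2 MX" using Hv1 by (auto simp: H1_def)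
  note W = weak_solution_weak_forms[OF sol q I(1,2) L2_minus[OF I(3)]]
  have e1: "(\<integral>p. q0 p * (d10 p * \<phi> (fst p) + u p * deriv \<phi> (fst p)) + (f (q0 p) + q2 p) * d01 p * \<phi> (fst p) + 0 * u p * \<phi> (fst p) \<partial>MQ) + \<phi> 0 * (\<integral>x. u0 x * u0 x \<partial>MX) = 0"
    by (rule weak_form_test_H1[OF W(1) H(1) \<phi>(1)])
  have e2: "(\<integral>p. q1 p * (v1t p * \<phi> (fst p) + v1 p * deriv \<phi> (fst p)) + \<tau> * q1 p * v1x p * \<phi> (fst p) + - q2 p * v1 p * \<phi> (fst p) \<partial>MQ) + \<phi> 0 * (\<integral>x. u0x x * v10 x \<partial>MX) = 0"
    by (rule weak_form_test_H1[OF W(2) Hv1 \<phi>(1)])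
  have e3: "(\<integral>p. \<tau> * q2 p * (d21 p * \<phi> (fst p) + d11 p * deriv \<phi> (fst p)) + q0 p * d12 p * \<phi> (fst p) + q1 p * d11 p * \<phi> (fst p) \<partial>MQ) + \<phi> 0 * (\<integral>x. \<tau> * - utx0 x * utx0 x \<partial>MX) = 0"
    by (rule weak_form_test_H1[OF W(3) H(3) \<phi>(1)])
  have s0: "(\<integral>p. u p * (d10 p * \<phi> (fst p) + u p * deriv \<phi> (fst p)) + 0 * d01 p * \<phi> (fst p) + d10 p * u p * \<phi> (fst p) \<partial>MQ) + \<phi> 0 * (\<integral>x. u0 x * u0 x \<partial>MX) = 0"
    by (rule weak_form_test_H1[OF H1_weak_form_time[OF H(1)] H(1) \<phi>(1)])
  \<comment> \<open>The law tested here is composed of the time derivative of \<open>v1\<close> and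
    \<tau> times its x-derivative, matching the transport operator in the equation for
    \<open>q1\<close>.\<close>
  have s1: "(\<integral>p. (v1 p + \<tau> * 0) * (v1t p * \<phi> (fst p) + v1 p * deriv \<phi> (fst p)) + (0 + \<tau> * v1 p) * v1x p * \<phi> (fst p) + (v1t p + \<tau> * v1x p) * v1 p * \<phi> (fst p) \<partial>MQ) + \<phi> 0 * (\<integral>x. (v10 x + \<tau> * 0) * v10 x \<partial>MX) = 0"
    by (rule weak_form_test_H1[OF weak_form_add[OF H1_weak_form_time[OF Hv1] weak_form_cmult[OF H1_weak_form_space[OF Hv1]]] Hv1 \<phi>(1)])
  have s2: "(\<integral>p. d11 p * (d21 p * \<phi> (fst p) + d11 p * deriv \<phi> (fst p)) + 0 * d12 p * \<phi> (fst p) + d21 p * d11 p * \<phi> (fst p) \<partial>MQ) + \<phi> 0 * (\<integral>x. utx0 x * utx0 x \<partial>MX) = 0"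
    by (rule weak_form_test_H1[OF H1_weak_form_time[OF H(3)] H(3) \<phi>(1)])
  \<comment> \<open>The integrand is \<phi> times the x-derivative of the product of
    \<open>u\<close> and \<open>d11\<close>, so its integral is 0.\<close>
  have sx: "(\<integral>p. 0 * (d21 p * \<phi> (fst p) + d11 p * deriv \<phi> (fst p)) + u p * d12 p * \<phi> (fst p) + d01 p * d11 p * \<phi> (fst p) \<partial>MQ) + \<phi> 0 * (\<integral>x. 0 * utx0 x \<partial>MX) = 0"
    by (rule weak_form_test_H1[OF H1_weak_form_space[OF H(1)] H(3) \<phi>(1)])
  have fz: "(\<integral>p. f (u p) * d01 p * \<phi> (fst p) \<partial>MQ) = 0" by (rule fu(1)[OF \<phi>(1)])
  note E = energy_inequality_time[OF ei \<phi>]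
  note it = L2_mult_test[OF _ _ s(1)] L2_mult_test[OF _ _ s(2)]

  let ?f = "\<lambda>p. \<phi> (fst p)" and ?g = "\<lambda>p. deriv \<phi> (fst p)"
  let ?E = "\<lambda>p. energy \<tau> (q0 p) (q1 p) (q2 p) * ?g p"
  let ?A1 = "\<lambda>p. q0 p * (d10 p * \<phi> (fst p) + u p * deriv \<phi> (fst p)) + (f (q0 p) + q2 p) * d01 p * \<phi> (fst p) + 0 * u p * \<phi> (fst p)"
  let ?A2 = "\<lambda>p. q1 p * (v1t p * \<phi> (fst p) + v1 p * deriv \<phi> (fst p)) + \<tau> * q1 p * v1x p * \<phi> (fst p) + - q2 p * v1 p * \<phi> (fst p)"
  let ?A3 = "\<lambda>p. \<tau> * q2 p * (d21 p * \<phi> (fst p) + d11 p * deriv \<phi> (fst p)) + q0 p * d12 p * \<phi> (fst p) + q1 p * d11 p * \<phi> (fst p)"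
  let ?s0 = "\<lambda>p. u p * (d10 p * \<phi> (fst p) + u p * deriv \<phi> (fst p)) + 0 * d01 p * \<phi> (fst p) + d10 p * u p * \<phi> (fst p)"
  let ?s1 = "\<lambda>p. (v1 p + \<tau> * 0) * (v1t p * \<phi> (fst p) + v1 p * deriv \<phi> (fst p)) + (0 + \<tau> * v1 p) * v1x p * \<phi> (fst p) + (v1t p + \<tau> * v1x p) * v1 p * \<phi> (fst p)"
  let ?s2 = "\<lambda>p. d11 p * (d21 p * \<phi> (fst p) + d11 p * deriv \<phi> (fst p)) + 0 * d12 p * \<phi> (fst p) + d21 p * d11 p * \<phi> (fst p)"
  let ?sx = "\<lambda>p. 0 * (d21 p * \<phi> (fst p) + d11 p * deriv \<phi> (fst p)) + u p * d12 p * \<phi> (fst p) + d01 p * d11 p * \<phi> (fst p)"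
  let ?fz = "\<lambda>p. f (u p) * d01 p * \<phi> (fst p)"
  have ii: "integrable MQ (\<lambda>p. A p * (B p * ?f p + C p * ?g p))"
    if "A \<in> L2 MQ" "B \<in> L2 MQ" "C \<in> L2 MQ" for A B C
    using it(1)[OF that(1,2)] it(2)[OF that(1,3)] by (simp add: distrib_left mult.assoc)
  have eL: "e \<in> borel_measurable MQ" "integrable MQ (\<lambda>p. e p)"
    unfolding e_def energy_def
    using L2_square[OF L2_diff[OF q(1) D(1)]] L2_square[OF L2_diff[OF q(2) V(1)]] L2_square[OF L2_add[OF q(3) D(4)]]
    by (auto simp: v1_def)
  have eT: "integrable MQ (\<lambda>p. e p * h (fst p))" if "smooth h" for h
    using integrable_product_test[OF eL(2) that smooth_const[of 1]] by simp
  have RL: "R \<in> L2 MQ" unfolding R_def by (intro L2_diff L2_cmult D)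
  have RT: "integrable MQ (\<lambda>p. (R p)\<^sup>2 * \<phi> (fst p))"
    using it(1)[OF RL RL] by (simp add: power2_eq_square)
  have iE: "integrable MQ ?E"
    using it(2)[OF q(1) q(1)] it(2)[OF q(2) q(2)] it(2)[OF q(3) q(3)]
    by (simp add: energy_def power2_eq_square distrib_right mult.assoc)
  have i1: "integrable MQ ?A1"
    by (intro Bochner_Integration.integrable_add ii it q D L2_add zero_L2)
  have i2: "integrable MQ ?A2"
    by (intro Bochner_Integration.integrable_add ii it q V L2_cmult L2_minus)
  have i3: "integrable MQ ?A3"
    by (intro Bochner_Integration.integrable_add ii it q D L2_cmult)
  have is0: "integrable MQ ?s0"
    by (intro Bochner_Integration.integrable_add ii it D zero_L2)
  have is1: "integrable MQ ?s1"
    by (intro Bochner_Integration.integrable_add ii it V L2_add L2_cmult zero_L2)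
  have is2: "integrable MQ ?s2"
    by (intro Bochner_Integration.integrable_add ii it D zero_L2)
  have isx: "integrable MQ ?sx"
    by (intro Bochner_Integration.integrable_add ii it D zero_L2)
  have ifz: "integrable MQ ?fz"
    using integrable_product_test[OF fu(2) s(1) smooth_const[of 1]] by simp
  define Y where "Y p = ?E p - ?A1 p - ?A2 p + ?A3 p + 1/2 * ?s0 p + 1/2 * ?s1 p + \<tau>/2 * ?s2 p - ?sx p + ?fz p" for p
  have Y: "integrable MQ Y \<and> (\<integral>p. Y p \<partial>MQ) = (\<integral>p. ?E p \<partial>MQ) - (\<integral>p. ?A1 p \<partial>MQ) - (\<integral>p. ?A2 p \<partial>MQ) + (\<integral>p. ?A3 p \<partial>MQ)
     + 1/2 * (\<integral>p. ?s0 p \<partial>MQ) + 1/2 * (\<integral>p. ?s1 p \<partial>MQ) + \<tau>/2 * (\<integral>p. ?s2 p \<partial>MQ) - (\<integral>p. ?sx p \<partial>MQ) + (\<integral>p. ?fz p \<partial>MQ)"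
    unfolding Y_def[abs_def] by (rule integral_nine_terms[OF iE i1 i2 i3 is0 is1 is2 isx ifz])
  have Ypt: "Y p \<le> e p * (deriv \<phi> (fst p) + (K * L + 1) * \<phi> (fst p)) + \<tau>\<^sup>2 / 2 * ((R p)\<^sup>2 * \<phi> (fst p))"
    if elim: "d10 p + deriv f (u p) * d01 p - d12 p = 0" "\<bar>d01 p\<bar> \<le> K" "p \<in> space MQ" for p
  proof -
    have "fst p \<in> {0<..<T}" using elim(3) unfolding space_MQ mem_Times_iff by (rule conjunct1)
    then have \<phi>p: "0 \<le> \<phi> (fst p)" by (intro \<phi>(2)) simp
    have d10: "d10 p = d12 p - deriv f (u p) * d01 p" using elim(1) by simp
    have Yp: "Y p = e p * deriv \<phi> (fst p) + (- (d01 p * (f (q0 p) - f (u p) - deriv f (u p) * (q0 p - u p)))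
        - \<tau> * R p * (q1 p - v1 p)) * \<phi> (fst p)"
      unfolding Y_def e_def R_def v1_def v1t_def v1x_def by (rule relative_energy_identity[OF d10 refl refl refl])
    have "- (d01 p * (f (q0 p) - f (u p) - deriv f (u p) * (q0 p - u p))) - \<tau> * R p * (q1 p - v1 p)
       \<le> (K * L + 1) * energy \<tau> (q0 p - u p) (q1 p - v1 p) (q2 p + d11 p) + \<tau>\<^sup>2 / 2 * (R p)\<^sup>2"
      by (rule relative_energy_source_le[OF elim(2) f(1) f(2) less_imp_le[OF \<tau>]])
    from mult_right_mono[OF this \<phi>p] show ?thesis unfolding Yp e_def v1_def by (simp add: algebra_simps)
  qed
  have Yle: "AE p in MQ. Y p \<le> e p * (deriv \<phi> (fst p) + (K * L + 1) * \<phi> (fst p)) + \<tau>\<^sup>2 / 2 * ((R p)\<^sup>2 * \<phi> (fst p))"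
    by (rule AE_mp[OF eq], rule AE_mp[OF K], rule AE_I2, intro impI, rule Ypt)
  have smD: "smooth (\<lambda>t. deriv \<phi> t + (K * L + 1) * \<phi> t)" by (intro smooth_intros s)
  \<comment> \<open>The initial values of \<open>q\<close> and \<open>v\<close> agree in the first
    and third components. In the second they differ by \<open>\<tau> * z0\<close>, and completing
    the square leaves only the square of this difference.\<close>
  have init: "\<phi> 0 * (\<integral>x. energy \<tau> (u0 x) (u0x x) (- utx0 x) \<partial>MX) - \<phi> 0 * (\<integral>x. u0 x * u0 x \<partial>MX)
     - \<phi> 0 * (\<integral>x. u0x x * v10 x \<partial>MX) + \<phi> 0 * (\<integral>x. \<tau> * - utx0 x * utx0 x \<partial>MX)
     + 1/2 * (\<phi> 0 * (\<integral>x. u0 x * u0 x \<partial>MX)) + 1/2 * (\<phi> 0 * (\<integral>x. (v10 x + \<tau> * 0) * v10 x \<partial>MX))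
     + \<tau>/2 * (\<phi> 0 * (\<integral>x. utx0 x * utx0 x \<partial>MX)) = \<phi> 0 * (\<tau>\<^sup>2 / 2 * (\<integral>x. (z0 x)\<^sup>2 \<partial>MX))"
  proof -
    have m: "integrable MX (\<lambda>x. A x * B x)" if "A \<in> L2 MX" "B \<in> L2 MX" for A B by (rule L2_mult[OF that])
    have 1: "(\<integral>x. energy \<tau> (u0 x) (u0x x) (- utx0 x) \<partial>MX) = 1/2 * (\<integral>x. u0 x * u0 x \<partial>MX) + 1/2 * (\<integral>x. u0x x * u0x x \<partial>MX) + \<tau>/2 * (\<integral>x. utx0 x * utx0 x \<partial>MX)"
      using m[OF I(1,1)] m[OF I(2,2)] m[OF I(3,3)] by (simp add: energy_def power2_eq_square)
    have 2: "(\<integral>x. u0x x * v10 x \<partial>MX) = (\<integral>x. u0x x * u0x x \<partial>MX) - \<tau> * (\<integral>x. u0x x * z0 x \<partial>MX)"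
    proof -
      have "(\<integral>x. u0x x * v10 x \<partial>MX) = (\<integral>x. u0x x * u0x x - \<tau> * (u0x x * z0 x) \<partial>MX)"
        by (simp add: v10_def algebra_simps)
      then show ?thesis using m[OF I(2,2)] m[OF I(2,4)] by simp
    qed
    have 3: "(\<integral>x. (v10 x + \<tau> * 0) * v10 x \<partial>MX) = (\<integral>x. u0x x * u0x x \<partial>MX) - 2 * \<tau> * (\<integral>x. u0x x * z0 x \<partial>MX) + \<tau>\<^sup>2 * (\<integral>x. (z0 x)\<^sup>2 \<partial>MX)"
    proof -
      have "(\<integral>x. (v10 x + \<tau> * 0) * v10 x \<partial>MX) = (\<integral>x. u0x x * u0x x - 2 * \<tau> * (u0x x * z0 x) + \<tau>\<^sup>2 * (z0 x)\<^sup>2 \<partial>MX)"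
        by (simp add: v10_def algebra_simps power2_eq_square)
      then show ?thesis using m[OF I(2,2)] m[OF I(2,4)] L2_square[OF I(4)] by simp
    qed
    have 4: "(\<integral>x. \<tau> * - utx0 x * utx0 x \<partial>MX) = - \<tau> * (\<integral>x. utx0 x * utx0 x \<partial>MX)"
      by (simp add: mult.assoc)
    show ?thesis unfolding 1 2 3 4 by (simp add: field_simps)
  qed
  have "0 \<le> (\<integral>p. Y p \<partial>MQ) + \<phi> 0 * (\<tau>\<^sup>2 / 2 * (\<integral>x. (z0 x)\<^sup>2 \<partial>MX))"
  proof -
    have "\<tau>/2 * ((\<integral>p. ?s2 p \<partial>MQ) + \<phi> 0 * (\<integral>x. utx0 x * utx0 x \<partial>MX)) = 0" unfolding s2 by simp
    then have t2: "\<tau>/2 * (\<integral>p. ?s2 p \<partial>MQ) + \<tau>/2 * (\<phi> 0 * (\<integral>x. utx0 x * utx0 x \<partial>MX)) = 0" by (simp only: distrib_left)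
    have tx: "(\<integral>p. ?sx p \<partial>MQ) = 0" using sx by simp
    show ?thesis unfolding Y[THEN conjunct2] init[symmetric] using E e1 e2 e3 s0 s1 t2 tx fz by linarith
  qed
  also have "(\<integral>p. Y p \<partial>MQ) \<le> (\<integral>p. e p * (deriv \<phi> (fst p) + (K * L + 1) * \<phi> (fst p)) + \<tau>\<^sup>2 / 2 * ((R p)\<^sup>2 * \<phi> (fst p)) \<partial>MQ)"
    by (rule integral_mono_AE[OF conjunct1[OF Y] _ Yle]) (intro Bochner_Integration.integrable_add integrable_mult_right eT[OF smD] RT)
  also have "\<dots> = (\<integral>p. e p * (deriv \<phi> (fst p) + (K * L + 1) * \<phi> (fst p)) \<partial>MQ) + \<tau>\<^sup>2 / 2 * (\<integral>p. (R p)\<^sup>2 * \<phi> (fst p) \<partial>MQ)"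
    using eT[OF smD] RT by simp
  finally show ?thesis by simp
qed

section \<open>From tested inequalities to norms at almost every time\<close>

text \<open>The test is the integrating factor \<open>exp (- M * s)\<close> times one minus the
  smooth step at \<open>t\<close>. For it, \<open>deriv \<phi> s + M * \<phi> s\<close> is minus the
  integrating factor times the time kernel centred at \<open>t\<close>. So the tested inequality
  bounds kernel averages of the weighted space integral of \<open>e\<close>, and
  \<open>AE_le_of_kernel_le\<close> makes this a bound at almost every \<open>t\<close>.\<close>

lemma Gronwall_test:
  assumes e: "integrable MQ e" and S: "integrable MQ S" "\<And>p. 0 \<le> S p"
    and c: "0 \<le> c1" "0 \<le> c2" "0 \<le> M"
    and test: "\<And>\<phi>. test_t0 \<phi> \<Longrightarrow> (\<And>t. 0 \<le> t \<Longrightarrow> 0 \<le> \<phi> t) \<Longrightarrow>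
      0 \<le> (\<integral>p. e p * (deriv \<phi> (fst p) + M * \<phi> (fst p)) \<partial>MQ) + c1 * (\<integral>p. S p * \<phi> (fst p) \<partial>MQ) + \<phi> 0 * c2"
  shows "AE t in MT. (\<integral>x. e (t, x) \<partial>MX) \<le> exp (M * T) * (c1 * (\<integral>p. S p \<partial>MQ) + c2)"
proof -
  define h where "h t = (\<integral>x. e (t, x) \<partial>MX)" for t
  define B where "B = c1 * (\<integral>p. S p \<partial>MQ) + c2"
  have B0: "0 \<le> B" unfolding B_def using S c by (intro add_nonneg_nonneg mult_nonneg_nonneg integral_nonneg_AE) auto
  have ei: "integrable (MT \<Otimes>\<^sub>M MX) (\<lambda>(t, x). e (t, x))" using e by (simp add: MQ_def)
  have hi: "integrable MT h" unfolding h_def[abs_def] using TX.integrable_fst[OF ei] by simp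
  have exps: "smooth (\<lambda>t. exp (- M * t))" by (intro smooth_intros)
  obtain E where E: "\<forall>t\<in>{0..T}. \<bar>exp (- M * t)\<bar> \<le> E" using smooth_bounded_interval[OF exps, of 0 T] by blast
  have wi: "integrable MT (\<lambda>t. h t * exp (- M * t))"
    by (rule integrable_bounded_mult(2)[OF hi smooth_MT[OF exps], of E]) (use E in \<open>auto intro!: AE_I2\<close>)
  have "AE t in MT. h t * exp (- M * t) \<le> B"
  proof (rule KT.AE_le_of_kernel_le[OF wi], rule AE_I2)
    fix t assume "t \<in> space MT"
    then have t: "0 < t" "t < T" by auto
    then have "0 < T - t" by simp
    from eventually_inverse_less[OF this, of 2]
    show "\<forall>\<^sub>F n in sequentially. (\<integral>s. h s * exp (- M * s) * time_kernel n t s \<partial>MT) \<le> B"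
    proof eventually_elim
      case (elim n)
      let ?e = "1 / real (Suc n)" and ?d = "2 / real (Suc n)"
      have ed: "?e < ?d" by (simp add: divide_strict_right_mono)
      obtain G where G: "\<And>x. (G has_real_derivative unit_bump ?e ?d x) (at x)"
        "\<And>x. x \<le> ?e \<Longrightarrow> G x = 0" "\<And>x. ?d \<le> x \<Longrightarrow> G x = 1" "\<And>x. 0 \<le> G x" "\<And>x. G x \<le> 1"
        using unit_bump_antiderivative[OF ed] by metis
      have Gs: "smooth G" using G(1) smooth_unit_bump by (rule smoothI)
      define \<phi> where "\<phi> s = exp (- M * s) * (1 - G (s - t))" for s
      have d\<phi>: "deriv \<phi> s = - M * \<phi> s - exp (- M * s) * time_bump n (s - t)" for s
      proof (rule DERIV_imp_deriv)
        have 1: "((\<lambda>s. exp (- M * s)) has_real_derivative exp (- M * s) * - M) (at s)"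
          by (auto intro!: derivative_eq_intros)
        have 2: "((\<lambda>s. 1 - G (s - t) / 1) has_real_derivative 0 - unit_bump ?e ?d (s - t) / 1) (at s)"
          by (intro DERIV_diff DERIV_const has_real_derivative_shift(1)[OF G(1)])
        show "(\<phi> has_real_derivative - M * \<phi> s - exp (- M * s) * time_bump n (s - t)) (at s)"
          using DERIV_mult[OF 1 2] by (simp add: \<phi>_def[abs_def] time_bump_def algebra_simps)
      qed
      have \<phi>t: "test_t0 \<phi>"
        unfolding test_t0_def
      proof
        show "smooth \<phi>" unfolding \<phi>_def[abs_def] by (intro smooth_mult exps smooth_diff smooth_const smooth_shift Gs)
        show "\<exists>r<T. \<forall>s>r. \<phi> s = 0"
          by (rule exI[of _ "t + ?d"]) (use elim in \<open>auto simp: \<phi>_def G(3)\<close>)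
      qed
      have \<phi>0: "0 \<le> \<phi> s" for s using G(5)[of "s - t"] by (simp add: \<phi>_def)
      have \<phi>1: "\<phi> s \<le> 1" if "0 \<le> s" for s
        unfolding \<phi>_def using G(4,5)[of "s - t"] c(3) that by (intro mult_le_one) auto
      have Si: "integrable MQ (\<lambda>p. S p * \<phi> (fst p))"
        using integrable_product_test[OF S(1) test_t0_smooth[OF \<phi>t] smooth_const[of 1]] by simp
      have "(\<integral>p. S p * \<phi> (fst p) \<partial>MQ) \<le> (\<integral>p. S p \<partial>MQ)"
      proof (rule integral_mono[OF Si S(1)])
        fix p assume "p \<in> space MQ"
        then have "0 \<le> fst p" by (simp add: mem_Times_iff)
        then show "S p * \<phi> (fst p) \<le> S p" using S(2)[of p] \<phi>0[of "fst p"] \<phi>1[of "fst p"] by (intro mult_left_le) auto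
      qed
      then have 1: "c1 * (\<integral>p. S p * \<phi> (fst p) \<partial>MQ) \<le> c1 * (\<integral>p. S p \<partial>MQ)" using c(1) by (rule mult_left_mono)
      have 2: "\<phi> 0 * c2 \<le> c2" using \<phi>1[of 0] \<phi>0[of 0] c(2) by (simp add: mult_left_le_one_le)
      have tk: "time_kernel n t s = time_bump n (s - t)" for s by (simp add: time_kernel_def time_bump_def)
      have ks: "smooth (\<lambda>s. exp (- M * s) * time_bump n (s - t))" by (intro smooth_mult exps smooth_shift smooth_time_bump)
      have j: "integrable (MT \<Otimes>\<^sub>M MX) (\<lambda>(s, x). e (s, x) * (exp (- M * s) * time_bump n (s - t)))"
        using integrable_product_test[OF e ks smooth_const[of 1]] by (simp add: MQ_def case_prod_unfold)
      have "(\<integral>s. h s * exp (- M * s) * time_kernel n t s \<partial>MT) = (\<integral>s. \<integral>x. e (s, x) * (exp (- M * s) * time_bump n (s - t)) \<partial>MX \<partial>MT)"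
        by (simp add: h_def tk mult.assoc)
      also have "\<dots> = (\<integral>p. e p * (exp (- M * fst p) * time_bump n (fst p - t)) \<partial>MQ)"
        using TX.integral_fst[OF j] by (simp add: MQ_def case_prod_unfold)
      finally have eq: "(\<integral>s. h s * exp (- M * s) * time_kernel n t s \<partial>MT) = (\<integral>p. e p * (exp (- M * fst p) * time_bump n (fst p - t)) \<partial>MQ)" .
      have "(\<integral>p. e p * (deriv \<phi> (fst p) + M * \<phi> (fst p)) \<partial>MQ) = - (\<integral>p. e p * (exp (- M * fst p) * time_bump n (fst p - t)) \<partial>MQ)"
        unfolding d\<phi> by simp
      then show ?case using test[OF \<phi>t \<phi>0] 1 2 unfolding eq B_def by linarith
    qed
  qed
  then show ?thesis using AE_space
  proof eventually_elim
    case (elim t)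
    have "h t = h t * exp (- M * t) * exp (M * t)" by (simp add: mult.assoc exp_add[symmetric])
    also have "\<dots> \<le> B * exp (M * t)" using elim(1) by (intro mult_right_mono) auto
    also have "\<dots> \<le> B * exp (M * T)" using elim(2) c(3) B0 by (intro mult_left_mono) (auto intro!: mult_left_mono)
    finally show ?case by (simp add: h_def B_def mult.commute)
  qed
qed

text \<open>Integrability of the sections accompanies the bound because a Bochner integral defaults
  to 0 exactly where the norm would be infinite.\<close>

lemma Linf_L2_norm_le:
  assumes w: "w \<in> borel_measurable MQ" and S: "0 \<le> S"
    and le: "AE t in MT. integrable MX (\<lambda>x. (w (t, x))\<^sup>2) \<and> (\<integral>x. (w (t, x))\<^sup>2 \<partial>MX) \<le> S"
  shows "Linf_L2_norm T a b w \<le> ennreal (sqrt S)"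
proof -
  have MT: "restrict_space lborel {0<..<T} = MT" by (simp add: MT_def space_measure_def)
  have [measurable]: "w \<in> borel_measurable (MT \<Otimes>\<^sub>M MX)" using w by (simp add: MQ_def)
  have "(\<lambda>t. \<integral>\<^sup>+ x. ennreal ((w (t, x))\<^sup>2) \<partial>MX) \<in> borel_measurable MT" by measurable
  then have m: "(\<lambda>t. L2_norm_space a b (\<lambda>x. w (t, x))) \<in> borel_measurable MT"
    unfolding L2_norm_space_def MX_def[symmetric] ennreal_sqrt_def by measurable
  show ?thesis unfolding Linf_L2_norm_def MT
  proof (rule esssup_I[OF m])
    show "AE t in MT. L2_norm_space a b (\<lambda>x. w (t, x)) \<le> ennreal (sqrt S)" using le
    proof eventually_elim
      case (elim t)
      have "(\<integral>\<^sup>+ x. ennreal ((w (t, x))\<^sup>2) \<partial>MX) = ennreal (\<integral>x. (w (t, x))\<^sup>2 \<partial>MX)"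
        using elim by (intro nn_integral_eq_integral) auto
      then show ?case using elim unfolding L2_norm_space_def MX_def[symmetric] ennreal_sqrt_def
        by (auto intro!: ennreal_leI)
    qed
  qed
qed

end

theorem theorem2p1:
  fixes T a b :: real
    and f \<Phi> :: "real \<Rightarrow> real"
    and u ux utx :: "real \<times> real \<Rightarrow> real"
    and u0 u0x utx0 :: "real \<Rightarrow> real"
  assumes T: "0 < T" and ab: "a < b"
    and f: "f \<in> W2inf_loc" "continuous_on UNIV f"
    and f'': "\<exists>f2 \<in> Linf lborel. weak_deriv test_line lborel [1, 1] f f2"
    and Phi: "\<And>y. (\<Phi> has_real_derivative y * deriv f y) (at y)"
    and u: "u \<in> H_st 4 T a b" "solves_equation f T a b u"
    and ux: "st_weak_deriv T a b [dir_x] u ux" "ux \<in> Linf (st_measure T a b)"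
    and u0: "u0 \<in> H_space 4 a b" "initial_trace T a b u u0"
    and u0x: "weak_deriv (test_space a b) (space_measure a b) [1] u0 u0x"
    and utx: "st_weak_deriv T a b [dir_t, dir_x] u utx" "initial_trace T a b utx utx0"
  shows "\<exists>C>0. \<exists>\<tau>0>0. \<forall>\<tau>. 0 < \<tau> \<and> \<tau> \<le> \<tau>0 \<longrightarrow>
    (\<forall>q0 q1 q2. entropy_solution f \<Phi> T a b \<tau> u0 u0x (\<lambda>x. - utx0 x) q0 q1 q2 \<longrightarrow>
      Linf_L2_norm T a b (\<lambda>p. u p - q0 p) + Linf_L2_norm T a b (\<lambda>p. ux p - q1 p)
        \<le> ennreal (C * \<tau>))"
proof -
  interpret periodic_domain T a b using T ab by unfold_locales
  obtain f2 where f2: "f2 \<in> Linf lborel" "weak_deriv test_line lborel [1, 1] f f2" using f'' by blast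
  obtain L where L: "0 \<le> L" "\<And>x. (f has_real_derivative deriv f x) (at x)"
    "\<And>x y. \<bar>f y - f x - deriv f x * (y - x)\<bar> \<le> L / 2 * (y - x)\<^sup>2"
    "\<And>x y. \<bar>deriv f y - deriv f x\<bar> \<le> L * \<bar>y - x\<bar>"
    using weak_second_derivative_bounded[OF f(2) f2(2,1)] by metis
  have f'c: "continuous_on UNIV (deriv f)"
  proof (rule lipschitz_on_continuous_on)
    show "L-lipschitz_on UNIV (deriv f)"
      using L(1,4) by (intro lipschitz_onI) (auto simp: dist_real_def abs_minus_commute)
  qed
  have fm: "f \<in> borel_measurable borel" "deriv f \<in> borel_measurable borel"
    by (intro borel_measurable_continuous_onI f(2) f'c)+
  have uL: "u \<in> L2 MQ" using u(1) by (simp add: H_st_def sobolev_def st_measure_MQ)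
  obtain d10 where d10: "d10 \<in> L2 MQ" "weak 1 0 u d10" by (rule H_st_weak[OF u(1), of 1 0]) auto
  obtain d01 where d01: "d01 \<in> L2 MQ" "weak 0 1 u d01" by (rule H_st_weak[OF u(1), of 0 1]) auto
  obtain d11 where d11: "d11 \<in> L2 MQ" "weak 1 1 u d11" by (rule H_st_weak[OF u(1), of 1 1]) auto
  obtain d02 where d02: "d02 \<in> L2 MQ" "weak 0 2 u d02" by (rule H_st_weak[OF u(1), of 0 2]) auto
  obtain d21 where d21: "d21 \<in> L2 MQ" "weak 2 1 u d21" by (rule H_st_weak[OF u(1), of 2 1]) auto
  obtain d12 where d12: "d12 \<in> L2 MQ" "weak 1 2 u d12" by (rule H_st_weak[OF u(1), of 1 2]) auto
  obtain d31 where d31: "d31 \<in> L2 MQ" "weak 3 1 u d31" by (rule H_st_weak[OF u(1), of 3 1]) auto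
  obtain d22 where d22: "d22 \<in> L2 MQ" "weak 2 2 u d22" by (rule H_st_weak[OF u(1), of 2 2]) auto
  note num = numeral_2_eq_2 numeral_3_eq_3
  have w: "weak 1 0 d01 d11" "weak 0 1 d01 d02" "weak 1 0 d11 d21" "weak 0 1 d11 d12"
    "weak 1 0 d21 d31" "weak 0 1 d21 d22" "weak 0 1 d10 d11"
    using weak_trans[OF d01(2), of 1 0 d11] weak_trans[OF d01(2), of 0 1 d02] weak_trans[OF d11(2), of 1 0 d21]
      weak_trans[OF d11(2), of 0 1 d12] weak_trans[OF d21(2), of 1 0 d31] weak_trans[OF d21(2), of 0 1 d22]
      weak_trans[OF d10(2), of 0 1 d11] d11 d02 d21 d12 d31 d22 by (simp_all add: num)
  have bs: "[dir_x] \<in> lists Basis" "[dir_t] \<in> lists Basis" "[dir_t, dir_x] \<in> lists Basis" "[dir_x, dir_x, dir_t] \<in> lists Basis"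
    by (auto simp: Basis_prod_def)
  \<comment> \<open>The given \<open>ux\<close> and the derivative drawn from \<open>H_st\<close>
    agree almost everywhere, so the bound on \<open>ux\<close> passes to \<open>d01\<close>.\<close>
  have uxd: "AE p in MQ. ux p = d01 p"
    using st_weak_deriv_weak[OF ux(1) bs(1)] by (intro weak_unique[OF _ d01(2) _ L2_locally_integrable[OF d01(1)]]) auto
  have utxd: "AE p in MQ. utx p = d11 p"
    using st_weak_deriv_weak[OF utx(1) bs(3)] by (intro weak_unique[OF _ d11(2) _ L2_locally_integrable[OF d11(1)]]) auto
  obtain K' where "AE p in MQ. \<bar>ux p\<bar> \<le> K'" using ux(2) by (auto simp: Linf_def st_measure_MQ)
  then have "AE p in MQ. \<bar>d01 p\<bar> \<le> \<bar>K'\<bar>" using uxd by eventually_elim auto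
  then obtain K where K: "0 \<le> K" "AE p in MQ. \<bar>d01 p\<bar> \<le> K" by (rule that[of "\<bar>K'\<bar>", rotated]) simp
  have uxm: "ux \<in> borel_measurable MQ" using ux(2) by (simp add: Linf_def st_measure_MQ)

  \<comment> \<open>The representation in time provides traces for the derivatives of
    \<open>u\<close>. They are identified afterwards with the prescribed \<open>u0\<close>,
    \<open>u0x\<close> and \<open>utx0\<close>.\<close>
  obtain v0 where v0: "v0 \<in> L2 MX" "AE p in MQ. u p = v0 (snd p) + prim_t d10 p"
    by (rule time_representation[OF uL d10])
  obtain v1 where v1: "v1 \<in> L2 MX" "AE p in MQ. d01 p = v1 (snd p) + prim_t d11 p"
    by (rule time_representation[OF d01(1) d11(1) w(1)])
  obtain v2 where v2: "v2 \<in> L2 MX" "AE p in MQ. d11 p = v2 (snd p) + prim_t d21 p"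
    by (rule time_representation[OF d11(1) d21(1) w(3)])
  \<comment> \<open>This is the trace of u_ttx, the initial value of the correction in
    \<open>v1\<close>. It is not among the prescribed data and enters the constants through its L2
    norm.\<close>
  obtain z0 where z0: "z0 \<in> L2 MX" "AE p in MQ. d21 p = z0 (snd p) + prim_t d31 p"
    by (rule time_representation[OF d21(1) d31(1) w(5)])
  have u0m: "u0 \<in> borel_measurable MX" "utx0 \<in> borel_measurable MX" "u0x \<in> borel_measurable MX"
    using u0(2) utx(2) u0x by (auto simp: initial_trace_def weak_deriv_def integrable_vs_tests_def MX_def)
  have Hu: "H1 u d10 d01 u0"
    by (rule H1_cong_initial[OF _ initial_trace_unique[OF u0(2) v0(2) d10(1)] u0m(1)])
       (use uL d10 d01 v0 in \<open>simp add: H1_def\<close>)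
  have Hux: "H1 d01 d11 d02 v1" using d01 d11 d02 v1 w by (simp add: H1_def)
  have H1: "H1 d01 d11 d02 u0x"
    by (rule H1_cong_initial[OF Hux initial_derivative_unique[OF Hu Hux w(7) u0x] u0m(3)])
  have utxr: "AE p in MQ. utx p = v2 (snd p) + prim_t d21 p" using utxd v2(2) by eventually_elim simp
  have H2: "H1 d11 d21 d12 utx0"
    by (rule H1_cong_initial[OF _ initial_trace_unique[OF utx(2) utxr d21(1)] u0m(2)])
       (use d11 d21 d12 v2 w in \<open>simp add: H1_def\<close>)
  have H3: "H1 d21 d31 d22 z0" using d21 d31 d22 z0 w by (simp add: H1_def)

  have um: "u \<in> borel_measurable MQ" "d01 \<in> borel_measurable MQ" using uL d01 by (auto intro: L2_measurable)
  \<comment> \<open>\<open>deriv f\<close> is Lipschitz, hence of at most linear growth, so square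
    integrability of \<open>u\<close> suffices. In the same way the quadratic growth of
    \<open>f\<close> makes \<open>f (u p)\<close> integrable below.\<close>
  have f'u: "(\<lambda>p. deriv f (u p)) \<in> L2 MQ" unfolding L2_def
  proof (intro CollectI conjI)
    show m: "(\<lambda>p. deriv f (u p)) \<in> borel_measurable MQ" by (rule measurable_compose[OF um(1) fm(2)])
    have b: "(\<lambda>p. \<bar>deriv f 0\<bar> + L * \<bar>u p\<bar>) \<in> L2 MQ"
      using uL by (intro L2_add L2_cmult KQ.fm.const_L2) (auto simp: L2_def)
    show "integrable MQ (\<lambda>p. (deriv f (u p))\<^sup>2)"
    proof (rule Bochner_Integration.integrable_bound[OF L2_square[OF b]])
      show "AE p in MQ. norm ((deriv f (u p))\<^sup>2) \<le> norm ((\<bar>deriv f 0\<bar> + L * \<bar>u p\<bar>)\<^sup>2)"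
      proof (rule AE_I2)
        fix p
        have "\<bar>deriv f (u p)\<bar> \<le> \<bar>deriv f 0\<bar> + L * \<bar>u p\<bar>" using L(4)[of "u p" 0] by simp
        then show "norm ((deriv f (u p))\<^sup>2) \<le> norm ((\<bar>deriv f 0\<bar> + L * \<bar>u p\<bar>)\<^sup>2)"
          using power_mono[of "\<bar>deriv f (u p)\<bar>" "\<bar>deriv f 0\<bar> + L * \<bar>u p\<bar>" 2] by simp
      qed
    qed (use m in measurable)
  qed
  have f'ud: "integrable MQ (\<lambda>p. deriv f (u p) * d01 p)" by (rule L2_mult[OF f'u d01(1)])
  have fu: "integrable MQ (\<lambda>p. f (u p))"
  proof (rule Bochner_Integration.integrable_bound)
    show "integrable MQ (\<lambda>p. \<bar>f 0\<bar> + \<bar>deriv f 0\<bar> * \<bar>u p\<bar> + L / 2 * (u p)\<^sup>2)"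
      using KQ.fm.L2_integrable[OF uL] L2_square[OF uL] by auto
    show "(\<lambda>p. f (u p)) \<in> borel_measurable MQ" by (rule measurable_compose[OF um(1) fm(1)])
    show "AE p in MQ. norm (f (u p)) \<le> norm (\<bar>f 0\<bar> + \<bar>deriv f 0\<bar> * \<bar>u p\<bar> + L / 2 * (u p)\<^sup>2)"
    proof (rule AE_I2)
      fix p
      have "\<bar>f (u p) - f 0 - deriv f 0 * u p\<bar> \<le> L / 2 * (u p)\<^sup>2" using L(3)[of "u p" 0] by simp
      then have "\<bar>f (u p)\<bar> \<le> \<bar>f 0\<bar> + \<bar>deriv f 0 * u p\<bar> + L / 2 * (u p)\<^sup>2" by linarith
      then show "norm (f (u p)) \<le> norm (\<bar>f 0\<bar> + \<bar>deriv f 0\<bar> * \<bar>u p\<bar> + L / 2 * (u p)\<^sup>2)"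
        by (simp add: abs_mult)
    qed
  qed
  have fud: "integrable MQ (\<lambda>p. f (u p) * d01 p)" by (rule integrable_bounded_mult(2)[OF fu um(2) K(2)])

  obtain ut fx uxxt where sol: "st_weak_deriv T a b [dir_t] u ut" "st_weak_deriv T a b [dir_x] (\<lambda>p. f (u p)) fx"
    "st_weak_deriv T a b [dir_x, dir_x, dir_t] u uxxt" "AE p in MQ. ut p + fx p - uxxt p = 0"
    using u(2) unfolding solves_equation_def st_measure_MQ by blast
  have "AE p in MQ. ut p = d10 p"
    using st_weak_deriv_weak[OF sol(1) bs(2)] by (intro weak_unique[OF _ d10(2) _ L2_locally_integrable[OF d10(1)]]) auto
  moreover have "AE p in MQ. uxxt p = d12 p"
    using st_weak_deriv_weak[OF sol(3) bs(4)]
    by (intro weak_unique[OF _ d12(2) _ L2_locally_integrable[OF d12(1)]]) (auto simp: num)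
  moreover have "AE p in MQ. fx p = deriv f (u p) * d01 p"
  proof (rule weak_unique[of 0 1 "\<lambda>p. f (u p)"])
    show "weak 0 1 (\<lambda>p. f (u p)) fx" "locally_integrable fx" using st_weak_deriv_weak[OF sol(2) bs(1)] by simp_all
    show "locally_integrable (\<lambda>p. deriv f (u p) * d01 p)" by (rule integrable_locally_integrable[OF f'ud])
    show "weak 0 1 (\<lambda>p. f (u p)) (\<lambda>p. deriv f (u p) * d01 p)"
      unfolding weak_def
    proof (intro allI impI)
      fix \<alpha> \<beta> assume t: "test_t \<alpha>" "periodic_smooth \<beta>"
      from chain_rule[OF uL d01(1) d02(1) d01(2) w(2) L(2) f'c f'ud fu test_t_smooth[OF t(1)] t(2)]
      show "(\<integral>p. f (u p) * ((deriv ^^ 0) \<alpha> (fst p) * (deriv ^^ 1) \<beta> (snd p)) \<partial>MQ) =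
        (- 1) ^ (0 + 1) * (\<integral>p. deriv f (u p) * d01 p * (\<alpha> (fst p) * \<beta> (snd p)) \<partial>MQ)" by simp
    qed
  qed
  ultimately have eq: "AE p in MQ. d10 p + deriv f (u p) * d01 p - d12 p = 0"
    using sol(4) by eventually_elim simp

  \<comment> \<open>With a primitive \<open>F\<close> of \<open>f\<close>, the product f(u) u_x is
    the x-derivative of F(u) and integrates to 0 over a period at almost every time.\<close>
  obtain F where F: "\<And>y. (F has_real_derivative f y) (at y)" using continuous_antiderivative[OF f(2)] by blast
  have fz: "(\<integral>p. f (u p) * d01 p * \<phi> (fst p) \<partial>MQ) = 0" if \<phi>: "test_t0 \<phi>" for \<phi>
  proof -
    have j: "integrable (MT \<Otimes>\<^sub>M MX) (\<lambda>(t, x). f (u (t, x)) * d01 (t, x) * \<phi> t)"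
      using integrable_product_test[OF fud test_t0_smooth[OF \<phi>] smooth_const[of 1]] by (simp add: MQ_def case_prod_unfold)
    have "(\<integral>p. f (u p) * d01 p * \<phi> (fst p) \<partial>MQ) = (\<integral>t. \<integral>x. f (u (t, x)) * d01 (t, x) * \<phi> t \<partial>MX \<partial>MT)"
      using TX.integral_fst[OF j] by (simp add: MQ_def case_prod_unfold)
    also have "\<dots> = (\<integral>t. 0 \<partial>MT)"
    proof (rule integral_cong_AE)
      show "(\<lambda>t. \<integral>x. f (u (t, x)) * d01 (t, x) * \<phi> t \<partial>MX) \<in> borel_measurable MT" using TX.integrable_fst[OF j] by auto
      show "AE t in MT. (\<integral>x. f (u (t, x)) * d01 (t, x) * \<phi> t \<partial>MX) = 0"
        using chain_rule_section[OF uL d01(1) d02(1) d01(2) w(2) F f(2) periodic_smooth_const[of 1]]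
        by eventually_elim simp
    qed simp
    finally show ?thesis by simp
  qed

  define Z where "Z = (\<integral>x. (z0 x)\<^sup>2 \<partial>MX)"
  \<comment> \<open>A square of a sum of three terms is at most three times the sum of the squares;
    together with \<open>\<tau> \<le> 1\<close> this bounds the squared residual by
    \<open>S\<close>, uniformly in \<tau>.\<close>
  define S where "S p = 3 * ((d02 p)\<^sup>2 + (d31 p)\<^sup>2 + (d22 p)\<^sup>2)" for p
  have Si: "integrable MQ S" unfolding S_def[abs_def]
    using L2_square[OF d02(1)] L2_square[OF d31(1)] L2_square[OF d22(1)] by auto
  have S0: "0 \<le> S p" for p by (simp add: S_def)
  define M where "M = K * L + 1"
  have M0: "0 \<le> M" using K L by (simp add: M_def)
  \<comment> \<open>The Gronwall bound divided by \<open>\<tau>\<^sup>2\<close>, with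
    \<open>S\<close> in place of the squared residual.\<close>
  define E where "E = exp (M * T) * (1/2 * (\<integral>p. S p \<partial>MQ) + 1/2 * Z)"
  \<comment> \<open>The bound of \<open>H1_time_slice_bound\<close> on the integral of
    \<open>(d21 (t, x))\<^sup>2\<close> over \<open>x\<close>.\<close>
  define N where "N = 2 * Z + 2 * T * (\<integral>p. (d31 p)\<^sup>2 \<partial>MQ)"
  have EN: "0 \<le> E" "0 \<le> N" unfolding E_def N_def Z_def using T S0
    by (auto intro!: mult_nonneg_nonneg add_nonneg_nonneg integral_nonneg_AE)
  \<comment> \<open>The first summand is for \<open>q0\<close>, as a squared component is at most
    twice the relative energy. The second is for \<open>q1\<close>: \<open>ux - q1\<close> is the
    sum of \<open>v - q1\<close> and \<open>\<tau> * d21\<close>, and squaring this sum doubles both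
    contributions. The \<open>+ 1\<close> makes \<open>C\<close> positive.\<close>
  define C where "C = sqrt (2 * E) + sqrt (4 * E + 2 * N) + 1"
  have C0: "0 < C" unfolding C_def using EN by (intro add_nonneg_pos add_nonneg_nonneg) auto
  have "Linf_L2_norm T a b (\<lambda>p. u p - q0 p) + Linf_L2_norm T a b (\<lambda>p. ux p - q1 p) \<le> ennreal (C * \<tau>)"
    if \<tau>: "0 < \<tau>" "\<tau> \<le> 1" and es: "entropy_solution f \<Phi> T a b \<tau> u0 u0x (\<lambda>x. - utx0 x) q0 q1 q2" for \<tau> q0 q1 q2
  proof -
    have qi: "q0 \<in> Linf MQ" "q1 \<in> Linf MQ" "q2 \<in> Linf MQ" and ws: "weak_solution f T a b \<tau> u0 u0x (\<lambda>x. - utx0 x) q0 q1 q2"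
      and ei: "energy_inequality \<Phi> T a b \<tau> u0 u0x (\<lambda>x. - utx0 x) q0 q1 q2"
      using es by (auto simp: entropy_solution_def st_measure_MQ)
    have q: "q0 \<in> L2 MQ" "q1 \<in> L2 MQ" "q2 \<in> L2 MQ" using qi by (auto intro: KQ.fm.Linf_L2)
    have fq: "(\<lambda>p. f (q0 p)) \<in> L2 MQ"
    proof -
      obtain c where c: "AE p in MQ. \<bar>q0 p\<bar> \<le> c" using qi(1) by (auto simp: Linf_def)
      have "compact (f ` {-c..c})" by (intro compact_continuous_image continuous_on_subset[OF f(2)]) auto
      then have "bounded (f ` {-c..c})" by (rule compact_imp_bounded)
      then obtain B where B: "\<forall>y\<in>{-c..c}. \<bar>f y\<bar> \<le> B" unfolding bounded_iff by auto
      have "AE p in MQ. \<bar>f (q0 p)\<bar> \<le> B" using c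
      proof eventually_elim
        case (elim p)
        then have "q0 p \<in> {-c..c}" unfolding atLeastAtMost_iff by linarith
        then show ?case using B by blast
      qed
      then show ?thesis by (intro KQ.fm.bounded_L2 measurable_compose[OF L2_measurable[OF q(1)] fm(1)])
    qed
    define v where "v p = d01 p - \<tau> * d21 p" for p
    define e where "e p = energy \<tau> (q0 p - u p) (q1 p - v p) (q2 p + d11 p)" for p
    define R where "R p = d02 p - d31 p - \<tau> * d22 p" for p
    have vL: "v \<in> L2 MQ" unfolding v_def[abs_def] by (intro L2_diff L2_cmult d01 d21)
    have RL: "R \<in> L2 MQ" unfolding R_def[abs_def] by (intro L2_diff L2_cmult d02 d31 d22)
    have D: "integrable MQ (\<lambda>p. (q0 p - u p)\<^sup>2)" "integrable MQ (\<lambda>p. (q1 p - v p)\<^sup>2)" "integrable MQ (\<lambda>p. (q2 p + d11 p)\<^sup>2)"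
      by (intro L2_square L2_diff L2_add q uL vL d11)+
    have eint: "integrable MQ e" unfolding e_def[abs_def] energy_def using D by auto
    have RS: "(R p)\<^sup>2 \<le> S p" for p
    proof -
      have *: "(\<tau> * d22 p)\<^sup>2 \<le> (d22 p)\<^sup>2"
        unfolding power_mult_distrib using \<tau> by (intro mult_left_le_one_le) (auto simp: power_le_one)
      have "(x - y - z)\<^sup>2 \<le> 3 * (x\<^sup>2 + y\<^sup>2 + z\<^sup>2)" for x y z :: real
      proof -
        have "0 \<le> (x + y)\<^sup>2 + (x + z)\<^sup>2 + (y - z)\<^sup>2" by simp
        then show ?thesis by (simp add: power2_eq_square algebra_simps)
      qed
      from this[of "d02 p" "d31 p" "\<tau> * d22 p"] have "(R p)\<^sup>2 \<le> 3 * ((d02 p)\<^sup>2 + (d31 p)\<^sup>2 + (\<tau> * d22 p)\<^sup>2)" by (simp add: R_def)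
      also have "3 * ((d02 p)\<^sup>2 + (d31 p)\<^sup>2 + (\<tau> * d22 p)\<^sup>2) \<le> S p" unfolding S_def using * by simp
      finally show ?thesis .
    qed
    have "AE t in MT. (\<integral>x. e (t, x) \<partial>MX) \<le> exp (M * T) * (\<tau>\<^sup>2 / 2 * (\<integral>p. (R p)\<^sup>2 \<partial>MQ) + \<tau>\<^sup>2 / 2 * Z)"
    proof (rule Gronwall_test[OF eint L2_square[OF RL] _ _ _ M0])
      fix \<phi> assume \<phi>: "test_t0 \<phi>" "\<And>t. 0 \<le> t \<Longrightarrow> 0 \<le> \<phi> t"
      from relative_energy_inequality[OF \<tau>(1) L(3,1) Hu H1 H2 H3 eq K(2) fz fud q fq ws ei \<phi>]
      show "0 \<le> (\<integral>p. e p * (deriv \<phi> (fst p) + M * \<phi> (fst p)) \<partial>MQ) + \<tau>\<^sup>2 / 2 * (\<integral>p. (R p)\<^sup>2 * \<phi> (fst p) \<partial>MQ) + \<phi> 0 * (\<tau>\<^sup>2 / 2 * Z)"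
        unfolding e_def v_def R_def M_def Z_def by simp
    qed (auto simp: Z_def)
    moreover have "exp (M * T) * (\<tau>\<^sup>2 / 2 * (\<integral>p. (R p)\<^sup>2 \<partial>MQ) + \<tau>\<^sup>2 / 2 * Z) \<le> \<tau>\<^sup>2 * E"
    proof -
      have "(\<integral>p. (R p)\<^sup>2 \<partial>MQ) \<le> (\<integral>p. S p \<partial>MQ)" by (intro integral_mono L2_square RL Si RS)
      then have "\<tau>\<^sup>2 / 2 * (\<integral>p. (R p)\<^sup>2 \<partial>MQ) + \<tau>\<^sup>2 / 2 * Z \<le> \<tau>\<^sup>2 / 2 * (\<integral>p. S p \<partial>MQ) + \<tau>\<^sup>2 / 2 * Z"
        by (intro add_mono mult_left_mono) auto
      also have "\<dots> = \<tau>\<^sup>2 * (1/2 * (\<integral>p. S p \<partial>MQ) + 1/2 * Z)" by (simp add: algebra_simps)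
      finally show ?thesis unfolding E_def mult.left_commute[of "\<tau>\<^sup>2"] by (intro mult_left_mono) auto
    qed
    ultimately have le: "AE t in MT. (\<integral>x. e (t, x) \<partial>MX) \<le> \<tau>\<^sup>2 * E" by (auto elim: AE_mp)
    have sec: "AE t in MT. integrable MX (\<lambda>x. g (t, x))" if "integrable MQ g" for g :: "real \<times> real \<Rightarrow> real"
      using TX.AE_integrable_fst'[of g] that by (simp add: MQ_def)
    have half: "(q0 p - u p)\<^sup>2 \<le> 2 * e p" "(q1 p - v p)\<^sup>2 \<le> 2 * e p" for p
      using \<tau> by (auto simp: e_def energy_def)
    have n0: "Linf_L2_norm T a b (\<lambda>p. u p - q0 p) \<le> ennreal (sqrt (2 * (\<tau>\<^sup>2 * E)))"
    proof (rule Linf_L2_norm_le)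
      show "(\<lambda>p. u p - q0 p) \<in> borel_measurable MQ" using um(1) L2_measurable[OF q(1)] by measurable
      show "AE t in MT. integrable MX (\<lambda>x. (u (t, x) - q0 (t, x))\<^sup>2) \<and> (\<integral>x. (u (t, x) - q0 (t, x))\<^sup>2 \<partial>MX) \<le> 2 * (\<tau>\<^sup>2 * E)"
        using le sec[OF D(1)] sec[OF eint]
      proof eventually_elim
        case (elim t)
        have i: "integrable MX (\<lambda>x. (u (t, x) - q0 (t, x))\<^sup>2)" using elim(2) by (simp add: power2_commute)
        have "(\<integral>x. (u (t, x) - q0 (t, x))\<^sup>2 \<partial>MX) \<le> (\<integral>x. 2 * e (t, x) \<partial>MX)"
        proof (rule integral_mono[OF i])
          show "integrable MX (\<lambda>x. 2 * e (t, x))" using elim(3) by simp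
          show "(u (t, x) - q0 (t, x))\<^sup>2 \<le> 2 * e (t, x)" for x using half(1)[of "(t, x)"] by (simp add: power2_commute)
        qed
        then show ?case using elim(1) i by simp
      qed
    qed (use EN in simp)
    have n1: "Linf_L2_norm T a b (\<lambda>p. ux p - q1 p) \<le> ennreal (sqrt (4 * (\<tau>\<^sup>2 * E) + 2 * \<tau>\<^sup>2 * N))"
    proof (rule Linf_L2_norm_le)
      show "(\<lambda>p. ux p - q1 p) \<in> borel_measurable MQ" using uxm L2_measurable[OF q(2)] by measurable
      have uL2: "ux \<in> L2 MQ" using uxd by (intro L2_AE_cong[OF d01(1) uxm]) (auto elim: AE_mp)
      have "AE p in MQ. (ux p - q1 p)\<^sup>2 \<le> 4 * e p + 2 * \<tau>\<^sup>2 * (d21 p)\<^sup>2" using uxd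
      proof eventually_elim
        case (elim p)
        have "ux p - q1 p = - (q1 p - v p) + \<tau> * d21 p" by (simp add: elim v_def)
        moreover have "(- x + y)\<^sup>2 \<le> 2 * x\<^sup>2 + 2 * y\<^sup>2" for x y :: real
        proof -
          have "0 \<le> (x + y)\<^sup>2" by simp
          then show ?thesis by (simp add: power2_eq_square algebra_simps)
        qed
        ultimately have "(ux p - q1 p)\<^sup>2 \<le> 2 * (q1 p - v p)\<^sup>2 + 2 * (\<tau> * d21 p)\<^sup>2" by metis
        then show ?case using half(2)[of p] by (simp add: power_mult_distrib)
      qed
      from TX.AE_pair[OF this[unfolded MQ_def]]
      have pw: "AE t in MT. AE x in MX. (ux (t, x) - q1 (t, x))\<^sup>2 \<le> 4 * e (t, x) + 2 * \<tau>\<^sup>2 * (d21 (t, x))\<^sup>2" by simp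
      show "AE t in MT. integrable MX (\<lambda>x. (ux (t, x) - q1 (t, x))\<^sup>2) \<and>
          (\<integral>x. (ux (t, x) - q1 (t, x))\<^sup>2 \<partial>MX) \<le> 4 * (\<tau>\<^sup>2 * E) + 2 * \<tau>\<^sup>2 * N"
        using le pw sec[OF L2_square[OF L2_diff[OF uL2 q(2)]]] sec[OF eint] H1_time_slice_bound[OF H3]
      proof eventually_elim
        case (elim t)
        have "(\<integral>x. (ux (t, x) - q1 (t, x))\<^sup>2 \<partial>MX) \<le> (\<integral>x. 4 * e (t, x) + 2 * \<tau>\<^sup>2 * (d21 (t, x))\<^sup>2 \<partial>MX)"
          using elim by (intro integral_mono_AE) auto
        also have "\<dots> = 4 * (\<integral>x. e (t, x) \<partial>MX) + 2 * \<tau>\<^sup>2 * (\<integral>x. (d21 (t, x))\<^sup>2 \<partial>MX)"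
          using elim by simp
        also have "\<dots> \<le> 4 * (\<tau>\<^sup>2 * E) + 2 * \<tau>\<^sup>2 * N"
          using elim unfolding N_def Z_def by (intro add_mono mult_left_mono) auto
        finally show ?case using elim(3) by simp
      qed
    qed (use EN in simp)
    have "sqrt (2 * (\<tau>\<^sup>2 * E)) = \<tau> * sqrt (2 * E)"
      using \<tau> by (simp add: real_sqrt_mult)
    moreover have "sqrt (4 * (\<tau>\<^sup>2 * E) + 2 * \<tau>\<^sup>2 * N) = \<tau> * sqrt (4 * E + 2 * N)"
    proof -
      have "4 * (\<tau>\<^sup>2 * E) + 2 * \<tau>\<^sup>2 * N = \<tau>\<^sup>2 * (4 * E + 2 * N)" by (simp add: algebra_simps)
      then show ?thesis using \<tau> by (simp add: real_sqrt_mult)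
    qed
    ultimately have "Linf_L2_norm T a b (\<lambda>p. u p - q0 p) + Linf_L2_norm T a b (\<lambda>p. ux p - q1 p) \<le>
      ennreal (\<tau> * sqrt (2 * E)) + ennreal (\<tau> * sqrt (4 * E + 2 * N))"
      using add_mono[OF n0 n1] by simp
    also have "\<dots> = ennreal (\<tau> * sqrt (2 * E) + \<tau> * sqrt (4 * E + 2 * N))"
      using \<tau> EN by (intro ennreal_plus[symmetric]) auto
    also have "\<dots> \<le> ennreal (C * \<tau>)" using \<tau> by (intro ennreal_leI) (simp add: C_def algebra_simps)
    finally show ?thesis .
  qed
  then show ?thesis using C0 by (intro exI[of _ C] conjI exI[of _ 1]) auto
qed

end
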